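(* Let $M=G/K$ be an irreducible Hermitian symmetric space of noncompact type with its standard Kähler structure $(J,\omega)$, and let $\mathfrak a\subset\mathfrak p$ be a maximal abelian subspace, $A=\mathrm{Exp}_o\mathfrak a$. Define, for $k\in K$ and $x_1,\dots,x_r\in\mathbb R$, $$\Psi\Big(k\,\mathrm{Exp}_o\sum_{i=1}^r x_i\widetilde H_i\Big)=\mathrm{Ad}(k)\sum_{i=1}^r(\tanh x_i)\widetilde H_i,\qquad \Phi\Big(k\,\mathrm{Exp}_o\sum_{i=1}^r x_i\widetilde H_i\Big)=\mathrm{Ad}(k)\sum_{i=1}^r(\sinh x_i)\widetilde H_i .$$ Then: (1) $\Psi:(M,J)\to(D_{\tanh},J_o)$ is a $K$-equivariant holomorphic diffeomorphism, where $D_{\tanh}=\mathrm{Ad}(K)\{\sum_{i=1}^r y_i\widetilde H_i: |y_i|<1\}\subset\mathfrak p$; and $\Phi:(M,\omega)\to(\mathfrak p,\omega_o)$ is a $K$-equivariant symplectomorphism. (2) $\Psi$ is, up to constant multiple, the unique $K$-equivariant holomorphic embedding from $(M,J)$ to $(\mathfrak p,J_o)$ mapping $A$ into $\mathfrak a$; and $\Phi$ is, up to sign, the unique $K$-equivariant symplectic embedding from $(M,\omega)$ to $(\mathfrak p,\omega_o)$ mapping $A$ into $\mathfrak a$.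
   Context: $G$ is the identity component of the isometry group of $M$, $K$ the stabilizer of a base point $o$. $\mathfrak g=\mathfrak k\oplus\mathfrak p$ is the Cartan decomposition with Cartan involution $\theta$, $B$ the Killing form of $\mathfrak g$, $\langle X,Y\rangle=-B(X,\theta Y)$; $\mathfrak p$ is identified with $T_oM$, and $M$ carries the $G$-invariant metric $g$ extending $\langle\cdot,\cdot\rangle|_{\mathfrak p}$. The center of $\mathfrak k$ is one-dimensional and contains an element $\zeta$ such that $J_o=\mathrm{ad}(\zeta)|_{\mathfrak p}$ is a complex structure on $\mathfrak p$; $J$ is the $G$-invariant complex structure on $M$ extending $J_o$, $\omega=g(J\cdot,\cdot)$ and $\omega_o=\langle J_o\cdot,\cdot\rangle$. $J_o,\omega_o$ also denote the corresponding constant structures on the vector space $\mathfrak p$. $\mathrm{Exp}_o:\mathfrak p\to M$ is the Riemannian exponential map (a diffeomorphism). $\mathfrak a\subset\mathfrak p$ is a maximal abelian subspace, $r=\dim\mathfrak a$ is the rank, $A=\mathrm{Exp}_o\mathfrak a$; one has $K\cdot A=M$ and $\mathrm{Ad}(K)\mathfrak a=\mathfrak p$. The restricted root system $\Sigma\subset\mathfrak a^*$ is of type $C_r$ or $BC_r$: there is an orthogonal basis $e_1,\dots,e_r$ of the dual space of $\mathfrak a$ with $\Sigma=\{\pm e_i\pm e_j\ (i<j)\}\cup\{\pm2e_i\}$, or this set together with $\{\pm e_i\}$. Let $H_i\in\mathfrak a$ be defined by $2e_i=B(H_i,\cdot)|_{\mathfrak a}$. The $H_i$ are orthogonal with common squared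 norm $C=\|H_i\|^2$; the normalized root vectors are $\widetilde H_i=\frac2C H_i$, an orthogonal basis of $\mathfrak a$. A map $\Omega:M\to\mathfrak p$ is $K$-equivariant if $\Omega(k\cdot x)=\mathrm{Ad}(k)\Omega(x)$ for all $k\in K$, $x\in M$. A holomorphic (resp. symplectic) embedding is a (at least $C^1$) embedding $\Omega$ with $J_o\circ d\Omega=d\Omega\circ J$ (resp. $\Omega^*\omega_o=\omega$). *)

theory Defs
  imports "HOL-Analysis.Analysis"
begin

section \<open>Smooth functions between Euclidean spaces\<close>

text \<open>To be used on open sets \<open>U\<close> only: then \<open>f\<close> is of class \<open>C\<^sup>k\<^sup>+\<^sup>1\<close> iff it is
  differentiable and all its directional derivatives are of class \<open>C\<^sup>k\<close>.\<close>

primrec Ck_on :: "nat \<Rightarrow> 'a::euclidean_space set \<Rightarrow> ('a \<Rightarrow> 'b::euclidean_space) \<Rightarrow> bool" where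
  "Ck_on 0 U f \<longleftrightarrow> continuous_on U f"
| "Ck_on (Suc k) U f \<longleftrightarrow>
     (\<forall>x\<in>U. f differentiable (at x)) \<and> (\<forall>v. Ck_on k U (\<lambda>x. frechet_derivative f (at x) v))"

definition smooth_on :: "'a::euclidean_space set \<Rightarrow> ('a \<Rightarrow> 'b::euclidean_space) \<Rightarrow> bool" where
  "smooth_on U f \<longleftrightarrow> (\<forall>k. Ck_on k U f)"

section \<open>Manifolds given by an atlas\<close>

text \<open>The manifold is the whole type \<open>'m\<close>; a chart is a pair of its domain and its coordinate map.\<close>

type_synonym ('m, 'e) chart = "'m set \<times> ('m \<Rightarrow> 'e)"

definition cinv :: "('m, 'e) chart \<Rightarrow> 'e \<Rightarrow> 'm" where
  "cinv c = inv_into (fst c) (snd c)"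

definition smooth_atlas ::
  "('m::{t2_space,second_countable_topology}, 'e::euclidean_space) chart set \<Rightarrow> bool" where
  "smooth_atlas A \<longleftrightarrow>
     (\<Union>c\<in>A. fst c) = UNIV \<and>
     (\<forall>c\<in>A. open (fst c) \<and> open (snd c ` fst c) \<and>
        homeomorphism (fst c) (snd c ` fst c) (snd c) (cinv c)) \<and>
     (\<forall>c\<in>A. \<forall>d\<in>A. smooth_on (snd c ` (fst c \<inter> fst d)) (snd d \<circ> cinv c))"

text \<open>\<open>Ck_fun\<close>: functions into a Euclidean space; \<open>smooth_self\<close>: maps of the manifold to itself;
  \<open>smooth_into\<close>: maps from a subset of a Euclidean space (in use: a relatively open subset of a
  linear subspace) into the manifold, smoothness on \<open>S\<close> meaning that there are local smooth
  extensions to open sets.\<close>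

definition Ck_fun :: "('m, 'e::euclidean_space) chart set \<Rightarrow> nat \<Rightarrow> ('m \<Rightarrow> 'b::euclidean_space) \<Rightarrow> bool" where
  "Ck_fun A k f \<longleftrightarrow> (\<forall>c\<in>A. Ck_on k (snd c ` fst c) (f \<circ> cinv c))"

definition smooth_self :: "('m::topological_space, 'e::euclidean_space) chart set \<Rightarrow> ('m \<Rightarrow> 'm) \<Rightarrow> bool" where
  "smooth_self A f \<longleftrightarrow> continuous_on UNIV f \<and>
     (\<forall>c\<in>A. \<forall>d\<in>A. smooth_on (snd c ` (fst c \<inter> f -` fst d)) (snd d \<circ> f \<circ> cinv c))"

definition smooth_into ::
  "('m::topological_space, 'e::euclidean_space) chart set \<Rightarrow> 'b::euclidean_space set \<Rightarrow> ('b \<Rightarrow> 'm) \<Rightarrow> bool" where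
  "smooth_into A S f \<longleftrightarrow> continuous_on S f \<and>
     (\<forall>c\<in>A. \<forall>p\<in>S. f p \<in> fst c \<longrightarrow>
        (\<exists>U F. open U \<and> p \<in> U \<and> smooth_on U F \<and> (\<forall>q\<in>S \<inter> U. f q \<in> fst c \<and> F q = snd c (f q))))"

text \<open>A tangent vector at \<open>x\<close> is represented by its coordinates \<open>u\<close> in each chart \<open>c\<close> around \<open>x\<close>.
  Accordingly \<open>chart_deriv c F x u\<close> is \<open>dF\<^sub>x(u)\<close> for vector-valued \<open>F\<close>; for a self-map \<open>f\<close> the
  coordinates of \<open>df\<^sub>x(u)\<close> in a chart \<open>d\<close> around \<open>f x\<close> are \<open>chart_deriv c (snd d \<circ> f) x u\<close>.
  Tensor fields are families of components indexed by the charts of the atlas.\<close>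

definition chart_deriv ::
  "('m, 'e::euclidean_space) chart \<Rightarrow> ('m \<Rightarrow> 'b::euclidean_space) \<Rightarrow> 'm \<Rightarrow> 'e \<Rightarrow> 'b" where
  "chart_deriv c F x u = frechet_derivative (F \<circ> cinv c) (at (snd c x)) u"

definition velocity :: "('m, 'e::euclidean_space) chart \<Rightarrow> (real \<Rightarrow> 'm) \<Rightarrow> real \<Rightarrow> 'e" where
  "velocity c \<gamma> t = vector_derivative (snd c \<circ> \<gamma>) (at t)"

section \<open>Riemannian metrics, geodesics, isometries\<close>

type_synonym ('m, 'e) metric_tensor = "('m, 'e) chart \<Rightarrow> 'm \<Rightarrow> 'e \<Rightarrow> 'e \<Rightarrow> real"

definition preserves_metric ::
  "('m, 'e::euclidean_space) chart set \<Rightarrow> ('m, 'e) metric_tensor \<Rightarrow> ('m \<Rightarrow> 'm) \<Rightarrow> bool" where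
  "preserves_metric A g f \<longleftrightarrow>
     (\<forall>c\<in>A. \<forall>d\<in>A. \<forall>x\<in>fst c. f x \<in> fst d \<longrightarrow>
        (\<forall>u w. g d (f x) (chart_deriv c (snd d \<circ> f) x u) (chart_deriv c (snd d \<circ> f) x w) = g c x u w))"

text \<open>\<open>preserves_metric A g id\<close> is the transformation law of the components under change of chart.\<close>

definition riemannian_metric ::
  "('m, 'e::euclidean_space) chart set \<Rightarrow> ('m, 'e) metric_tensor \<Rightarrow> bool" where
  "riemannian_metric A g \<longleftrightarrow>
     (\<forall>c\<in>A. \<forall>x\<in>fst c. bilinear (g c x) \<and> (\<forall>u w. g c x u w = g c x w u) \<and> (\<forall>u. u \<noteq> 0 \<longrightarrow> g c x u u > 0)) \<and>
     (\<forall>c\<in>A. \<forall>u w. smooth_on (snd c ` fst c) (\<lambda>y. g c (cinv c y) u w)) \<and>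
     preserves_metric A g id"

text \<open>Christoffel symbol of the first kind,
  \<open>\<Gamma>(u,v;w) = (D\<^sub>u g(v,w) + D\<^sub>v g(u,w) - D\<^sub>w g(u,v)) / 2\<close>; the geodesic equation
  \<open>\<nabla>\<^sub>\<gamma>\<^sub>' \<gamma>' = 0\<close> then reads \<open>g(q'', w) + \<Gamma>(q',q';w) = 0\<close> for all \<open>w\<close>, where \<open>q\<close> is \<open>\<gamma>\<close> in coordinates.\<close>

definition metric_deriv ::
  "('m, 'e::euclidean_space) chart \<Rightarrow> ('m, 'e) metric_tensor \<Rightarrow> 'm \<Rightarrow> 'e \<Rightarrow> 'e \<Rightarrow> 'e \<Rightarrow> real" where
  "metric_deriv c g x u v w = chart_deriv c (\<lambda>y. g c y v w) x u"

definition christoffel ::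
  "('m, 'e::euclidean_space) chart \<Rightarrow> ('m, 'e) metric_tensor \<Rightarrow> 'm \<Rightarrow> 'e \<Rightarrow> 'e \<Rightarrow> 'e \<Rightarrow> real" where
  "christoffel c g x u v w =
     (metric_deriv c g x u v w + metric_deriv c g x v u w - metric_deriv c g x w u v) / 2"

definition geodesic ::
  "('m::topological_space, 'e::euclidean_space) chart set \<Rightarrow> ('m, 'e) metric_tensor \<Rightarrow> (real \<Rightarrow> 'm) \<Rightarrow> bool" where
  "geodesic A g \<gamma> \<longleftrightarrow> continuous_on UNIV \<gamma> \<and>
     (\<forall>c\<in>A. \<forall>t. \<gamma> t \<in> fst c \<longrightarrow>
        (snd c \<circ> \<gamma>) differentiable (at t) \<and>
        (\<exists>acc. (velocity c \<gamma> has_vector_derivative acc) (at t) \<and>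
           (\<forall>w. g c (\<gamma> t) acc w + christoffel c g (\<gamma> t) (velocity c \<gamma> t) (velocity c \<gamma> t) w = 0)))"

text \<open>Riemannian exponential map at \<open>x\<close>; the tangent vector is given by its coordinates \<open>v c\<close> in
  all charts \<open>c\<close> around \<open>x\<close>.\<close>

definition riemannian_exp ::
  "('m::topological_space, 'e::euclidean_space) chart set \<Rightarrow> ('m, 'e) metric_tensor \<Rightarrow>
   'm \<Rightarrow> (('m, 'e) chart \<Rightarrow> 'e) \<Rightarrow> 'm" where
  "riemannian_exp A g x v =
     (THE y. \<exists>\<gamma>. geodesic A g \<gamma> \<and> \<gamma> 0 = x \<and> (\<forall>c\<in>A. x \<in> fst c \<longrightarrow> velocity c \<gamma> 0 = v c) \<and> \<gamma> 1 = y)"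

definition isometries ::
  "('m::topological_space, 'e::euclidean_space) chart set \<Rightarrow> ('m, 'e) metric_tensor \<Rightarrow> ('m \<Rightarrow> 'm) set" where
  "isometries A g =
     {f. bij f \<and> smooth_self A f \<and> smooth_self A (inv f) \<and> preserves_metric A g f}"

text \<open>Identity component of the isometry group. The library topology on functions is that of
  pointwise convergence; on the isometry group it coincides with the compact-open topology.\<close>

definition isom0 ::
  "('m::topological_space, 'e::euclidean_space) chart set \<Rightarrow> ('m, 'e) metric_tensor \<Rightarrow> ('m \<Rightarrow> 'm) set" where
  "isom0 A g = connected_component_set (isometries A g) id"

definition stabilizer ::
  "('m::topological_space, 'e::euclidean_space) chart set \<Rightarrow> ('m, 'e) metric_tensor \<Rightarrow> 'm \<Rightarrow> ('m \<Rightarrow> 'm) set" where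
  "stabilizer A g ob = {k \<in> isom0 A g. k ob = ob}"

section \<open>Complex structures and Hermitian symmetric spaces\<close>

type_synonym ('m, 'e) endo_tensor = "('m, 'e) chart \<Rightarrow> 'm \<Rightarrow> 'e \<Rightarrow> 'e"

definition preserves_J ::
  "('m, 'e::euclidean_space) chart set \<Rightarrow> ('m, 'e) endo_tensor \<Rightarrow> ('m \<Rightarrow> 'm) \<Rightarrow> bool" where
  "preserves_J A J f \<longleftrightarrow>
     (\<forall>c\<in>A. \<forall>d\<in>A. \<forall>x\<in>fst c. f x \<in> fst d \<longrightarrow>
        (\<forall>u. chart_deriv c (snd d \<circ> f) x (J c x u) = J d (f x) (chart_deriv c (snd d \<circ> f) x u)))"

text \<open>The last condition is integrability: around every point there is a smooth chart \<open>d\<close> in which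
  the structure is a constant one \<open>j\<close>, i.e. a holomorphic chart.\<close>

definition complex_structure ::
  "('m::{t2_space,second_countable_topology}, 'e::euclidean_space) chart set \<Rightarrow> ('m, 'e) endo_tensor \<Rightarrow> bool" where
  "complex_structure A J \<longleftrightarrow>
     (\<forall>c\<in>A. \<forall>x\<in>fst c. linear (J c x) \<and> (\<forall>u. J c x (J c x u) = - u)) \<and>
     (\<forall>c\<in>A. \<forall>u. smooth_on (snd c ` fst c) (\<lambda>y. J c (cinv c y) u)) \<and>
     preserves_J A J id \<and>
     (\<forall>x. \<exists>d j. x \<in> fst d \<and> smooth_atlas (insert d A) \<and> linear j \<and> (\<forall>u. j (j u) = - u) \<and>
        (\<forall>c\<in>A. \<forall>y\<in>fst c \<inter> fst d. \<forall>u.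
           chart_deriv c (snd d) y (J c y u) = j (chart_deriv c (snd d) y u)))"

definition hermitian_symmetric_space ::
  "('m::{t2_space,second_countable_topology}, 'e::euclidean_space) chart set \<Rightarrow>
   ('m, 'e) metric_tensor \<Rightarrow> ('m, 'e) endo_tensor \<Rightarrow> bool" where
  "hermitian_symmetric_space A g J \<longleftrightarrow>
     connected (UNIV :: 'm set) \<and> smooth_atlas A \<and> riemannian_metric A g \<and> complex_structure A J \<and>
     (\<forall>c\<in>A. \<forall>x\<in>fst c. \<forall>u w. g c x (J c x u) (J c x w) = g c x u w) \<and>
     (\<forall>x. \<exists>s\<in>isometries A g. preserves_J A J s \<and> s \<circ> s = id \<and> s x = x \<and>
        (\<exists>U. open U \<and> x \<in> U \<and> (\<forall>y\<in>U. s y = y \<longrightarrow> y = x)))"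

definition kaehler_form ::
  "('m, 'e) metric_tensor \<Rightarrow> ('m, 'e) endo_tensor \<Rightarrow> ('m, 'e) chart \<Rightarrow> 'm \<Rightarrow> 'e \<Rightarrow> 'e \<Rightarrow> real" where
  "kaehler_form g J c x u w = g c x (J c x u) w"

section \<open>The Lie algebra of a Lie group of transformations\<close>

definition one_parameter_subgroup ::
  "('m::topological_space \<Rightarrow> 'm) set \<Rightarrow> (real \<Rightarrow> 'm \<Rightarrow> 'm) \<Rightarrow> bool" where
  "one_parameter_subgroup G \<phi> \<longleftrightarrow>
     range \<phi> \<subseteq> G \<and> continuous_on UNIV \<phi> \<and> (\<forall>s t. \<phi> (s + t) = \<phi> s \<circ> \<phi> t)"

text \<open>Below, \<open>ex :: 'g \<Rightarrow> 'm \<Rightarrow> 'm\<close> is the exponential map of the group \<open>G\<close> of transformations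
  of \<open>'m\<close>. The inner product that \<open>'g\<close> has as a Euclidean space is auxiliary.\<close>

definition Ad :: "('g::real_vector \<Rightarrow> 'm \<Rightarrow> 'm) \<Rightarrow> ('m \<Rightarrow> 'm) \<Rightarrow> 'g \<Rightarrow> 'g" where
  "Ad ex f Y = (THE Z. \<forall>t::real. ex (t *\<^sub>R Z) = f \<circ> ex (t *\<^sub>R Y) \<circ> inv f)"

text \<open>\<open>'g\<close> with bracket \<open>br\<close> is the Lie algebra of \<open>G\<close>: its elements correspond to the
  one-parameter subgroups, the vector space structure is the one for which \<open>(X, x) \<mapsto> exp(X) x\<close>
  is smooth (so that \<open>X\<close> is mapped linearly to the vector field \<open>d/dt exp(tX) x\<close> at \<open>t = 0\<close>), and
  \<open>[X, Y] = d/dt Ad(exp(tX)) Y\<close> at \<open>t = 0\<close>.\<close>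

definition is_lie_algebra_of ::
  "('m::topological_space, 'e::euclidean_space) chart set \<Rightarrow> ('m \<Rightarrow> 'm) set \<Rightarrow>
   ('g::euclidean_space \<Rightarrow> 'm \<Rightarrow> 'm) \<Rightarrow> ('g \<Rightarrow> 'g \<Rightarrow> 'g) \<Rightarrow> bool" where
  "is_lie_algebra_of A G ex br \<longleftrightarrow>
     (\<forall>X. one_parameter_subgroup G (\<lambda>t. ex (t *\<^sub>R X))) \<and>
     (\<forall>\<phi>. one_parameter_subgroup G \<phi> \<longrightarrow> (\<exists>!X. \<phi> = (\<lambda>t. ex (t *\<^sub>R X)))) \<and>
     continuous_on UNIV (\<lambda>(X, x). ex X x) \<and>
     (\<forall>c\<in>A. \<forall>d\<in>A. smooth_on {(X, y). y \<in> snd c ` fst c \<and> ex X (cinv c y) \<in> fst d}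
        (\<lambda>(X, y). snd d (ex X (cinv c y)))) \<and>
     (\<forall>X Y. ((\<lambda>t. Ad ex (ex (t *\<^sub>R X)) Y) has_vector_derivative br X Y) (at 0))"

text \<open>Value at \<open>x\<close> of the fundamental vector field of \<open>X\<close>, in the chart \<open>c\<close>.\<close>

definition fundamental :: "('g::real_vector \<Rightarrow> 'm \<Rightarrow> 'm) \<Rightarrow> ('m, 'e::euclidean_space) chart \<Rightarrow> 'g \<Rightarrow> 'm \<Rightarrow> 'e" where
  "fundamental ex c X x = velocity c (\<lambda>t. ex (t *\<^sub>R X) x) 0"

text \<open>The Lie algebra of the stabilizer of \<open>ob\<close>.\<close>

definition isotropy_algebra :: "('g::real_vector \<Rightarrow> 'm \<Rightarrow> 'm) \<Rightarrow> 'm \<Rightarrow> 'g set" where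
  "isotropy_algebra ex ob = {X. \<forall>t. ex (t *\<^sub>R X) ob = ob}"

text \<open>\<open>B(X,Y) = tr (ad X \<circ> ad Y)\<close>; the trace does not depend on the basis.\<close>

definition killing_form :: "('g::euclidean_space \<Rightarrow> 'g \<Rightarrow> 'g) \<Rightarrow> 'g \<Rightarrow> 'g \<Rightarrow> real" where
  "killing_form br X Y = (\<Sum>b\<in>Basis. br X (br Y b) \<bullet> b)"

definition cartan_ip :: "('g::euclidean_space \<Rightarrow> 'g \<Rightarrow> 'g) \<Rightarrow> ('g \<Rightarrow> 'g) \<Rightarrow> 'g \<Rightarrow> 'g \<Rightarrow> real" where
  "cartan_ip br \<theta> X Y = - killing_form br X (\<theta> Y)"

definition cartan_involution :: "('g::euclidean_space \<Rightarrow> 'g \<Rightarrow> 'g) \<Rightarrow> ('g \<Rightarrow> 'g) \<Rightarrow> bool" where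
  "cartan_involution br \<theta> \<longleftrightarrow>
     linear \<theta> \<and> (\<forall>X. \<theta> (\<theta> X) = X) \<and> (\<forall>X Y. \<theta> (br X Y) = br (\<theta> X) (\<theta> Y)) \<and>
     (\<forall>X. X \<noteq> 0 \<longrightarrow> cartan_ip br \<theta> X X > 0)"

definition pspace :: "('g::euclidean_space \<Rightarrow> 'g) \<Rightarrow> 'g set" where
  "pspace \<theta> = {X. \<theta> X = - X}"

definition kspace :: "('g \<Rightarrow> 'g) \<Rightarrow> 'g set" where
  "kspace \<theta> = {X. \<theta> X = X}"

section \<open>Irreducible Hermitian symmetric spaces of noncompact type\<close>

text \<open>\<open>M = G/K\<close> is of noncompact type if \<open>\<gg> = \<kk> \<oplus> \<pp>\<close>, with \<open>\<kk>\<close> the isotropy algebra, is the Cartan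
  decomposition of a Cartan involution of \<open>\<gg>\<close>, and irreducible if \<open>\<kk>\<close> acts irreducibly on \<open>\<pp>\<close>.\<close>

definition noncompact_type_at ::
  "('g::euclidean_space \<Rightarrow> 'm \<Rightarrow> 'm) \<Rightarrow> ('g \<Rightarrow> 'g \<Rightarrow> 'g) \<Rightarrow> ('g \<Rightarrow> 'g) \<Rightarrow> 'm \<Rightarrow> bool" where
  "noncompact_type_at ex br \<theta> ob \<longleftrightarrow> cartan_involution br \<theta> \<and> kspace \<theta> = isotropy_algebra ex ob"

definition irreducible_pair :: "('g::euclidean_space \<Rightarrow> 'g \<Rightarrow> 'g) \<Rightarrow> ('g \<Rightarrow> 'g) \<Rightarrow> bool" where
  "irreducible_pair br \<theta> \<longleftrightarrow>
     (\<forall>W. subspace W \<and> W \<subseteq> pspace \<theta> \<and> (\<forall>X\<in>kspace \<theta>. \<forall>Y\<in>W. br X Y \<in> W) \<longrightarrow> W = {0} \<or> W = pspace \<theta>)"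

text \<open>The standard Kaehler structure. The metric is automatically \<open>G\<close>-invariant, since \<open>G\<close> consists
  of isometries.\<close>

definition standard_kaehler ::
  "('m::topological_space, 'e::euclidean_space) chart set \<Rightarrow> ('m, 'e) metric_tensor \<Rightarrow> ('m, 'e) endo_tensor \<Rightarrow>
   ('g::euclidean_space \<Rightarrow> 'm \<Rightarrow> 'm) \<Rightarrow> ('g \<Rightarrow> 'g \<Rightarrow> 'g) \<Rightarrow> ('g \<Rightarrow> 'g) \<Rightarrow> 'g \<Rightarrow> 'm \<Rightarrow> bool" where
  "standard_kaehler A g J ex br \<theta> \<zeta> ob \<longleftrightarrow>
     (let Z = {X \<in> kspace \<theta>. \<forall>Y\<in>kspace \<theta>. br X Y = 0} in dim Z = 1 \<and> \<zeta> \<in> Z) \<and>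
     (\<forall>X\<in>pspace \<theta>. br \<zeta> (br \<zeta> X) = - X) \<and>
     (\<forall>f\<in>isom0 A g. preserves_J A J f) \<and>
     (\<forall>c\<in>A. ob \<in> fst c \<longrightarrow>
        bij_betw (\<lambda>X. fundamental ex c X ob) (pspace \<theta>) UNIV \<and>
        (\<forall>X\<in>pspace \<theta>. J c ob (fundamental ex c X ob) = fundamental ex c (br \<zeta> X) ob) \<and>
        (\<forall>X\<in>pspace \<theta>. \<forall>Y\<in>pspace \<theta>.
           g c ob (fundamental ex c X ob) (fundamental ex c Y ob) = cartan_ip br \<theta> X Y))"

text \<open>\<open>Exp\<^sub>o : \<pp> \<rightarrow> M\<close>, where \<open>\<pp>\<close> is identified with the tangent space at \<open>o\<close>.\<close>

definition Exp_at ::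
  "('m::topological_space, 'e::euclidean_space) chart set \<Rightarrow> ('m, 'e) metric_tensor \<Rightarrow>
   ('g::euclidean_space \<Rightarrow> 'm \<Rightarrow> 'm) \<Rightarrow> 'm \<Rightarrow> 'g \<Rightarrow> 'm" where
  "Exp_at A g ex ob X = riemannian_exp A g ob (\<lambda>c. fundamental ex c X ob)"

section \<open>Restricted roots\<close>

definition maximal_abelian_in :: "('g::euclidean_space \<Rightarrow> 'g \<Rightarrow> 'g) \<Rightarrow> 'g set \<Rightarrow> 'g set \<Rightarrow> bool" where
  "maximal_abelian_in br P a \<longleftrightarrow>
     subspace a \<and> a \<subseteq> P \<and> (\<forall>X\<in>a. \<forall>Y\<in>a. br X Y = 0) \<and>
     (\<forall>b. subspace b \<and> a \<subseteq> b \<and> b \<subseteq> P \<and> (\<forall>X\<in>b. \<forall>Y\<in>b. br X Y = 0) \<longrightarrow> b = a)"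

text \<open>Elements of the dual of \<open>a\<close> are functions on \<open>'g\<close> extended by \<open>0\<close> outside \<open>a\<close>, so that equality
  in the dual is equality of functions.\<close>

definition dual_space :: "'g::euclidean_space set \<Rightarrow> ('g \<Rightarrow> real) set" where
  "dual_space a =
     {l. (\<forall>X\<in>a. \<forall>Y\<in>a. l (X + Y) = l X + l Y) \<and> (\<forall>t. \<forall>X\<in>a. l (t *\<^sub>R X) = t * l X) \<and> (\<forall>X. X \<notin> a \<longrightarrow> l X = 0)}"

definition restricted_roots :: "('g::euclidean_space \<Rightarrow> 'g \<Rightarrow> 'g) \<Rightarrow> 'g set \<Rightarrow> ('g \<Rightarrow> real) set" where
  "restricted_roots br a =
     {l \<in> dual_space a. l \<noteq> (\<lambda>_. 0) \<and> (\<exists>X. X \<noteq> 0 \<and> (\<forall>H\<in>a. br H X = l H *\<^sub>R X))}"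

text \<open>The vector of \<open>a\<close> dual to \<open>l\<close> with respect to \<open>B\<close>, which on \<open>\<pp>\<close> is the inner product \<open>\<langle>\<cdot>,\<cdot>\<rangle>\<close>.\<close>

definition dual_vector :: "('g::euclidean_space \<Rightarrow> 'g \<Rightarrow> 'g) \<Rightarrow> 'g set \<Rightarrow> ('g \<Rightarrow> real) \<Rightarrow> 'g" where
  "dual_vector br a l = (THE H. H \<in> a \<and> (\<forall>X\<in>a. l X = killing_form br H X))"

definition orthogonal_dual_basis ::
  "('g::euclidean_space \<Rightarrow> 'g \<Rightarrow> 'g) \<Rightarrow> 'g set \<Rightarrow> (nat \<Rightarrow> 'g \<Rightarrow> real) \<Rightarrow> bool" where
  "orthogonal_dual_basis br a e \<longleftrightarrow>
     (\<forall>i\<in>{1..dim a}. e i \<in> dual_space a \<and> e i \<noteq> (\<lambda>_. 0)) \<and>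
     (\<forall>l\<in>dual_space a. \<exists>t. l = (\<lambda>X. \<Sum>i=1..dim a. t i * e i X)) \<and>
     (\<forall>i\<in>{1..dim a}. \<forall>j\<in>{1..dim a}. i \<noteq> j \<longrightarrow>
        killing_form br (dual_vector br a (e i)) (dual_vector br a (e j)) = 0)"

definition roots_C :: "nat \<Rightarrow> (nat \<Rightarrow> 'g \<Rightarrow> real) \<Rightarrow> ('g \<Rightarrow> real) set" where
  "roots_C r e =
     {(\<lambda>X. s * e i X + t * e j X) | s t i j. s \<in> {-1, 1} \<and> t \<in> {-1, 1} \<and> 1 \<le> i \<and> i < j \<and> j \<le> r} \<union>
     {(\<lambda>X. s * (2 * e i X)) | s i. s \<in> {-1, 1} \<and> 1 \<le> i \<and> i \<le> r}"

definition roots_BC :: "nat \<Rightarrow> (nat \<Rightarrow> 'g \<Rightarrow> real) \<Rightarrow> ('g \<Rightarrow> real) set" where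
  "roots_BC r e = roots_C r e \<union> {(\<lambda>X. s * e i X) | s i. s \<in> {-1, 1} \<and> 1 \<le> i \<and> i \<le> r}"

text \<open>\<open>2 e\<^sub>i = B(H\<^sub>i, \<cdot>)\<close> on \<open>a\<close>, and the normalized vector is \<open>(2 / \<parallel>H\<^sub>i\<parallel>\<^sup>2) H\<^sub>i\<close>.\<close>

definition root_vector :: "('g::euclidean_space \<Rightarrow> 'g \<Rightarrow> 'g) \<Rightarrow> 'g set \<Rightarrow> (nat \<Rightarrow> 'g \<Rightarrow> real) \<Rightarrow> nat \<Rightarrow> 'g" where
  "root_vector br a e i = dual_vector br a (\<lambda>X. 2 * e i X)"

definition normalized_root_vector ::
  "('g::euclidean_space \<Rightarrow> 'g \<Rightarrow> 'g) \<Rightarrow> ('g \<Rightarrow> 'g) \<Rightarrow> 'g set \<Rightarrow> (nat \<Rightarrow> 'g \<Rightarrow> real) \<Rightarrow> nat \<Rightarrow> 'g" where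
  "normalized_root_vector br \<theta> a e i =
     (2 / cartan_ip br \<theta> (root_vector br a e i) (root_vector br a e i)) *\<^sub>R root_vector br a e i"

definition flat_vector ::
  "('g::euclidean_space \<Rightarrow> 'g \<Rightarrow> 'g) \<Rightarrow> ('g \<Rightarrow> 'g) \<Rightarrow> 'g set \<Rightarrow> (nat \<Rightarrow> 'g \<Rightarrow> real) \<Rightarrow> (nat \<Rightarrow> real) \<Rightarrow> 'g" where
  "flat_vector br \<theta> a e x = (\<Sum>i=1..dim a. x i *\<^sub>R normalized_root_vector br \<theta> a e i)"

section \<open>Maps from the symmetric space to the vector space \<open>\<pp>\<close>\<close>

text \<open>\<open>\<Omega>(k Exp\<^sub>o(\<Sum> x\<^sub>i H\<^sub>i)) = Ad(k) \<Sum> f(x\<^sub>i) H\<^sub>i\<close>, with the normalized vectors \<open>H\<^sub>i\<close>.\<close>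

definition radial_map ::
  "('m::topological_space, 'e::euclidean_space) chart set \<Rightarrow> ('m, 'e) metric_tensor \<Rightarrow>
   ('g::euclidean_space \<Rightarrow> 'm \<Rightarrow> 'm) \<Rightarrow> ('g \<Rightarrow> 'g \<Rightarrow> 'g) \<Rightarrow> ('g \<Rightarrow> 'g) \<Rightarrow> 'm \<Rightarrow>
   'g set \<Rightarrow> (nat \<Rightarrow> 'g \<Rightarrow> real) \<Rightarrow> (real \<Rightarrow> real) \<Rightarrow> ('m \<Rightarrow> 'g) \<Rightarrow> bool" where
  "radial_map A g ex br \<theta> ob a e f \<Omega> \<longleftrightarrow>
     (\<forall>k\<in>stabilizer A g ob. \<forall>x :: nat \<Rightarrow> real.
        \<Omega> (k (Exp_at A g ex ob (flat_vector br \<theta> a e x))) = Ad ex k (flat_vector br \<theta> a e (\<lambda>i. f (x i))))"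

definition D_tanh ::
  "('m::topological_space, 'e::euclidean_space) chart set \<Rightarrow> ('m, 'e) metric_tensor \<Rightarrow>
   ('g::euclidean_space \<Rightarrow> 'm \<Rightarrow> 'm) \<Rightarrow> ('g \<Rightarrow> 'g \<Rightarrow> 'g) \<Rightarrow> ('g \<Rightarrow> 'g) \<Rightarrow> 'm \<Rightarrow>
   'g set \<Rightarrow> (nat \<Rightarrow> 'g \<Rightarrow> real) \<Rightarrow> 'g set" where
  "D_tanh A g ex br \<theta> ob a e =
     {Ad ex k (flat_vector br \<theta> a e y) | k y. k \<in> stabilizer A g ob \<and> (\<forall>i\<in>{1..dim a}. \<bar>y i\<bar> < 1)}"

definition K_equivariant ::
  "('m::topological_space, 'e::euclidean_space) chart set \<Rightarrow> ('m, 'e) metric_tensor \<Rightarrow>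
   ('g::euclidean_space \<Rightarrow> 'm \<Rightarrow> 'm) \<Rightarrow> 'm \<Rightarrow> ('m \<Rightarrow> 'g) \<Rightarrow> bool" where
  "K_equivariant A g ex ob \<Omega> \<longleftrightarrow> (\<forall>k\<in>stabilizer A g ob. \<forall>x. \<Omega> (k x) = Ad ex k (\<Omega> x))"

text \<open>The constant structures on \<open>\<pp>\<close> are \<open>J\<^sub>o = ad \<zeta>\<close> and \<open>\<omega>\<^sub>o(X,Y) = \<langle>J\<^sub>o X, Y\<rangle>\<close>.\<close>

definition holomorphic_map ::
  "('m, 'e::euclidean_space) chart set \<Rightarrow> ('m, 'e) endo_tensor \<Rightarrow>
   ('g::euclidean_space \<Rightarrow> 'g \<Rightarrow> 'g) \<Rightarrow> 'g \<Rightarrow> ('m \<Rightarrow> 'g) \<Rightarrow> bool" where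
  "holomorphic_map A J br \<zeta> \<Omega> \<longleftrightarrow>
     (\<forall>c\<in>A. \<forall>x\<in>fst c. \<forall>u. br \<zeta> (chart_deriv c \<Omega> x u) = chart_deriv c \<Omega> x (J c x u))"

definition symplectic_map ::
  "('m, 'e::euclidean_space) chart set \<Rightarrow> ('m, 'e) metric_tensor \<Rightarrow> ('m, 'e) endo_tensor \<Rightarrow>
   ('g::euclidean_space \<Rightarrow> 'g \<Rightarrow> 'g) \<Rightarrow> ('g \<Rightarrow> 'g) \<Rightarrow> 'g \<Rightarrow> ('m \<Rightarrow> 'g) \<Rightarrow> bool" where
  "symplectic_map A g J br \<theta> \<zeta> \<Omega> \<longleftrightarrow>
     (\<forall>c\<in>A. \<forall>x\<in>fst c. \<forall>u w.
        cartan_ip br \<theta> (br \<zeta> (chart_deriv c \<Omega> x u)) (chart_deriv c \<Omega> x w) = kaehler_form g J c x u w)"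

definition diffeo_onto ::
  "('m::topological_space, 'e::euclidean_space) chart set \<Rightarrow> 'g::euclidean_space set \<Rightarrow> 'g set \<Rightarrow>
   ('m \<Rightarrow> 'g) \<Rightarrow> bool" where
  "diffeo_onto A P D \<Omega> \<longleftrightarrow>
     openin (top_of_set P) D \<and> bij_betw \<Omega> UNIV D \<and> (\<forall>k. Ck_fun A k \<Omega>) \<and> smooth_into A D (inv \<Omega>)"

definition C1_embedding ::
  "('m::topological_space, 'e::euclidean_space) chart set \<Rightarrow> 'g::euclidean_space set \<Rightarrow> ('m \<Rightarrow> 'g) \<Rightarrow> bool" where
  "C1_embedding A P \<Omega> \<longleftrightarrow>
     range \<Omega> \<subseteq> P \<and> Ck_fun A 1 \<Omega> \<and> (\<forall>c\<in>A. \<forall>x\<in>fst c. inj (chart_deriv c \<Omega> x)) \<and>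
     (\<exists>\<Omega>'. homeomorphism UNIV (range \<Omega>) \<Omega> \<Omega>')"

definition maps_flat ::
  "('m::topological_space, 'e::euclidean_space) chart set \<Rightarrow> ('m, 'e) metric_tensor \<Rightarrow>
   ('g::euclidean_space \<Rightarrow> 'm \<Rightarrow> 'm) \<Rightarrow> 'm \<Rightarrow> 'g set \<Rightarrow> ('m \<Rightarrow> 'g) \<Rightarrow> bool" where
  "maps_flat A g ex ob a \<Omega> \<longleftrightarrow> \<Omega> ` (Exp_at A g ex ob ` a) \<subseteq> a"

end

(*  Write m = exp(X) o with X in p. The p-part of Ad(exp X) zeta and the operator U on p built from its k-part
    are smooth in X and K-equivariant, and on the flat they are given by sinh(2 x_i) and 1 + cosh(2 x_i);
    so Phi = 2 J (Ad(exp(X/2)) zeta)_p and U Psi = 2 J (Ad(exp X) zeta)_p are smooth without any discussion of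
    the Weyl chambers. For a K-equivariant map Omega let L_X be its differential at m, transported to p by exp(X).
    Differentiating equivariance along the isotropy algebra gives sinh(mu(X)) L_X Y = mu(Omega) Y for Y in the
    root space of mu and X in the flat. Hence L_X is diagonal in the root space decomposition, J permutes the
    root spaces (e_i + e_j with e_i - e_j, and 2 e_i with a), and "holomorphic" or "symplectic" becomes an identity
    between the eigenvalues, which for tanh and sinh holds by the addition theorems. Conversely these identities
    are ordinary differential equations for the components of Omega on the flat, and the walls x_i = x_j force
    all components to have the same profile. *)

theory Submission
  imports Defs
begin

section \<open>Calculus of the classes Ck\<close>

text \<open>The root system is given only as a set of functionals on \<open>a\<close>, so the fact
  that J permutes the root spaces has to be produced. Its source is the condition [[X, J X], X] = -
  4 J X: for such X the operators P = ad(X)^2 and P' = - J P J on p satisfy 3 P P' = 4 P - P^2.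
  Hence J sends a nonzero eigenvalue m of P to (4 - m) / 3, and roots are bounded by 2 on X. Enough
  such X come from diagonalizing a Jordan triple product on \<open>a\<close>; the bound by 2 forces
  the resulting frame to be, up to signs, the normalized root vectors. Everything about M is
  extracted from the atlas: conserved momenta determine the geodesics from o, properness makes Exp
  surjective, and compactness of the orbits of Ad(K) gives Ad(K) a = p by maximizing a linear
  functional. That k and x are not determined by the point k Exp(x) is handled without describing
  the Weyl group: an odd function of the coordinates agrees, at the finitely many values involved,
  with an odd polynomial, and odd polynomials extend to equivariant maps.\<close>

lemma Ck_on_cong:
  assumes "open U" "\<And>x. x \<in> U \<Longrightarrow> f x = g x" "Ck_on k U f"
  shows "Ck_on k U g"
  using assms
proof (induction k arbitrary: f g)
  case 0
  then show ?case by (simp cong: continuous_on_cong)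
next
  case (Suc k)
  have d: "(g has_derivative frechet_derivative f (at x)) (at x)" if "x \<in> U" for x
  proof (rule has_derivative_transform_within_open[OF _ Suc.prems(1) that Suc.prems(2)])
    show "(f has_derivative frechet_derivative f (at x)) (at x)"
      using Suc.prems(3) that frechet_derivative_works by auto
  qed
  have e: "frechet_derivative f (at x) = frechet_derivative g (at x)" if "x \<in> U" for x
    by (rule frechet_derivative_at[OF d[OF that]])
  have "Ck_on k U (\<lambda>x. frechet_derivative g (at x) v)" for v
    by (rule Suc.IH[OF Suc.prems(1), of "\<lambda>x. frechet_derivative f (at x) v"])
       (use e Suc.prems in auto)
  then show ?case using d by (auto simp: differentiable_def)
qed

lemma Ck_on_subset: "Ck_on k U f \<Longrightarrow> V \<subseteq> U \<Longrightarrow> Ck_on k V f"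
  by (induction k arbitrary: f) (auto intro: continuous_on_subset)

lemma Ck_on_continuous: "Ck_on k U f \<Longrightarrow> continuous_on U f"
  by (cases k) (auto simp: continuous_at_imp_continuous_on differentiable_imp_continuous_within)

lemma Ck_on_Suc_imp: "Ck_on (Suc k) U f \<Longrightarrow> Ck_on k U f"
proof (induction k arbitrary: f)
  case 0
  then show ?case using Ck_on_continuous[of "Suc 0"] by simp
next
  case (Suc k)
  then show ?case by (metis Ck_on.simps(2))
qed

lemma Ck_on_SucI:
  assumes "open U" "\<And>x. x \<in> U \<Longrightarrow> (f has_derivative f' x) (at x)" "\<And>v. Ck_on k U (\<lambda>x. f' x v)"
  shows "Ck_on (Suc k) U f"
proof -
  have "frechet_derivative f (at x) = f' x" if "x \<in> U" for x
    by (metis frechet_derivative_at assms(2) that)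
  then have "Ck_on k U (\<lambda>x. frechet_derivative f (at x) v)" for v
    by (intro Ck_on_cong[OF assms(1) _ assms(3)]) auto
  then show ?thesis using assms(2) by (auto simp: differentiable_def)
qed

lemma Ck_on_SucD:
  assumes "Ck_on (Suc k) U f"
  shows "\<And>x. x \<in> U \<Longrightarrow> (f has_derivative frechet_derivative f (at x)) (at x)"
    and "\<And>v. Ck_on k U (\<lambda>x. frechet_derivative f (at x) v)"
  using assms by (auto simp: frechet_derivative_works[symmetric])

lemma Ck_on_local:
  assumes "\<And>x. x \<in> U \<Longrightarrow> \<exists>V. open V \<and> x \<in> V \<and> Ck_on k V f"
  shows "Ck_on k U f"
  using assms
proof (induction k arbitrary: f)
  case 0
  have "continuous (at x) f" if "x \<in> U" for x
    using 0[OF that] by (auto simp: continuous_on_eq_continuous_at)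
  then show ?case by (simp add: continuous_at_imp_continuous_on)
next
  case (Suc k)
  have "f differentiable (at x)" if "x \<in> U" for x
    using Suc.prems[OF that] by auto
  moreover have "Ck_on k U (\<lambda>x. frechet_derivative f (at x) v)" for v
    using Suc.prems by (intro Suc.IH) force
  ultimately show ?case by simp
qed

lemma Ck_on_const [simp]: "Ck_on k U (\<lambda>_. c)"
proof (induction k arbitrary: c)
  case (Suc k)
  then show ?case by (simp add: frechet_derivative_const)
qed auto

lemma Ck_on_add:
  assumes "open U" "Ck_on k U f" "Ck_on k U g"
  shows "Ck_on k U (\<lambda>x. f x + g x)"
  using assms
proof (induction k arbitrary: f g)
  case 0
  then show ?case by (simp add: continuous_on_add)
next
  case (Suc k)
  show ?case
    by (rule Ck_on_SucI[OF Suc.prems(1) has_derivative_add[OF Ck_on_SucD(1)[OF Suc.prems(2)] Ck_on_SucD(1)[OF Suc.prems(3)]]])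
       (use Suc in \<open>auto intro!: Suc.IH\<close>)
qed

lemma Ck_on_bounded_linear:
  assumes "bounded_linear h" "open U" "Ck_on k U f"
  shows "Ck_on k U (\<lambda>x. h (f x))"
  using assms(3)
proof (induction k arbitrary: f)
  case 0
  then show ?case using assms(1) by (simp add: bounded_linear.continuous_on)
next
  case (Suc k)
  show ?case
    by (rule Ck_on_SucI[OF assms(2) bounded_linear.has_derivative[OF assms(1) Ck_on_SucD(1)[OF Suc.prems]]])
       (use Suc in \<open>auto intro!: Suc.IH\<close>)
qed

lemma Ck_on_id: "Ck_on k U (\<lambda>x. x)"
  by (cases k) (auto simp: frechet_derivative_ident)

lemma Ck_on_linear:
  assumes "linear (h :: 'a::euclidean_space \<Rightarrow> 'b::euclidean_space)" shows "Ck_on k U h"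
  by (rule Ck_on_subset[of _ UNIV])
    (use assms in \<open>auto intro!: Ck_on_bounded_linear[where f = "\<lambda>x. x"] Ck_on_id simp: linear_conv_bounded_linear\<close>)

lemma Ck_on_bounded_bilinear:
  fixes h :: "'b::euclidean_space \<Rightarrow> 'c::euclidean_space \<Rightarrow> 'd::euclidean_space"
  assumes "bounded_bilinear h" "open U" "Ck_on k U f" "Ck_on k U g"
  shows "Ck_on k U (\<lambda>x. h (f x) (g x))"
  using assms(3,4)
proof (induction k arbitrary: f g)
  case 0
  then show ?case using assms(1) by (simp add: bounded_bilinear.continuous_on)
next
  case (Suc k)
  show ?case
    by (rule Ck_on_SucI[OF assms(2) bounded_bilinear.FDERIV[OF assms(1)
           Ck_on_SucD(1)[OF Suc.prems(1)] Ck_on_SucD(1)[OF Suc.prems(2)]]], assumption, assumption)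
       (intro Ck_on_add assms(2) Suc.IH Ck_on_Suc_imp[OF Suc.prems(1)] Ck_on_Suc_imp[OF Suc.prems(2)]
          Ck_on_SucD(2)[OF Suc.prems(1)] Ck_on_SucD(2)[OF Suc.prems(2)])
qed

lemmas Ck_on_scaleR = Ck_on_bounded_bilinear[OF bounded_bilinear_scaleR]
lemmas Ck_on_inner = Ck_on_bounded_bilinear[OF bounded_bilinear_inner]

lemma Ck_on_scaleR_const: "open U \<Longrightarrow> Ck_on k U f \<Longrightarrow> Ck_on k U (\<lambda>x. c *\<^sub>R f x)"
  by (intro Ck_on_scaleR) auto

lemma Ck_on_minus: "open U \<Longrightarrow> Ck_on k U f \<Longrightarrow> Ck_on k U (\<lambda>x. - f x)"
  using Ck_on_bounded_linear[OF bounded_linear_minus[OF bounded_linear_ident]] by blast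

lemma Ck_on_diff: "open U \<Longrightarrow> Ck_on k U f \<Longrightarrow> Ck_on k U g \<Longrightarrow> Ck_on k U (\<lambda>x. f x - g x)"
  using Ck_on_add[of U k f "\<lambda>x. - g x"] Ck_on_minus by auto

lemma Ck_on_sum:
  assumes "open U" "finite I" "\<And>i. i \<in> I \<Longrightarrow> Ck_on k U (f i)"
  shows "Ck_on k U (\<lambda>x. \<Sum>i\<in>I. f i x)"
  using assms(2,3) by (induction I rule: finite_induct) (auto intro!: Ck_on_add assms(1) simp del: Ck_on.simps)

text \<open>Smoothness of an operator family is available vector by vector; expanding the argument
  in the basis turns the joint dependence into a finite sum of products. The chain rule in
  \<open>Ck_on_compose\<close> rests on this.\<close>

lemma Ck_on_apply_linear:
  fixes F :: "'a::euclidean_space \<Rightarrow> 'b::euclidean_space \<Rightarrow> 'c::euclidean_space"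
  assumes "open U" "\<And>x. x \<in> U \<Longrightarrow> linear (F x)" "\<And>v. Ck_on k U (\<lambda>x. F x v)" "Ck_on k U w"
  shows "Ck_on k U (\<lambda>x. F x (w x))"
proof -
  have "Ck_on k U (\<lambda>x. \<Sum>b\<in>Basis. (w x \<bullet> b) *\<^sub>R F x b)"
    by (intro Ck_on_sum Ck_on_scaleR Ck_on_inner assms finite_Basis Ck_on_const)
  moreover have "(\<Sum>b\<in>Basis. (w x \<bullet> b) *\<^sub>R F x b) = F x (w x)" if "x \<in> U" for x
  proof -
    have "F x (w x) = F x (\<Sum>b\<in>Basis. (w x \<bullet> b) *\<^sub>R b)" by (simp add: euclidean_representation)
    also have "\<dots> = (\<Sum>b\<in>Basis. (w x \<bullet> b) *\<^sub>R F x b)"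
      using assms(2)[OF that] by (simp add: linear_sum linear_scale)
    finally show ?thesis by simp
  qed
  ultimately show ?thesis by (intro Ck_on_cong[OF assms(1), where g = "\<lambda>x. F x (w x)"])
qed

lemma Ck_on_compose:
  fixes f :: "'b::euclidean_space \<Rightarrow> 'c::euclidean_space"
  assumes "open U" "Ck_on k V f" "Ck_on k U g" "g ` U \<subseteq> V"
  shows "Ck_on k U (\<lambda>x. f (g x))"
  using assms(2,3)
proof (induction k arbitrary: f)
  case 0
  then show ?case using assms(4) by (auto intro: continuous_on_compose2)
next
  case (Suc k)
  have g: "Ck_on k U g" using Suc.prems(2) by (rule Ck_on_Suc_imp)
  show ?case
  proof (rule Ck_on_SucI[OF assms(1)])
    fix x assume "x \<in> U"
    then show "((\<lambda>x. f (g x)) has_derivative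
         (\<lambda>v. frechet_derivative f (at (g x)) (frechet_derivative g (at x) v))) (at x)"
      using assms(4) by (intro has_derivative_compose[OF Ck_on_SucD(1)[OF Suc.prems(2)]] Ck_on_SucD(1)[OF Suc.prems(1)]) auto
  next
    fix v
    show "Ck_on k U (\<lambda>x. frechet_derivative f (at (g x)) (frechet_derivative g (at x) v))"
    proof (rule Ck_on_apply_linear[OF assms(1), where F = "\<lambda>x. frechet_derivative f (at (g x))"])
      fix x assume that: "x \<in> U"
      show "linear (frechet_derivative f (at (g x)))"
        using that assms(4) Suc.prems(1) by (intro linear_frechet_derivative) auto
    next
      fix v show "Ck_on k U (\<lambda>x. frechet_derivative f (at (g x)) v)"
        using Suc.IH[OF Ck_on_SucD(2)[OF Suc.prems(1)] g] .
    next
      show "Ck_on k U (\<lambda>x. frechet_derivative g (at x) v)" by (rule Ck_on_SucD(2)[OF Suc.prems(2)])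
    qed
  qed
qed

lemma Ck_on_Pair:
  assumes "open U" "Ck_on k U f" "Ck_on k U g"
  shows "Ck_on k U (\<lambda>x. (f x, g x))"
proof -
  have "Ck_on k U (\<lambda>x. (f x, 0) + (0, g x))"
    by (intro Ck_on_add assms Ck_on_bounded_linear[of "\<lambda>x. (x, 0)"] Ck_on_bounded_linear[of "\<lambda>x. (0, x)"]
         bounded_linear_Pair bounded_linear_ident bounded_linear_zero)
  then show ?thesis by simp
qed

lemma has_vector_derivative_compose:
  assumes "(c has_vector_derivative w) (at t)" "(f has_derivative f') (at (c t))"
  shows "((\<lambda>t. f (c t)) has_vector_derivative f' w) (at t)"
proof -
  have "((\<lambda>t. f (c t)) has_derivative (\<lambda>r. f' (r *\<^sub>R w))) (at t)"
    by (rule has_derivative_compose[where f = c and g = f, OF assms(1)[unfolded has_vector_derivative_def] assms(2)])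
  then show ?thesis
    using linear_scale[OF has_derivative_linear[OF assms(2)]] by (simp add: has_vector_derivative_def)
qed

lemma has_derivative_compose_at:
  assumes "(f has_derivative f') (at x)" "(g has_derivative g') (at p)" "f x = p"
  shows "((\<lambda>x. g (f x)) has_derivative (\<lambda>v. g' (f' v))) (at x)"
  using has_derivative_compose[of f f' x UNIV g g'] assms by simp

section \<open>Equality of mixed second derivatives\<close>

lemma mixed_difference:
  fixes f :: "'a::euclidean_space \<Rightarrow> real"
  assumes "Ck_on 2 U f" "0 < h" "\<And>s t. 0 \<le> s \<Longrightarrow> s \<le> h \<Longrightarrow> 0 \<le> t \<Longrightarrow> t \<le> h \<Longrightarrow> x + s *\<^sub>R v + t *\<^sub>R w \<in> U"
  shows "\<exists>s t. 0 < s \<and> s < h \<and> 0 < t \<and> t < h \<and>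
    f (x + h *\<^sub>R v + h *\<^sub>R w) - f (x + h *\<^sub>R v) - f (x + h *\<^sub>R w) + f x =
    h * h * frechet_derivative (\<lambda>y. frechet_derivative f (at y) v) (at (x + s *\<^sub>R v + t *\<^sub>R w)) w"
proof -
  let ?D = "\<lambda>y. frechet_derivative f (at y) v"
  have f: "(f has_derivative frechet_derivative f (at y)) (at y)" if "y \<in> U" for y
    using Ck_on_SucD(1)[of "Suc 0" U f y] assms(1) that by (simp add: numeral_2_eq_2)
  have D: "(?D has_derivative frechet_derivative ?D (at y)) (at y)" if "y \<in> U" for y
    using Ck_on_SucD(1)[OF Ck_on_SucD(2)[of "Suc 0" U f v], of y] assms(1) that by (simp add: numeral_2_eq_2)
  have df: "((\<lambda>s. f (x + s *\<^sub>R v + t *\<^sub>R w)) has_real_derivative ?D (x + s *\<^sub>R v + t *\<^sub>R w)) (at s)"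
    if "0 \<le> s" "s \<le> h" "0 \<le> t" "t \<le> h" for s t
  proof -
    have "((\<lambda>s. x + s *\<^sub>R v + t *\<^sub>R w) has_vector_derivative v) (at s)"
      by (auto intro!: derivative_eq_intros)
    from has_vector_derivative_compose[OF this f[OF assms(3)[OF that]]] show ?thesis
      by (simp add: has_real_derivative_iff_has_vector_derivative)
  qed
  have dD: "((\<lambda>t. ?D (x + s *\<^sub>R v + t *\<^sub>R w)) has_real_derivative frechet_derivative ?D (at (x + s *\<^sub>R v + t *\<^sub>R w)) w) (at t)"
    if "0 \<le> s" "s \<le> h" "0 \<le> t" "t \<le> h" for s t
  proof -
    have "((\<lambda>t. x + s *\<^sub>R v + t *\<^sub>R w) has_vector_derivative w) (at t)"
      by (auto intro!: derivative_eq_intros)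
    from has_vector_derivative_compose[OF this D[OF assms(3)[OF that]]] show ?thesis
      by (simp add: has_real_derivative_iff_has_vector_derivative)
  qed
  have "((\<lambda>s. f (x + s *\<^sub>R v + h *\<^sub>R w) - f (x + s *\<^sub>R v + 0 *\<^sub>R w)) has_real_derivative
      ?D (x + s *\<^sub>R v + h *\<^sub>R w) - ?D (x + s *\<^sub>R v + 0 *\<^sub>R w)) (at s)" if "0 \<le> s" "s \<le> h" for s
    by (rule DERIV_diff; rule df) (use that assms(2) in auto)
  from MVT2[OF assms(2) this] obtain s where s: "0 < s" "s < h" and
    e1: "(f (x + h *\<^sub>R v + h *\<^sub>R w) - f (x + h *\<^sub>R v + 0 *\<^sub>R w)) - (f (x + 0 *\<^sub>R v + h *\<^sub>R w) - f (x + 0 *\<^sub>R v + 0 *\<^sub>R w))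
      = (h - 0) * (?D (x + s *\<^sub>R v + h *\<^sub>R w) - ?D (x + s *\<^sub>R v + 0 *\<^sub>R w))"
    by blast
  from MVT2[OF assms(2) dD[of s]] s obtain t where t: "0 < t" "t < h" and
    e2: "?D (x + s *\<^sub>R v + h *\<^sub>R w) - ?D (x + s *\<^sub>R v + 0 *\<^sub>R w) =
      (h - 0) * frechet_derivative ?D (at (x + s *\<^sub>R v + t *\<^sub>R w)) w"
    by force
  show ?thesis
    using s t e1 e2 by (intro exI[of _ s] exI[of _ t]) (auto simp: algebra_simps)
qed

text \<open>The same second difference over a small square is evaluated in both orders by
  \<open>mixed_difference\<close>, so the two mixed derivatives agree at two points close to
  \<open>x\<close>; by continuity they cannot differ at \<open>x\<close>.\<close>

lemma second_derivative_symmetric_real: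
  fixes f :: "'a::euclidean_space \<Rightarrow> real"
  assumes "open U" "Ck_on 2 U f" "x \<in> U"
  shows "frechet_derivative (\<lambda>y. frechet_derivative f (at y) v) (at x) w =
         frechet_derivative (\<lambda>y. frechet_derivative f (at y) w) (at x) v" (is "?P x = ?Q x")
proof (rule ccontr)
  assume ne: "?P x \<noteq> ?Q x"
  define \<epsilon> where "\<epsilon> = \<bar>?P x - ?Q x\<bar> / 2"
  have e: "\<epsilon> > 0" using ne by (simp add: \<epsilon>_def)
  have "continuous_on U ?P" "continuous_on U ?Q"
    using assms(2) by (auto simp: numeral_2_eq_2)
  then have "isCont ?P x" "isCont ?Q x"
    using assms by (auto simp: continuous_on_eq_continuous_at)
  then obtain r1 r2 where r: "r1 > 0" "r2 > 0" "\<And>y. dist y x < r1 \<Longrightarrow> \<bar>?P y - ?P x\<bar> < \<epsilon>"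
    "\<And>y. dist y x < r2 \<Longrightarrow> \<bar>?Q y - ?Q x\<bar> < \<epsilon>"
    using e unfolding continuous_at_eps_delta dist_real_def by metis
  obtain r3 where r3: "r3 > 0" "ball x r3 \<subseteq> U" using assms openE by blast
  \<comment> \<open>The side is so small that the whole square lies within all three radii of
    \<open>x\<close>; the summand 1 keeps the denominator positive when both directions
    vanish.\<close>
  define h where "h = min r1 (min r2 r3) / (norm v + norm w + 1)"
  have h: "h > 0" using r r3 by (simp add: h_def add_nonneg_pos)
  have bd: "dist (x + s *\<^sub>R v + t *\<^sub>R w) x < min r1 (min r2 r3)" if "0 \<le> s" "s \<le> h" "0 \<le> t" "t \<le> h" for s t
  proof -
    have "dist (x + s *\<^sub>R v + t *\<^sub>R w) x = norm (s *\<^sub>R v + t *\<^sub>R w)" by (simp add: dist_norm add.assoc)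
    also have "\<dots> \<le> s * norm v + t * norm w"
      using that norm_triangle_ineq[of "s *\<^sub>R v" "t *\<^sub>R w"] by simp
    also have "\<dots> \<le> h * norm v + h * norm w"
      using that by (intro add_mono mult_right_mono) auto
    also have "\<dots> < h * (norm v + norm w + 1)" using h by (simp add: algebra_simps)
    also have "\<dots> = min r1 (min r2 r3)" unfolding h_def
      by (metis add_nonneg_pos add_nonneg_nonneg nonzero_eq_divide_eq norm_ge_zero less_irrefl zero_less_one)
    finally show ?thesis .
  qed
  have inU: "x + s *\<^sub>R v + t *\<^sub>R w \<in> U" if "0 \<le> s" "s \<le> h" "0 \<le> t" "t \<le> h" for s t
    using bd[OF that] r3 by (auto simp: dist_commute subset_iff)
  have inU': "x + s *\<^sub>R w + t *\<^sub>R v \<in> U" if "0 \<le> s" "s \<le> h" "0 \<le> t" "t \<le> h" for s t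
    using inU[of t s] that by (simp add: algebra_simps)
  obtain s t where st: "0 < s" "s < h" "0 < t" "t < h" and
    1: "f (x + h *\<^sub>R v + h *\<^sub>R w) - f (x + h *\<^sub>R v) - f (x + h *\<^sub>R w) + f x = h * h * ?P (x + s *\<^sub>R v + t *\<^sub>R w)"
    using mixed_difference[of U f h x v w, OF assms(2) h inU] by auto
  obtain s' t' where st': "0 < s'" "s' < h" "0 < t'" "t' < h" and
    2: "f (x + h *\<^sub>R w + h *\<^sub>R v) - f (x + h *\<^sub>R w) - f (x + h *\<^sub>R v) + f x = h * h * ?Q (x + s' *\<^sub>R w + t' *\<^sub>R v)"
    using mixed_difference[of U f h x w v, OF assms(2) h inU'] by auto
  have "f (x + h *\<^sub>R w + h *\<^sub>R v) = f (x + h *\<^sub>R v + h *\<^sub>R w)" by (simp add: algebra_simps)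
  with 1 2 have "h * h * ?P (x + s *\<^sub>R v + t *\<^sub>R w) = h * h * ?Q (x + s' *\<^sub>R w + t' *\<^sub>R v)" by linarith
  then have eq: "?P (x + s *\<^sub>R v + t *\<^sub>R w) = ?Q (x + s' *\<^sub>R w + t' *\<^sub>R v)"
    using h by simp
  have "\<bar>?P (x + s *\<^sub>R v + t *\<^sub>R w) - ?P x\<bar> < \<epsilon>" using bd[of s t] st by (intro r) auto
  moreover have "\<bar>?Q (x + s' *\<^sub>R w + t' *\<^sub>R v) - ?Q x\<bar> < \<epsilon>"
    using bd[of t' s'] st' by (intro r) (auto simp: algebra_simps)
  moreover have False if "\<bar>a - p\<bar> < e" "\<bar>b - q\<bar> < e" "a = b" "e = \<bar>p - q\<bar> / 2" for a b p q e :: real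
    using that by (auto simp: abs_if split: if_splits)
  ultimately show False using eq \<epsilon>_def by blast
qed

lemma frechet_derivative_bounded_linear:
  assumes "bounded_linear h" "f differentiable (at x)"
  shows "frechet_derivative (\<lambda>y. h (f y)) (at x) = (\<lambda>v. h (frechet_derivative f (at x) v))"
  using bounded_linear.has_derivative[OF assms(1)] assms(2) frechet_derivative_works
    frechet_derivative_at by metis

lemma second_derivative_symmetric:
  fixes f :: "'a::euclidean_space \<Rightarrow> 'b::euclidean_space"
  assumes "open U" "Ck_on 2 U f" "x \<in> U"
  shows "frechet_derivative (\<lambda>y. frechet_derivative f (at y) v) (at x) w =
         frechet_derivative (\<lambda>y. frechet_derivative f (at y) w) (at x) v"
proof (rule euclidean_eqI)
  fix b :: 'b assume b: "b \<in> Basis"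
  let ?f = "\<lambda>y. f y \<bullet> b"
  have C: "Ck_on 2 U ?f" using assms by (intro Ck_on_bounded_linear[of "\<lambda>z. z \<bullet> b"] bounded_linear_inner_left)
  have d1: "frechet_derivative ?f (at y) u = frechet_derivative f (at y) u \<bullet> b" if "y \<in> U" for y u
    using frechet_derivative_bounded_linear[OF bounded_linear_inner_left, of f y b] assms(2) that
    by (simp add: numeral_2_eq_2)
  have d2: "frechet_derivative (\<lambda>y. frechet_derivative ?f (at y) v) (at x) w =
     frechet_derivative (\<lambda>y. frechet_derivative f (at y) v) (at x) w \<bullet> b" for v w
  proof -
    have df: "(\<lambda>y. frechet_derivative f (at y) v) differentiable (at x)"
      using assms by (simp add: numeral_2_eq_2)
    have "((\<lambda>y. frechet_derivative f (at y) v \<bullet> b) has_derivative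
        (\<lambda>w. frechet_derivative (\<lambda>y. frechet_derivative f (at y) v) (at x) w \<bullet> b)) (at x)"
      by (rule bounded_linear.has_derivative[OF bounded_linear_inner_left]) (use df frechet_derivative_works in blast)
    then have "((\<lambda>y. frechet_derivative ?f (at y) v) has_derivative
        (\<lambda>w. frechet_derivative (\<lambda>y. frechet_derivative f (at y) v) (at x) w \<bullet> b)) (at x)"
      by (rule has_derivative_transform_within_open[OF _ assms(1,3)]) (simp add: d1)
    then show ?thesis by (metis frechet_derivative_at)
  qed
  show "frechet_derivative (\<lambda>y. frechet_derivative f (at y) v) (at x) w \<bullet> b =
         frechet_derivative (\<lambda>y. frechet_derivative f (at y) w) (at x) v \<bullet> b"
    using second_derivative_symmetric_real[OF assms(1) C assms(3), of v w] d2 by metis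
qed

section \<open>Smoothness of inverse operators and of inverse maps\<close>

lemma has_derivative_left_inverse:
  fixes f :: "'a::euclidean_space \<Rightarrow> 'a"
  assumes "open U" "x \<in> U" "continuous_on U f" "\<And>x. x \<in> U \<Longrightarrow> g (f x) = x"
    "(f has_derivative f') (at x)" "inj f'"
  shows "(g has_derivative inv f') (at (f x))"
proof (rule has_derivative_inverse_strong[OF assms(1-5)])
  have "surj f'" using linear_inj_imp_surj[OF has_derivative_linear[OF assms(5)] assms(6)] .
  then show "f' \<circ> inv f' = id" by (simp add: surj_iff)
qed

lemma linear_inv:
  fixes f :: "'a::euclidean_space \<Rightarrow> 'a"
  assumes "linear f" "inj f" shows "linear (inv f)" "f (inv f v) = v" "inv f (f v) = v"
proof -
  have s: "f (inv f v) = v" for v by (rule surj_f_inv_f[OF linear_inj_imp_surj[OF assms]])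
  show "f (inv f v) = v" by (rule s)
  show "inv f (f v) = v" by (rule inv_f_f[OF assms(2)])
  show "linear (inv f)"
    by (rule linearI; rule injD[OF assms(2)]) (simp_all only: s linear_add[OF assms(1)] linear_scale[OF assms(1)])
qed

lemma smooth_on_apply_linear:
  fixes F :: "'a::euclidean_space \<Rightarrow> 'b::euclidean_space \<Rightarrow> 'c::euclidean_space"
  assumes "open U" "\<And>x. x \<in> U \<Longrightarrow> linear (F x)" "\<And>v. Ck_on k U (\<lambda>x. F x v)"
  shows "Ck_on k (U \<times> UNIV) (\<lambda>p. F (fst p) (snd p))"
proof (rule Ck_on_apply_linear[where F = "\<lambda>p. F (fst p)"])
  show "open (U \<times> (UNIV :: 'b set))" using assms(1) by (simp add: open_Times)
  then show "Ck_on k (U \<times> (UNIV :: 'b set)) (\<lambda>p. F (fst p) v)" for v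
  proof (rule Ck_on_compose[of "U \<times> UNIV" k U "\<lambda>x. F x v" fst])
    show "Ck_on k U (\<lambda>x. F x v)" by (rule assms(3))
    show "Ck_on k (U \<times> (UNIV :: 'b set)) fst" by (rule Ck_on_linear[OF linear_fst])
  qed auto
qed (use assms(2) in \<open>auto intro: Ck_on_linear linear_snd\<close>)

context
  fixes F :: "'a::euclidean_space \<Rightarrow> 'b::euclidean_space \<Rightarrow> 'b" and U :: "'a set"
  assumes U: "open U" and lin: "\<And>x. x \<in> U \<Longrightarrow> linear (F x)" and inj: "\<And>x. x \<in> U \<Longrightarrow> inj (F x)"
    and smooth: "\<And>k v. Ck_on k U (\<lambda>x. F x v)"
begin

private abbreviation "\<Phi> \<equiv> \<lambda>p. F (fst p) (snd p)"

lemma operator_family_joint: "Ck_on k (U \<times> UNIV) \<Phi>"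
  by (rule smooth_on_apply_linear[OF U lin smooth])

lemma operator_family_joint_derivative:
  assumes "x \<in> U" shows "(\<Phi> has_derivative frechet_derivative \<Phi> (at (x, y))) (at (x, y))"
  using operator_family_joint[of "Suc 0"] assms frechet_derivative_works by auto

lemma operator_family_partial_snd:
  assumes "x \<in> U" shows "frechet_derivative \<Phi> (at (x, y)) (0, w) = F x w"
proof -
  have "((\<lambda>y. \<Phi> (x, y)) has_derivative (\<lambda>w. frechet_derivative \<Phi> (at (x, y)) (0, w))) (at y)"
    by (rule has_derivative_compose_at[where f = "\<lambda>y. (x, y)", OF _ operator_family_joint_derivative[OF assms]])
       (auto intro!: derivative_eq_intros)
  moreover have "((\<lambda>y. \<Phi> (x, y)) has_derivative F x) (at y)"
    using lin[OF assms] by (auto intro: linear_imp_has_derivative)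
  ultimately show ?thesis using has_derivative_unique by (metis (no_types, lifting))
qed

lemma operator_family_partial_fst:
  assumes "x \<in> U" shows "frechet_derivative \<Phi> (at (x, y)) (w, 0) = frechet_derivative (\<lambda>x. F x y) (at x) w"
proof -
  have "((\<lambda>x. \<Phi> (x, y)) has_derivative (\<lambda>w. frechet_derivative \<Phi> (at (x, y)) (w, 0))) (at x)"
    by (rule has_derivative_compose_at[where f = "\<lambda>x. (x, y)", OF _ operator_family_joint_derivative[OF assms]])
       (auto intro!: derivative_eq_intros)
  then have "((\<lambda>x. F x y) has_derivative (\<lambda>w. frechet_derivative \<Phi> (at (x, y)) (w, 0))) (at x)" by simp
  from frechet_derivative_at[OF this] show ?thesis by metis
qed

text \<open>The map \<open>(x, y) \<mapsto> (x, F x y)\<close> has the left inverse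
  \<open>(x, v) \<mapsto> (x, inv (F x) v)\<close> and an injective derivative, so the inverse
  function theorem applies to it. The second component of the inverse derivative is the familiar -
  F^-1 (dF) F^-1.\<close>

lemma operator_inverse_has_derivative:
  assumes "x \<in> U"
  shows "((\<lambda>x. inv (F x) v) has_derivative
    (\<lambda>w. - inv (F x) (frechet_derivative (\<lambda>x'. F x' (inv (F x) v)) (at x) w))) (at x)"
proof -
  let ?y = "inv (F x) v"
  let ?h = "\<lambda>p. (fst p, \<Phi> p)" and ?g = "\<lambda>p. (fst p, inv (F (fst p)) (snd p))"
  let ?h' = "\<lambda>p. (fst p, frechet_derivative \<Phi> (at (x, ?y)) p)"
  have hd: "(?h has_derivative ?h') (at (x, ?y))"
    by (rule has_derivative_Pair[OF _ operator_family_joint_derivative[OF assms]]) (auto intro!: derivative_eq_intros)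
  have "inj ?h'"
  proof (rule linear_injective_0[THEN iffD2, OF has_derivative_linear[OF hd], rule_format])
    fix p assume "?h' p = 0"
    then have "fst p = 0" "frechet_derivative \<Phi> (at (x, ?y)) (0, snd p) = 0"
      by (auto simp: prod_eq_iff) (metis prod.collapse)
    then have "fst p = 0" "F x (snd p) = 0" using operator_family_partial_snd[OF assms] by auto
    then show "p = 0" using linear_injective_0[OF lin[OF assms]] inj[OF assms] by (auto simp: prod_eq_iff)
  qed
  moreover have "continuous_on (U \<times> UNIV) ?h"
    by (intro continuous_intros Ck_on_continuous[OF operator_family_joint])
  ultimately have "(?g has_derivative inv ?h') (at (?h (x, ?y)))"
    using assms U inj hd
    by (intro has_derivative_left_inverse[of "U \<times> UNIV"]) (auto intro!: open_Times)
  moreover have e: "?h (x, ?y) = (x, v)" using linear_inv(2)[OF lin inj] assms by simp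
  ultimately have "((\<lambda>x. snd (?g (x, v))) has_derivative (\<lambda>w. snd (inv ?h' (w, 0)))) (at x)"
    by (intro bounded_linear.has_derivative[OF bounded_linear_snd] has_derivative_compose_at[where g = ?g and f = "\<lambda>x. (x, v)"])
       (auto intro!: derivative_eq_intros)
  moreover have "snd (inv ?h' (w, 0)) = - inv (F x) (frechet_derivative (\<lambda>x. F x ?y) (at x) w)" for w
  proof -
    let ?z = "- inv (F x) (frechet_derivative (\<lambda>x. F x ?y) (at x) w)"
    have "frechet_derivative \<Phi> (at (x, ?y)) (w, ?z) =
      frechet_derivative \<Phi> (at (x, ?y)) (w, 0) + frechet_derivative \<Phi> (at (x, ?y)) (0, ?z)"
      using linear_add[OF has_derivative_linear[OF operator_family_joint_derivative[OF assms]], of ?y "(w, 0)" "(0, ?z)"] by simp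
    also have "\<dots> = 0"
      using operator_family_partial_fst[OF assms] operator_family_partial_snd[OF assms]
        linear_neg[OF lin[OF assms]] linear_inv(2)[OF lin inj] assms by simp
    finally have "?h' (w, ?z) = (w, 0)" by simp
    then have "inv ?h' (w, 0) = (w, ?z)" by (rule inv_f_eq[OF \<open>inj ?h'\<close>])
    then show ?thesis by simp
  qed
  ultimately show ?thesis by simp
qed

text \<open>The derivative formula contains only the inverse itself and derivatives of
  \<open>F\<close>, so each degree of smoothness of the inverse yields the next one.\<close>

lemma operator_inverse_Ck: "Ck_on k U (\<lambda>x. inv (F x) v)"
proof (induction k arbitrary: v)
  case 0
  have "isCont (\<lambda>x. inv (F x) v) x" if "x \<in> U" for x
    using has_derivative_continuous[OF operator_inverse_has_derivative[OF that]] .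
  then show ?case by (simp add: continuous_at_imp_continuous_on)
next
  case (Suc k)
  show ?case
  proof (rule Ck_on_SucI[OF U operator_inverse_has_derivative])
    fix w
    let ?H = "\<lambda>x y. frechet_derivative (\<lambda>x. F x y) (at x) w"
    have linH: "linear (?H x)" if "x \<in> U" for x
    proof -
      have d: "((\<lambda>x. F x y) has_derivative frechet_derivative (\<lambda>x. F x y) (at x)) (at x)" for y
        using smooth[of "Suc 0" y] that frechet_derivative_works by auto
      show ?thesis
      proof (rule linearI)
        fix y z
        have "((\<lambda>x. F x y + F x z) has_derivative
           (\<lambda>w. frechet_derivative (\<lambda>x. F x y) (at x) w + frechet_derivative (\<lambda>x. F x z) (at x) w)) (at x)"
          by (intro has_derivative_add d)
        then have "((\<lambda>x. F x (y + z)) has_derivative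
           (\<lambda>w. frechet_derivative (\<lambda>x. F x y) (at x) w + frechet_derivative (\<lambda>x. F x z) (at x) w)) (at x)"
          by (rule has_derivative_transform_within_open[OF _ U that]) (simp add: linear_add[OF lin])
        from frechet_derivative_at[OF this, THEN fun_cong, of w] show "?H x (y + z) = ?H x y + ?H x z" by simp
      next
        fix c y
        have "((\<lambda>x. c *\<^sub>R F x y) has_derivative (\<lambda>w. c *\<^sub>R frechet_derivative (\<lambda>x. F x y) (at x) w)) (at x)"
          by (intro has_derivative_scaleR_right d)
        then have "((\<lambda>x. F x (c *\<^sub>R y)) has_derivative (\<lambda>w. c *\<^sub>R frechet_derivative (\<lambda>x. F x y) (at x) w)) (at x)"
          by (rule has_derivative_transform_within_open[OF _ U that]) (simp add: linear_scale[OF lin])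
        from frechet_derivative_at[OF this, THEN fun_cong, of w] show "?H x (c *\<^sub>R y) = c *\<^sub>R ?H x y" by simp
      qed
    qed
    have "Ck_on k U (\<lambda>x. ?H x (inv (F x) v))"
      by (rule Ck_on_apply_linear[OF U linH Ck_on_SucD(2)[OF smooth] Suc.IH])
    then have "Ck_on k U (\<lambda>x. inv (F x) (?H x (inv (F x) v)))"
      by (intro Ck_on_apply_linear[OF U linear_inv(1)[OF lin inj] Suc.IH])
    then show "Ck_on k U (\<lambda>x. - inv (F x) (?H x (inv (F x) v)))"
      by (rule Ck_on_minus[OF U])
  qed
qed

end

text \<open>Openness of the image is invariance of domain, since \<open>g\<close> makes
  \<open>f\<close> injective. The derivative of \<open>g\<close> at \<open>y\<close> is the inverse
  of the derivative of \<open>f\<close> at \<open>g y\<close>, which is as smooth as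
  \<open>g\<close> is; this raises the class of \<open>g\<close> by one.\<close>

theorem smooth_inverse:
  fixes f :: "'a::euclidean_space \<Rightarrow> 'a"
  assumes U: "open U" and f: "\<And>k. Ck_on k U f" and g: "\<And>x. x \<in> U \<Longrightarrow> g (f x) = x"
    and inj: "\<And>x. x \<in> U \<Longrightarrow> inj (frechet_derivative f (at x))"
  shows "open (f ` U)" "Ck_on k (f ` U) g"
proof -
  have cont: "continuous_on U f" by (rule Ck_on_continuous[OF f])
  have io: "inj_on f U" using g by (metis inj_onI)
  show o: "open (f ` U)" by (rule invariance_of_domain[OF cont U io])
  have df: "(f has_derivative frechet_derivative f (at x)) (at x)" if "x \<in> U" for x
    using Ck_on_SucD(1)[OF f that] .
  have dg: "(g has_derivative inv (frechet_derivative f (at (g y)))) (at y)" if "y \<in> f ` U" for y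
  proof -
    obtain x where x: "x \<in> U" "y = f x" using \<open>y \<in> f ` U\<close> by auto
    show ?thesis using has_derivative_left_inverse[OF U x(1) cont g df[OF x(1)] inj[OF x(1)]] x g by simp
  qed
  show "Ck_on k (f ` U) g"
  proof (induction k)
    case 0
    then show ?case using dg has_derivative_continuous continuous_at_imp_continuous_on by (metis Ck_on.simps(1))
  next
    case (Suc k)
    show ?case
    proof (rule Ck_on_SucI[OF o dg])
      fix v
      have "Ck_on k U (\<lambda>x. inv (frechet_derivative f (at x)) v)"
        by (rule operator_inverse_Ck[OF U has_derivative_linear[OF df] inj Ck_on_SucD(2)[OF f]])
      then show "Ck_on k (f ` U) (\<lambda>y. inv (frechet_derivative f (at (g y))) v)"
        by (rule Ck_on_compose[OF o _ Suc.IH]) (auto simp: g)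
    qed
  qed
qed

section \<open>Maps into a manifold and velocities of curves\<close>

definition Ck_into ::
  "('m::topological_space, 'e::euclidean_space) chart set \<Rightarrow> nat \<Rightarrow> 'a::euclidean_space set \<Rightarrow> ('a \<Rightarrow> 'm) \<Rightarrow> bool" where
  "Ck_into A k U \<phi> \<longleftrightarrow> continuous_on U \<phi> \<and> (\<forall>c\<in>A. Ck_on k (U \<inter> \<phi> -` fst c) (\<lambda>u. snd c (\<phi> u)))"

text \<open>Continuity of the curve is part of the notion because coordinate maps are total
  functions: differentiability of the coordinate expression alone does not keep the curve inside the
  chart near \<open>t\<close>.\<close>

definition has_velocity :: "('m::topological_space, 'e::euclidean_space) chart \<Rightarrow> (real \<Rightarrow> 'm) \<Rightarrow> real \<Rightarrow> 'e \<Rightarrow> bool" where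
  "has_velocity c \<gamma> t w \<longleftrightarrow>
     \<gamma> t \<in> fst c \<and> isCont \<gamma> t \<and> ((\<lambda>s. snd c (\<gamma> s)) has_vector_derivative w) (at t)"

lemma has_velocity_imp_velocity: "has_velocity c \<gamma> t w \<Longrightarrow> velocity c \<gamma> t = w"
  by (auto simp: has_velocity_def velocity_def comp_def vector_derivative_at)

lemma has_velocity_unique: "has_velocity c \<gamma> t w \<Longrightarrow> has_velocity c \<gamma> t w' \<Longrightarrow> w = w'"
  by (metis has_velocity_imp_velocity)

locale atlas =
  fixes A :: "('m::{t2_space,second_countable_topology}, 'e::euclidean_space) chart set"
  assumes atlas: "smooth_atlas A"
begin

lemma chart_at: obtains c where "c \<in> A" "x \<in> fst c"
  using atlas unfolding smooth_atlas_def by blast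

lemma chart_open: "c \<in> A \<Longrightarrow> open (fst c)" "c \<in> A \<Longrightarrow> open (snd c ` fst c)"
  and chart_homeo: "c \<in> A \<Longrightarrow> homeomorphism (fst c) (snd c ` fst c) (snd c) (cinv c)"
  using atlas unfolding smooth_atlas_def by blast+

lemma chart_continuous: "c \<in> A \<Longrightarrow> continuous_on (fst c) (snd c)"
  and cinv_continuous: "c \<in> A \<Longrightarrow> continuous_on (snd c ` fst c) (cinv c)"
  and cinv_chart [simp]: "c \<in> A \<Longrightarrow> x \<in> fst c \<Longrightarrow> cinv c (snd c x) = x"
  using chart_homeo unfolding homeomorphism_def by blast+

lemma chart_cinv [simp]: "c \<in> A \<Longrightarrow> y \<in> snd c ` fst c \<Longrightarrow> snd c (cinv c y) = y"
  and cinv_in [simp]: "c \<in> A \<Longrightarrow> y \<in> snd c ` fst c \<Longrightarrow> cinv c y \<in> fst c"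
  using cinv_chart by auto

lemma transition_Ck:
  "c \<in> A \<Longrightarrow> d \<in> A \<Longrightarrow> Ck_on k (snd c ` (fst c \<inter> fst d)) (\<lambda>y. snd d (cinv c y))"
  using atlas unfolding smooth_atlas_def smooth_on_def comp_def by blast

lemma Ck_into_open:
  assumes "open U" "Ck_into A k U \<phi>" "c \<in> A"
  shows "open (U \<inter> \<phi> -` fst c)"
  using assms continuous_open_preimage[OF _ assms(1) chart_open(1)[OF assms(3)]] by (auto simp: Ck_into_def)

lemma Ck_into_subset: "Ck_into A k U \<phi> \<Longrightarrow> V \<subseteq> U \<Longrightarrow> Ck_into A k V \<phi>"
  unfolding Ck_into_def by (meson Ck_on_subset Int_mono continuous_on_subset order_refl)

lemma Ck_into_const: "Ck_into A k U (\<lambda>_. x)"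
  by (auto simp: Ck_into_def intro: Ck_on_subset[OF Ck_on_const])

lemma Ck_into_compose:
  assumes "open V" "Ck_into A k U \<phi>" "Ck_on k V \<psi>" "\<psi> ` V \<subseteq> U"
  shows "Ck_into A k V (\<lambda>v. \<phi> (\<psi> v))"
  unfolding Ck_into_def
proof (intro conjI ballI)
  show c: "continuous_on V (\<lambda>v. \<phi> (\<psi> v))"
    by (rule continuous_on_compose2[OF _ Ck_on_continuous[OF assms(3)] assms(4)]) (use assms in \<open>simp add: Ck_into_def\<close>)
  fix c assume c': "c \<in> A"
  have "open (V \<inter> (\<lambda>v. \<phi> (\<psi> v)) -` fst c)"
    using continuous_open_preimage[OF c assms(1) chart_open(1)[OF c']] .
  then show "Ck_on k (V \<inter> (\<lambda>v. \<phi> (\<psi> v)) -` fst c) (\<lambda>v. snd c (\<phi> (\<psi> v)))"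
    by (rule Ck_on_compose[where f = "\<lambda>u. snd c (\<phi> u)" and g = \<psi> and V = "U \<inter> \<phi> -` fst c"])
       (use assms c' in \<open>auto simp: Ck_into_def intro: Ck_on_subset\<close>)
qed

lemma Ck_fun_compose:
  fixes \<Omega> :: "'m \<Rightarrow> 'b::euclidean_space"
  assumes "open U" "Ck_fun A k \<Omega>" "Ck_into A k U \<phi>"
  shows "Ck_on k U (\<lambda>u. \<Omega> (\<phi> u))"
proof (rule Ck_on_local)
  fix u assume u: "u \<in> U"
  obtain c where c: "c \<in> A" "\<phi> u \<in> fst c" by (rule chart_at)
  let ?V = "U \<inter> \<phi> -` fst c"
  have o: "open ?V" by (rule Ck_into_open[OF assms(1,3) c(1)])
  have "Ck_on k ?V (\<lambda>u. (\<Omega> \<circ> cinv c) (snd c (\<phi> u)))"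
    by (rule Ck_on_compose[where f = "\<Omega> \<circ> cinv c" and g = "\<lambda>u. snd c (\<phi> u)" and V = "snd c ` fst c", OF o])
       (use assms c in \<open>auto simp: Ck_fun_def Ck_into_def simp del: comp_apply\<close>)
  then have "Ck_on k ?V (\<lambda>u. \<Omega> (\<phi> u))"
    by (rule Ck_on_cong[OF o, rotated]) (use c in auto)
  then show "\<exists>V. open V \<and> u \<in> V \<and> Ck_on k V (\<lambda>u. \<Omega> (\<phi> u))" using o u c by blast
qed

lemma Ck_into_local:
  assumes "continuous_on U \<phi>"
    "\<And>u d. u \<in> U \<Longrightarrow> d \<in> A \<Longrightarrow> \<phi> u \<in> fst d \<Longrightarrow> \<exists>V. open V \<and> u \<in> V \<and> Ck_on k V (\<lambda>u. snd d (\<phi> u))"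
  shows "Ck_into A k U \<phi>"
  unfolding Ck_into_def using assms by (auto intro!: Ck_on_local)

lemma smooth_self_compose:
  assumes "open U" "smooth_self A f" "Ck_into A k U \<phi>"
  shows "Ck_into A k U (\<lambda>u. f (\<phi> u))"
proof (rule Ck_into_local)
  show cont: "continuous_on U (\<lambda>u. f (\<phi> u))"
    using assms by (auto simp: smooth_self_def Ck_into_def intro: continuous_on_compose2)
  fix u d assume u: "u \<in> U" "d \<in> A" "f (\<phi> u) \<in> fst d"
  obtain c where c: "c \<in> A" "\<phi> u \<in> fst c" by (rule chart_at)
  let ?V = "(U \<inter> \<phi> -` fst c) \<inter> (U \<inter> (\<lambda>u. f (\<phi> u)) -` fst d)"
  have o: "open ?V"
    using Ck_into_open[OF assms(1,3) c(1)] continuous_open_preimage[OF cont assms(1) chart_open(1)[OF u(2)]] by blast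
  have "Ck_on k ?V (\<lambda>u. (snd d \<circ> f \<circ> cinv c) (snd c (\<phi> u)))"
  proof (rule Ck_on_compose[where f = "snd d \<circ> f \<circ> cinv c" and g = "\<lambda>u. snd c (\<phi> u)" and V = "snd c ` (fst c \<inter> f -` fst d)", OF o])
    show "Ck_on k (snd c ` (fst c \<inter> f -` fst d)) (snd d \<circ> f \<circ> cinv c)"
      using assms(2) c u by (simp add: smooth_self_def smooth_on_def)
    show "Ck_on k ?V (\<lambda>u. snd c (\<phi> u))"
      by (rule Ck_on_subset[of k "U \<inter> \<phi> -` fst c"]) (use assms(3) c in \<open>auto simp: Ck_into_def\<close>)
  qed auto
  then have "Ck_on k ?V (\<lambda>u. snd d (f (\<phi> u)))"
    by (rule Ck_on_cong[OF o, rotated]) (use c in auto)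
  then show "\<exists>V. open V \<and> u \<in> V \<and> Ck_on k V (\<lambda>u. snd d (f (\<phi> u)))" using o u c by blast
qed

lemma smooth_self_chart_set:
  assumes "c \<in> A"
  shows "snd c ` (fst c \<inter> f -` S) = snd c ` fst c \<inter> (\<lambda>y. f (cinv c y)) -` S"
  using assms by auto

lemma Ck_into_cinv:
  assumes "c \<in> A" shows "Ck_into A k (snd c ` fst c) (cinv c)"
  unfolding Ck_into_def
  using cinv_continuous[OF assms] transition_Ck[OF assms, of _ k] smooth_self_chart_set[OF assms, of "\<lambda>x. x"] by simp

lemma smooth_self_iff:
  "smooth_self A f \<longleftrightarrow> continuous_on UNIV f \<and> (\<forall>c\<in>A. \<forall>k. Ck_into A k (snd c ` fst c) (\<lambda>y. f (cinv c y)))"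
proof (intro iffI conjI ballI allI)
  fix c k assume "smooth_self A f" "c \<in> A"
  then show "Ck_into A k (snd c ` fst c) (\<lambda>y. f (cinv c y))"
    by (intro smooth_self_compose[OF chart_open(2) _ Ck_into_cinv])
next
  assume f: "continuous_on UNIV f \<and> (\<forall>c\<in>A. \<forall>k. Ck_into A k (snd c ` fst c) (\<lambda>y. f (cinv c y)))"
  show "smooth_self A f"
    unfolding smooth_self_def smooth_on_def
  proof (intro conjI ballI allI)
    fix c d k assume cd: "c \<in> A" "d \<in> A"
    then have "Ck_on k (snd c ` fst c \<inter> (\<lambda>y. f (cinv c y)) -` fst d) (\<lambda>y. snd d (f (cinv c y)))"
      using f by (simp add: Ck_into_def)
    then show "Ck_on k (snd c ` (fst c \<inter> f -` fst d)) (snd d \<circ> f \<circ> cinv c)"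
      by (simp add: smooth_self_chart_set cd comp_def)
  qed (use f in simp)
qed (auto simp: smooth_self_def)

lemma smooth_self_id: "smooth_self A id"
  using Ck_into_cinv by (auto simp: smooth_self_iff id_def)

lemma smooth_self_comp: "smooth_self A f \<Longrightarrow> smooth_self A h \<Longrightarrow> smooth_self A (f \<circ> h)"
  unfolding smooth_self_iff[of "f \<circ> h"]
proof (intro conjI ballI allI)
  assume f: "smooth_self A f" and h: "smooth_self A h"
  show "continuous_on UNIV (f \<circ> h)"
    using f h continuous_on_compose[of UNIV h f] continuous_on_subset[of UNIV f "range h"] by (auto simp: smooth_self_def)
  fix c k assume c: "c \<in> A"
  show "Ck_into A k (snd c ` fst c) (\<lambda>y. (f \<circ> h) (cinv c y))"
    using smooth_self_compose[OF chart_open(2)[OF c] f smooth_self_compose[OF chart_open(2)[OF c] h Ck_into_cinv[OF c]]]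
    by simp
qed

lemma Ck_into_has_velocity:
  assumes "open I" "Ck_into A (Suc k) I \<gamma>" "t \<in> I" "c \<in> A" "\<gamma> t \<in> fst c"
  shows "has_velocity c \<gamma> t (velocity c \<gamma> t)"
proof -
  have "(\<lambda>s. snd c (\<gamma> s)) differentiable (at t)"
    using assms by (auto simp: Ck_into_def)
  then show ?thesis
    using assms by (auto simp: has_velocity_def velocity_def comp_def vector_derivative_works Ck_into_def continuous_on_eq_continuous_at)
qed

lemma has_velocity_eventually:
  assumes "has_velocity c \<gamma> t w" "c \<in> A"
  shows "\<forall>\<^sub>F s in at t. \<gamma> s \<in> fst c"
  using topological_tendstoD[of \<gamma> "\<gamma> t" "at t" "fst c"] chart_open(1)[OF assms(2)] assms(1)
  by (simp add: has_velocity_def isCont_def)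

lemma has_vector_derivative_transform_eventually:
  assumes "(f has_vector_derivative f') (at t)" "\<forall>\<^sub>F s in at t. f s = h s" "f t = h t"
  shows "(h has_vector_derivative f') (at t)"
  using assms unfolding has_vector_derivative_def
  using has_derivative_transform_eventually[of f "\<lambda>x. x *\<^sub>R f'" t UNIV h] by auto

lemma has_velocity_compose:
  assumes "has_velocity c \<gamma> t w" "c \<in> A" "(F \<circ> cinv c) differentiable (at (snd c (\<gamma> t)))"
  shows "((\<lambda>s. F (\<gamma> s)) has_vector_derivative chart_deriv c F (\<gamma> t) w) (at t)"
proof -
  have "((\<lambda>s. (F \<circ> cinv c) (snd c (\<gamma> s))) has_vector_derivative chart_deriv c F (\<gamma> t) w) (at t)"
    unfolding chart_deriv_def
    by (rule has_vector_derivative_compose[where c = "\<lambda>s. snd c (\<gamma> s)"])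
       (use assms has_velocity_def frechet_derivative_works in blast)+
  then show ?thesis
    by (rule has_vector_derivative_transform_eventually)
       (use has_velocity_eventually[OF assms(1,2)] assms in \<open>auto simp: has_velocity_def elim!: eventually_mono\<close>)
qed

lemma Ck_fun_differentiable:
  assumes "Ck_fun A (Suc k) \<Omega>" "c \<in> A" "x \<in> fst c"
  shows "(\<Omega> \<circ> cinv c) differentiable (at (snd c x))"
  using assms by (auto simp: Ck_fun_def)

lemma smooth_self_differentiable:
  assumes "smooth_self A f" "c \<in> A" "d \<in> A" "x \<in> fst c" "f x \<in> fst d"
  shows "((snd d \<circ> f) \<circ> cinv c) differentiable (at (snd c x))"
proof -
  have "Ck_on (Suc 0) (snd c ` (fst c \<inter> f -` fst d)) (snd d \<circ> f \<circ> cinv c)"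
    using assms(1-3) unfolding smooth_self_def smooth_on_def by blast
  then have "snd d \<circ> f \<circ> cinv c differentiable (at y)" if "y \<in> snd c ` (fst c \<inter> f -` fst d)" for y
    using that unfolding Ck_on.simps by blast
  then have "snd d \<circ> f \<circ> cinv c differentiable (at (snd c x))" using assms by blast
  then show ?thesis by simp
qed

lemma has_velocity_fun:
  assumes "has_velocity c \<gamma> t w" "c \<in> A" "Ck_fun A (Suc k) \<Omega>"
  shows "((\<lambda>s. \<Omega> (\<gamma> s)) has_vector_derivative chart_deriv c \<Omega> (\<gamma> t) w) (at t)"
  by (rule has_velocity_compose[OF assms(1,2) Ck_fun_differentiable[OF assms(3,2)]])
     (use assms in \<open>auto simp: has_velocity_def\<close>)

lemma has_velocity_self:
  assumes "has_velocity c \<gamma> t w" "c \<in> A" "smooth_self A f" "d \<in> A" "f (\<gamma> t) \<in> fst d"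
  shows "has_velocity d (\<lambda>s. f (\<gamma> s)) t (chart_deriv c (snd d \<circ> f) (\<gamma> t) w)"
proof -
  have "\<gamma> t \<in> fst c" "isCont \<gamma> t" using assms by (auto simp: has_velocity_def)
  moreover have "isCont (\<lambda>s. f (\<gamma> s)) t"
    using assms by (auto simp: has_velocity_def smooth_self_def continuous_on_eq_continuous_at intro: isCont_o2)
  ultimately show ?thesis
    using has_velocity_compose[OF assms(1,2) smooth_self_differentiable[OF assms(3,2,4)]] assms(5)
    unfolding has_velocity_def comp_apply by blast
qed

text \<open>Every coordinate vector is the velocity of a curve, so chain rules for
  \<open>chart_deriv\<close> can be proved by following curves.\<close>

lemma has_velocity_line:
  assumes "c \<in> A" "x \<in> fst c"
  shows "has_velocity c (\<lambda>t. cinv c (snd c x + t *\<^sub>R u)) 0 u"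
proof -
  let ?l = "\<lambda>t. snd c x + t *\<^sub>R u"
  have o: "open (?l -` (snd c ` fst c))"
    by (rule open_vimage[OF chart_open(2)[OF assms(1)]]) (intro continuous_intros)
  have "continuous_on (?l -` (snd c ` fst c)) (\<lambda>t. cinv c (?l t))"
    by (rule continuous_on_compose2[OF cinv_continuous[OF assms(1)]]) (auto intro!: continuous_intros)
  then have 1: "isCont (\<lambda>t. cinv c (?l t)) 0"
    using o assms by (simp add: continuous_on_eq_continuous_at)
  have "(?l has_vector_derivative u) (at 0)" by (auto intro!: derivative_eq_intros)
  then have "((\<lambda>t. snd c (cinv c (?l t))) has_vector_derivative u) (at 0)"
    by (rule has_vector_derivative_transform_eventually)
       (use assms in \<open>auto intro!: eventually_mono[OF eventually_at_in_open'[OF o]] simp: image_iff[symmetric]\<close>)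
  then show ?thesis using 1 assms by (simp add: has_velocity_def)
qed

lemma chart_deriv_linear:
  assumes "(F \<circ> cinv c) differentiable (at (snd c x))"
  shows "linear (chart_deriv c F x)"
  using linear_frechet_derivative[OF assms] by (simp add: chart_deriv_def[abs_def])

lemma chart_deriv_comp:
  assumes "c \<in> A" "d \<in> A" "e \<in> A" "x \<in> fst c" "h x \<in> fst d" "f (h x) \<in> fst e" "smooth_self A h" "smooth_self A f"
  shows "chart_deriv c (snd e \<circ> (f \<circ> h)) x u = chart_deriv d (snd e \<circ> f) (h x) (chart_deriv c (snd d \<circ> h) x u)"
proof -
  let ?\<gamma> = "\<lambda>t. cinv c (snd c x + t *\<^sub>R u)"
  have l: "has_velocity c ?\<gamma> 0 u" by (rule has_velocity_line[OF assms(1,4)])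
  have 0: "?\<gamma> 0 = x" using assms by simp
  have h: "has_velocity d (\<lambda>s. h (?\<gamma> s)) 0 (chart_deriv c (snd d \<circ> h) x u)"
    using has_velocity_self[OF l assms(1,7,2)] assms by simp
  have "has_velocity e (\<lambda>s. f (h (?\<gamma> s))) 0 (chart_deriv d (snd e \<circ> f) (h x) (chart_deriv c (snd d \<circ> h) x u))"
    using has_velocity_self[OF h assms(2,8,3)] assms by simp
  moreover have "has_velocity e (\<lambda>s. (f \<circ> h) (?\<gamma> s)) 0 (chart_deriv c (snd e \<circ> (f \<circ> h)) x u)"
    using has_velocity_self[OF l assms(1) smooth_self_comp[OF assms(8,7)] assms(3)] assms by simp
  ultimately show ?thesis using has_velocity_unique[where c = e and \<gamma> = "\<lambda>s. f (h (?\<gamma> s))"] by simp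
qed

lemma chart_deriv_id:
  assumes "c \<in> A" "x \<in> fst c" shows "chart_deriv c (snd c \<circ> id) x u = u"
  using has_velocity_self[OF has_velocity_line[OF assms] assms(1) smooth_self_id assms(1), of u]
    has_velocity_line[OF assms, of u] assms has_velocity_unique by simp

text \<open>The set of times at which the curve is at its starting point is closed; it is open
  because in a chart a vanishing derivative on an interval forces a constant. Serves as the
  uniqueness principle for integral curves.\<close>

lemma constant_curve:
  assumes "continuous_on UNIV \<gamma>" "\<And>t c. c \<in> A \<Longrightarrow> \<gamma> t \<in> fst c \<Longrightarrow> has_velocity c \<gamma> t 0"
  shows "\<gamma> t = \<gamma> 0"
proof -
  let ?T = "{t. \<gamma> t = \<gamma> 0}"
  have "closed ?T" by (rule closed_Collect_eq[OF assms(1)]) (intro continuous_intros)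
  moreover have "open ?T"
    unfolding open_contains_ball
  proof
    fix t assume "t \<in> ?T"
    obtain c where c: "c \<in> A" "\<gamma> t \<in> fst c" by (rule chart_at)
    have "open (\<gamma> -` fst c)" using open_vimage[OF chart_open(1)[OF c(1)] assms(1)] .
    then obtain e where e: "e > 0" "ball t e \<subseteq> \<gamma> -` fst c" using c openE by blast
    have "((\<lambda>s. snd c (\<gamma> s)) has_vector_derivative 0) (at s within ball t e)" if "s \<in> ball t e" for s
      using assms(2)[OF c(1), of s] e that has_vector_derivative_at_within
      unfolding has_velocity_def by blast
    then have "snd c (\<gamma> s) = snd c (\<gamma> t)" if "s \<in> ball t e" for s
      using has_vector_derivative_zero_constant[of "ball t e" "\<lambda>s. snd c (\<gamma> s)"] that e(1)
      by (metis convex_ball centre_in_ball)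
    then have "\<gamma> s = \<gamma> t" if "s \<in> ball t e" for s
    proof -
      have "\<gamma> s \<in> fst c" "\<gamma> t \<in> fst c" using that e by (auto simp: subset_iff)
      then show ?thesis using \<open>\<And>s. s \<in> ball t e \<Longrightarrow> snd c (\<gamma> s) = snd c (\<gamma> t)\<close>[OF that] cinv_chart[OF c(1)] by metis
    qed
    then have "ball t e \<subseteq> ?T" using \<open>t \<in> ?T\<close> by auto
    then show "\<exists>e>0. ball t e \<subseteq> ?T" using e(1) by blast
  qed
  moreover have "0 \<in> ?T" by simp
  ultimately have "?T = UNIV" using clopen[of ?T] by blast
  then show ?thesis by auto
qed

end

section \<open>The isometry group and its Lie algebra\<close>

lemma bounded_linear_unique_vector:
  fixes h :: "'a::euclidean_space \<Rightarrow> real"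
  assumes "linear h" shows "\<exists>r. \<forall>v. h v = v \<bullet> r"
proof -
  have "h v = v \<bullet> (\<Sum>b\<in>Basis. h b *\<^sub>R b)" for v
  proof -
    have "h v = h (\<Sum>b\<in>Basis. (v \<bullet> b) *\<^sub>R b)" by (simp add: euclidean_representation)
    then show ?thesis using assms by (simp add: linear_sum linear_scale inner_sum_right mult.commute)
  qed
  then show ?thesis by blast
qed

lemma span_eq_UNIV_if_separating:
  fixes S :: "'a::euclidean_space set"
  assumes "\<And>z. (\<forall>r\<in>S. z \<bullet> r = 0) \<Longrightarrow> z = 0"
  shows "span S = UNIV"
proof (rule ccontr)
  assume "span S \<noteq> UNIV"
  then have "span S \<subset> span UNIV" by auto
  then obtain x where "x \<noteq> 0" "\<And>y. y \<in> span S \<Longrightarrow> orthogonal x y"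
    using orthogonal_to_subspace_exists_gen by metis
  then show False using assms[of x] by (auto simp: orthogonal_def span_base)
qed

locale lie_action = atlas A for A :: "('m::{t2_space,second_countable_topology}, 'e::euclidean_space) chart set" +
  fixes g :: "('m, 'e) metric_tensor" and ex :: "'g::euclidean_space \<Rightarrow> 'm \<Rightarrow> 'm" and br :: "'g \<Rightarrow> 'g \<Rightarrow> 'g"
  assumes metric: "riemannian_metric A g" and lie: "is_lie_algebra_of A (isom0 A g) ex br"
begin

abbreviation "G \<equiv> isom0 A g"

lemma isometries_id: "id \<in> isometries A g"
  using metric smooth_self_id by (simp add: isometries_def riemannian_metric_def)

lemma isometries_comp:
  assumes "f \<in> isometries A g" "h \<in> isometries A g" shows "f \<circ> h \<in> isometries A g"
proof -
  have f: "bij f" "smooth_self A f" "smooth_self A (inv f)" "preserves_metric A g f"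
    and h: "bij h" "smooth_self A h" "smooth_self A (inv h)" "preserves_metric A g h"
    using assms by (auto simp: isometries_def)
  have "preserves_metric A g (f \<circ> h)"
    unfolding preserves_metric_def
  proof (intro ballI impI allI)
    fix c e x u w assume c: "c \<in> A" "e \<in> A" "x \<in> fst c" "(f \<circ> h) x \<in> fst e"
    obtain d where d: "d \<in> A" "h x \<in> fst d" by (rule chart_at)
    note [simp] = chart_deriv_comp[OF c(1) d(1) c(2) c(3) d(2) _ h(2) f(2)]
    show "g e ((f \<circ> h) x) (chart_deriv c (snd e \<circ> (f \<circ> h)) x u) (chart_deriv c (snd e \<circ> (f \<circ> h)) x w) = g c x u w"
      using f(4) h(4) c d unfolding preserves_metric_def by simp
  qed
  then show ?thesis
    using f h by (simp add: isometries_def bij_comp smooth_self_comp o_inv_distrib)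
qed

lemma isometries_inv:
  assumes "f \<in> isometries A g" shows "inv f \<in> isometries A g"
proof -
  have f: "bij f" "smooth_self A f" "smooth_self A (inv f)" "preserves_metric A g f"
    using assms by (auto simp: isometries_def)
  have ff: "f \<circ> inv f = id" using f(1) bij_is_surj surj_iff by blast
  have "preserves_metric A g (inv f)"
    unfolding preserves_metric_def
  proof (intro ballI impI allI)
    fix c d x u w assume c: "c \<in> A" "d \<in> A" "x \<in> fst c" "inv f x \<in> fst d"
    have fx: "f (inv f x) = x" using f(1) by (simp add: bij_is_surj surj_f_inv_f)
    have "chart_deriv d (snd c \<circ> f) (inv f x) (chart_deriv c (snd d \<circ> inv f) x u) = u" for u
      using chart_deriv_comp[OF c(1) c(2) c(1) c(3,4) _ f(3,2), of u] chart_deriv_id[OF c(1,3)] fx c(3) ff by simp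
    then show "g d (inv f x) (chart_deriv c (snd d \<circ> inv f) x u) (chart_deriv c (snd d \<circ> inv f) x w) = g c x u w"
      using f(4) c fx unfolding preserves_metric_def by metis
  qed
  then show ?thesis using f by (simp add: isometries_def bij_imp_bij_inv inv_inv_eq)
qed

lemma isometry_continuous: "f \<in> isometries A g \<Longrightarrow> continuous_on UNIV f"
  by (auto simp: isometries_def smooth_self_def)

lemma G_subset: "G \<subseteq> isometries A g"
  unfolding isom0_def by (rule connected_component_subset)

lemma G_id: "id \<in> G"
  using isometries_id by (simp add: isom0_def connected_component_refl)

lemma left_translate_continuous:
  assumes "continuous_on UNIV (f :: 'm \<Rightarrow> 'm)" shows "continuous_on S (\<lambda>h. f \<circ> h)"
proof -
  have "continuous_on S (\<lambda>h. h x)" for x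
    by (rule continuous_on_subset[OF continuous_on_product_coordinates]) auto
  then have "continuous_on S (\<lambda>h. f (h x))" for x
    by (rule continuous_on_compose2[OF assms]) auto
  then show ?thesis by (intro continuous_on_coordinatewise_then_product) (simp add: comp_def)
qed

lemma G_connected: "connected G"
  unfolding isom0_def by (rule connected_connected_component)

lemma G_maximal: "connected S \<Longrightarrow> S \<subseteq> isometries A g \<Longrightarrow> h \<in> S \<Longrightarrow> h \<in> G \<Longrightarrow> S \<subseteq> G"
  by (metis connected_component_eq connected_component_maximal isom0_def)

text \<open>Left translation by \<open>f\<close> is continuous for pointwise convergence, so the
  translate of \<open>G\<close> is connected; it contains \<open>f\<close> and therefore stays in
  the component.\<close>

lemma G_comp: assumes "f \<in> G" "h \<in> G" shows "f \<circ> h \<in> G"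
proof -
  have "(\<lambda>h. f \<circ> h) ` G \<subseteq> G"
  proof (rule G_maximal)
    show "connected ((\<lambda>h. f \<circ> h) ` G)"
      using assms G_subset by (intro connected_continuous_image left_translate_continuous G_connected isometry_continuous) auto
    show "(\<lambda>h. f \<circ> h) ` G \<subseteq> isometries A g" using assms G_subset isometries_comp by blast
    show "f \<in> (\<lambda>h. f \<circ> h) ` G" using G_id by (metis comp_id image_eqI)
  qed (rule assms)
  then show ?thesis using assms by blast
qed

lemma G_bij: "f \<in> G \<Longrightarrow> bij f" and G_smooth: "f \<in> G \<Longrightarrow> smooth_self A f"
  using G_subset by (auto simp: isometries_def)

lemma G_inv: assumes "f \<in> G" shows "inv f \<in> G"
proof -
  have i: "inv f \<in> isometries A g" using assms G_subset isometries_inv by blast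
  have "(\<lambda>h. inv f \<circ> h) ` G \<subseteq> G"
  proof (rule G_maximal)
    show "connected ((\<lambda>h. inv f \<circ> h) ` G)"
      by (intro connected_continuous_image left_translate_continuous G_connected isometry_continuous i)
    show "(\<lambda>h. inv f \<circ> h) ` G \<subseteq> isometries A g" using i G_subset isometries_comp by blast
    show "id \<in> (\<lambda>h. inv f \<circ> h) ` G" using assms G_bij[OF assms] by (metis bij_is_inj image_eqI inv_o_cancel)
  qed (rule G_id)
  then show ?thesis using G_id by auto
qed

lemma G_inv_apply [simp]: "f \<in> G \<Longrightarrow> f (inv f x) = x" "f \<in> G \<Longrightarrow> inv f (f x) = x"
  using G_bij by (auto simp: bij_is_surj surj_f_inv_f bij_is_inj inv_f_f)

lemma ex_one_parameter: "one_parameter_subgroup G (\<lambda>t. ex (t *\<^sub>R X))"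
  and ex_unique: "one_parameter_subgroup G \<phi> \<Longrightarrow> \<exists>!X. \<phi> = (\<lambda>t. ex (t *\<^sub>R X))"
  and ex_continuous: "continuous_on UNIV (\<lambda>(X, x). ex X x)"
  and ex_smooth: "c \<in> A \<Longrightarrow> d \<in> A \<Longrightarrow> Ck_on k {(X, y). y \<in> snd c ` fst c \<and> ex X (cinv c y) \<in> fst d}
        (\<lambda>(X, y). snd d (ex X (cinv c y)))"
  and Ad_derivative_0: "((\<lambda>t. Ad ex (ex (t *\<^sub>R X)) Y) has_vector_derivative br X Y) (at 0)"
  using lie unfolding is_lie_algebra_of_def smooth_on_def by blast+

lemma ex_eqI: "(\<And>t. ex (t *\<^sub>R X) = ex (t *\<^sub>R Y)) \<Longrightarrow> X = Y"
  using ex_unique[OF ex_one_parameter, of X] by (metis (no_types, lifting) ext)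

lemma ex_G: "ex X \<in> G"
  using ex_one_parameter[of X] by (auto simp: one_parameter_subgroup_def dest: range_subsetD[of _ _ 1])

lemma ex_add: "ex (s *\<^sub>R X) (ex (t *\<^sub>R X) x) = ex ((s + t) *\<^sub>R X) x"
  using ex_one_parameter[of X] by (simp add: one_parameter_subgroup_def)

text \<open>\<open>ex 0\<close> is idempotent and injective.\<close>

lemma ex_0 [simp]: "ex 0 x = x"
  using ex_add[of 0 0 0 x] G_bij[OF ex_G[of 0]] by (simp add: bij_is_inj inj_eq)

lemma ex_minus [simp]: "ex (- X) (ex X x) = x" "ex X (ex (- X) x) = x"
  using ex_add[of "-1" X 1 x] ex_add[of 1 X "-1" x] by auto

lemma inv_ex: "inv (ex X) = ex (- X)"
  by (rule inv_equality) auto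

lemma Ck_into_ex:
  fixes \<psi> :: "'a::euclidean_space \<Rightarrow> 'g"
  assumes U: "open U" and psi: "Ck_on k U \<psi>" and phi: "Ck_into A k U \<phi>"
  shows "Ck_into A k U (\<lambda>u. ex (\<psi> u) (\<phi> u))"
proof (rule Ck_into_local)
  have "continuous_on U (\<lambda>u. (\<psi> u, \<phi> u))"
    using Ck_on_continuous[OF psi] phi by (auto simp: Ck_into_def intro: continuous_intros)
  then show cont: "continuous_on U (\<lambda>u. ex (\<psi> u) (\<phi> u))"
    using continuous_on_compose2[OF ex_continuous, of U "\<lambda>u. (\<psi> u, \<phi> u)"] by simp
  fix u d assume u: "u \<in> U" "d \<in> A" "ex (\<psi> u) (\<phi> u) \<in> fst d"
  obtain c where c: "c \<in> A" "\<phi> u \<in> fst c" by (rule chart_at)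
  let ?V = "(U \<inter> \<phi> -` fst c) \<inter> (U \<inter> (\<lambda>u. ex (\<psi> u) (\<phi> u)) -` fst d)"
  have o: "open ?V"
    using Ck_into_open[OF U phi c(1)] continuous_open_preimage[OF cont U chart_open(1)[OF u(2)]] by blast
  have "Ck_on k ?V (\<lambda>u. (\<lambda>(X, y). snd d (ex X (cinv c y))) (\<psi> u, snd c (\<phi> u)))"
  proof (rule Ck_on_compose[where f = "\<lambda>(X, y). snd d (ex X (cinv c y))" and g = "\<lambda>u. (\<psi> u, snd c (\<phi> u))", OF o ex_smooth[OF c(1) u(2)]])
    have "Ck_on k ?V (\<lambda>u. snd c (\<phi> u))"
      by (rule Ck_on_subset[of k "U \<inter> \<phi> -` fst c"]) (use phi c in \<open>auto simp: Ck_into_def\<close>)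
    moreover have "Ck_on k ?V \<psi>" by (rule Ck_on_subset[OF psi]) auto
    ultimately show "Ck_on k ?V (\<lambda>u. (\<psi> u, snd c (\<phi> u)))" by (intro Ck_on_Pair[OF o])
  qed (use c u in auto)
  then have "Ck_on k ?V (\<lambda>u. snd d (ex (\<psi> u) (\<phi> u)))"
    by (rule Ck_on_cong[OF o, rotated]) (use c in auto)
  then show "\<exists>V. open V \<and> u \<in> V \<and> Ck_on k V (\<lambda>u. snd d (ex (\<psi> u) (\<phi> u)))" using o u c by blast
qed

lemma ex_curve_Ck_into: "Ck_into A k UNIV (\<lambda>t. ex (t *\<^sub>R X) x)"
  by (intro Ck_into_ex open_UNIV Ck_into_const Ck_on_scaleR Ck_on_id Ck_on_const)

lemma fundamental_velocity:
  assumes "c \<in> A" "x \<in> fst c"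
  shows "has_velocity c (\<lambda>t. ex (t *\<^sub>R X) x) 0 (fundamental ex c X x)"
  unfolding fundamental_def
  by (rule Ck_into_has_velocity[OF open_UNIV ex_curve_Ck_into]) (use assms in auto)

lemma has_velocity_shift:
  assumes "has_velocity c (\<lambda>s. \<gamma> (t + s)) 0 w" shows "has_velocity c \<gamma> t w"
proof -
  have "isCont (\<lambda>s. (\<lambda>s. \<gamma> (t + s)) (s - t)) t"
    by (rule isCont_o2[where g = "\<lambda>s. \<gamma> (t + s)"]) (use assms in \<open>auto simp: has_velocity_def\<close>)
  moreover have "((\<lambda>s. s - t) has_vector_derivative 1) (at t)" by (auto intro!: derivative_eq_intros)
  then have "((\<lambda>s. snd c (\<gamma> (t + (s - t)))) has_vector_derivative 1 *\<^sub>R w) (at t)"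
    using vector_diff_chain_at[of "\<lambda>s. s - t" 1 t "\<lambda>s. snd c (\<gamma> (t + s))" w] assms
    by (simp add: has_velocity_def comp_def)
  ultimately show ?thesis using assms by (simp add: has_velocity_def)
qed

lemma fundamental_velocity_at:
  assumes "c \<in> A" "ex (t *\<^sub>R X) x \<in> fst c"
  shows "has_velocity c (\<lambda>t. ex (t *\<^sub>R X) x) t (fundamental ex c X (ex (t *\<^sub>R X) x))"
proof (rule has_velocity_shift)
  show "has_velocity c (\<lambda>s. ex ((t + s) *\<^sub>R X) x) 0 (fundamental ex c X (ex (t *\<^sub>R X) x))"
    using fundamental_velocity[OF assms, of X] by (simp add: ex_add add.commute)
qed

text \<open>The value of the field is the derivative at 0 of \<open>Y \<mapsto> ex Y x\<close>,
  applied to \<open>X\<close>. Here the joint smoothness in the Lie algebra variable ties the vector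
  space structure to the group.\<close>

lemma fundamental_linear:
  assumes "c \<in> A" "x \<in> fst c"
  shows "linear (\<lambda>X. fundamental ex c X x)"
proof -
  have into: "Ck_into A (Suc 0) UNIV (\<lambda>Y. ex Y x)"
    by (intro Ck_into_ex open_UNIV Ck_into_const Ck_on_id)
  let ?W = "UNIV \<inter> (\<lambda>Y. ex Y x) -` fst c"
  have "Ck_on (Suc 0) ?W (\<lambda>Y. snd c (ex Y x))" using into assms by (simp add: Ck_into_def)
  then have d: "((\<lambda>Y. snd c (ex Y x)) has_derivative frechet_derivative (\<lambda>Y. snd c (ex Y x)) (at 0)) (at 0)"
    by (rule Ck_on_SucD(1)) (use assms in simp)
  have "fundamental ex c X x = frechet_derivative (\<lambda>Y. snd c (ex Y x)) (at 0) X" for X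
  proof -
    have "((\<lambda>t. t *\<^sub>R X) has_vector_derivative X) (at 0)" by (auto intro!: derivative_eq_intros)
    then have "((\<lambda>t. snd c (ex (t *\<^sub>R X) x)) has_vector_derivative frechet_derivative (\<lambda>Y. snd c (ex Y x)) (at 0) X) (at 0)"
      by (rule has_vector_derivative_compose) (use d in simp)
    then show ?thesis
      using fundamental_velocity[OF assms, of X] by (auto simp: has_velocity_def intro: vector_derivative_unique_at)
  qed
  then have "(\<lambda>X. fundamental ex c X x) = frechet_derivative (\<lambda>Y. snd c (ex Y x)) (at 0)" by auto
  then show ?thesis using has_derivative_linear[OF d] by simp
qed

text \<open>A vanishing field has constant orbits, and an element of the Lie algebra is determined
  by its one-parameter group. Identities in the Lie algebra can therefore be checked on fundamental
  fields.\<close>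

lemma fundamental_eq_0:
  assumes "\<And>c x. c \<in> A \<Longrightarrow> x \<in> fst c \<Longrightarrow> fundamental ex c Z x = 0"
  shows "Z = 0"
proof (rule ex_eqI)
  fix t
  show "ex (t *\<^sub>R Z) = ex (t *\<^sub>R 0)"
  proof
    fix x
    have "(\<lambda>t. ex (t *\<^sub>R Z) x) t = (\<lambda>t. ex (t *\<^sub>R Z) x) 0"
    proof (rule constant_curve)
      show "continuous_on UNIV (\<lambda>t. ex (t *\<^sub>R Z) x)" using ex_curve_Ck_into by (simp add: Ck_into_def)
      show "has_velocity c (\<lambda>t. ex (t *\<^sub>R Z) x) t 0" if "c \<in> A" "ex (t *\<^sub>R Z) x \<in> fst c" for t c
        using fundamental_velocity_at[OF that] assms[OF that] by simp
    qed
    then show "ex (t *\<^sub>R Z) x = ex (t *\<^sub>R 0) x" by simp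
  qed
qed

lemma fundamental_eqI:
  assumes "\<And>c x. c \<in> A \<Longrightarrow> x \<in> fst c \<Longrightarrow> fundamental ex c Y x = fundamental ex c Z x"
  shows "Y = Z"
proof -
  have "Y - Z = 0" by (rule fundamental_eq_0) (simp add: linear_diff[OF fundamental_linear] assms)
  then show ?thesis by simp
qed

lemma conj_one_parameter:
  assumes "f \<in> G" shows "one_parameter_subgroup G (\<lambda>t. f \<circ> ex (t *\<^sub>R Y) \<circ> inv f)"
  unfolding one_parameter_subgroup_def
proof (intro conjI allI)
  show "range (\<lambda>t. f \<circ> ex (t *\<^sub>R Y) \<circ> inv f) \<subseteq> G" using G_comp G_inv ex_G assms by auto
  show "continuous_on UNIV (\<lambda>t. f \<circ> ex (t *\<^sub>R Y) \<circ> inv f)"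
  proof (rule continuous_on_coordinatewise_then_product)
    fix x
    have "continuous_on UNIV f" using G_smooth[OF assms] by (simp add: smooth_self_def)
    moreover have "continuous_on UNIV (\<lambda>t. ex (t *\<^sub>R Y) (inv f x))" using ex_curve_Ck_into by (simp add: Ck_into_def)
    ultimately show "continuous_on UNIV (\<lambda>t. (f \<circ> ex (t *\<^sub>R Y) \<circ> inv f) x)"
      using continuous_on_compose2[of UNIV f UNIV "\<lambda>t. ex (t *\<^sub>R Y) (inv f x)"] by simp
  qed
  show "f \<circ> ex ((s + t) *\<^sub>R Y) \<circ> inv f = f \<circ> ex (s *\<^sub>R Y) \<circ> inv f \<circ> (f \<circ> ex (t *\<^sub>R Y) \<circ> inv f)" for s t
    using assms by (auto simp: ex_add)
qed

lemma Ad_conj: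
  assumes "f \<in> G" shows "ex (t *\<^sub>R Ad ex f Y) = f \<circ> ex (t *\<^sub>R Y) \<circ> inv f"
proof -
  have "\<exists>!Z. \<forall>t. ex (t *\<^sub>R Z) = f \<circ> ex (t *\<^sub>R Y) \<circ> inv f"
    using ex_unique[OF conj_one_parameter[OF assms], of Y] by (simp add: fun_eq_iff) metis
  from theI'[OF this] show ?thesis by (simp add: Ad_def)
qed

lemma Ad_eqI:
  assumes "f \<in> G" "\<And>t. ex (t *\<^sub>R Z) = f \<circ> ex (t *\<^sub>R Y) \<circ> inv f" shows "Ad ex f Y = Z"
  by (rule ex_eqI) (simp add: Ad_conj assms)

lemma Ad_apply: "f \<in> G \<Longrightarrow> ex (t *\<^sub>R Ad ex f Y) (f x) = f (ex (t *\<^sub>R Y) x)"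
  by (simp add: Ad_conj)

lemma Ad_apply1: "f \<in> G \<Longrightarrow> ex (Ad ex f Y) (f x) = f (ex Y x)"
  using Ad_apply[of f 1 Y x] by simp

lemma Ad_comp: "f \<in> G \<Longrightarrow> h \<in> G \<Longrightarrow> Ad ex (f \<circ> h) Y = Ad ex f (Ad ex h Y)"
  by (rule Ad_eqI) (auto simp: G_comp Ad_conj o_inv_distrib G_bij)

lemma Ad_id [simp]: "Ad ex id Y = Y"
  by (rule Ad_eqI) (auto simp: G_id)

lemma Ad_inv [simp]: "f \<in> G \<Longrightarrow> Ad ex f (Ad ex (inv f) Y) = Y" "f \<in> G \<Longrightarrow> Ad ex (inv f) (Ad ex f Y) = Y"
proof -
  assume f: "f \<in> G"
  have "f \<circ> inv f = id" "inv f \<circ> f = id" using f by auto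
  then show "Ad ex f (Ad ex (inv f) Y) = Y" "Ad ex (inv f) (Ad ex f Y) = Y"
    using Ad_comp[OF f G_inv[OF f], of Y] Ad_comp[OF G_inv[OF f] f, of Y] by (metis Ad_id)+
qed

lemma Ad_ex_minus [simp]: "Ad ex (ex X) (Ad ex (ex (- X)) Y) = Y" "Ad ex (ex (- X)) (Ad ex (ex X) Y) = Y"
  using Ad_inv[OF ex_G] by (simp_all add: inv_ex)

lemma Ad_ex_add: "Ad ex (ex (s *\<^sub>R X)) (Ad ex (ex (t *\<^sub>R X)) Y) = Ad ex (ex ((s + t) *\<^sub>R X)) Y"
proof -
  have "ex (s *\<^sub>R X) \<circ> ex (t *\<^sub>R X) = ex ((s + t) *\<^sub>R X)" by (auto simp: ex_add)
  then show ?thesis using Ad_comp[OF ex_G ex_G, of "s *\<^sub>R X" "t *\<^sub>R X" Y] by simp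
qed

lemma fundamental_Ad:
  assumes "f \<in> G" "c \<in> A" "d \<in> A" "x \<in> fst c" "f x \<in> fst d"
  shows "fundamental ex d (Ad ex f Y) (f x) = chart_deriv c (snd d \<circ> f) x (fundamental ex c Y x)"
proof -
  have "has_velocity d (\<lambda>t. f (ex (t *\<^sub>R Y) x)) 0 (chart_deriv c (snd d \<circ> f) x (fundamental ex c Y x))"
    using has_velocity_self[OF fundamental_velocity[OF assms(2,4)] assms(2) G_smooth[OF assms(1)] assms(3)] assms(5) by simp
  then show ?thesis
    using fundamental_velocity[OF assms(3,5), of "Ad ex f Y"] assms(1) has_velocity_unique by (simp add: Ad_apply)
qed

lemma chart_deriv_G_linear:
  assumes "f \<in> G" "c \<in> A" "d \<in> A" "x \<in> fst c" "f x \<in> fst d"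
  shows "linear (chart_deriv c (snd d \<circ> f) x)"
  by (rule chart_deriv_linear[OF smooth_self_differentiable]) (use assms G_smooth in auto)

text \<open>\<open>Ad\<close> is specified only through conjugated one-parameter groups. Linearity
  is read off from the fundamental fields, which are moved by the differential of
  \<open>f\<close>.\<close>

lemma Ad_linear: assumes "f \<in> G" shows "linear (Ad ex f)"
proof (rule linearI; rule fundamental_eqI)
  fix Y Z and r :: real and d x' assume d: "d \<in> A" "x' \<in> fst d"
  define x where "x = inv f x'"
  have fx: "f x = x'" using assms by (simp add: x_def)
  obtain c where c: "c \<in> A" "x \<in> fst c" by (rule chart_at)
  have *: "fundamental ex d (Ad ex f Y) x' = chart_deriv c (snd d \<circ> f) x (fundamental ex c Y x)" for Y
    using fundamental_Ad[OF assms c(1) d(1) c(2)] fx d by simp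
  have l: "linear (chart_deriv c (snd d \<circ> f) x)" using chart_deriv_G_linear[OF assms c(1) d(1) c(2)] fx d by simp
  show "fundamental ex d (Ad ex f (Y + Z)) x' = fundamental ex d (Ad ex f Y + Ad ex f Z) x'"
    by (simp add: linear_add[OF fundamental_linear[OF d]] * linear_add[OF fundamental_linear[OF c]] linear_add[OF l])
  show "fundamental ex d (Ad ex f (r *\<^sub>R Y)) x' = fundamental ex d (r *\<^sub>R Ad ex f Y) x'"
    by (simp add: linear_scale[OF fundamental_linear[OF d]] * linear_scale[OF fundamental_linear[OF c]] linear_scale[OF l])
qed

end

lemma zero_vector_derivative_constant:
  fixes f :: "real \<Rightarrow> 'a::real_normed_vector"
  assumes "\<And>t. (f has_vector_derivative 0) (at t)" shows "f t = f s"
  using has_vector_derivative_zero_constant[of UNIV f] assms by (metis UNIV_I convex_UNIV)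

lemma trace_commute:
  fixes S T :: "'a::euclidean_space \<Rightarrow> 'a"
  assumes "linear S" "linear T"
  shows "(\<Sum>b\<in>Basis. S (T b) \<bullet> b) = (\<Sum>b\<in>Basis. T (S b) \<bullet> b)"
proof -
  have *: "S (T b) \<bullet> b = (\<Sum>c\<in>Basis. (T b \<bullet> c) * (S c \<bullet> b))" if "linear S" for S T :: "'a \<Rightarrow> 'a" and b
  proof -
    have "S (T b) = S (\<Sum>c\<in>Basis. (T b \<bullet> c) *\<^sub>R c)" by (simp add: euclidean_representation)
    then show ?thesis using that by (simp add: linear_sum linear_scale inner_sum_left)
  qed
  show ?thesis
    unfolding *[OF assms(1), of T] *[OF assms(2), of S]
    by (subst sum.swap) (simp add: mult.commute)
qed

section \<open>Smoothness of the adjoint action and the identities of the bracket\<close>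

context lie_action
begin

text \<open>A covector that reads off one coordinate of the fundamental field at one point pairs
  smoothly with \<open>Ad ex (ex X) Y\<close>, because that field value is a time derivative of a
  smooth map. By \<open>fundamental_eq_0\<close> these covectors separate points, so they span the
  dual and all coordinates are smooth.\<close>

lemma Ad_ex_Ck: "Ck_on k UNIV (\<lambda>X. Ad ex (ex X) Y)"
proof -
  define S where "S = {r. \<exists>c x b. c \<in> A \<and> x \<in> fst c \<and> (\<forall>Z. fundamental ex c Z x \<bullet> b = Z \<bullet> r)}"
  have "span S = UNIV"
  proof (rule span_eq_UNIV_if_separating)
    fix Z assume Z: "\<forall>r\<in>S. Z \<bullet> r = 0"
    show "Z = 0"
    proof (rule fundamental_eq_0, rule euclidean_eqI)
      fix c x and b :: 'e assume c: "c \<in> A" "x \<in> fst c"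
      have "linear (\<lambda>Z. fundamental ex c Z x \<bullet> b)"
        using fundamental_linear[OF c] by (auto simp: linear_iff inner_add_left)
      then have "\<exists>r. \<forall>Z. fundamental ex c Z x \<bullet> b = Z \<bullet> r" using bounded_linear_unique_vector by blast
      then obtain r where r: "\<forall>Z. fundamental ex c Z x \<bullet> b = Z \<bullet> r" by blast
      then have "r \<in> S" using c unfolding S_def by blast
      then show "fundamental ex c Z x \<bullet> b = 0 \<bullet> b" using Z r by simp
    qed
  qed
  have "Ck_on k UNIV (\<lambda>X. Ad ex (ex X) Y \<bullet> r)" if "r \<in> span S" for r
    using that
  proof (induction rule: span_induct_alt)
    case base
    then show ?case by simp
  next
    case (step a r r')
    have "Ck_on k UNIV (\<lambda>X. Ad ex (ex X) Y \<bullet> r)"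
    proof -
      obtain c x b where c: "c \<in> A" "x \<in> fst c" and r: "\<And>Z. fundamental ex c Z x \<bullet> b = Z \<bullet> r"
        using step(1) unfolding S_def by blast
      \<comment> \<open>The conjugate of \<open>ex (t *\<^sub>R Y)\<close> by \<open>ex X\<close> as
        a smooth map of \<open>X\<close> and the time; its time derivative at 0 is the field of
        \<open>Ad ex (ex X) Y\<close> at \<open>x\<close>.\<close>
      let ?P = "\<lambda>p :: 'g \<times> real. ex (fst p) (ex (snd p *\<^sub>R Y) (ex (- fst p) x))"
      have into: "Ck_into A l UNIV ?P" for l
        by (intro Ck_into_ex open_UNIV Ck_into_const Ck_on_scaleR Ck_on_minus Ck_on_linear linear_fst linear_snd Ck_on_const)
      let ?W = "UNIV \<inter> ?P -` fst c"
      have W: "open ?W" by (rule Ck_into_open[OF open_UNIV into c(1)])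
      have C: "Ck_on (Suc l) ?W (\<lambda>p. snd c (?P p))" for l using into[of "Suc l"] c by (simp add: Ck_into_def)
      have in0: "(X, 0) \<in> ?W" for X using c by simp
      have "fundamental ex c (Ad ex (ex X) Y) x = frechet_derivative (\<lambda>p. snd c (?P p)) (at (X, 0)) (0, 1)" for X
      proof -
        have "((\<lambda>t. (X, t)) has_vector_derivative (0, 1)) (at 0)"
          by (auto intro!: derivative_eq_intros)
        then have "((\<lambda>t. snd c (?P (X, t))) has_vector_derivative
            frechet_derivative (\<lambda>p. snd c (?P p)) (at (X, 0)) (0, 1)) (at 0)"
          using has_vector_derivative_compose Ck_on_SucD(1)[OF C in0] by blast
        moreover have "?P (X, t) = ex (t *\<^sub>R Ad ex (ex X) Y) x" for t
          using Ad_apply[OF ex_G[of X], of t Y "ex (- X) x"] by simp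
        ultimately show ?thesis
          using fundamental_velocity[OF c, of "Ad ex (ex X) Y"]
          by (auto simp: has_velocity_def intro: vector_derivative_unique_at)
      qed
      moreover have "Ck_on k UNIV (\<lambda>X. frechet_derivative (\<lambda>p. snd c (?P p)) (at (X, 0)) (0, 1))"
        by (rule Ck_on_compose[where f = "\<lambda>p. frechet_derivative (\<lambda>p. snd c (?P p)) (at p) (0, 1)" and V = ?W
              and g = "\<lambda>X. (X, 0)", OF open_UNIV Ck_on_SucD(2)[OF C]])
           (use in0 in \<open>auto intro!: Ck_on_Pair Ck_on_id\<close>)
      ultimately have "Ck_on k UNIV (\<lambda>X. fundamental ex c (Ad ex (ex X) Y) x)" by simp
      then have "Ck_on k UNIV (\<lambda>X. fundamental ex c (Ad ex (ex X) Y) x \<bullet> b)" by (intro Ck_on_inner open_UNIV Ck_on_const)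
      then show ?thesis by (simp add: r)
    qed
    then have "Ck_on k UNIV (\<lambda>X. a * (Ad ex (ex X) Y \<bullet> r) + Ad ex (ex X) Y \<bullet> r')"
      using step(2) Ck_on_scaleR_const[of UNIV k "\<lambda>X. Ad ex (ex X) Y \<bullet> r" a] by (intro Ck_on_add) auto
    then show ?case by (simp add: inner_add_right)
  qed
  then have "Ck_on k UNIV (\<lambda>X. \<Sum>b\<in>Basis. (Ad ex (ex X) Y \<bullet> b) *\<^sub>R b)"
    using \<open>span S = UNIV\<close> by (intro Ck_on_sum Ck_on_scaleR open_UNIV finite_Basis Ck_on_const) auto
  then show ?thesis by (simp add: euclidean_representation)
qed

lemma bracket_eq_derivative: "br X Y = frechet_derivative (\<lambda>X. Ad ex (ex X) Y) (at 0) X"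
proof -
  have "((\<lambda>t. t *\<^sub>R X) has_vector_derivative X) (at 0)" by (auto intro!: derivative_eq_intros)
  then have "((\<lambda>t. Ad ex (ex (t *\<^sub>R X)) Y) has_vector_derivative frechet_derivative (\<lambda>X. Ad ex (ex X) Y) (at 0) X) (at 0)"
    by (rule has_vector_derivative_compose) (use Ck_on_SucD(1)[OF Ad_ex_Ck] in simp)
  then show ?thesis using Ad_derivative_0 vector_derivative_unique_at by blast
qed

lemma bracket_linear_left: "linear (\<lambda>X. br X Y)"
  unfolding bracket_eq_derivative
  using has_derivative_linear[OF Ck_on_SucD(1)[OF Ad_ex_Ck, of 0]] by simp

lemma bracket_linear_right: "linear (br X)"
proof (rule linearI)
  note l = Ad_linear[OF ex_G]
  show "br X (Y + Z) = br X Y + br X Z" for Y Z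
    using has_vector_derivative_add[OF Ad_derivative_0 Ad_derivative_0, of X Y X Z]
      vector_derivative_unique_at[OF Ad_derivative_0[of X "Y + Z"]] by (simp add: linear_add[OF l])
  show "br X (r *\<^sub>R Y) = r *\<^sub>R br X Y" for r Y
    using bounded_linear.has_vector_derivative[OF bounded_linear_scaleR_right Ad_derivative_0, of r X Y]
      vector_derivative_unique_at[OF Ad_derivative_0[of X "r *\<^sub>R Y"]] by (simp add: linear_scale[OF l])
qed

lemma Ad_bounded_linear: "f \<in> G \<Longrightarrow> bounded_linear (Ad ex f)"
  using Ad_linear by (simp add: linear_conv_bounded_linear)

lemma bracket_Ad:
  assumes "f \<in> G" shows "Ad ex f (br X Y) = br (Ad ex f X) (Ad ex f Y)"
proof -
  have "((\<lambda>t. Ad ex f (Ad ex (ex (t *\<^sub>R X)) Y)) has_vector_derivative Ad ex f (br X Y)) (at 0)"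
    by (rule bounded_linear.has_vector_derivative[OF Ad_bounded_linear[OF assms] Ad_derivative_0])
  moreover have "Ad ex f (Ad ex (ex (t *\<^sub>R X)) Y) = Ad ex (ex (t *\<^sub>R Ad ex f X)) (Ad ex f Y)" for t
  proof -
    have "f \<circ> ex (t *\<^sub>R X) = ex (t *\<^sub>R Ad ex f X) \<circ> f" using assms by (auto simp: Ad_apply)
    then show ?thesis using Ad_comp[OF assms ex_G] Ad_comp[OF ex_G assms] by metis
  qed
  ultimately show ?thesis using Ad_derivative_0 vector_derivative_unique_at by (metis (no_types, lifting) ext)
qed

lemma Ad_derivative:
  "((\<lambda>t. Ad ex (ex (t *\<^sub>R X)) Y) has_vector_derivative Ad ex (ex (t *\<^sub>R X)) (br X Y)) (at t)"
proof -
  have "((\<lambda>s. Ad ex (ex (t *\<^sub>R X)) (Ad ex (ex (s *\<^sub>R X)) Y)) has_vector_derivative Ad ex (ex (t *\<^sub>R X)) (br X Y)) (at (t - t))"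
    using bounded_linear.has_vector_derivative[OF Ad_bounded_linear[OF ex_G] Ad_derivative_0] by simp
  moreover have "((\<lambda>s. s - t) has_vector_derivative 1) (at t)" by (auto intro!: derivative_eq_intros)
  ultimately have "((\<lambda>s. Ad ex (ex (t *\<^sub>R X)) (Ad ex (ex ((s - t) *\<^sub>R X)) Y)) has_vector_derivative 1 *\<^sub>R Ad ex (ex (t *\<^sub>R X)) (br X Y)) (at t)"
    using vector_diff_chain_at[of "\<lambda>s. s - t" 1 t] by (simp add: comp_def)
  then show ?thesis by (simp add: Ad_ex_add)
qed

lemma Ad_ex_self: "Ad ex (ex (t *\<^sub>R X)) X = X"
proof (rule Ad_eqI[OF ex_G])
  fix s show "ex (s *\<^sub>R X) = ex (t *\<^sub>R X) \<circ> ex (s *\<^sub>R X) \<circ> inv (ex (t *\<^sub>R X))"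
    using ex_add[of _ X] by (auto simp: inv_ex simp flip: scaleR_minus_left)
qed

lemma bracket_self [simp]: "br X X = 0"
proof -
  have "((\<lambda>t. X) has_vector_derivative br X X) (at 0)" using Ad_derivative_0[of X X] by (simp add: Ad_ex_self)
  then show ?thesis using has_vector_derivative_const vector_derivative_unique_at by blast
qed

lemma bracket_bounded_bilinear: "bounded_bilinear br"
  using bracket_linear_left bracket_linear_right by (simp add: bilinear_conv_bounded_bilinear[symmetric] bilinear_def)

text \<open>The derivative at 0 of the fact that \<open>Ad\<close> along the one-parameter group of
  \<open>Z\<close> respects brackets.\<close>

lemma jacobi: "br Z (br X Y) = br (br Z X) Y + br X (br Z Y)"
proof -
  let ?A = "\<lambda>t. Ad ex (ex (t *\<^sub>R Z))"
  have "((\<lambda>t. br (?A t X) (?A t Y)) has_vector_derivative br (?A 0 X) (br Z Y) + br (br Z X) (?A 0 Y)) (at 0)"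
    by (rule bounded_bilinear.has_vector_derivative[OF bracket_bounded_bilinear Ad_derivative_0 Ad_derivative_0])
  then have "((\<lambda>t. ?A t (br X Y)) has_vector_derivative br X (br Z Y) + br (br Z X) Y) (at 0)"
    by (simp add: bracket_Ad[OF ex_G] ex_0[abs_def] flip: id_def)
  then show ?thesis using Ad_derivative_0[of Z "br X Y"] vector_derivative_unique_at by (metis add.commute)
qed

text \<open>Multiplication by \<open>exp (- l * t)\<close> gives a curve with zero
  derivative.\<close>

lemma Ad_eigenvector:
  assumes "br X E = l *\<^sub>R E" shows "Ad ex (ex (t *\<^sub>R X)) E = exp (l * t) *\<^sub>R E"
proof -
  let ?f = "\<lambda>t. exp (- l * t) *\<^sub>R Ad ex (ex (t *\<^sub>R X)) E"
  have "(?f has_vector_derivative 0) (at t)" for t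
  proof -
    have "(?f has_vector_derivative exp (- l * t) *\<^sub>R Ad ex (ex (t *\<^sub>R X)) (br X E) + (- l * exp (- l * t)) *\<^sub>R Ad ex (ex (t *\<^sub>R X)) E) (at t)"
      by (intro has_vector_derivative_scaleR Ad_derivative) (auto intro!: derivative_eq_intros)
    then show ?thesis by (simp add: assms linear_scale[OF Ad_linear[OF ex_G]] mult.commute)
  qed
  from zero_vector_derivative_constant[OF this, of t 0]
  have "exp (l * t) *\<^sub>R exp (- l * t) *\<^sub>R Ad ex (ex (t *\<^sub>R X)) E = exp (l * t) *\<^sub>R E"
    by (simp add: ex_0[abs_def] flip: id_def)
  then show ?thesis by (simp flip: exp_add)
qed

lemma Ad_commuting: "br X Y = 0 \<Longrightarrow> Ad ex (ex X) Y = Y"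
  using Ad_eigenvector[of X Y 0 1] by simp

lemma ex_product_velocity:
  assumes c: "c \<in> A" "x \<in> fst c"
  shows "has_velocity c (\<lambda>t. ex (t *\<^sub>R X) (ex (t *\<^sub>R Y) x)) 0 (fundamental ex c (X + Y) x)"
proof -
  let ?P = "\<lambda>p :: real \<times> real. ex (fst p *\<^sub>R X) (ex (snd p *\<^sub>R Y) x)"
  have into: "Ck_into A (Suc 0) UNIV ?P"
    by (intro Ck_into_ex open_UNIV Ck_into_const Ck_on_scaleR Ck_on_linear linear_fst linear_snd Ck_on_const)
  define D where "D = frechet_derivative (\<lambda>p. snd c (?P p)) (at (0, 0))"
  have D: "((\<lambda>p. snd c (?P p)) has_derivative D) (at (0, 0))"
    unfolding D_def by (rule Ck_on_SucD(1)[of 0 "UNIV \<inter> ?P -` fst c"]) (use into c in \<open>auto simp: Ck_into_def\<close>)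
  have "((\<lambda>t. (t, 0 :: real)) has_vector_derivative (1, 0)) (at 0)" by (auto intro!: derivative_eq_intros)
  from has_vector_derivative_compose[OF this D]
  have 1: "fundamental ex c X x = D (1, 0)"
    using fundamental_velocity[OF c, of X] by (auto simp: has_velocity_def intro: vector_derivative_unique_at)
  have "((\<lambda>t. (0 :: real, t)) has_vector_derivative (0, 1)) (at 0)" by (auto intro!: derivative_eq_intros)
  from has_vector_derivative_compose[OF this D]
  have 2: "fundamental ex c Y x = D (0, 1)"
    using fundamental_velocity[OF c, of Y] by (auto simp: has_velocity_def intro: vector_derivative_unique_at)
  have "((\<lambda>t :: real. (t, t)) has_vector_derivative (1, 1)) (at 0)" by (auto intro!: derivative_eq_intros)
  from has_vector_derivative_compose[OF this D]
  have 3: "((\<lambda>t. snd c (ex (t *\<^sub>R X) (ex (t *\<^sub>R Y) x))) has_vector_derivative D (1, 1)) (at 0)" by simp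
  have "D (1, 1) = D (1, 0) + D (0, 1)" using linear_add[OF has_derivative_linear[OF D], of "(1, 0)" "(0, 1)"] by simp
  then have "D (1, 1) = fundamental ex c (X + Y) x" by (simp add: 1 2 linear_add[OF fundamental_linear[OF c]])
  moreover have "Ck_into A 0 UNIV (\<lambda>t. ex (t *\<^sub>R X) (ex (t *\<^sub>R Y) x))"
    by (intro Ck_into_ex open_UNIV Ck_into_const Ck_on_scaleR Ck_on_id Ck_on_const)
  ultimately show ?thesis using 3 c by (simp add: has_velocity_def Ck_into_def continuous_on_eq_continuous_at)
qed

text \<open>Commuting makes the product of the two one-parameter groups a one-parameter group, so it
  has some generator; the velocity at time 0 identifies it as \<open>X + Y\<close>.\<close>

lemma ex_commuting_add:
  assumes "br X Y = 0" shows "ex (X + Y) x = ex X (ex Y x)"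
proof -
  let ?\<phi> = "\<lambda>t. ex (t *\<^sub>R X) \<circ> ex (t *\<^sub>R Y)"
  have "Ad ex (ex (t *\<^sub>R X)) Y = Y" for t
    using Ad_commuting[of "t *\<^sub>R X" Y] assms by (simp add: linear_scale[OF bracket_linear_left])
  then have comm: "ex (t *\<^sub>R X) (ex (s *\<^sub>R Y) x) = ex (s *\<^sub>R Y) (ex (t *\<^sub>R X) x)" for s t x
    using Ad_apply[OF ex_G, of s "t *\<^sub>R X" Y x] by simp
  have "one_parameter_subgroup G ?\<phi>"
    unfolding one_parameter_subgroup_def
  proof (intro conjI allI)
    show "range ?\<phi> \<subseteq> G" using G_comp ex_G by auto
    show "continuous_on UNIV ?\<phi>"
    proof (rule continuous_on_coordinatewise_then_product)
      fix x
      have "Ck_into A 0 UNIV (\<lambda>t. ex (t *\<^sub>R X) (ex (t *\<^sub>R Y) x))"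
        by (intro Ck_into_ex open_UNIV Ck_into_const Ck_on_scaleR Ck_on_id Ck_on_const)
      then show "continuous_on UNIV (\<lambda>t. ?\<phi> t x)" by (simp add: Ck_into_def)
    qed
    show "?\<phi> (s + t) = ?\<phi> s \<circ> ?\<phi> t" for s t
      by (rule ext) (simp add: ex_add[symmetric] comm)
  qed
  then obtain V where V: "?\<phi> = (\<lambda>t. ex (t *\<^sub>R V))" using ex_unique by blast
  have "V = X + Y"
  proof (rule fundamental_eqI)
    fix c x assume c: "c \<in> A" "x \<in> fst c"
    have "has_velocity c (\<lambda>t. ex (t *\<^sub>R V) x) 0 (fundamental ex c (X + Y) x)"
      using ex_product_velocity[OF c, of X Y] V by (simp add: fun_eq_iff)
    then show "fundamental ex c V x = fundamental ex c (X + Y) x"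
      using fundamental_velocity[OF c] has_velocity_unique by blast
  qed
  then show ?thesis using V[THEN fun_cong, of 1] by (simp add: fun_eq_iff)
qed

lemma killing_form_Ad:
  assumes "f \<in> G" shows "killing_form br (Ad ex f X) (Ad ex f Y) = killing_form br X Y"
proof -
  let ?F = "Ad ex f" and ?I = "Ad ex (inv f)"
  have "br (?F X) (br (?F Y) b) = ?F (br X (br Y (?I b)))" for b
    using assms by (simp add: bracket_Ad)
  then have "killing_form br (?F X) (?F Y) = (\<Sum>b\<in>Basis. ?F ((br X \<circ> br Y \<circ> ?I) b) \<bullet> b)"
    by (simp add: killing_form_def)
  also have "\<dots> = (\<Sum>b\<in>Basis. (br X \<circ> br Y \<circ> ?I) (?F b) \<bullet> b)"
    by (rule trace_commute) (intro Ad_linear assms G_inv linear_compose bracket_linear_right)+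
  also have "\<dots> = killing_form br X Y" using assms by (simp add: killing_form_def)
  finally show ?thesis .
qed

end

section \<open>Commuting symmetric operators\<close>

lemma quadratic_nonneg_linear_term_0:
  fixes \<beta> \<gamma> :: real
  assumes "\<And>t. 2 * t * \<beta> + t\<^sup>2 * \<gamma> \<ge> 0" shows "\<beta> = 0"
proof (rule ccontr)
  assume "\<beta> \<noteq> 0"
  \<comment> \<open>Any positive \<open>d\<close> with \<open>\<gamma> < 2 * d\<close> makes the
    quadratic expression negative at \<open>t = - \<beta> / d\<close>.\<close>
  define d where "d = \<bar>\<gamma>\<bar> + 1"
  have d: "d > 0" "\<gamma> < 2 * d" by (auto simp: d_def)
  have "0 \<le> d\<^sup>2 * (2 * (- \<beta> / d) * \<beta> + (- \<beta> / d)\<^sup>2 * \<gamma>)"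
    using assms[of "- \<beta> / d"] by (intro mult_nonneg_nonneg) auto
  also have "\<dots> = \<beta>\<^sup>2 * (\<gamma> - 2 * d)" using d(1) by (simp add: field_simps power2_eq_square)
  also have "\<dots> < 0" using d \<open>\<beta> \<noteq> 0\<close> by (simp add: mult_pos_neg)
  finally show False by simp
qed

locale positive_form =
  fixes f :: "'a::euclidean_space \<Rightarrow> 'a \<Rightarrow> real"
  assumes bilin: "bilinear f" and sym: "f x y = f y x" and pos: "x \<noteq> 0 \<Longrightarrow> f x x > 0"
begin

lemma lin: "linear (f x)" "linear (\<lambda>x. f x y)"
  using bilin by (auto simp: bilinear_def)

lemmas form_simps = linear_add[OF lin(1)] linear_add[OF lin(2)] linear_scale[OF lin(1)] linear_scale[OF lin(2)]
  linear_diff[OF lin(1)] linear_diff[OF lin(2)] linear_neg[OF lin(1)] linear_neg[OF lin(2)]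

lemma zero [simp]: "f 0 x = 0" "f x 0 = 0"
  using linear_0[OF lin(1)] linear_0[OF lin(2)] by auto

lemma eq_0_iff: "f x x = 0 \<longleftrightarrow> x = 0"
  using pos[of x] zero(1)[of 0] by fastforce

lemma nonneg: "f x x \<ge> 0"
  using pos[of x] by (cases "x = 0") auto

lemma orthogonal_span_eq_0:
  assumes "\<And>b. b \<in> S \<Longrightarrow> f x b = 0" "x \<in> span S" shows "x = 0"
proof -
  have "f x y = 0" if "y \<in> span S" for y
    using that by (induction rule: span_induct_alt) (auto simp: form_simps assms(1))
  then show ?thesis using assms(2) eq_0_iff by blast
qed

lemma orthogonal_expansion:
  assumes "finite S" "0 \<notin> S" "\<And>b c. b \<in> S \<Longrightarrow> c \<in> S \<Longrightarrow> b \<noteq> c \<Longrightarrow> f b c = 0" "x \<in> span S"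
  shows "x = (\<Sum>b\<in>S. (f x b / f b b) *\<^sub>R b)"
proof -
  let ?y = "x - (\<Sum>b\<in>S. (f x b / f b b) *\<^sub>R b)"
  have "?y = 0"
  proof (rule orthogonal_span_eq_0)
    show "?y \<in> span S" by (intro span_diff[OF assms(4)] span_sum span_scale span_base)
    fix c assume c: "c \<in> S"
    have "f (\<Sum>b\<in>S. (f x b / f b b) *\<^sub>R b) c = (\<Sum>b\<in>S. (f x b / f b b) * f b c)"
      by (simp add: linear_sum[OF lin(2)] form_simps)
    also have "\<dots> = (\<Sum>b\<in>S. if b = c then f x c else 0)"
      using c assms(2,3) eq_0_iff by (intro sum.cong) auto
    finally show "f ?y c = 0" using c assms(1) by (simp add: form_simps)
  qed
  then show ?thesis by simp
qed

definition commuting_family :: "'a set \<Rightarrow> ('a \<Rightarrow> 'a) set \<Rightarrow> bool" where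
  "commuting_family V F \<longleftrightarrow> (\<forall>T\<in>F. linear T \<and> T ` V \<subseteq> V \<and> (\<forall>x\<in>V. \<forall>y\<in>V. f (T x) y = f x (T y))) \<and>
     (\<forall>S\<in>F. \<forall>T\<in>F. \<forall>x\<in>V. S (T x) = T (S x))"

text \<open>An eigenvector maximizes the Rayleigh quotient. The quotient is homogeneous of degree 0,
  so the unit sphere of the auxiliary Euclidean norm can be used although \<open>T\<close> is
  symmetric only for \<open>f\<close>.\<close>

lemma symmetric_eigenvector:
  assumes V: "subspace V" "V \<noteq> {0}" and T: "linear T" "T ` V \<subseteq> V" "\<And>x y. x \<in> V \<Longrightarrow> y \<in> V \<Longrightarrow> f (T x) y = f x (T y)"
  shows "\<exists>v l. v \<in> V \<and> v \<noteq> 0 \<and> T v = l *\<^sub>R v"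
proof -
  let ?K = "V \<inter> sphere 0 1"
  have "compact ?K" using closed_subspace[OF V(1)] by (simp add: closed_Int_compact)
  moreover obtain x where x: "x \<in> V" "x \<noteq> 0" using V subspace_0 by blast
  have "(1 / norm x) *\<^sub>R x \<in> ?K" using x subspace_scale[OF V(1)] by simp
  then have "?K \<noteq> {}" by blast
  moreover have "continuous_on ?K (\<lambda>v. f (T v) v / f v v)"
  proof -
    have b: "bounded_bilinear f" using bilin by (simp add: bilinear_conv_bounded_bilinear)
    have "continuous_on ?K T" using T(1) linear_continuous_on linear_conv_bounded_linear by blast
    then have "continuous_on ?K (\<lambda>v. f (T v) v)" "continuous_on ?K (\<lambda>v. f v v)"
      by (auto intro!: bounded_bilinear.continuous_on[OF b] continuous_on_id)
    then show ?thesis by (intro continuous_on_divide) (auto simp: eq_0_iff)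
  qed
  ultimately obtain v where v: "v \<in> V" "norm v = 1" and mx: "\<And>w. w \<in> V \<Longrightarrow> norm w = 1 \<Longrightarrow> f (T w) w / f w w \<le> f (T v) v / f v v"
    using continuous_attains_sup[of ?K] by (metis (no_types, lifting) Int_iff mem_sphere_0)
  define l where "l = f (T v) v / f v v"
  have v0: "v \<noteq> 0" using v by auto
  have le: "f (T w) w \<le> l * f w w" if "w \<in> V" for w
  proof (cases "w = 0")
    case False
    let ?w = "(1 / norm w) *\<^sub>R w"
    have "f (T ?w) ?w / f ?w ?w \<le> l" unfolding l_def using False that subspace_scale[OF V(1)] by (intro mx) auto
    moreover have "f (T ?w) ?w / f ?w ?w = f (T w) w / f w w"
      using False by (simp add: linear_scale[OF T(1)] form_simps)
    ultimately show ?thesis using pos[OF False] by (simp add: divide_le_eq)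
  qed (simp add: linear_0[OF T(1)])
  \<comment> \<open>The first-order condition at the maximum, tested in the direction of the defect
    itself, gives \<open>f w w = 0\<close>.\<close>
  define w where "w = l *\<^sub>R v - T v"
  have w: "w \<in> V" using v T V(1) by (auto simp: w_def intro!: subspace_diff subspace_scale)
  have "f w w = 0"
  proof (rule quadratic_nonneg_linear_term_0)
    fix t
    have "f (T (v + t *\<^sub>R w)) (v + t *\<^sub>R w) \<le> l * f (v + t *\<^sub>R w) (v + t *\<^sub>R w)"
      using v w V(1) by (intro le subspace_add subspace_scale)
    moreover have "f (T v) v = l * f v v" using v0 eq_0_iff by (simp add: l_def)
    moreover have "f (T w) v = f (T v) w" using T(3)[OF w v(1)] sym by simp
    moreover have lq: "l * f v w = f w w + f (T v) w" by (subst (2) w_def) (simp add: form_simps)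
    have "l * f (v + t *\<^sub>R w) (v + t *\<^sub>R w) = l * f v v + 2 * t * (l * f v w) + t\<^sup>2 * (l * f w w)"
      by (simp add: form_simps sym[of w v] algebra_simps power2_eq_square)
    ultimately show "2 * t * f w w + t\<^sup>2 * (l * f w w - f (T w) w) \<ge> 0"
      by (simp add: lq linear_add[OF T(1)] linear_scale[OF T(1)] form_simps algebra_simps power2_eq_square)
  qed
  then have "T v = l *\<^sub>R v" by (simp add: eq_0_iff w_def)
  then show ?thesis using v v0 by blast
qed

text \<open>If some operator of the family is not scalar on \<open>V\<close>, one of its eigenspaces
  is a proper subspace, and the other operators preserve it because they commute with that
  operator.\<close>

lemma joint_eigenvector:
  assumes "subspace V" "V \<noteq> {0}" "commuting_family V F"
  shows "\<exists>v\<in>V. v \<noteq> 0 \<and> (\<forall>T\<in>F. \<exists>l. T v = l *\<^sub>R v)"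
  using assms
proof (induction "dim V" arbitrary: V rule: less_induct)
  case less
  show ?case
  proof (cases "\<forall>T\<in>F. \<exists>l. \<forall>x\<in>V. T x = l *\<^sub>R x")
    case True
    obtain v where "v \<in> V" "v \<noteq> 0" using less.prems subspace_0 by blast
    then show ?thesis using True by meson
  next
    case False
    then obtain T where T: "T \<in> F" "\<And>l. \<exists>x\<in>V. T x \<noteq> l *\<^sub>R x" by auto
    have lT: "linear T" using T(1) less.prems(3) by (auto simp: commuting_family_def)
    have "\<exists>v l. v \<in> V \<and> v \<noteq> 0 \<and> T v = l *\<^sub>R v"
      using T(1) less.prems by (intro symmetric_eigenvector) (auto simp: commuting_family_def)
    then obtain v l where v: "v \<in> V" "v \<noteq> 0" "T v = l *\<^sub>R v" by blast
    define W where "W = {x \<in> V. T x = l *\<^sub>R x}"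
    have sW: "subspace W"
      using less.prems(1) lT by (auto simp: W_def subspace_def linear_0 linear_add linear_scale scaleR_add_right)
    have WV: "W \<subseteq> V" by (auto simp: W_def)
    have "W \<noteq> V" using T(2)[of l] by (auto simp: W_def)
    then have "dim W < dim V"
      using subspace_dim_equal[OF sW less.prems(1) WV] dim_subset[OF WV] by linarith
    moreover have "W \<noteq> {0}" using v by (auto simp: W_def)
    moreover have "commuting_family W F"
      using less.prems(3) T(1) WV unfolding commuting_family_def W_def
      by (auto simp: linear_scale image_subset_iff)
    ultimately show ?thesis using less.hyps[of W] sW WV by blast
  qed
qed

text \<open>One joint eigenvector is split off; by symmetry its orthogonal complement is invariant
  again and has smaller dimension.\<close>

theorem joint_eigenbasis:
  assumes "subspace V" "commuting_family V F"
  shows "\<exists>S. finite S \<and> S \<subseteq> V \<and> span S = V \<and> 0 \<notin> S \<and> (\<forall>b\<in>S. \<forall>T\<in>F. \<exists>l. T b = l *\<^sub>R b) \<and>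
    (\<forall>b\<in>S. \<forall>c\<in>S. b \<noteq> c \<longrightarrow> f b c = 0)"
  using assms
proof (induction "dim V" arbitrary: V rule: less_induct)
  case less
  show ?case
  proof (cases "V = {0}")
    case True
    then show ?thesis by (intro exI[of _ "{}"]) auto
  next
    case False
    obtain v where v: "v \<in> V" "v \<noteq> 0" "\<And>T. T \<in> F \<Longrightarrow> \<exists>l. T v = l *\<^sub>R v"
      using joint_eigenvector[OF less.prems(1) False less.prems(2)] by blast
    define W where "W = {x \<in> V. f v x = 0}"
    have sW: "subspace W" using less.prems(1) by (auto simp: W_def subspace_def form_simps)
    have WV: "W \<subseteq> V" by (auto simp: W_def)
    have "W \<noteq> V" using v eq_0_iff by (auto simp: W_def)
    then have "dim W < dim V"
      using subspace_dim_equal[OF sW less.prems(1) WV] dim_subset[OF WV] by linarith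
    moreover have "commuting_family W F"
      unfolding commuting_family_def
    proof (intro conjI ballI)
      fix T assume T: "T \<in> F"
      show "linear T" using T less.prems by (auto simp: commuting_family_def)
      obtain l where l: "T v = l *\<^sub>R v" using v(3)[OF T] by blast
      show "T ` W \<subseteq> W"
      proof
        fix y assume "y \<in> T ` W"
        then obtain x where x: "x \<in> V" "f v x = 0" "y = T x" by (auto simp: W_def)
        have "f v (T x) = f (T v) x" using T v(1) x less.prems(2) by (simp add: commuting_family_def)
        then have "f v y = 0" using x l by (simp add: form_simps)
        moreover have "y \<in> V" using T x less.prems(2) by (auto simp: commuting_family_def)
        ultimately show "y \<in> W" by (simp add: W_def)
      qed
      show "f (T x) y = f x (T y)" if "x \<in> W" "y \<in> W" for x y
        using that T WV less.prems(2) unfolding commuting_family_def by blast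
      show "S (T x) = T (S x)" if "S \<in> F" "x \<in> W" for S x
        using that T WV less.prems(2) unfolding commuting_family_def by blast
    qed
    ultimately obtain S where S: "finite S" "S \<subseteq> W" "span S = W" "0 \<notin> S" "\<forall>b\<in>S. \<forall>T\<in>F. \<exists>l. T b = l *\<^sub>R b"
      "\<forall>b\<in>S. \<forall>c\<in>S. b \<noteq> c \<longrightarrow> f b c = 0"
      using less.hyps[of W] sW by blast
    have "span (insert v S) = V"
    proof
      show "span (insert v S) \<subseteq> V" using v S WV by (intro span_minimal less.prems(1)) auto
      show "V \<subseteq> span (insert v S)"
      proof
        fix x assume x: "x \<in> V"
        let ?y = "x - (f v x / f v v) *\<^sub>R v"
        have "f v ?y = 0" using v(2) eq_0_iff by (simp add: form_simps)
        then have "?y \<in> W" using x v(1) less.prems(1) by (auto simp: W_def intro!: subspace_diff subspace_scale)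
        then have "?y \<in> span (insert v S)" using S(3) span_mono[of S "insert v S"] by blast
        moreover have "(f v x / f v v) *\<^sub>R v \<in> span (insert v S)" by (intro span_scale span_base) simp
        ultimately have "?y + (f v x / f v v) *\<^sub>R v \<in> span (insert v S)" by (rule span_add)
        then show "x \<in> span (insert v S)" by simp
      qed
    qed
    moreover have "f v b = 0" "f b v = 0" if "b \<in> S" for b using that S(2) sym[of b v] by (auto simp: W_def)
    ultimately show ?thesis
      using S v WV by (intro exI[of _ "insert v S"]) auto
  qed
qed

end

section \<open>Cartan decompositions\<close>

locale cartan_algebra =
  fixes br :: "'g::euclidean_space \<Rightarrow> 'g \<Rightarrow> 'g" and \<theta> :: "'g \<Rightarrow> 'g"
  assumes bracket_left: "linear (\<lambda>X. br X Y)" and bracket_right: "linear (br X)"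
    and bracket_self0: "br X X = 0" and jacobi_id: "br Z (br X Y) = br (br Z X) Y + br X (br Z Y)"
    and cartan: "cartan_involution br \<theta>"
begin

abbreviation "B \<equiv> killing_form br"
abbreviation "ip \<equiv> cartan_ip br \<theta>"
abbreviation "\<pp> \<equiv> pspace \<theta>"
abbreviation "\<kk> \<equiv> kspace \<theta>"

lemmas br_simps = linear_add[OF bracket_left] linear_add[OF bracket_right] linear_scale[OF bracket_left] linear_scale[OF bracket_right]
  linear_diff[OF bracket_left] linear_diff[OF bracket_right] linear_neg[OF bracket_left] linear_neg[OF bracket_right]

lemma br_0 [simp]: "br 0 X = 0" "br X 0 = 0"
  using linear_0[OF bracket_left] linear_0[OF bracket_right] by auto

lemma br_anti: "br X Y = - br Y X"
proof -
  have "br X Y + br Y X = 0" using bracket_self0[of "X + Y"] unfolding br_simps by (simp add: bracket_self0 add.commute)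
  then show ?thesis by (simp add: eq_neg_iff_add_eq_0)
qed

lemma br_br: "br (br X Y) Z = br X (br Y Z) - br Y (br X Z)"
  using jacobi_id[of X Y Z] by simp

lemma theta_linear: "linear \<theta>" and theta_theta [simp]: "\<theta> (\<theta> X) = X"
  and theta_br: "\<theta> (br X Y) = br (\<theta> X) (\<theta> Y)" and ip_pos: "X \<noteq> 0 \<Longrightarrow> ip X X > 0"
  using cartan by (auto simp: cartan_involution_def)

lemmas theta_simps = linear_add[OF theta_linear] linear_scale[OF theta_linear] linear_diff[OF theta_linear]
  linear_neg[OF theta_linear]

lemma pspace_iff: "X \<in> \<pp> \<longleftrightarrow> \<theta> X = - X" and kspace_iff: "X \<in> \<kk> \<longleftrightarrow> \<theta> X = X"
  by (auto simp: pspace_def kspace_def)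

lemma subspace_p: "subspace \<pp>" and subspace_k: "subspace \<kk>"
  by (auto simp: subspace_def pspace_def kspace_def theta_simps linear_0[OF theta_linear])

lemma br_kp: "X \<in> \<kk> \<Longrightarrow> Y \<in> \<pp> \<Longrightarrow> br X Y \<in> \<pp>"
  and br_pk: "X \<in> \<pp> \<Longrightarrow> Y \<in> \<kk> \<Longrightarrow> br X Y \<in> \<pp>" and br_pp: "X \<in> \<pp> \<Longrightarrow> Y \<in> \<pp> \<Longrightarrow> br X Y \<in> \<kk>"
  by (simp_all add: pspace_iff kspace_iff theta_br br_simps)

definition k_part :: "'g \<Rightarrow> 'g" where "k_part X = (1 / 2) *\<^sub>R (X + \<theta> X)"
definition p_part :: "'g \<Rightarrow> 'g" where "p_part X = (1 / 2) *\<^sub>R (X - \<theta> X)"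

lemma k_part_in: "k_part X \<in> \<kk>" and p_part_in: "p_part X \<in> \<pp>" and parts: "k_part X + p_part X = X"
  by (simp_all add: k_part_def p_part_def pspace_iff kspace_iff theta_simps algebra_simps flip: scaleR_add_left)

lemma part_linear: "linear k_part" "linear p_part"
  unfolding k_part_def p_part_def by (auto simp: linear_iff theta_simps algebra_simps)

lemma part_simps: "X \<in> \<pp> \<Longrightarrow> p_part X = X" "X \<in> \<pp> \<Longrightarrow> k_part X = 0" "X \<in> \<kk> \<Longrightarrow> p_part X = 0" "X \<in> \<kk> \<Longrightarrow> k_part X = X"
  by (auto simp: k_part_def p_part_def pspace_iff kspace_iff simp flip: scaleR_2)

lemma kp_disjoint: "X \<in> \<kk> \<Longrightarrow> X \<in> \<pp> \<Longrightarrow> X = 0"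
  using part_simps by metis

lemma killing_linear: "linear (B X)" "linear (\<lambda>X. B X Y)"
  unfolding killing_form_def
  by (auto simp: linear_iff br_simps inner_add_left sum.distrib sum_distrib_left)

lemmas killing_simps = linear_add[OF killing_linear(1)] linear_add[OF killing_linear(2)] linear_scale[OF killing_linear(1)]
  linear_scale[OF killing_linear(2)] linear_diff[OF killing_linear(1)] linear_diff[OF killing_linear(2)]
  linear_neg[OF killing_linear(1)] linear_neg[OF killing_linear(2)]

lemma killing_sym: "B X Y = B Y X"
  unfolding killing_form_def by (rule trace_commute[OF bracket_right bracket_right])

lemma killing_invariant: "B (br X Y) Z = B X (br Y Z)"
proof -
  have l: "linear (\<lambda>b. br Y (br Z b))" "linear (\<lambda>b. br X (br Z b))"
    using linear_compose[OF bracket_right bracket_right] by (auto simp: comp_def)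
  have "B (br X Y) Z = (\<Sum>b\<in>Basis. br X (br Y (br Z b)) \<bullet> b) - (\<Sum>b\<in>Basis. br Y (br X (br Z b)) \<bullet> b)"
    by (simp add: killing_form_def br_br inner_diff_left sum_subtractf)
  also have "(\<Sum>b\<in>Basis. br Y (br X (br Z b)) \<bullet> b) = (\<Sum>b\<in>Basis. br X (br Z (br Y b)) \<bullet> b)"
    by (rule trace_commute[OF bracket_right l(2)])
  also have "(\<Sum>b\<in>Basis. br X (br Y (br Z b)) \<bullet> b) - \<dots> = B X (br Y Z)"
    by (simp add: killing_form_def br_br br_simps inner_diff_left sum_subtractf)
  finally show ?thesis .
qed

lemma killing_theta: "B (\<theta> X) (\<theta> Y) = B X Y"
proof -
  have "br (\<theta> X) (br (\<theta> Y) b) = \<theta> (br X (br Y (\<theta> b)))" for b by (simp add: theta_br)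
  then have "B (\<theta> X) (\<theta> Y) = (\<Sum>b\<in>Basis. \<theta> ((\<lambda>b. br X (br Y (\<theta> b))) b) \<bullet> b)" by (simp add: killing_form_def)
  also have "\<dots> = (\<Sum>b\<in>Basis. (\<lambda>b. br X (br Y (\<theta> b))) (\<theta> b) \<bullet> b)"
    using linear_compose[OF linear_compose[OF theta_linear bracket_right] bracket_right]
    by (intro trace_commute theta_linear) (simp add: comp_def)
  finally show ?thesis by (simp add: killing_form_def)
qed

sublocale form: positive_form ip
proof
  show "bilinear ip" by (auto simp: bilinear_def cartan_ip_def linear_iff killing_simps theta_simps)
  show "ip X Y = ip Y X" for X Y
    using killing_theta[of X "\<theta> Y"] killing_sym by (simp add: cartan_ip_def)
qed (rule ip_pos)

lemma ip_br: "ip (br X Y) Z = - ip Y (br (\<theta> X) Z)"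
proof -
  have "ip (br X Y) Z = B (br Y X) (\<theta> Z)" by (subst br_anti) (simp add: cartan_ip_def killing_simps)
  also have "\<dots> = B Y (\<theta> (br (\<theta> X) Z))" by (simp add: killing_invariant theta_br)
  finally show ?thesis by (simp add: cartan_ip_def)
qed

lemma ip_br_p: "X \<in> \<pp> \<Longrightarrow> ip (br X Y) Z = ip Y (br X Z)" and ip_br_k: "X \<in> \<kk> \<Longrightarrow> ip (br X Y) Z = - ip Y (br X Z)"
  using ip_br[of X Y Z] by (auto simp: pspace_iff kspace_iff br_simps form.form_simps)

lemma ip_kp: "X \<in> \<kk> \<Longrightarrow> Y \<in> \<pp> \<Longrightarrow> ip X Y = 0"
  using killing_theta[of X Y] by (simp add: cartan_ip_def pspace_iff kspace_iff killing_simps)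

lemma ip_p: "Y \<in> \<pp> \<Longrightarrow> ip X Y = B X Y" "X \<in> \<pp> \<Longrightarrow> ip X Y = B X Y"
  using form.sym[of X Y] killing_sym[of X Y] by (auto simp: cartan_ip_def pspace_iff killing_simps)

lemma killing_eq_0: "(\<And>Y. B X Y = 0) \<Longrightarrow> X = 0"
  using form.eq_0_iff[of X] by (simp add: cartan_ip_def)

text \<open>Describes \<open>\<pp>\<close> by \<open>\<kk>\<close> and the Killing form, both of
  which the isotropy group preserves. Invariance of \<open>\<pp>\<close> under the isotropy group is
  obtained in this way, before \<open>\<theta>\<close> is known to commute with it.\<close>

lemma pspace_iff_orthogonal: "X \<in> \<pp> \<longleftrightarrow> (\<forall>Z\<in>\<kk>. B X Z = 0)"
proof
  assume "X \<in> \<pp>"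
  then show "\<forall>Z\<in>\<kk>. B X Z = 0" using ip_kp form.sym ip_p by metis
next
  assume 0: "\<forall>Z\<in>\<kk>. B X Z = 0"
  have "ip (k_part X) (k_part X) = - B (k_part X) (k_part X)" using k_part_in[of X] by (simp add: cartan_ip_def kspace_iff)
  also have "B (k_part X) (k_part X) = B X (k_part X) - B (p_part X) (k_part X)"
    by (subst parts[of X, symmetric]) (simp add: killing_simps)
  also have "\<dots> = - B (k_part X) (p_part X)" using 0 k_part_in[of X] killing_sym[of "p_part X"] by simp
  also have "\<dots> = 0" using ip_kp[OF k_part_in p_part_in, of X X] ip_p(1)[OF p_part_in, of "k_part X" X] by simp
  finally have "k_part X = 0" using form.eq_0_iff by simp
  then show "X \<in> \<pp>" using parts[of X] p_part_in[of X] by simp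
qed

text \<open>A central element pairs to 0 with everything under the Killing form, which is
  nondegenerate because twisting it by \<open>\<theta>\<close> gives a definite form.\<close>

lemma center_trivial: "(\<And>Y. br X Y = 0) \<Longrightarrow> X = 0"
  by (rule killing_eq_0) (simp add: killing_form_def)

lemma ip_br_br_p: "X \<in> \<pp> \<Longrightarrow> ip (br X (br X Y)) Y = ip (br X Y) (br X Y)"
  by (simp add: ip_br_p)

end

section \<open>Hermitian Cartan decompositions and their restricted roots\<close>

locale hermitian_algebra = cartan_algebra br \<theta> for br :: "'g::euclidean_space \<Rightarrow> 'g \<Rightarrow> 'g" and \<theta> +
  fixes \<zeta> :: 'g and a :: "'g set" and e :: "nat \<Rightarrow> 'g \<Rightarrow> real"
  assumes zeta_k: "\<zeta> \<in> \<kk>" and zeta_central: "X \<in> \<kk> \<Longrightarrow> br \<zeta> X = 0"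
    and J_J: "X \<in> \<pp> \<Longrightarrow> br \<zeta> (br \<zeta> X) = - X"
    and max_abelian: "maximal_abelian_in br \<pp> a"
    and dual_basis: "orthogonal_dual_basis br a e"
    and roots: "restricted_roots br a = roots_C (dim a) e \<or> restricted_roots br a = roots_BC (dim a) e"
begin

abbreviation "JJ \<equiv> br \<zeta>"
abbreviation "\<Sigma>' \<equiv> restricted_roots br a"

lemma J_p: "X \<in> \<pp> \<Longrightarrow> JJ X \<in> \<pp>"
  by (rule br_kp[OF zeta_k])

lemma J_skew: "ip (JJ X) Y = - ip X (JJ Y)"
  by (rule ip_br_k[OF zeta_k])

lemma J_isometry: "X \<in> \<pp> \<Longrightarrow> ip (JJ X) (JJ Y) = ip X Y"
  using J_skew[of Y "JJ X"] J_J[of X] by (simp add: form.sym[of "JJ X"] form.sym[of X] form.form_simps)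

lemma J_br_k: "Z \<in> \<kk> \<Longrightarrow> JJ (br Z Y) = br Z (JJ Y)"
  using jacobi_id[of \<zeta> Z Y] zeta_central by simp

lemma br_J_left: "X \<in> \<pp> \<Longrightarrow> Y \<in> \<pp> \<Longrightarrow> br (JJ X) Y = - br X (JJ Y)"
  using jacobi_id[of \<zeta> X Y] zeta_central[OF br_pp] by (simp add: eq_neg_iff_add_eq_0)

lemma br_J_swap: "X \<in> \<pp> \<Longrightarrow> Y \<in> \<pp> \<Longrightarrow> br X (JJ Y) = br Y (JJ X)"
  using br_J_left[of X Y] br_anti[of "JJ X" Y] by simp

lemma J_br_p: "X \<in> \<pp> \<Longrightarrow> U \<in> \<kk> \<Longrightarrow> br (JJ X) U = JJ (br X U)"
  using jacobi_id[of \<zeta> X U] zeta_central by simp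

lemma J_eq_0: "X \<in> \<pp> \<Longrightarrow> JJ X = 0 \<Longrightarrow> X = 0"
  using J_J by force

subsection \<open>Tripotents\<close>

lemma J_br_J:
  assumes "X \<in> \<pp>" "Y \<in> \<pp>"
  shows "br (br X (JJ X)) Y = - br X (br X (JJ Y)) - JJ (br X (br X Y))"
proof -
  have "br (br X (JJ X)) Y = br X (br (JJ X) Y) - br (JJ X) (br X Y)" by (rule br_br)
  also have "br (JJ X) Y = - br X (JJ Y)" by (rule br_J_left[OF assms])
  also have "br (JJ X) (br X Y) = JJ (br X (br X Y))" by (rule J_br_p[OF assms(1) br_pp[OF assms]])
  finally show ?thesis by (simp add: br_simps)
qed

text \<open>Equivalently, \<open>JJ X\<close> is an eigenvector of ad(X)^2 for the eigenvalue 4. In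
  terms of \<open>triple\<close> below, the cube of \<open>X\<close> is
  \<open>4 *\<^sub>R X\<close>, which is a tripotent of a Jordan triple system up to
  normalization.\<close>

definition tripotent :: "'g \<Rightarrow> bool" where
  "tripotent X \<longleftrightarrow> X \<in> \<pp> \<and> br (br X (JJ X)) X = - 4 *\<^sub>R JJ X"

text \<open>With P = ad(X)^2 and P' = - J P J on p this reads 3 P P' = 4 P - P^2. The element
  [X, J X] is applied to [X, v] in two ways, by expanding the commutator and as a derivation; the
  tripotent condition says what the derivation does to X.\<close>

lemma tripotent_identity:
  assumes X: "tripotent X" and y: "y \<in> \<pp>"
  shows "3 *\<^sub>R br X (br X (- JJ (br X (br X (JJ y))))) = 4 *\<^sub>R br X (br X y) - br X (br X (br X (br X y)))"
proof -
  have Xp: "X \<in> \<pp>" and XX: "br (br X (JJ X)) X = - 4 *\<^sub>R JJ X" using X by (auto simp: tripotent_def)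
  define A where "A = br X (JJ X)"
  have E: "3 *\<^sub>R br X (JJ (br X (br X v))) = 4 *\<^sub>R br X (JJ v) - br X (br X (br X (JJ v)))" if v: "v \<in> \<pp>" for v
  proof -
    define u where "u = br X v"
    have u: "u \<in> \<kk>" using br_pp Xp v by (simp add: u_def)
    have "br A u = br X (br (JJ X) u) - br (JJ X) (br X u)" by (simp add: A_def br_br)
    also have "br (JJ X) u = JJ (br X u)" by (rule J_br_p[OF Xp u])
    also have "br (JJ X) (br X u) = - br X (JJ (br X u))" by (rule br_J_left[OF Xp br_pk[OF Xp u]])
    finally have 1: "br A u = 2 *\<^sub>R br X (JJ (br X u))" by (simp add: scaleR_2)
    have "br A u = br (br A X) v + br X (br A v)" unfolding u_def by (rule jacobi_id)
    also have "br (br A X) v = 4 *\<^sub>R br X (JJ v)" using XX br_J_left[OF Xp v] by (simp add: A_def br_simps)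
    also have "br A v = - br X (br X (JJ v)) - JJ (br X (br X v))" unfolding A_def by (rule J_br_J[OF Xp v])
    finally have "2 *\<^sub>R br X (JJ (br X u)) = 4 *\<^sub>R br X (JJ v) - br X (br X (br X (JJ v))) - br X (JJ (br X u))"
      using 1 by (simp add: br_simps u_def algebra_simps)
    then have "2 *\<^sub>R br X (JJ (br X u)) + br X (JJ (br X u)) = 4 *\<^sub>R br X (JJ v) - br X (br X (br X (JJ v)))" by simp
    then show ?thesis by (simp add: u_def flip: scaleR_left_distrib[of 2 1, simplified])
  qed
  have "3 *\<^sub>R br X (JJ (br X (br X (JJ y)))) = - 4 *\<^sub>R br X y + br X (br X (br X y))"
    using E[OF J_p[OF y]] by (simp add: J_J[OF y] br_simps)
  then have "br X (3 *\<^sub>R br X (JJ (br X (br X (JJ y))))) = br X (- 4 *\<^sub>R br X y + br X (br X (br X y)))" by simp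
  then show ?thesis by (simp add: br_simps algebra_simps)
qed

text \<open>A Peirce rule: J pairs the eigenvalue m of ad(X)^2 with (4 - m) / 3, so 4 is paired with
  0 and 1 with itself. The bound on \<open>m\<close> holds because ad(X)^2 is nonnegative, so the
  partner eigenvalue cannot be negative.\<close>

lemma tripotent_eigenvector:
  assumes X: "tripotent X" and Y: "Y \<in> \<pp>" "br X (br X Y) = m *\<^sub>R Y" "m \<noteq> 0"
  shows "br X (br X (JJ Y)) = ((4 - m) / 3) *\<^sub>R JJ Y" "Y \<noteq> 0 \<Longrightarrow> m \<le> 4"
proof -
  have Xp: "X \<in> \<pp>" using X by (simp add: tripotent_def)
  have PP: "br X (br X V) \<in> \<pp>" if "V \<in> \<pp>" for V by (intro br_pk br_pp Xp that)
  let ?P' = "\<lambda>V. - JJ (br X (br X (JJ V)))"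
  have P'p: "?P' V \<in> \<pp>" if "V \<in> \<pp>" for V using PP[OF J_p[OF that]] J_p subspace_neg[OF subspace_p] by blast
  have symP: "ip (br X (br X V)) U = ip V (br X (br X U))" for U V by (simp add: ip_br_p Xp)
  have symP': "ip (?P' V) U = ip V (?P' U)" for U V by (simp add: form.form_simps J_skew symP)
  \<comment> \<open>\<open>m\<close> times the expected defect 3 P' Y - (4 - m) Y. Since P and P'
    are symmetric, pairing the identity for \<open>V\<close> with \<open>Y\<close> produces exactly
    the squared norm of \<open>V\<close>.\<close>
  define V where "V = (3 * m) *\<^sub>R ?P' Y - (4 * m) *\<^sub>R Y + (m * m) *\<^sub>R Y"
  have V: "V \<in> \<pp>" unfolding V_def
    by (intro subspace_add[OF subspace_p] subspace_diff[OF subspace_p] subspace_scale[OF subspace_p] P'p Y)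
  have "0 = ip (3 *\<^sub>R br X (br X (?P' V)) - 4 *\<^sub>R br X (br X V) + br X (br X (br X (br X V)))) Y"
    using tripotent_identity[OF X V] by simp
  also have "\<dots> = 3 * ip (br X (br X (?P' V))) Y - 4 * ip (br X (br X V)) Y + ip (br X (br X (br X (br X V)))) Y"
    by (simp only: form.form_simps real_scaleR_def)
  also have "\<dots> = 3 * m * ip V (?P' Y) - 4 * m * ip V Y + m * m * ip V Y"
    unfolding symP Y(2) using symP' by (simp add: form.form_simps br_simps Y(2))
  also have "\<dots> = ip V V" by (subst (4) V_def) (simp only: form.form_simps real_scaleR_def)
  finally have "V = 0" using form.eq_0_iff by simp
  then have "m *\<^sub>R (3 *\<^sub>R ?P' Y - (4 - m) *\<^sub>R Y) = 0" by (simp add: V_def algebra_simps)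
  then have "3 *\<^sub>R ?P' Y = (4 - m) *\<^sub>R Y" using Y(3) by simp
  then have "(1 / 3) *\<^sub>R (3 *\<^sub>R ?P' Y) = (1 / 3) *\<^sub>R ((4 - m) *\<^sub>R Y)" by simp
  then have "?P' Y = ((4 - m) / 3) *\<^sub>R Y" by simp
  then have "JJ (?P' Y) = ((4 - m) / 3) *\<^sub>R JJ Y" by (simp add: br_simps)
  then show *: "br X (br X (JJ Y)) = ((4 - m) / 3) *\<^sub>R JJ Y" using J_J[OF PP[OF J_p[OF Y(1)]]] by (simp add: br_simps)
  assume "Y \<noteq> 0"
  then have "ip (JJ Y) (JJ Y) > 0" using J_isometry[OF Y(1)] ip_pos by simp
  moreover have "((4 - m) / 3) * ip (JJ Y) (JJ Y) = ip (br X (JJ Y)) (br X (JJ Y))"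
    using ip_br_br_p[OF Xp, of "JJ Y"] * by (simp add: form.form_simps)
  ultimately show "m \<le> 4" using form.nonneg[of "br X (JJ Y)"] by (smt (verit) divide_neg_pos mult_neg_pos)
qed

subsection \<open>The maximal abelian subspace\<close>

lemma a_subspace: "subspace a" and a_p: "X \<in> a \<Longrightarrow> X \<in> \<pp>" and a_abelian: "X \<in> a \<Longrightarrow> Y \<in> a \<Longrightarrow> br X Y = 0"
  using max_abelian by (auto simp: maximal_abelian_in_def)

lemma a_centralizer:
  assumes "X \<in> \<pp>" "\<And>H. H \<in> a \<Longrightarrow> br H X = 0" shows "X \<in> a"
proof -
  let ?b = "span (insert X a)"
  have c: "br Y Z = 0" if "Y \<in> insert X a" "Z \<in> insert X a" for Y Z
  proof -
    have "br X Z = 0" if "Z \<in> a" for Z using assms(2)[OF that] br_anti[of X Z] by simp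
    then show ?thesis using that a_abelian assms(2) bracket_self0 by blast
  qed
  have 1: "br Y Z = 0" if "Y \<in> insert X a" "Z \<in> ?b" for Y Z
    using that(2) by (induction rule: span_induct_alt) (auto simp: br_simps c[OF that(1)] simp del: insert_iff)
  have "br Y Z = 0" if "Y \<in> ?b" "Z \<in> ?b" for Y Z
    using that(1) by (induction rule: span_induct_alt) (auto simp: br_simps 1[OF _ that(2)] simp del: insert_iff)
  moreover have "?b \<subseteq> \<pp>" using assms(1) a_p by (intro span_minimal subspace_p) auto
  moreover have "a \<subseteq> ?b" by (meson span_superset subset_insertI subset_trans)
  ultimately have "?b = a" using max_abelian by (simp add: maximal_abelian_in_def)
  then show ?thesis using span_base[of X "insert X a"] by simp
qed

lemma a_commute: "H \<in> a \<Longrightarrow> H' \<in> a \<Longrightarrow> br H (br H' Y) = br H' (br H Y)"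
  using jacobi_id[of H H' Y] a_abelian by simp

lemma J_a_orthogonal: "H \<in> a \<Longrightarrow> H' \<in> a \<Longrightarrow> ip (JJ H) H' = 0"
  using ip_p(1)[OF a_p, of H' "JJ H"] killing_invariant[of \<zeta> H H'] a_abelian by (simp add: linear_0[OF killing_linear(1)])

definition root_pair :: "('g \<Rightarrow> real) \<Rightarrow> 'g \<Rightarrow> 'g \<Rightarrow> bool" where
  "root_pair \<mu> Y W \<longleftrightarrow> Y \<in> \<pp> \<and> W \<in> \<kk> \<and> (\<forall>H\<in>a. br H Y = \<mu> H *\<^sub>R W \<and> br H W = \<mu> H *\<^sub>R Y)"

lemma root_pairD:
  assumes "root_pair \<mu> Y W" shows "Y \<in> \<pp>" "W \<in> \<kk>" "H \<in> a \<Longrightarrow> br H Y = \<mu> H *\<^sub>R W" "H \<in> a \<Longrightarrow> br H W = \<mu> H *\<^sub>R Y"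
  using assms by (auto simp: root_pair_def)

lemma root_pair_orthogonal: "root_pair \<mu> Y W \<Longrightarrow> H \<in> a \<Longrightarrow> \<mu> H \<noteq> 0 \<Longrightarrow> H' \<in> a \<Longrightarrow> ip Y H' = 0"
proof -
  assume *: "root_pair \<mu> Y W" "H \<in> a" "\<mu> H \<noteq> 0" "H' \<in> a"
  have "\<mu> H * ip Y H' = ip (br H W) H'" using root_pairD[OF *(1)] *(2) by (simp add: form.form_simps)
  also have "\<dots> = 0" using * a_p a_abelian by (simp add: ip_br_p)
  finally show ?thesis using * by simp
qed

text \<open>\<open>\<theta>\<close> carries a root vector for \<open>\<mu>\<close> to one for
  \<open>- \<mu>\<close>, so it cannot fix it and the part in \<open>\<pp>\<close> is
  nonzero.\<close>

lemma root_pair_root: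
  assumes "\<mu> \<in> \<Sigma>'" shows "\<exists>Y W. Y \<noteq> 0 \<and> root_pair \<mu> Y W"
proof -
  obtain E where E: "E \<noteq> 0" "\<And>H. H \<in> a \<Longrightarrow> br H E = \<mu> H *\<^sub>R E" and \<mu>: "\<mu> \<in> dual_space a" "\<mu> \<noteq> (\<lambda>_. 0)"
    using assms by (auto simp: restricted_roots_def)
  have th: "br H (\<theta> E) = - \<mu> H *\<^sub>R \<theta> E" if "H \<in> a" for H
  proof -
    have "\<theta> (br H E) = - br H (\<theta> E)" using theta_br[of H E] a_p[OF that] by (simp add: pspace_iff br_simps)
    then show ?thesis using E(2)[OF that] by (simp add: theta_simps)
  qed
  obtain H where H: "\<mu> H \<noteq> 0" using \<mu>(2) by blast
  with \<mu>(1) have "H \<in> a" unfolding dual_space_def by blast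
  note H = this H
  have "E - \<theta> E \<noteq> 0"
  proof
    assume "E - \<theta> E = 0"
    then have "\<theta> E = E" by simp
    then have "\<mu> H *\<^sub>R E = - \<mu> H *\<^sub>R E" using th[OF H(1)] E(2)[OF H(1)] by simp
    then have "\<mu> H = - \<mu> H" by (rule scaleR_right_imp_eq[OF E(1)])
    then show False using H by simp
  qed
  moreover have "root_pair \<mu> (E - \<theta> E) (E + \<theta> E)"
    using E th by (auto simp: root_pair_def pspace_iff kspace_iff theta_simps br_simps algebra_simps)
  ultimately show ?thesis by blast
qed

lemma tripotent_root_bound:
  assumes "tripotent X" "X \<in> a" "\<mu> \<in> \<Sigma>'" shows "\<bar>\<mu> X\<bar> \<le> 2"
proof -
  obtain Y W where Y: "Y \<noteq> 0" "root_pair \<mu> Y W" using root_pair_root[OF assms(3)] by blast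
  have "br X (br X Y) = (\<mu> X)\<^sup>2 *\<^sub>R Y" using root_pairD[OF Y(2)] assms(2) by (simp add: br_simps power2_eq_square)
  then have "(\<mu> X)\<^sup>2 \<le> 2\<^sup>2"
    using tripotent_eigenvector(2)[OF assms(1) root_pairD(1)[OF Y(2)] _ _ Y(1)] by (cases "\<mu> X = 0") auto
  then show ?thesis using abs_le_square_iff[of "\<mu> X" 2] by simp
qed

text \<open>A single \<open>br H\<close> exchanges \<open>\<pp>\<close> and \<open>\<kk>\<close>;
  products of two act on \<open>\<pp>\<close>, as commuting symmetric operators. A joint eigenvector
  that commutes with \<open>a\<close> lies in \<open>a\<close> by maximality; for any other one the
  root is reconstructed from the eigenvalues of these products.\<close>

lemma eigenbasis_p:
  "\<exists>S. finite S \<and> S \<subseteq> \<pp> \<and> span S = \<pp> \<and> 0 \<notin> S \<and> (\<forall>b\<in>S. \<forall>c\<in>S. b \<noteq> c \<longrightarrow> ip b c = 0) \<and>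
    (\<forall>b\<in>S. b \<in> a \<or> (\<exists>\<mu>\<in>\<Sigma>'. \<exists>W. root_pair \<mu> b W))"
proof -
  let ?F = "{\<lambda>Y. br H (br H' Y) | H H'. H \<in> a \<and> H' \<in> a}"
  have "form.commuting_family \<pp> ?F"
    unfolding form.commuting_family_def
  proof (intro conjI ballI)
    fix T assume "T \<in> ?F"
    then obtain H H' where H: "H \<in> a" "H' \<in> a" "T = (\<lambda>Y. br H (br H' Y))" by blast
    show "linear T" using linear_compose[OF bracket_right bracket_right] by (simp add: H(3) comp_def)
    show "T ` \<pp> \<subseteq> \<pp>" using H a_p br_pk br_pp by auto
    show "ip (T x) y = ip x (T y)" for x y using H a_p a_commute by (simp add: ip_br_p)
    show "S (T x) = T (S x)" if SF: "S \<in> ?F" for S x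
    proof -
      obtain K K' where K: "K \<in> a" "K' \<in> a" "S = (\<lambda>Y. br K (br K' Y))" using SF by blast
      have *: "br L (T x) = T (br L x)" if "L \<in> a" for L x
        using a_commute[OF that H(1)] a_commute[OF that H(2)] by (simp add: H(3))
      show ?thesis using *[OF K(1)] *[OF K(2)] by (simp add: K(3))
    qed
  qed
  from form.joint_eigenbasis[OF subspace_p this] obtain S where
    S: "finite S" "S \<subseteq> \<pp>" "span S = \<pp>" "0 \<notin> S" "\<forall>b\<in>S. \<forall>T\<in>?F. \<exists>l. T b = l *\<^sub>R b"
      "\<forall>b\<in>S. \<forall>c\<in>S. b \<noteq> c \<longrightarrow> ip b c = 0"
    by (elim exE conjE) (rule that)
  have "b \<in> a \<or> (\<exists>\<mu>\<in>\<Sigma>'. \<exists>W. root_pair \<mu> b W)" if b: "b \<in> S" for b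
  proof (cases "\<forall>H\<in>a. br H b = 0")
    case True
    then show ?thesis using a_centralizer b S(2) by blast
  next
    case False
    then obtain H0 where H0: "H0 \<in> a" "br H0 b \<noteq> 0" by blast
    have "\<exists>l. br H (br H' b) = l *\<^sub>R b" if "H \<in> a" "H' \<in> a" for H H'
    proof -
      have "(\<lambda>Y. br H (br H' Y)) \<in> ?F" using that by blast
      then show ?thesis using bspec[OF bspec[OF S(5) b]] by fast
    qed
    then obtain \<kappa> where \<kappa>: "\<And>H H'. H \<in> a \<Longrightarrow> H' \<in> a \<Longrightarrow> br H (br H' b) = \<kappa> H H' *\<^sub>R b" by metis
    have b0: "b \<noteq> 0" using b S(4) by blast
    have "\<kappa> H0 H0 * ip b b = ip (br H0 b) (br H0 b)"
      using ip_br_br_p[OF a_p[OF H0(1)], of b] \<kappa>[OF H0(1,1)] by (simp add: form.form_simps)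
    also have "\<dots> > 0" using H0 ip_pos by simp
    finally have "\<kappa> H0 H0 > 0" using ip_pos[OF b0] by (simp add: zero_less_mult_iff)
    \<comment> \<open>This is the value of the root at \<open>H0\<close>. The value at any other
      \<open>H\<close> is then the eigenvalue of \<open>br H\<close> after \<open>br H0\<close>,
      divided by \<open>m\<close>.\<close>
    define m where "m = sqrt (\<kappa> H0 H0)"
    have m: "m > 0" "m * m = \<kappa> H0 H0" using \<open>\<kappa> H0 H0 > 0\<close> by (auto simp: m_def)
    define W where "W = (1 / m) *\<^sub>R br H0 b"
    define \<mu> where "\<mu> = (\<lambda>H. if H \<in> a then \<kappa> H H0 / m else 0)"
    have W: "W \<in> \<kk>" using br_pp a_p[OF H0(1)] b S(2) subspace_scale[OF subspace_k] by (auto simp: W_def)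
    have HW: "br H W = \<mu> H *\<^sub>R b" if "H \<in> a" for H using \<kappa>[OF that H0(1)] that by (simp add: W_def \<mu>_def br_simps)
    have Hb: "br H b = \<mu> H *\<^sub>R W" if "H \<in> a" for H
    proof -
      have "\<mu> H0 = m" using m H0(1) by (simp add: \<mu>_def field_simps)
      then have "br H0 W = m *\<^sub>R b" using HW[OF H0(1)] by simp
      then have "m *\<^sub>R br H b = br H (br H0 W)" by (simp add: br_simps)
      also have "\<dots> = br H0 (\<mu> H *\<^sub>R b)" unfolding a_commute[OF that H0(1), of W] HW[OF that] by (rule refl)
      also have "\<dots> = \<mu> H *\<^sub>R m *\<^sub>R W" using m by (simp add: br_simps W_def)
      finally have "m *\<^sub>R br H b = m *\<^sub>R \<mu> H *\<^sub>R W" by (simp add: mult.commute)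
      then show ?thesis by (rule scaleR_left_imp_eq[rotated]) (use m in simp)
    qed
    have rp: "root_pair \<mu> b W" using b S(2) W HW Hb by (auto simp: root_pair_def)
    have "\<mu> \<in> dual_space a"
    proof -
      have *: "x = y" if "x *\<^sub>R b = y *\<^sub>R b" for x y using that b0 by simp
      have "\<mu> (X + Y) = \<mu> X + \<mu> Y" if "X \<in> a" "Y \<in> a" for X Y
        using HW[OF that(1)] HW[OF that(2)] HW[OF subspace_add[OF a_subspace that]]
        by (intro *) (simp add: br_simps scaleR_left_distrib)
      moreover have "\<mu> (t *\<^sub>R X) = t * \<mu> X" if "X \<in> a" for X t
      proof (rule *)
        have "\<mu> (t *\<^sub>R X) *\<^sub>R b = br (t *\<^sub>R X) W" using HW[OF subspace_scale[OF a_subspace that]] by simp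
        then show "\<mu> (t *\<^sub>R X) *\<^sub>R b = (t * \<mu> X) *\<^sub>R b" using HW[OF that] by (simp only: br_simps scaleR_scaleR)
      qed
      ultimately show ?thesis by (auto simp: dual_space_def \<mu>_def)
    qed
    moreover have "\<mu> \<noteq> (\<lambda>_. 0)"
    proof
      assume "\<mu> = (\<lambda>_. 0)"
      then have "br H0 b = 0" using Hb[OF H0(1)] by simp
      then show False using H0 by simp
    qed
    moreover have "b + W \<noteq> 0"
    proof
      assume "b + W = 0"
      then have "b = - W" by (simp add: eq_neg_iff_add_eq_0)
      then have "b \<in> \<kk>" using W subspace_neg[OF subspace_k] by simp
      then show False using kp_disjoint b S(2) b0 by blast
    qed
    moreover have "br H (b + W) = \<mu> H *\<^sub>R (b + W)" if "H \<in> a" for H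
      using HW[OF that] Hb[OF that] by (simp add: br_simps scaleR_add_right)
    ultimately have "\<mu> \<in> \<Sigma>'" unfolding restricted_roots_def by blast
    then show ?thesis using rp by blast
  qed
  then show ?thesis using S by (intro exI[of _ S]) blast
qed

end

context hermitian_algebra
begin

subsection \<open>Coordinates on the maximal abelian subspace\<close>

abbreviation "r \<equiv> dim a"
abbreviation "Ht \<equiv> normalized_root_vector br \<theta> a e"
abbreviation "flat \<equiv> flat_vector br \<theta> a e"

lemma a_orthogonal_basis:
  assumes "form.commuting_family a F"
  shows "\<exists>S. finite S \<and> S \<subseteq> a \<and> span S = a \<and> 0 \<notin> S \<and> (\<forall>b\<in>S. \<forall>T\<in>F. \<exists>l. T b = l *\<^sub>R b) \<and>
    (\<forall>b\<in>S. \<forall>c\<in>S. b \<noteq> c \<longrightarrow> ip b c = 0)"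
  by (rule form.joint_eigenbasis[OF a_subspace assms])

lemma dual_eq_on_span:
  assumes "l \<in> dual_space a" "m \<in> dual_space a" "S \<subseteq> a" "\<And>b. b \<in> S \<Longrightarrow> l b = m b" "X \<in> span S"
  shows "l X = m X"
proof -
  have l: "l (t *\<^sub>R X + Y) = t * l X + l Y" if "l \<in> dual_space a" "X \<in> a" "Y \<in> a" for l X Y t
    using that subspace_scale[OF a_subspace] by (simp add: dual_space_def)
  have l0: "l 0 = 0" if "l \<in> dual_space a" for l
    using l[OF that, of 0 0 1] subspace_0[OF a_subspace] by simp
  have "X \<in> a \<and> l X = m X"
    using assms(5)
  proof (induction rule: span_induct_alt)
    case base
    then show ?case using l0[OF assms(1)] l0[OF assms(2)] subspace_0[OF a_subspace] by simp
  next
    case (step c x y)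
    then have "x \<in> a" "c *\<^sub>R x \<in> a" using assms(3) subspace_scale[OF a_subspace] by auto
    then show ?case using step l[OF assms(1)] l[OF assms(2)] assms(4) subspace_add[OF a_subspace] by simp
  qed
  then show ?thesis by simp
qed

lemma ip_dual: "H \<in> a \<Longrightarrow> (\<lambda>X. if X \<in> a then ip H X else 0) \<in> dual_space a"
  by (auto simp: dual_space_def form.form_simps subspace_add[OF a_subspace] subspace_scale[OF a_subspace])

text \<open>The description by \<open>THE\<close> is meaningful because the form is definite on
  \<open>a\<close>; the witness is written out in an orthogonal basis.\<close>

lemma dual_vector:
  assumes "l \<in> dual_space a"
  shows "dual_vector br a l \<in> a" "X \<in> a \<Longrightarrow> l X = ip (dual_vector br a l) X"
proof -
  obtain S where S: "finite S" "S \<subseteq> a" "span S = a" "0 \<notin> S" "\<forall>b\<in>S. \<forall>c\<in>S. b \<noteq> c \<longrightarrow> ip b c = 0"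
    using a_orthogonal_basis[of "{}"] by (auto simp: form.commuting_family_def)
  define H where "H = (\<Sum>b\<in>S. (l b / ip b b) *\<^sub>R b)"
  have H: "H \<in> a" unfolding H_def using S(2) by (intro subspace_sum[OF a_subspace] subspace_scale[OF a_subspace]) auto
  have lb: "ip H b = l b" if "b \<in> S" for b
  proof -
    have "ip H b = (\<Sum>c\<in>S. (l c / ip c c) * ip c b)" by (simp add: H_def linear_sum[OF form.lin(2)] form.form_simps)
    also have "\<dots> = (\<Sum>c\<in>S. if c = b then l b else 0)"
      using S(4,5) that form.eq_0_iff by (intro sum.cong) auto
    finally show ?thesis using that S(1) by simp
  qed
  have "l X = (\<lambda>X. if X \<in> a then ip H X else 0) X" if "X \<in> a" for X
  proof (rule dual_eq_on_span[OF assms ip_dual[OF H] S(2)])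
    show "X \<in> span S" using S(3) that by simp
    show "l b = (if b \<in> a then ip H b else 0)" if "b \<in> S" for b using lb[OF that] subsetD[OF S(2) that] by simp
  qed
  then have ex: "H \<in> a \<and> (\<forall>X\<in>a. l X = B H X)" using H a_p by (auto simp: ip_p)
  have "H = H'" if "H' \<in> a \<and> (\<forall>X\<in>a. l X = B H' X)" for H'
  proof -
    have d: "H - H' \<in> a" using that H subspace_diff[OF a_subspace] by blast
    then have "B H (H - H') = B H' (H - H')" using ex that by metis
    then have "ip (H - H') (H - H') = 0" using ip_p(2)[OF a_p[OF d]] by (simp add: killing_simps)
    then show ?thesis by (simp add: form.eq_0_iff)
  qed
  then have "dual_vector br a l = H" unfolding dual_vector_def using ex by (intro the_equality) metis+
  then show "dual_vector br a l \<in> a" "X \<in> a \<Longrightarrow> l X = ip (dual_vector br a l) X"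
    using ex ip_p(2)[OF a_p] by auto
qed

lemma dual_vector_eqI:
  assumes "l \<in> dual_space a" "H \<in> a" "\<And>X. X \<in> a \<Longrightarrow> l X = ip H X" shows "dual_vector br a l = H"
proof -
  let ?d = "dual_vector br a l - H"
  have "?d \<in> a" using dual_vector(1)[OF assms(1)] assms(2) subspace_diff[OF a_subspace] by blast
  moreover have "ip ?d X = 0" if "X \<in> a" for X using dual_vector(2)[OF assms(1) that] assms(3)[OF that] by (simp add: form.form_simps)
  ultimately have "ip ?d ?d = 0" by blast
  then show ?thesis by (simp add: form.eq_0_iff)
qed

lemma e_dual: "i \<in> {1..r} \<Longrightarrow> e i \<in> dual_space a" "i \<in> {1..r} \<Longrightarrow> e i \<noteq> (\<lambda>_. 0)"
  using dual_basis by (auto simp: orthogonal_dual_basis_def)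

lemma e_linear: "i \<in> {1..r} \<Longrightarrow> X \<in> a \<Longrightarrow> Y \<in> a \<Longrightarrow> e i (X + Y) = e i X + e i Y"
  "i \<in> {1..r} \<Longrightarrow> X \<in> a \<Longrightarrow> e i (t *\<^sub>R X) = t * e i X"
  using e_dual(1) by (auto simp: dual_space_def)

lemma e_0: "i \<in> {1..r} \<Longrightarrow> e i 0 = 0"
  using e_linear(2)[of i 0 0] subspace_0[OF a_subspace] by simp

lemma e_sum:
  assumes "i \<in> {1..r}" "finite I" "\<And>j. j \<in> I \<Longrightarrow> v j \<in> a"
  shows "e i (\<Sum>j\<in>I. x j *\<^sub>R v j) = (\<Sum>j\<in>I. x j * e i (v j))"
  using assms(2,3)
proof (induction I rule: finite_induct)
  case (insert j I)
  have "(\<Sum>j\<in>I. x j *\<^sub>R v j) \<in> a" using insert.prems by (intro subspace_sum[OF a_subspace] subspace_scale[OF a_subspace]) auto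
  then show ?case using insert e_linear[OF assms(1)] subspace_scale[OF a_subspace] by simp
qed (simp add: e_0[OF assms(1)])

abbreviation "ev i \<equiv> dual_vector br a (e i)"

lemma ev: "i \<in> {1..r} \<Longrightarrow> ev i \<in> a" "i \<in> {1..r} \<Longrightarrow> X \<in> a \<Longrightarrow> e i X = ip (ev i) X"
  using dual_vector e_dual by auto

lemma ev_pos: "i \<in> {1..r} \<Longrightarrow> ip (ev i) (ev i) > 0"
proof -
  assume i: "i \<in> {1..r}"
  have "ev i \<noteq> 0"
  proof
    assume "ev i = 0"
    then have "e i X = 0" for X using ev(2)[OF i, of X] e_dual(1)[OF i] by (cases "X \<in> a") (auto simp: dual_space_def)
    then show False using e_dual(2)[OF i] by auto
  qed
  then show ?thesis by (rule ip_pos)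
qed

lemma ev_orth: "i \<in> {1..r} \<Longrightarrow> j \<in> {1..r} \<Longrightarrow> i \<noteq> j \<Longrightarrow> ip (ev i) (ev j) = 0"
  using dual_basis ev(1)[of i] a_p[of "ev i"] by (simp add: orthogonal_dual_basis_def ip_p)

text \<open>With H_i twice the dual vector of e_i, the factor 2 / |H_i|^2 makes the normalized
  vectors the basis of \<open>a\<close> dual to the e_i. The functionals e_i are therefore the
  coordinates used in \<open>flat\<close>.\<close>

lemma Ht_eq: assumes "i \<in> {1..r}" shows "Ht i = (1 / ip (ev i) (ev i)) *\<^sub>R ev i"
proof -
  have "root_vector br a e i = 2 *\<^sub>R ev i"
    unfolding root_vector_def
    by (rule dual_vector_eqI)
       (use e_dual[OF assms] ev[OF assms] subspace_scale[OF a_subspace] in \<open>auto simp: dual_space_def form.form_simps\<close>)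
  then show ?thesis by (simp add: normalized_root_vector_def form.form_simps)
qed

lemma Ht_a: "i \<in> {1..r} \<Longrightarrow> Ht i \<in> a"
  using Ht_eq ev(1) subspace_scale[OF a_subspace] by simp

lemma Ht_p: "i \<in> {1..r} \<Longrightarrow> Ht i \<in> \<pp>"
  using Ht_a a_p by blast

lemma e_Ht: "i \<in> {1..r} \<Longrightarrow> j \<in> {1..r} \<Longrightarrow> e i (Ht j) = (if i = j then 1 else 0)"
  using ev_pos[of i] by (simp add: ev(2) Ht_a) (auto simp: Ht_eq form.form_simps ev_orth)

lemma Ht_orth: "i \<in> {1..r} \<Longrightarrow> j \<in> {1..r} \<Longrightarrow> i \<noteq> j \<Longrightarrow> ip (Ht i) (Ht j) = 0"
  by (simp add: Ht_eq form.form_simps ev_orth)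

lemma Ht_pos: "i \<in> {1..r} \<Longrightarrow> ip (Ht i) (Ht i) > 0"
  using e_Ht[of i i] e_0[of i] by (intro ip_pos) auto

lemma flat_a: "flat x \<in> a"
  unfolding flat_vector_def using Ht_a by (intro subspace_sum[OF a_subspace] subspace_scale[OF a_subspace]) auto

lemma flat_p: "flat x \<in> \<pp>"
  using flat_a a_p by blast

lemma e_flat: "i \<in> {1..r} \<Longrightarrow> e i (flat x) = x i"
  unfolding flat_vector_def by (subst e_sum) (auto simp: Ht_a e_Ht if_distrib cong: if_cong)

lemma a_flat: assumes "X \<in> a" shows "flat (\<lambda>i. e i X) = X"
proof -
  let ?Y = "X - flat (\<lambda>i. e i X)"
  have Y: "?Y \<in> a" using assms flat_a subspace_diff[OF a_subspace] by blast
  have 0: "e i ?Y = 0" if "i \<in> {1..r}" for i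
    using e_linear(1)[OF that assms, of "- 1 *\<^sub>R flat (\<lambda>i. e i X)"] e_linear(2)[OF that flat_a, of "-1"]
      e_flat[OF that] subspace_scale[OF a_subspace flat_a, of "-1"] by simp
  obtain t where "(\<lambda>X. if X \<in> a then ip ?Y X else 0) = (\<lambda>X. \<Sum>i=1..r. t i * e i X)"
    using dual_basis ip_dual[OF Y] unfolding orthogonal_dual_basis_def by blast
  from fun_cong[OF this, of ?Y] have "ip ?Y ?Y = 0" using Y 0 by simp
  then show ?thesis by (simp add: form.eq_0_iff)
qed

lemma flat_eqI: "(\<And>i. i \<in> {1..r} \<Longrightarrow> x i = y i) \<Longrightarrow> flat x = flat y"
  by (simp add: flat_vector_def)

lemma flat_linear: "flat (\<lambda>i. x i + y i) = flat x + flat y" "flat (\<lambda>i. t * x i) = t *\<^sub>R flat x"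
  by (simp_all add: flat_vector_def scaleR_add_left sum.distrib scaleR_sum_right)

lemma flat_Ht: "i \<in> {1..r} \<Longrightarrow> flat (\<lambda>j. if j = i then t else 0) = t *\<^sub>R Ht i"
  by (simp add: flat_vector_def if_distrib[of "\<lambda>c. c *\<^sub>R _"] cong: if_cong)

subsection \<open>The restricted roots\<close>

lemma root_cases:
  assumes "\<mu> \<in> \<Sigma>'"
  obtains (sum) s t i j where "s \<in> {-1, 1}" "t \<in> {-1, 1}" "i \<in> {1..r}" "j \<in> {1..r}" "i < j" "\<mu> = (\<lambda>X. s * e i X + t * e j X)"
    | (long) s i where "s \<in> {-1, 1}" "i \<in> {1..r}" "\<mu> = (\<lambda>X. s * (2 * e i X))"
    | (short) s i where "s \<in> {-1, 1}" "i \<in> {1..r}" "\<mu> = (\<lambda>X. s * e i X)"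
proof -
  have "\<mu> \<in> roots_BC r e" using assms roots by (auto simp: roots_BC_def)
  then consider "\<exists>s t i j. \<mu> = (\<lambda>X. s * e i X + t * e j X) \<and> s \<in> {-1, 1} \<and> t \<in> {-1, 1} \<and> 1 \<le> i \<and> i < j \<and> j \<le> r"
    | "\<exists>s i. \<mu> = (\<lambda>X. s * (2 * e i X)) \<and> s \<in> {-1, 1} \<and> 1 \<le> i \<and> i \<le> r"
    | "\<exists>s i. \<mu> = (\<lambda>X. s * e i X) \<and> s \<in> {-1, 1} \<and> 1 \<le> i \<and> i \<le> r"
    unfolding roots_BC_def roots_C_def by blast
  then show ?thesis
  proof cases
    case 1
    then obtain s t i j where "\<mu> = (\<lambda>X. s * e i X + t * e j X)" "s \<in> {-1, 1}" "t \<in> {-1, 1}" "1 \<le> i" "i < j" "j \<le> r" by blast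
    then show ?thesis by (intro sum[of s t i j]) simp_all
  next
    case 2
    then obtain s i where "\<mu> = (\<lambda>X. s * (2 * e i X))" "s \<in> {-1, 1}" "1 \<le> i" "i \<le> r" by blast
    then show ?thesis by (intro long[of s i]) simp_all
  next
    case 3
    then obtain s i where "\<mu> = (\<lambda>X. s * e i X)" "s \<in> {-1, 1}" "1 \<le> i" "i \<le> r" by blast
    then show ?thesis by (intro short[of s i]) simp_all
  qed
qed

lemma long_root: assumes "i \<in> {1..r}" shows "(\<lambda>X. 2 * e i X) \<in> \<Sigma>'"
proof -
  have "(\<lambda>X. 1 * (2 * e i X)) \<in> roots_C r e"
    unfolding roots_C_def by (intro UnI2 CollectI exI[of _ 1] exI[of _ i] conjI) (use assms in simp_all)
  then show ?thesis using roots by (auto simp: roots_BC_def)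
qed

lemma diff_root:
  assumes "i \<in> {1..r}" "j \<in> {1..r}" "i < j" shows "(\<lambda>X. e i X - e j X) \<in> \<Sigma>'"
proof -
  have "(\<lambda>X. 1 * e i X + -1 * e j X) \<in> roots_C r e"
    unfolding roots_C_def by (intro UnI1 CollectI exI[of _ 1] exI[of _ "-1"] exI[of _ i] exI[of _ j] conjI) (use assms in simp_all)
  then show ?thesis using roots by (auto simp: roots_BC_def)
qed

lemma finite_roots: "finite \<Sigma>'"
proof (rule finite_subset)
  let ?I = "{-1, 1 :: real}"
  let ?R = "(\<lambda>(s, t, i, j). \<lambda>X. s * e i X + t * e j X) ` (?I \<times> ?I \<times> {1..r} \<times> {1..r})
     \<union> ((\<lambda>(s, i). \<lambda>X. s * (2 * e i X)) ` (?I \<times> {1..r}) \<union> (\<lambda>(s, i). \<lambda>X. s * e i X) ` (?I \<times> {1..r}))"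
  show "finite ?R" by (intro finite_UnI finite_imageI finite_SigmaI; simp)
  show "\<Sigma>' \<subseteq> ?R"
  proof
    fix \<mu> assume "\<mu> \<in> \<Sigma>'"
    then show "\<mu> \<in> ?R"
    proof (cases rule: root_cases)
      case (sum s t i j)
      then show ?thesis by (intro UnI1 image_eqI[where x = "(s, t, i, j)"]) simp_all
    next
      case (long s i)
      then show ?thesis by (intro UnI2 UnI1 image_eqI[where x = "(s, i)"]) simp_all
    next
      case (short s i)
      then show ?thesis by (intro UnI2[OF UnI2] image_eqI[where x = "(s, i)"]) simp_all
    qed
  qed
qed

definition regular :: "'g \<Rightarrow> bool" where
  "regular H \<longleftrightarrow> H \<in> a \<and> (\<forall>\<mu>\<in>\<Sigma>'. \<mu> H \<noteq> 0)"

lemma regular_exists: "\<exists>H. regular H"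
proof -
  \<comment> \<open>The coordinates 1, ..., r are distinct and positive, so neither sums nor
    differences of two of them vanish.\<close>
  have "\<mu> (flat real) \<noteq> 0" if "\<mu> \<in> \<Sigma>'" for \<mu>
    using that
  proof (cases rule: root_cases)
    case (sum s t i j)
    then show ?thesis by (auto simp: e_flat[OF sum(3)] e_flat[OF sum(4)])
  next
    case (long s i)
    then show ?thesis by (auto simp: e_flat[OF long(2)])
  next
    case (short s i)
    then show ?thesis by (auto simp: e_flat[OF short(2)])
  qed
  then show ?thesis using flat_a by (auto simp: regular_def)
qed

lemma root_dual: "\<mu> \<in> \<Sigma>' \<Longrightarrow> \<mu> \<in> dual_space a"
  by (simp add: restricted_roots_def)

lemma root_linear:
  assumes "\<mu> \<in> \<Sigma>'" "X \<in> a" "Y \<in> a" shows "\<mu> (X + t *\<^sub>R Y) = \<mu> X + t * \<mu> Y"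
  using root_dual[OF assms(1)] assms subspace_scale[OF a_subspace] by (simp add: dual_space_def)

lemma regular_nearby:
  assumes "regular H" "X \<in> a" shows "\<forall>\<^sub>F t in at 0. regular (X + t *\<^sub>R H)"
proof -
  have H: "H \<in> a" using assms by (simp add: regular_def)
  have "\<forall>\<^sub>F t in at 0. \<mu> (X + t *\<^sub>R H) \<noteq> 0" if m: "\<mu> \<in> \<Sigma>'" for \<mu>
  proof -
    have mH: "\<mu> H \<noteq> 0" using assms m by (simp add: regular_def)
    have "\<forall>\<^sub>F t in at 0. t \<noteq> - \<mu> X / \<mu> H"
      using eventually_neq_at_within[of "- \<mu> X / \<mu> H" 0 UNIV] by simp
    then show ?thesis
      by (rule eventually_mono) (use mH root_linear[OF m assms(2) H] in \<open>auto simp: field_simps\<close>)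
  qed
  then have "\<forall>\<^sub>F t in at 0. \<forall>\<mu>\<in>\<Sigma>'. \<mu> (X + t *\<^sub>R H) \<noteq> 0"
    using finite_roots by (simp add: eventually_ball_finite_distrib)
  then show ?thesis
    by (rule eventually_mono) (use assms H subspace_add[OF a_subspace] subspace_scale[OF a_subspace] in \<open>auto simp: regular_def\<close>)
qed

text \<open>On a root vector \<open>b\<close> the coefficient of \<open>X\<close>, multiplied by the
  nonzero number \<open>\<mu> H\<close>, is the inner product of \<open>br H X\<close> with the
  partner of \<open>b\<close>; so only the part of \<open>X\<close> in \<open>a\<close>
  survives.\<close>

lemma regular_centralizer:
  assumes H: "regular H" and X: "X \<in> \<pp>" "br H X = 0" shows "X \<in> a"
proof -
  obtain S where S: "finite S" "S \<subseteq> \<pp>" "span S = \<pp>" "0 \<notin> S" "\<forall>b\<in>S. \<forall>c\<in>S. b \<noteq> c \<longrightarrow> ip b c = 0"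
    "\<forall>b\<in>S. b \<in> a \<or> (\<exists>\<mu>\<in>\<Sigma>'. \<exists>W. root_pair \<mu> b W)" using eigenbasis_p by (elim exE conjE) (rule that)
  have "X = (\<Sum>b\<in>S. (ip X b / ip b b) *\<^sub>R b)"
    by (rule form.orthogonal_expansion) (use S X in auto)
  also have "\<dots> \<in> a"
  proof (rule subspace_sum[OF a_subspace])
    fix b assume b: "b \<in> S"
    show "(ip X b / ip b b) *\<^sub>R b \<in> a"
    proof (cases "b \<in> a")
      case False
      then obtain \<mu> W where m: "\<mu> \<in> \<Sigma>'" "root_pair \<mu> b W" using S(6) b by blast
      have Ha: "H \<in> a" "\<mu> H \<noteq> 0" using H m by (auto simp: regular_def)
      have "\<mu> H * ip X b = ip X (br H W)" using root_pairD(4)[OF m(2) Ha(1)] by (simp add: form.form_simps)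
      also have "\<dots> = 0" using ip_br_p[OF a_p[OF Ha(1)], of X W] X by simp
      finally show ?thesis using Ha subspace_0[OF a_subspace] by simp
    qed (simp add: subspace_scale[OF a_subspace])
  qed
  finally show ?thesis .
qed

end

context hermitian_algebra
begin

subsection \<open>The triple product and frames of tripotents\<close>

text \<open>On \<open>a\<close> this is, up to a scalar, the Jordan triple product of the Hermitian
  symmetric space, and it is symmetric in all three arguments there.\<close>

definition triple :: "'g \<Rightarrow> 'g \<Rightarrow> 'g \<Rightarrow> 'g" where
  "triple X Y Z = JJ (br (br X (JJ Y)) Z)"

lemma triple_linear: "linear (triple X Y)" "linear (\<lambda>Y. triple X Y Z)" "linear (\<lambda>X. triple X Y Z)"
  by (auto simp: triple_def[abs_def] linear_iff br_simps)

lemmas triple_simps = linear_add[OF triple_linear(1)] linear_add[OF triple_linear(2)] linear_add[OF triple_linear(3)]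
  linear_scale[OF triple_linear(1)] linear_scale[OF triple_linear(2)] linear_scale[OF triple_linear(3)]
  linear_diff[OF triple_linear(1)] linear_diff[OF triple_linear(2)] linear_diff[OF triple_linear(3)]
  linear_neg[OF triple_linear(1)] linear_neg[OF triple_linear(2)] linear_neg[OF triple_linear(3)]

lemma br_J_k: "X \<in> \<pp> \<Longrightarrow> Y \<in> \<pp> \<Longrightarrow> br X (JJ Y) \<in> \<kk>"
  by (intro br_pp J_p)

lemma triple_p: "X \<in> \<pp> \<Longrightarrow> Y \<in> \<pp> \<Longrightarrow> Z \<in> \<pp> \<Longrightarrow> triple X Y Z \<in> \<pp>"
  unfolding triple_def by (intro J_p br_kp br_J_k)

lemma triple_sym12: "X \<in> \<pp> \<Longrightarrow> Y \<in> \<pp> \<Longrightarrow> triple X Y Z = triple Y X Z"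
  using br_J_swap by (simp add: triple_def)

lemma triple_sym23: "X \<in> a \<Longrightarrow> Y \<in> a \<Longrightarrow> Z \<in> a \<Longrightarrow> triple X Y Z = triple X Z Y"
  using br_br[of X "JJ Y" Z] br_br[of X "JJ Z" Y] a_abelian[of X] br_J_left[OF a_p a_p] br_J_swap[OF a_p a_p, of Y Z]
  by (simp add: triple_def)

lemma br_triple:
  assumes "X \<in> \<pp>" "Y \<in> \<pp>" "Z \<in> \<pp>" shows "br (br X (JJ Y)) Z = - JJ (triple X Y Z)"
  using J_J[OF br_kp[OF br_J_k[OF assms(1,2)] assms(3)]] by (simp add: triple_def)

text \<open>Apply A = [X, J X] to itself as a derivation: the two resulting terms of 0 = [A,
  [X, J X]] coincide by \<open>br_J_swap\<close>.\<close>

lemma br_cube: assumes X: "X \<in> \<pp>" shows "br X (triple X X X) = 0"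
proof -
  define A where "A = br X (JJ X)"
  have A: "A \<in> \<kk>" using br_J_k[OF X X] by (simp add: A_def)
  have t: "triple X X X = br A (JJ X)" using J_br_k[OF A] by (simp add: triple_def A_def)
  have "0 = br A (br X (JJ X))" by (simp add: A_def bracket_self0)
  also have "\<dots> = br (br A X) (JJ X) + br X (br A (JJ X))" by (rule jacobi_id)
  also have "br (br A X) (JJ X) = br X (JJ (br A X))" by (rule br_J_swap[OF br_kp[OF A X] X])
  finally have "2 *\<^sub>R br X (br A (JJ X)) = 0" using J_br_k[OF A] by (simp add: scaleR_2)
  then show ?thesis by (simp add: t)
qed

text \<open>The cube commutes with \<open>X\<close>, so it lies in \<open>a\<close> when
  \<open>X\<close> is regular; the general case follows by moving \<open>X\<close> in a regular
  direction, since \<open>a\<close> is closed.\<close>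

lemma cube_a: assumes X: "X \<in> a" shows "triple X X X \<in> a"
proof -
  obtain H where H: "regular H" using regular_exists by blast
  have bb: "bounded_bilinear br" using bracket_left bracket_right by (simp add: bilinear_conv_bounded_bilinear[symmetric] bilinear_def)
  let ?X = "\<lambda>t. X + t *\<^sub>R H"
  have "((\<lambda>t. triple (?X t) (?X t) (?X t)) \<longlongrightarrow> triple (?X 0) (?X 0) (?X 0)) (at 0)"
    unfolding triple_def by (intro bounded_bilinear.tendsto[OF bb] tendsto_intros)
  moreover have "\<forall>\<^sub>F t in at 0. triple (?X t) (?X t) (?X t) \<in> a"
    using regular_nearby[OF H X]
  proof (rule eventually_mono)
    fix t assume t: "regular (?X t)"
    then have "?X t \<in> \<pp>" using a_p by (simp add: regular_def)
    then show "triple (?X t) (?X t) (?X t) \<in> a" by (intro regular_centralizer[OF t] triple_p br_cube)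
  qed
  ultimately have "triple (?X 0) (?X 0) (?X 0) \<in> a"
    by (intro Lim_in_closed_set[OF closed_subspace[OF a_subspace]]) auto
  then show ?thesis by simp
qed

text \<open>Polarization of the cube: (X + Y)^3 - (X - Y)^3 = 6 X X Y + 2 Y^3 by the total symmetry
  on \<open>a\<close>, and a second polarization separates the two equal arguments.\<close>

lemma triple_a: assumes "X \<in> a" "Y \<in> a" "Z \<in> a" shows "triple X Y Z \<in> a"
proof -
  have sq: "triple X X Y \<in> a" if X: "X \<in> a" and Y: "Y \<in> a" for X Y
  proof -
    have s: "triple Y X X = triple X X Y" "triple X Y X = triple X X Y" "triple X Y Y = triple Y Y X" "triple Y X Y = triple Y Y X"
      using triple_sym12[OF a_p a_p] triple_sym23 X Y by metis+
    have "6 *\<^sub>R triple X X Y = triple (X + Y) (X + Y) (X + Y) - triple (X - Y) (X - Y) (X - Y) - 2 *\<^sub>R triple Y Y Y"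
    proof -
      have "6 *\<^sub>R x = (1 + (1 + (1 + (1 + 2)))) *\<^sub>R x" for x :: 'g by simp
      then have six: "6 *\<^sub>R x = x + (x + (x + (x + 2 *\<^sub>R x)))" for x :: 'g by (simp only: scaleR_left_distrib scaleR_one)
      show ?thesis by (simp add: triple_simps s algebra_simps six scaleR_2)
    qed
    also have "\<dots> \<in> a" using X Y by (intro subspace_diff[OF a_subspace] subspace_scale[OF a_subspace] cube_a subspace_add[OF a_subspace])
    finally have "(1 / 6) *\<^sub>R 6 *\<^sub>R triple X X Y \<in> a" by (rule subspace_scale[OF a_subspace])
    then show ?thesis by simp
  qed
  have s: "triple Y X Z = triple X Y Z" using triple_sym12[OF a_p a_p] assms by metis
  have "2 *\<^sub>R triple X Y Z = triple (X + Y) (X + Y) Z - triple X X Z - triple Y Y Z"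
    by (simp add: triple_simps s scaleR_2)
  also have "\<dots> \<in> a" using assms by (intro subspace_diff[OF a_subspace] sq subspace_add[OF a_subspace])
  finally have "(1 / 2) *\<^sub>R 2 *\<^sub>R triple X Y Z \<in> a" by (rule subspace_scale[OF a_subspace])
  then show ?thesis by simp
qed

lemma triple_symmetric:
  assumes "X \<in> \<pp>" "Y \<in> \<pp>" "Z \<in> \<pp>" "V \<in> \<pp>" shows "ip (triple X Y Z) V = ip Z (triple X Y V)"
  using J_br_k[OF br_J_k[OF assms(1,2)], of V]
  by (simp add: triple_def J_skew ip_br_k[OF br_J_k[OF assms(1,2)]])

lemma triple_norm:
  assumes "X \<in> \<pp>" "Y \<in> \<pp>" shows "ip (triple X Y X) Y = ip (br X (JJ Y)) (br X (JJ Y))"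
proof -
  have "ip (triple X Y X) Y = - ip (br (br X (JJ Y)) X) (JJ Y)" by (simp add: triple_def J_skew)
  also have "\<dots> = ip (br X (br X (JJ Y))) (JJ Y)" by (subst br_anti) (simp add: form.form_simps)
  also have "\<dots> = ip (br X (JJ Y)) (br X (JJ Y))" by (rule ip_br_p[OF assms(1)])
  finally show ?thesis .
qed

lemma br_JJ: "X \<in> \<pp> \<Longrightarrow> Y \<in> \<pp> \<Longrightarrow> br (JJ X) (JJ Y) = br X Y"
  using br_J_left[OF _ J_p] by (simp add: J_J br_simps)

text \<open>The elements [X, J Y] and [U, J V] of k commute: the first one, acting as a derivation
  on the second, produces brackets within J a and within \<open>a\<close>, and these vanish by
  \<open>triple_a\<close>.\<close>

lemma triple_commute:
  assumes "X \<in> a" "Y \<in> a" "U \<in> a" "V \<in> a" "Z \<in> a"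
  shows "triple X Y (triple U V Z) = triple U V (triple X Y Z)"
proof -
  note p = assms[THEN a_p]
  define K where "K = br X (JJ Y)" define L where "L = br U (JJ V)"
  have K: "K \<in> \<kk>" and L: "L \<in> \<kk>" using br_J_k p by (auto simp: K_def L_def)
  have t: "triple X Y W = JJ (br K W)" "triple U V W = JJ (br L W)" for W by (auto simp: triple_def K_def L_def)
  have "br K (br U (JJ V)) = br (br K U) (JJ V) + br U (br K (JJ V))" by (rule jacobi_id)
  also have "br K U = - JJ (triple X Y U)" using br_triple p by (simp add: K_def)
  also have "br (- JJ (triple X Y U)) (JJ V) = 0"
    using br_JJ[OF a_p a_p] triple_a[OF assms(1,2,3)] assms(4) a_abelian by (simp add: br_simps)
  also have "br K (JJ V) = triple X Y V" using J_br_k[OF K] by (simp add: t)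
  also have "br U (triple X Y V) = 0" using triple_a[OF assms(1,2,4)] assms(3) a_abelian by simp
  finally have KL: "br K L = 0" by (simp add: L_def)
  have "triple X Y (triple U V Z) = - br K (br L Z)"
    using J_br_k[OF K, of "JJ (br L Z)"] J_J[OF br_kp[OF L p(5)]] by (simp add: t br_simps)
  also have "\<dots> = - br L (br K Z)" using jacobi_id[of K L Z] KL by simp
  also have "\<dots> = triple U V (triple X Y Z)"
    using J_br_k[OF L, of "JJ (br K Z)"] J_J[OF br_kp[OF K p(5)]] by (simp add: t br_simps)
  finally show ?thesis .
qed

lemma tripotentI: assumes "X \<in> \<pp>" "triple X X X = 4 *\<^sub>R X" shows "tripotent X"
  using br_triple[OF assms(1,1,1)] assms by (simp add: tripotent_def br_simps)

text \<open>A Jordan frame of \<open>a\<close>: tripotents that annihilate each other under the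
  triple product, forming an orthogonal basis.\<close>

definition frame :: "'g set \<Rightarrow> bool" where
  "frame S \<longleftrightarrow> finite S \<and> S \<subseteq> a \<and> span S = a \<and> 0 \<notin> S \<and> (\<forall>b\<in>S. \<forall>c\<in>S. b \<noteq> c \<longrightarrow> ip b c = 0) \<and>
    (\<forall>v\<in>S. triple v v v = 4 *\<^sub>R v) \<and> (\<forall>v\<in>S. \<forall>w\<in>S. v \<noteq> w \<longrightarrow> (\<forall>Z\<in>a. triple v w Z = 0))"

text \<open>The operators \<open>triple X Y\<close> on \<open>a\<close> are symmetric and commute; a
  joint eigenbasis is a frame after scaling. If the cube of a basis vector v vanished, J v would
  commute with \<open>a\<close> and so lie in \<open>a\<close>, but J a is orthogonal to
  \<open>a\<close>.\<close>

lemma frame_exists: "\<exists>S. frame S"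
proof -
  let ?F = "{triple X Y | X Y. X \<in> a \<and> Y \<in> a}"
  have "form.commuting_family a ?F"
    unfolding form.commuting_family_def
  proof (intro conjI ballI)
    fix T assume "T \<in> ?F"
    then obtain X Y where T: "T = triple X Y" "X \<in> a" "Y \<in> a" by blast
    show "linear T" by (simp add: T triple_linear)
    show "T ` a \<subseteq> a" using triple_a T by auto
    show "ip (T Z) V = ip Z (T V)" if "Z \<in> a" "V \<in> a" for Z V
      unfolding T(1) by (intro triple_symmetric a_p T that)
    fix R Z assume "R \<in> ?F" and Z: "Z \<in> a"
    then obtain U V where R: "R = triple U V" "U \<in> a" "V \<in> a" by blast
    show "R (T Z) = T (R Z)" unfolding T(1) R(1) by (intro triple_commute T R Z)
  qed
  from a_orthogonal_basis[OF this] obtain S where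
    S: "finite S" "S \<subseteq> a" "span S = a" "0 \<notin> S" "\<forall>b\<in>S. \<forall>T\<in>?F. \<exists>l. T b = l *\<^sub>R b" "\<forall>b\<in>S. \<forall>c\<in>S. b \<noteq> c \<longrightarrow> ip b c = 0"
    by (elim exE conjE) (rule that)
  have eig: "\<exists>l. triple X Y b = l *\<^sub>R b" if "X \<in> a" "Y \<in> a" "b \<in> S" for X Y b
  proof -
    have "triple X Y \<in> ?F" using that by blast
    then show ?thesis using S(5) that(3) by blast
  qed
  have Sa: "b \<in> a" if "b \<in> S" for b using S(2) that by blast
  \<comment> \<open>By total symmetry the product is a multiple of \<open>v\<close> and a multiple
    of \<open>w\<close>, and these two are orthogonal.\<close>
  have off: "triple v w Z = 0" if vw: "v \<in> S" "w \<in> S" "v \<noteq> w" "Z \<in> a" for v w Z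
  proof -
    obtain l where "triple w Z v = l *\<^sub>R v" using eig[OF Sa[OF vw(2)] vw(4,1)] by blast
    moreover obtain m where m: "triple v Z w = m *\<^sub>R w" using eig[OF Sa[OF vw(1)] vw(4,2)] by blast
    moreover have "triple v w Z = triple v Z w" by (rule triple_sym23[OF Sa[OF vw(1)] Sa[OF vw(2)] vw(4)])
    moreover have "triple v w Z = triple w Z v"
      using triple_sym12[OF a_p a_p, OF Sa[OF vw(1)] Sa[OF vw(2)]] triple_sym23[OF Sa[OF vw(2)] Sa[OF vw(1)] vw(4)] by simp
    ultimately have eq: "l *\<^sub>R v = m *\<^sub>R w" by simp
    then have "l * ip v w = m * ip w w" by (metis form.form_simps(4) real_scaleR_def)
    then have "m = 0" using S(4,6) vw form.eq_0_iff[of w] by auto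
    then show ?thesis using m \<open>triple v w Z = triple v Z w\<close> by simp
  qed
  have "\<exists>c>0. triple v v v = c *\<^sub>R v" if v: "v \<in> S" for v
  proof -
    note va = Sa[OF v]
    obtain c where c: "triple v v v = c *\<^sub>R v" using eig[OF va va v] by blast
    have v0: "v \<noteq> 0" using S(4) v by blast
    have "c * ip v v \<ge> 0" using triple_norm[OF a_p[OF va] a_p[OF va]] form.nonneg by (simp add: c form.form_simps)
    then have "c \<ge> 0" using ip_pos[OF v0] by (simp add: zero_le_mult_iff)
    moreover have "c \<noteq> 0"
    proof
      assume "c = 0"
      have 0: "triple v X v = 0" if "X \<in> span S" for X
        using that
      proof (induction rule: span_induct_alt)
        case base
        then show ?case using linear_0[OF triple_linear(2)] by simp
      next
        case (step t w X)
        have "triple v w v = 0" using off[OF v step(1) _ va] c \<open>c = 0\<close> by (cases "w = v") auto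
        then show ?case using step by (simp add: triple_simps)
      qed
      have "br X (JJ v) = 0" if "X \<in> a" for X
      proof -
        have "ip (br v (JJ X)) (br v (JJ X)) = 0"
          using triple_norm[OF a_p[OF va] a_p[OF that]] 0[of X] S(3) that by simp
        then show ?thesis using form.eq_0_iff br_J_swap[OF a_p[OF va] a_p[OF that]] by simp
      qed
      then have "JJ v \<in> a" by (rule a_centralizer[OF J_p[OF a_p[OF va]]])
      then have "JJ v = 0" using J_a_orthogonal[OF va] form.eq_0_iff by blast
      then show False using J_eq_0[OF a_p[OF va]] v0 by blast
    qed
    ultimately show ?thesis using c by (intro exI[of _ c]) simp
  qed
  then obtain c where c: "\<And>v. v \<in> S \<Longrightarrow> c v > 0" "\<And>v. v \<in> S \<Longrightarrow> triple v v v = c v *\<^sub>R v" by metis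
  \<comment> \<open>Cubing scales the eigenvalue by the square of the factor, so this factor turns
    \<open>c v\<close> into 4.\<close>
  define h where "h v = (2 / sqrt (c v)) *\<^sub>R v" for v
  have hS: "h v \<in> a" if "v \<in> S" for v using Sa[OF that] subspace_scale[OF a_subspace] by (simp add: h_def)
  have "frame (h ` S)"
    unfolding frame_def
  proof (intro conjI ballI impI)
    show "finite (h ` S)" using S(1) by simp
    show "h ` S \<subseteq> a" using hS by blast
    show "span (h ` S) = a"
    proof
      show "span (h ` S) \<subseteq> a" using hS by (intro span_minimal a_subspace) blast
      have "v \<in> span (h ` S)" if "v \<in> S" for v
      proof -
        have "(sqrt (c v) / 2) *\<^sub>R h v \<in> span (h ` S)" using that by (intro span_scale span_base) simp
        then show ?thesis using c(1)[OF that] by (simp add: h_def)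
      qed
      then have "span S \<subseteq> span (h ` S)" by (intro span_minimal) auto
      then show "a \<subseteq> span (h ` S)" using S(3) by simp
    qed
    show "0 \<notin> h ` S" using S(4) c(1) by (force simp: h_def)
    have dist: "\<exists>v w. v \<in> S \<and> w \<in> S \<and> v \<noteq> w \<and> x = h v \<and> y = h w" if "x \<in> h ` S" "y \<in> h ` S" "x \<noteq> y" for x y
      using that by blast
    show "ip x y = 0" if "x \<in> h ` S" "y \<in> h ` S" "x \<noteq> y" for x y
    proof -
      obtain v w where "v \<in> S" "w \<in> S" "v \<noteq> w" "x = h v" "y = h w" using dist[OF \<open>x \<in> h ` S\<close> \<open>y \<in> h ` S\<close> \<open>x \<noteq> y\<close>] by blast
      then show ?thesis using S(6) by (simp add: h_def form.form_simps)
    qed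
    show "triple x x x = 4 *\<^sub>R x" if x: "x \<in> h ` S" for x
    proof -
      obtain v where v: "v \<in> S" "x = h v" using x by blast
      define q where "q = 2 / sqrt (c v)"
      have q: "q * q * c v = 4" using c(1)[OF v(1)] by (simp add: q_def)
      have "triple x x x = (q * q * c v) *\<^sub>R q *\<^sub>R v"
        using c(2)[OF v(1)] by (simp add: v(2) h_def q_def[symmetric] triple_simps mult_ac)
      then show ?thesis by (simp only: q) (simp add: v(2) h_def q_def)
    qed
    show "triple x y Z = 0" if "x \<in> h ` S" "y \<in> h ` S" "x \<noteq> y" "Z \<in> a" for x y Z
    proof -
      obtain v w where "v \<in> S" "w \<in> S" "v \<noteq> w" "x = h v" "y = h w" using dist[OF \<open>x \<in> h ` S\<close> \<open>y \<in> h ` S\<close> \<open>x \<noteq> y\<close>] by blast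
      then show ?thesis using off \<open>Z \<in> a\<close> by (simp add: h_def triple_simps)
    qed
  qed
  then show ?thesis by blast
qed

context
  fixes S assumes S: "frame S"
begin

definition coord :: "'g \<Rightarrow> 'g \<Rightarrow> real" where "coord v H = ip H v / ip v v"

lemma frame_a: "v \<in> S \<Longrightarrow> v \<in> a"
  using S by (auto simp: frame_def)

lemma coord_frame: "v \<in> S \<Longrightarrow> w \<in> S \<Longrightarrow> coord v w = (if v = w then 1 else 0)"
  using S form.eq_0_iff[of v] by (auto simp: frame_def coord_def)

lemma coord_linear: "linear (coord v)"
  by (auto simp: coord_def[abs_def] linear_iff form.form_simps add_divide_distrib)

lemma frame_expansion: "H \<in> a \<Longrightarrow> (\<Sum>v\<in>S. coord v H *\<^sub>R v) = H"
  using form.orthogonal_expansion[of S H] S by (simp add: frame_def coord_def)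

lemma frame_triple:
  assumes "v \<in> S" "H \<in> a" "H' \<in> a" shows "triple H H' v = (4 * coord v H * coord v H') *\<^sub>R v"
proof -
  have 1: "triple X Y v = coord v X *\<^sub>R triple v Y v" if "X \<in> a" "Y \<in> a" for X Y
  proof -
    have "triple X Y v = triple (\<Sum>w\<in>S. coord w X *\<^sub>R w) Y v" using frame_expansion[OF that(1)] by simp
    also have "\<dots> = (\<Sum>w\<in>S. coord w X *\<^sub>R triple w Y v)" by (simp add: linear_sum[OF triple_linear(3)] triple_simps)
    also have "\<dots> = (\<Sum>w\<in>S. if w = v then coord v X *\<^sub>R triple v Y v else 0)"
    proof (rule sum.cong)
      fix w assume w: "w \<in> S"
      have "triple w Y v = triple w v Y" by (rule triple_sym23[OF frame_a[OF w] that(2) frame_a[OF assms(1)]])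
      then show "coord w X *\<^sub>R triple w Y v = (if w = v then coord v X *\<^sub>R triple v Y v else 0)"
        using S w assms(1) that(2) by (auto simp: frame_def)
    qed simp
    finally show ?thesis using S assms(1) by (simp add: frame_def)
  qed
  have "triple v H' v = triple H' v v" by (rule triple_sym12[OF a_p a_p]) (use assms frame_a in auto)
  then show ?thesis using 1[OF assms(2,3)] 1[OF assms(3) frame_a[OF assms(1)]] S assms(1) by (simp add: frame_def)
qed

text \<open>For distinct frame elements the squared norm of [w, J v] is a value of the triple
  product and vanishes. So \<open>JJ v\<close> is a root vector for twice the coordinate along
  \<open>v\<close>.\<close>

lemma frame_root_pair:
  assumes v: "v \<in> S" shows "root_pair (\<lambda>H. 2 * coord v H) (JJ v) ((1 / 2) *\<^sub>R br v (JJ v))"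
  unfolding root_pair_def
proof (intro conjI ballI)
  note va = frame_a[OF v]
  show "JJ v \<in> \<pp>" by (intro J_p a_p va)
  show "(1 / 2) *\<^sub>R br v (JJ v) \<in> \<kk>" by (intro subspace_scale[OF subspace_k] br_J_k a_p va)
  fix H assume H: "H \<in> a"
  have off: "br w (JJ v) = 0" if "w \<in> S" "w \<noteq> v" for w
  proof -
    have "triple w v w = 0" using S that v frame_a[OF that(1)] by (auto simp: frame_def)
    then show ?thesis using triple_norm[OF a_p[OF frame_a[OF that(1)]] a_p[OF va]] form.eq_0_iff by simp
  qed
  have "br H (JJ v) = br (\<Sum>w\<in>S. coord w H *\<^sub>R w) (JJ v)" using frame_expansion[OF H] by simp
  also have "\<dots> = (\<Sum>w\<in>S. coord w H *\<^sub>R br w (JJ v))" by (simp add: linear_sum[OF bracket_left] br_simps)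
  also have "\<dots> = (\<Sum>w\<in>S. if w = v then coord v H *\<^sub>R br v (JJ v) else 0)" using off by (intro sum.cong) auto
  also have "\<dots> = coord v H *\<^sub>R br v (JJ v)" using S v by (simp add: frame_def)
  finally show "br H (JJ v) = (2 * coord v H) *\<^sub>R (1 / 2) *\<^sub>R br v (JJ v)" by simp
  have "br (br v (JJ v)) H = - JJ (triple v v H)" using br_triple a_p[OF va] a_p[OF H] by simp
  also have "triple v v H = triple H v v"
    using triple_sym23[OF va va H] triple_sym12[OF a_p[OF va] a_p[OF H]] by simp
  also have "\<dots> = (4 * coord v H) *\<^sub>R v" using frame_triple[OF v H va] coord_frame[OF v v] by simp
  finally have "br H (br v (JJ v)) = (4 * coord v H) *\<^sub>R JJ v" by (subst br_anti) (simp add: br_simps)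
  then show "br H ((1 / 2) *\<^sub>R br v (JJ v)) = (2 * coord v H) *\<^sub>R JJ v" by (simp add: br_simps)
qed

text \<open>In a frame the triple product is coordinatewise, so an element is tripotent as soon as
  its coordinates satisfy s^3 = s.\<close>

lemma frame_tripotent:
  assumes "\<And>v. v \<in> S \<Longrightarrow> s v \<in> {-1, 0, 1}" shows "tripotent (\<Sum>v\<in>S. s v *\<^sub>R v)"
proof -
  let ?X = "\<Sum>v\<in>S. s v *\<^sub>R v"
  have X: "?X \<in> a" using frame_a by (intro subspace_sum[OF a_subspace] subspace_scale[OF a_subspace])
  have c: "coord v ?X = s v" if "v \<in> S" for v
  proof -
    have "coord v ?X = (\<Sum>w\<in>S. s w * coord v w)" by (simp add: linear_sum[OF coord_linear] linear_scale[OF coord_linear])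
    also have "\<dots> = (\<Sum>w\<in>S. if w = v then s v else 0)" using coord_frame that by (intro sum.cong) auto
    finally show ?thesis using S that by (simp add: frame_def)
  qed
  have "triple ?X ?X ?X = (\<Sum>v\<in>S. s v *\<^sub>R triple ?X ?X v)" by (simp add: linear_sum[OF triple_linear(1)] triple_simps)
  also have "\<dots> = (\<Sum>v\<in>S. 4 *\<^sub>R (s v *\<^sub>R v))"
    using assms c frame_triple[OF _ X X] by (intro sum.cong) force+
  also have "\<dots> = 4 *\<^sub>R ?X" by (simp add: scaleR_sum_right)
  finally show ?thesis by (intro tripotentI a_p X)
qed

lemma frame_root:
  assumes v: "v \<in> S" shows "(\<lambda>H. if H \<in> a then 2 * coord v H else 0) \<in> \<Sigma>'"
proof -
  let ?W = "(1 / 2) *\<^sub>R br v (JJ v)"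
  note rp = frame_root_pair[OF v]
  have "JJ v + ?W \<noteq> 0"
  proof
    assume "JJ v + ?W = 0"
    then have "JJ v = - ?W" by (simp add: eq_neg_iff_add_eq_0)
    then have "JJ v \<in> \<kk>" using root_pairD(2)[OF rp] subspace_neg[OF subspace_k] by metis
    then have "v = 0" using kp_disjoint J_eq_0 a_p[OF frame_a[OF v]] J_p by blast
    then show False using S v by (simp add: frame_def)
  qed
  moreover have "br H (JJ v + ?W) = (2 * coord v H) *\<^sub>R (JJ v + ?W)" if "H \<in> a" for H
    using root_pairD(3,4)[OF rp that] by (simp add: br_simps(2) scaleR_add_right)
  moreover have "(\<lambda>H. if H \<in> a then 2 * coord v H else 0) \<in> dual_space a"
    by (auto simp: dual_space_def linear_add[OF coord_linear] linear_scale[OF coord_linear]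
        subspace_add[OF a_subspace] subspace_scale[OF a_subspace])
  moreover have "(\<lambda>H. if H \<in> a then 2 * coord v H else 0) \<noteq> (\<lambda>_. 0)"
    using coord_frame[OF v v] frame_a[OF v] by (metis (no_types, lifting) mult_1_right zero_neq_numeral)
  ultimately show ?thesis unfolding restricted_roots_def by (auto intro!: exI[of _ "JJ v + ?W"] simp del: scaleR_add_right)
qed

lemma root_Ht_bound:
  assumes "\<mu> \<in> \<Sigma>'" "k \<in> {1..r}"
  shows "\<bar>\<mu> (Ht k)\<bar> \<le> 2" "\<bar>\<mu> (Ht k)\<bar> = 2 \<Longrightarrow> \<exists>s\<in>{-1, 1}. \<mu> = (\<lambda>X. s * (2 * e k X))"
proof -
  have "\<bar>\<mu> (Ht k)\<bar> \<le> 2 \<and> (\<bar>\<mu> (Ht k)\<bar> = 2 \<longrightarrow> (\<exists>s\<in>{-1, 1}. \<mu> = (\<lambda>X. s * (2 * e k X))))"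
    using assms(1)
  proof (cases rule: root_cases)
    case (sum s t i j)
    have "e i (Ht k) = 0 \<and> e j (Ht k) = 0 \<or> e i (Ht k) = 1 \<and> e j (Ht k) = 0 \<or> e i (Ht k) = 0 \<and> e j (Ht k) = 1"
      using e_Ht[OF sum(3) assms(2)] e_Ht[OF sum(4) assms(2)] sum(5) by auto
    then have "\<bar>\<mu> (Ht k)\<bar> \<le> 1" using sum(1,2,6) by auto
    then show ?thesis by linarith
  next
    case (long s i)
    have "\<bar>s\<bar> = 1" using long(1) by auto
    then have "\<bar>\<mu> (Ht k)\<bar> = (if i = k then 2 else 0)" using e_Ht[OF long(2) assms(2)] long(3) by (simp add: abs_mult)
    then show ?thesis using long(1,3) by (cases "i = k") auto
  next
    case (short s i)
    have "\<bar>s\<bar> = 1" using short(1) by auto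
    then have "\<bar>\<mu> (Ht k)\<bar> \<le> 1" using e_Ht[OF short(2) assms(2)] short(3) by (simp add: abs_mult)
    then show ?thesis by linarith
  qed
  then show "\<bar>\<mu> (Ht k)\<bar> \<le> 2" "\<bar>\<mu> (Ht k)\<bar> = 2 \<Longrightarrow> \<exists>s\<in>{-1, 1}. \<mu> = (\<lambda>X. s * (2 * e k X))" by blast+
qed

text \<open>The frame comes from J, the vectors \<open>Ht k\<close> from the given root system. They
  are matched by comparing two bounds by 2: every root on a tripotent, and every root on
  \<open>Ht k\<close>, where only the long root for \<open>k\<close> and its negative reach
  it.\<close>

lemma Ht_frame:
  assumes k: "k \<in> {1..r}" shows "\<exists>v\<in>S. Ht k = v \<or> Ht k = - v"
proof -
  have fin: "finite S" using S by (simp add: frame_def)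
  \<comment> \<open>The frame elements added with the signs of \<open>e k\<close> form a tripotent,
    on which the root \<open>2 * e k\<close> is at most 2.\<close>
  have sum1: "(\<Sum>v\<in>S. \<bar>e k v\<bar>) \<le> 1" if k: "k \<in> {1..r}" for k
  proof -
    let ?X = "\<Sum>v\<in>S. sgn (e k v) *\<^sub>R v"
    have "tripotent ?X" by (rule frame_tripotent) (auto simp: sgn_if)
    moreover have "?X \<in> a" using frame_a by (intro subspace_sum[OF a_subspace] subspace_scale[OF a_subspace])
    ultimately have "\<bar>2 * e k ?X\<bar> \<le> 2" using tripotent_root_bound[OF _ _ long_root[OF k]] by blast
    moreover have "e k ?X = (\<Sum>v\<in>S. \<bar>e k v\<bar>)"
      using e_sum[OF k fin frame_a] by (simp add: mult.commute[of "sgn _"] flip: abs_mult_sgn)  (simp add: abs_sgn mult.commute)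
    ultimately show ?thesis by linarith
  qed
  have ex: "\<exists>v\<in>S. \<exists>s\<in>{-1, 1}. \<forall>H\<in>a. coord v H = s * e k H" if k: "k \<in> {1..r}" for k
  proof (rule ccontr)
    assume neg: "\<not> ?thesis"
    \<comment> \<open>If no root \<open>2 * coord v\<close> is the long root for \<open>k\<close> up
      to sign, all of them stay strictly below 2 at \<open>Ht k\<close>; expanding
      \<open>e k (Ht k) = 1\<close> in the frame then contradicts \<open>sum1\<close>.\<close>
    have lt: "\<bar>coord v (Ht k)\<bar> < 1" if v: "v \<in> S" for v
    proof -
      let ?m = "\<lambda>H. if H \<in> a then 2 * coord v H else 0"
      have "\<bar>?m (Ht k)\<bar> \<le> 2" by (rule root_Ht_bound(1)[OF frame_root[OF v] k])
      moreover have "\<bar>?m (Ht k)\<bar> \<noteq> 2"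
      proof
        assume "\<bar>?m (Ht k)\<bar> = 2"
        then obtain s where s: "s \<in> {-1, 1}" "?m = (\<lambda>X. s * (2 * e k X))" using root_Ht_bound(2)[OF frame_root[OF v] k] by blast
        have "coord v H = s * e k H" if "H \<in> a" for H using fun_cong[OF s(2), of H] that by simp
        then show False using neg v s(1) by blast
      qed
      ultimately show ?thesis using Ht_a[OF k] by simp
    qed
    have "1 = e k (\<Sum>v\<in>S. coord v (Ht k) *\<^sub>R v)" using frame_expansion[OF Ht_a[OF k]] e_Ht[OF k k] by simp
    also have "\<dots> = (\<Sum>v\<in>S. coord v (Ht k) * e k v)" by (rule e_sum[OF k fin frame_a])
    finally have one: "1 = (\<Sum>v\<in>S. coord v (Ht k) * e k v)" .
    then obtain v where v: "v \<in> S" "coord v (Ht k) * e k v \<noteq> 0"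
      using sum.not_neutral_contains_not_neutral[of "\<lambda>v. coord v (Ht k) * e k v" S] by auto
    have "1 \<le> (\<Sum>v\<in>S. \<bar>coord v (Ht k)\<bar> * \<bar>e k v\<bar>)"
      using one sum_abs[of "\<lambda>v. coord v (Ht k) * e k v" S] by (simp add: abs_mult)
    also have "\<dots> < (\<Sum>v\<in>S. \<bar>e k v\<bar>)"
    proof (rule sum_strict_mono_ex1[OF fin])
      show "\<forall>v\<in>S. \<bar>coord v (Ht k)\<bar> * \<bar>e k v\<bar> \<le> \<bar>e k v\<bar>" using lt by (auto intro!: mult_left_le_one_le simp: less_imp_le)
      have "\<bar>coord v (Ht k)\<bar> * \<bar>e k v\<bar> < 1 * \<bar>e k v\<bar>" using v lt[OF v(1)] by (intro mult_strict_right_mono) auto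
      then show "\<exists>v\<in>S. \<bar>coord v (Ht k)\<bar> * \<bar>e k v\<bar> < \<bar>e k v\<bar>" using v(1) by auto
    qed
    finally show False using sum1[OF k] by simp
  qed
  obtain v s where v: "v \<in> S" "s \<in> {-1, 1}" "\<And>H. H \<in> a \<Longrightarrow> coord v H = s * e k H" using ex[OF k] by blast
  \<comment> \<open>Different indices select different frame elements, so all coordinates of
    \<open>v\<close> except the one for \<open>k\<close> vanish.\<close>
  have "e l v = (if l = k then s else 0)" if l: "l \<in> {1..r}" for l
  proof (cases "l = k")
    case True
    then show ?thesis using v(3)[OF frame_a[OF v(1)]] coord_frame[OF v(1,1)] v(2) by auto
  next
    case False
    obtain w u where w: "w \<in> S" "u \<in> {-1, 1}" "\<And>H. H \<in> a \<Longrightarrow> coord w H = u * e l H" using ex[OF l] by blast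
    have "w \<noteq> v"
    proof
      assume "w = v"
      then have "u * e l (Ht l) = s * e k (Ht l)" using v(3)[OF Ht_a[OF l]] w(3)[OF Ht_a[OF l]] by simp
      then show False using e_Ht[OF l l] e_Ht[OF k l] False w(2) by auto
    qed
    then have "u * e l v = 0" using w(3)[OF frame_a[OF v(1)]] coord_frame[OF w(1) v(1)] by simp
    then show ?thesis using w(2) False by auto
  qed
  then have "flat (\<lambda>l. e l v) = flat (\<lambda>l. if l = k then s else 0)" by (rule flat_eqI)
  then have "v = s *\<^sub>R Ht k" using a_flat[OF frame_a[OF v(1)]] flat_Ht[OF k] by simp
  then show ?thesis using v(1,2) by (intro bexI[of _ v]) auto
qed

end

end

context hermitian_algebra
begin

subsection \<open>The complex structure on the root spaces\<close>

abbreviation "Wt i \<equiv> (1 / 2) *\<^sub>R br (Ht i) (JJ (Ht i))"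

lemma e_eq: "k \<in> {1..r} \<Longrightarrow> H \<in> a \<Longrightarrow> e k H = ip H (Ht k) / ip (Ht k) (Ht k)"
  using ev_pos[of k] by (simp add: ev(2) Ht_eq form.form_simps form.sym[of H] field_simps)

lemma root_pair_cong: "root_pair \<mu> Y W \<Longrightarrow> (\<And>H. H \<in> a \<Longrightarrow> \<mu> H = \<nu> H) \<Longrightarrow> root_pair \<nu> Y W"
  by (simp add: root_pair_def)

lemma root_pairI:
  assumes "Y \<in> \<pp>" "W \<in> \<kk>" "\<And>k. k \<in> {1..r} \<Longrightarrow> br (Ht k) Y = m k *\<^sub>R W" "\<And>k. k \<in> {1..r} \<Longrightarrow> br (Ht k) W = m k *\<^sub>R Y"
  shows "root_pair (\<lambda>H. \<Sum>k=1..r. m k * e k H) Y W"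
proof -
  have "br H V = (\<Sum>k=1..r. e k H *\<^sub>R br (Ht k) V)" if "H \<in> a" for H V
  proof -
    have "br H V = br (flat (\<lambda>k. e k H)) V" by (simp add: a_flat[OF that])
    then show ?thesis by (simp add: flat_vector_def linear_sum[OF bracket_left] br_simps)
  qed
  then show ?thesis
    using assms by (simp add: root_pair_def scaleR_sum_left mult.commute)
qed

text \<open>The sign left open by \<open>Ht_frame\<close> is harmless: replacing \<open>v\<close> by
  its negative changes the sign of both the coordinate and \<open>JJ v\<close>, and leaves the
  bracket of the two vectors fixed.\<close>

lemma Ht_root_pair:
  assumes k: "k \<in> {1..r}" shows "root_pair (\<lambda>H. 2 * e k H) (JJ (Ht k)) (Wt k)"
proof -
  obtain S where S: "frame S" using frame_exists by blast
  obtain v where v: "v \<in> S" "Ht k = v \<or> Ht k = - v" using Ht_frame[OF S k] by blast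
  note rp = frame_root_pair[OF S v(1)]
  from v(2) show ?thesis
  proof
    assume "Ht k = v"
    then show ?thesis using rp by (intro root_pair_cong[OF rp[folded \<open>Ht k = v\<close>]]) (simp add: e_eq[OF k] coord_def[OF S])
  next
    assume "Ht k = - v"
    then have vH: "v = - Ht k" by simp
    have "root_pair (\<lambda>H. 2 * coord (- Ht k) H) (- JJ (Ht k)) (Wt k)"
      using rp unfolding vH by (simp add: br_simps)
    then have "root_pair (\<lambda>H. - (2 * e k H)) (- JJ (Ht k)) (Wt k)"
      by (rule root_pair_cong) (simp add: e_eq[OF k] coord_def[OF S] form.form_simps)
    then show ?thesis using subspace_neg[OF subspace_p, of "- JJ (Ht k)"] by (simp add: root_pair_def br_simps)
  qed
qed

lemma Wt_k: "k \<in> {1..r} \<Longrightarrow> Wt k \<in> \<kk>"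
  using Ht_root_pair root_pairD(2) by blast

lemma Ht_J_Ht: "k \<in> {1..r} \<Longrightarrow> H \<in> a \<Longrightarrow> br H (JJ (Ht k)) = (2 * e k H) *\<^sub>R Wt k"
  "k \<in> {1..r} \<Longrightarrow> H \<in> a \<Longrightarrow> br H (Wt k) = (2 * e k H) *\<^sub>R JJ (Ht k)"
  using root_pairD(3,4)[OF Ht_root_pair] by blast+

lemma J_flat: "JJ (flat x) = (\<Sum>k=1..r. x k *\<^sub>R JJ (Ht k))"
  by (simp add: flat_vector_def linear_sum[OF bracket_right] br_simps)

lemma br_flat_J_flat: "br (flat x) (JJ (flat x)) = (\<Sum>k=1..r. (2 * (x k)\<^sup>2) *\<^sub>R Wt k)"
  unfolding J_flat linear_sum[OF bracket_right] br_simps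
  by (intro sum.cong) (simp_all only: Ht_J_Ht(1)[OF _ flat_a] e_flat, simp_all add: power2_eq_square)

lemma flat_tripotent:
  assumes "\<And>k. k \<in> {1..r} \<Longrightarrow> s k \<in> {-1, 0, 1}" shows "tripotent (flat s)"
proof -
  have "br (br (flat s) (JJ (flat s))) (flat s) = (\<Sum>k=1..r. (2 * (s k)\<^sup>2) *\<^sub>R br (Wt k) (flat s))"
    by (simp only: br_flat_J_flat linear_sum[OF bracket_left] br_simps)
  also have "\<dots> = (\<Sum>k=1..r. - 4 *\<^sub>R (s k *\<^sub>R JJ (Ht k)))"
  proof (rule sum.cong)
    fix k assume k: "k \<in> {1..r}"
    have "br (Wt k) (flat s) = - ((2 * s k) *\<^sub>R JJ (Ht k))"
      using Ht_J_Ht(2)[OF k flat_a[of s]] e_flat[OF k, of s] br_anti[of "Wt k" "flat s"] by simp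
    then show "(2 * (s k)\<^sup>2) *\<^sub>R br (Wt k) (flat s) = - 4 *\<^sub>R (s k *\<^sub>R JJ (Ht k))"
      using assms[OF k] by auto
  qed simp
  also have "\<dots> = - 4 *\<^sub>R JJ (flat s)" by (simp only: J_flat scaleR_sum_right)
  finally show ?thesis by (simp add: tripotent_def flat_p)
qed

lemma root_pair_square: "root_pair \<mu> Y W \<Longrightarrow> H \<in> a \<Longrightarrow> br H (br H Y) = (\<mu> H)\<^sup>2 *\<^sub>R Y"
  using root_pairD(3,4)[of \<mu> Y W H] by (simp add: br_simps power2_eq_square)

text \<open>The Peirce rule for m = 4, where the partner eigenvalue is 0; the next lemma is the
  self-paired case m = 1.\<close>

lemma tripotent_root_2:
  assumes "root_pair \<mu> Y W" "\<And>k. k \<in> {1..r} \<Longrightarrow> s k \<in> {-1, 0, 1}" "(\<mu> (flat s))\<^sup>2 = 4"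
  shows "br (flat s) (JJ Y) = 0"
proof -
  have "br (flat s) (br (flat s) (JJ Y)) = 0"
    using tripotent_eigenvector(1)[OF flat_tripotent[of s, OF assms(2)] root_pairD(1)[OF assms(1)] root_pair_square[OF assms(1) flat_a]]
      assms(3) by simp
  then show ?thesis using ip_br_br_p[OF flat_p, of s "JJ Y"] form.eq_0_iff by simp
qed

lemma tripotent_root_1:
  assumes "root_pair \<mu> Y W" "\<And>k. k \<in> {1..r} \<Longrightarrow> s k \<in> {-1, 0, 1}" "(\<mu> (flat s))\<^sup>2 = 1"
  shows "br (flat s) (br (flat s) (JJ Y)) = JJ Y"
  using tripotent_eigenvector(1)[OF flat_tripotent[of s, OF assms(2)] root_pairD(1)[OF assms(1)] root_pair_square[OF assms(1) flat_a]]
      assms(3) by simp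

abbreviation "unit i s \<equiv> (\<lambda>k. if k = i then s else (0::real))"

lemma flat_two: "i \<in> {1..r} \<Longrightarrow> j \<in> {1..r} \<Longrightarrow> flat (\<lambda>k. unit i s k + unit j t k) = s *\<^sub>R Ht i + t *\<^sub>R Ht j"
  by (simp only: flat_linear flat_Ht)

text \<open>The root has the value 2 on the tripotent s Ht_i + t Ht_j, still 2 after adding any
  other Ht_k, and modulus 1 on Ht_i. The Peirce rule for these tripotents determines how all of
  \<open>a\<close> acts on \<open>JJ Y\<close>.\<close>

lemma J_sum_root:
  assumes st: "s \<in> {-1, 1}" "t \<in> {-1, 1}" and ij: "i \<in> {1..r}" "j \<in> {1..r}" "i \<noteq> j"
    and rp: "root_pair (\<lambda>X. s * e i X + t * e j X) Y W"
  shows "\<exists>W'. root_pair (\<lambda>X. s * e i X - t * e j X) (JJ Y) W'"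
proof -
  let ?X = "s *\<^sub>R Ht i + t *\<^sub>R Ht j"
  have Y: "JJ Y \<in> \<pp>" using root_pairD(1)[OF rp] J_p by blast
  have ev: "s * e i (flat x) + t * e j (flat x) = s * x i + t * x j" for x using e_flat ij by simp
  have "br (flat (\<lambda>k. unit i s k + unit j t k)) (JJ Y) = 0"
    using st ij by (intro tripotent_root_2[OF rp]; (unfold ev)?) auto
  then have 0: "br ?X (JJ Y) = 0" unfolding flat_two[OF ij(1,2)] .
  have k0: "br (Ht k) (JJ Y) = 0" if k: "k \<in> {1..r}" "k \<noteq> i" "k \<noteq> j" for k
  proof -
    have "flat (\<lambda>l. (unit i s l + unit j t l) + unit k 1 l) = ?X + Ht k"
      by (simp only: flat_linear flat_Ht ij k(1) scaleR_one)
    moreover have "br (flat (\<lambda>l. (unit i s l + unit j t l) + unit k 1 l)) (JJ Y) = 0"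
      using st ij k(2,3) by (intro tripotent_root_2[OF rp]; (unfold ev)?) auto
    ultimately show ?thesis using 0 by (simp add: br_simps)
  qed
  have "br (flat (unit i 1)) (br (flat (unit i 1)) (JJ Y)) = JJ Y"
    using st ij by (intro tripotent_root_1[OF rp]; (unfold ev)?) auto
  then have 1: "br (Ht i) (br (Ht i) (JJ Y)) = JJ Y" unfolding flat_Ht[OF ij(1)] scaleR_one .
  define W' where "W' = s *\<^sub>R br (Ht i) (JJ Y)"
  have ss: "s * s = 1" "t * t = 1" using st by auto
  have i: "br (Ht i) (JJ Y) = s *\<^sub>R W'" using ss by (simp add: W'_def)
  have "t *\<^sub>R (s *\<^sub>R br (Ht i) (JJ Y) + t *\<^sub>R br (Ht j) (JJ Y)) = 0" using 0 by (simp add: br_simps)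
  then have j: "br (Ht j) (JJ Y) = - t *\<^sub>R W'" using ss by (simp add: W'_def scaleR_add_right eq_neg_iff_add_eq_0 add.commute)
  have i': "br (Ht i) W' = s *\<^sub>R JJ Y" using 1 by (simp add: W'_def br_simps)
  have j': "br (Ht j) W' = - t *\<^sub>R JJ Y"
  proof -
    have "br (Ht j) W' = s *\<^sub>R br (Ht i) (br (Ht j) (JJ Y))"
      using a_commute[OF Ht_a[OF ij(2)] Ht_a[OF ij(1)], of "JJ Y"] by (simp add: W'_def br_simps)
    also have "\<dots> = (s * - t * s) *\<^sub>R JJ Y" by (simp add: j i' br_simps)
    also have "s * - t * s = - t" using st(1) by auto
    finally show ?thesis .
  qed
  have "root_pair (\<lambda>H. \<Sum>k=1..r. (unit i s k + unit j (- t) k) * e k H) (JJ Y) W'"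
  proof (rule root_pairI[OF Y])
    show "W' \<in> \<kk>" unfolding W'_def using Ht_p[OF ij(1)] Y by (intro subspace_scale[OF subspace_k] br_pp)
    fix k assume k: "k \<in> {1..r}"
    show "br (Ht k) (JJ Y) = (unit i s k + unit j (- t) k) *\<^sub>R W'" using i j k0[OF k] ij(3) by auto
    show "br (Ht k) W' = (unit i s k + unit j (- t) k) *\<^sub>R JJ Y"
      using i' j' k0[OF k] ij(3) a_commute[OF Ht_a[OF k] Ht_a[OF ij(1)], of "JJ Y"] by (auto simp: W'_def br_simps)
  qed
  moreover have "(\<Sum>k=1..r. (unit i s k + unit j (- t) k) * e k H) = s * e i H - t * e j H" for H
    using ij by (simp add: distrib_right sum.distrib if_distrib[of "\<lambda>c. c * _"] cong: if_cong)
  ultimately show ?thesis by auto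
qed

text \<open>The root has modulus 1 on Ht_i, and still after adding or subtracting another Ht_k;
  comparing the two signs shows that Ht_k annihilates \<open>JJ Y\<close>.\<close>

lemma J_short_root:
  assumes s: "s \<in> {-1, 1}" and i: "i \<in> {1..r}" and rp: "root_pair (\<lambda>X. s * e i X) Y W"
  shows "\<exists>W'. root_pair (\<lambda>X. s * e i X) (JJ Y) W'"
proof -
  have Y: "JJ Y \<in> \<pp>" using root_pairD(1)[OF rp] J_p by blast
  have ev: "s * e i (flat x) = s * x i" for x using e_flat i by simp
  have ss: "s * s = 1" using s by auto
  have "br (flat (unit i 1)) (br (flat (unit i 1)) (JJ Y)) = JJ Y"
    using s by (intro tripotent_root_1[OF rp]; (unfold ev)?) auto
  then have 1: "br (Ht i) (br (Ht i) (JJ Y)) = JJ Y" unfolding flat_Ht[OF i] scaleR_one .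
  have k0: "br (Ht k) (JJ Y) = 0" if k: "k \<in> {1..r}" "k \<noteq> i" for k
  proof -
    have 2: "br (1 *\<^sub>R Ht i + u *\<^sub>R Ht k) (br (1 *\<^sub>R Ht i + u *\<^sub>R Ht k) (JJ Y)) = JJ Y" if "u \<in> {-1, 1}" for u
      unfolding flat_two[OF i k(1), symmetric]
      using s k(2) that by (intro tripotent_root_1[OF rp]; (unfold ev)?) auto
    let ?P = "br (Ht k) (br (Ht k) (JJ Y))" and ?Q = "br (Ht k) (br (Ht i) (JJ Y))"
    have "?P + ?Q + ?Q = 0" "?P - ?Q - ?Q = 0"
      using 2[of 1] 2[of "-1"] 1 a_commute[OF Ht_a[OF i] Ht_a[OF k(1)], of "JJ Y"]
      by (simp_all add: br_simps algebra_simps)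
    moreover have "2 *\<^sub>R ?P = (?P + ?Q + ?Q) + (?P - ?Q - ?Q)" by (simp add: scaleR_2)
    ultimately have "2 *\<^sub>R ?P = 0" by simp
    then have "?P = 0" by simp
    then show ?thesis using ip_br_br_p[OF Ht_p[OF k(1)], of "JJ Y"] form.eq_0_iff by simp
  qed
  define W' where "W' = s *\<^sub>R br (Ht i) (JJ Y)"
  have "root_pair (\<lambda>H. \<Sum>k=1..r. unit i s k * e k H) (JJ Y) W'"
  proof (rule root_pairI[OF Y])
    show "W' \<in> \<kk>" unfolding W'_def using Ht_p[OF i] Y by (intro subspace_scale[OF subspace_k] br_pp)
    fix k assume k: "k \<in> {1..r}"
    show "br (Ht k) (JJ Y) = unit i s k *\<^sub>R W'" using k0[OF k] ss by (auto simp: W'_def)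
    show "br (Ht k) W' = unit i s k *\<^sub>R JJ Y"
      using 1 k0[OF k] a_commute[OF Ht_a[OF k] Ht_a[OF i], of "JJ Y"] by (auto simp: W'_def br_simps)
  qed
  moreover have "(\<Sum>k=1..r. unit i s k * e k H) = s * e i H" for H
    using i by (simp add: if_distrib[of "\<lambda>c. c * _"] cong: if_cong)
  ultimately show ?thesis by auto
qed

text \<open>The root has modulus 2 on Ht_i and on Ht_i + Ht_k, so all these tripotents annihilate
  \<open>JJ Y\<close>; it commutes with \<open>a\<close> and belongs to it by maximality.\<close>

lemma J_long_root:
  assumes s: "s \<in> {-1, 1}" and i: "i \<in> {1..r}" and rp: "root_pair (\<lambda>X. s * (2 * e i X)) Y W"
  shows "JJ Y \<in> a"
proof (rule a_centralizer)
  show "JJ Y \<in> \<pp>" using root_pairD(1)[OF rp] J_p by blast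
  have ev: "s * (2 * e i (flat x)) = 2 * s * x i" for x using e_flat i by simp
  have "br (flat (unit i 1)) (JJ Y) = 0"
    using s by (intro tripotent_root_2[OF rp]; (unfold ev)?) auto
  then have 0: "br (Ht i) (JJ Y) = 0" unfolding flat_Ht[OF i] scaleR_one .
  have k0: "br (Ht k) (JJ Y) = 0" if k: "k \<in> {1..r}" for k
  proof (cases "k = i")
    case False
    have "br (1 *\<^sub>R Ht i + 1 *\<^sub>R Ht k) (JJ Y) = 0"
      unfolding flat_two[OF i k, symmetric]
      using s False by (intro tripotent_root_2[OF rp]; (unfold ev)?) auto
    then show ?thesis using 0 by (simp add: br_simps)
  qed (use 0 in simp)
  fix H assume "H \<in> a"
  have "br H (JJ Y) = br (flat (\<lambda>k. e k H)) (JJ Y)" by (simp add: a_flat \<open>H \<in> a\<close>)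
  also have "\<dots> = 0" using k0 by (simp add: flat_vector_def linear_sum[OF bracket_left] br_simps)
  finally show "br H (JJ Y) = 0" .
qed

text \<open>By \<open>J_br_J\<close> the left side is the sum of the squared norms of [X, J Y] and
  [X, Y]. This is what makes \<open>cosh_op\<close> invertible.\<close>

lemma positive_square: "X \<in> \<pp> \<Longrightarrow> Y \<in> \<pp> \<Longrightarrow> ip (JJ (br (br X (JJ X)) Y)) Y \<ge> 0"
proof -
  assume X: "X \<in> \<pp>" and Y: "Y \<in> \<pp>"
  have "JJ (br (br X (JJ X)) Y) = - JJ (br X (br X (JJ Y))) + br X (br X Y)"
    using J_br_J[OF X Y] J_J[OF br_pk[OF X br_pp[OF X Y]]] by (simp add: br_simps)
  then have "ip (JJ (br (br X (JJ X)) Y)) Y = ip (br X (br X (JJ Y))) (JJ Y) + ip (br X (br X Y)) Y"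
    by (simp add: form.form_simps J_skew)
  also have "\<dots> \<ge> 0" using ip_br_br_p[OF X] form.nonneg by simp
  finally show ?thesis .
qed

end

section \<open>The flow of a fundamental field in a chart\<close>

context lie_action
begin

definition flow :: "('m, 'e) chart \<Rightarrow> 'g \<Rightarrow> real \<times> 'e \<Rightarrow> 'm" where
  "flow c W p = ex (fst p *\<^sub>R W) (cinv c (snd p))"

definition flow_dom :: "('m, 'e) chart \<Rightarrow> 'g \<Rightarrow> (real \<times> 'e) set" where
  "flow_dom c W = (UNIV \<times> snd c ` fst c) \<inter> flow c W -` fst c"

lemma flow_into:
  assumes "c \<in> A" shows "Ck_into A k (UNIV \<times> snd c ` fst c) (flow c W)"
proof -
  have o: "open (UNIV \<times> snd c ` fst c :: (real \<times> 'e) set)" using chart_open[OF assms] by (simp add: open_Times)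
  have "Ck_into A k (UNIV \<times> snd c ` fst c) (\<lambda>p :: real \<times> 'e. cinv c (snd p))"
    by (rule Ck_into_compose[OF o Ck_into_cinv[OF assms] Ck_on_linear[OF linear_snd]]) auto
  then show ?thesis unfolding flow_def[abs_def]
    by (intro Ck_into_ex o Ck_on_scaleR Ck_on_linear linear_fst Ck_on_const)
qed

lemma flow_dom_open: "c \<in> A \<Longrightarrow> open (flow_dom c W)"
  unfolding flow_dom_def
  by (rule Ck_into_open[OF _ flow_into]) (auto intro: open_Times chart_open)

lemma flow_Ck: "c \<in> A \<Longrightarrow> Ck_on k (flow_dom c W) (\<lambda>p. snd c (flow c W p))"
  using flow_into[of c k W] by (simp add: Ck_into_def flow_dom_def)

lemma flow_dom_0: "c \<in> A \<Longrightarrow> y \<in> snd c ` fst c \<Longrightarrow> (0, y) \<in> flow_dom c W"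
  by (auto simp: flow_dom_def flow_def)

lemma flow_has_derivative:
  "c \<in> A \<Longrightarrow> p \<in> flow_dom c W \<Longrightarrow>
   ((\<lambda>p. snd c (flow c W p)) has_derivative frechet_derivative (\<lambda>p. snd c (flow c W p)) (at p)) (at p)"
  by (rule Ck_on_SucD(1)[OF flow_Ck])

lemma flow_derivative:
  assumes "c \<in> A" "y \<in> snd c ` fst c"
  shows "fundamental ex c W (cinv c y) = frechet_derivative (\<lambda>p. snd c (flow c W p)) (at (0, y)) (1, 0)"
proof -
  have "((\<lambda>t. (t, y)) has_vector_derivative (1, 0)) (at 0)" by (auto intro!: derivative_eq_intros)
  from has_vector_derivative_compose[OF this flow_has_derivative[OF assms(1) flow_dom_0[OF assms], of W]]
  have "((\<lambda>t. snd c (ex (t *\<^sub>R W) (cinv c y))) has_vector_derivative frechet_derivative (\<lambda>p. snd c (flow c W p)) (at (0, y)) (1, 0)) (at 0)"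
    by (simp add: flow_def)
  then show ?thesis
    using fundamental_velocity[OF assms(1) cinv_in[OF assms], of W] by (auto simp: has_velocity_def intro: vector_derivative_unique_at)
qed

lemma fundamental_Ck:
  assumes "c \<in> A" shows "Ck_on k (snd c ` fst c) (\<lambda>y. fundamental ex c W (cinv c y))"
proof (rule Ck_on_cong[OF chart_open(2)[OF assms] flow_derivative[OF assms, symmetric]])
  show "Ck_on k (snd c ` fst c) (\<lambda>y. frechet_derivative (\<lambda>p. snd c (flow c W p)) (at (0, y)) (1, 0))"
    by (rule Ck_on_compose[where f = "\<lambda>p. frechet_derivative (\<lambda>p. snd c (flow c W p)) (at p) (1, 0)" and g = "\<lambda>y. (0, y)",
          OF chart_open(2)[OF assms] Ck_on_SucD(2)[OF flow_Ck[OF assms]]])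
       (use flow_dom_0[OF assms] in \<open>auto intro!: Ck_on_Pair Ck_on_id chart_open(2)[OF assms]\<close>)
qed

end

section \<open>Symmetric spaces of noncompact type\<close>

locale symmetric_space = lie_action A g ex br
  for A :: "('m::{t2_space,second_countable_topology}, 'e::euclidean_space) chart set"
    and g :: "('m, 'e) metric_tensor" and ex :: "'g::euclidean_space \<Rightarrow> 'm \<Rightarrow> 'm" and br +
  fixes J :: "('m, 'e) endo_tensor" and ob :: 'm and \<theta> :: "'g \<Rightarrow> 'g" and \<zeta> :: 'g
  assumes conn: "connected (UNIV :: 'm set)"
    and transitive: "\<exists>f\<in>isom0 A g. f ob = x"
    and noncompact: "noncompact_type_at ex br \<theta> ob"
    and kaehler: "standard_kaehler A g J ex br \<theta> \<zeta> ob"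
begin

sublocale cartan_algebra br \<theta>
  by (rule cartan_algebra.intro[OF bracket_linear_left bracket_linear_right bracket_self jacobi])
     (use noncompact in \<open>simp add: noncompact_type_at_def\<close>)

abbreviation "K \<equiv> stabilizer A g ob"

lemma K_G: "k \<in> K \<Longrightarrow> k \<in> G" and K_ob: "k \<in> K \<Longrightarrow> k ob = ob"
  by (auto simp: stabilizer_def)

lemma K_inv: "k \<in> K \<Longrightarrow> inv k \<in> K"
  using G_inv[of k] G_inv_apply(2)[of k ob] unfolding stabilizer_def by auto

lemma K_comp: "k \<in> K \<Longrightarrow> h \<in> K \<Longrightarrow> k \<circ> h \<in> K"
  using G_comp by (simp add: stabilizer_def)

lemma K_id: "id \<in> K"
  using G_id by (simp add: stabilizer_def)

lemma k_iff: "Z \<in> \<kk> \<longleftrightarrow> (\<forall>t. ex (t *\<^sub>R Z) ob = ob)"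
  using noncompact by (auto simp: noncompact_type_at_def isotropy_algebra_def)

lemma ex_k_K: "Z \<in> \<kk> \<Longrightarrow> ex Z \<in> K"
  using k_iff[of Z] ex_G[of Z] unfolding stabilizer_def by (auto dest: spec[of _ 1])

lemma Ad_K_k: "k \<in> K \<Longrightarrow> Z \<in> \<kk> \<Longrightarrow> Ad ex k Z \<in> \<kk>"
  unfolding k_iff using Ad_apply[OF K_G, of k _ Z ob] K_ob[of k] by simp

lemma Ad_K_p: assumes k: "k \<in> K" and X: "X \<in> \<pp>" shows "Ad ex k X \<in> \<pp>"
  unfolding pspace_iff_orthogonal
proof
  fix Z assume Z: "Z \<in> \<kk>"
  have "B (Ad ex k X) Z = B (Ad ex k X) (Ad ex k (Ad ex (inv k) Z))" using K_G[OF k] by simp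
  also have "\<dots> = B X (Ad ex (inv k) Z)" by (rule killing_form_Ad[OF K_G[OF k]])
  also have "\<dots> = 0" using X Ad_K_k[OF K_inv[OF k] Z] pspace_iff_orthogonal by blast
  finally show "B (Ad ex k X) Z = 0" .
qed

lemma Ad_theta: assumes k: "k \<in> K" shows "\<theta> (Ad ex k X) = Ad ex k (\<theta> X)"
proof -
  note l = Ad_linear[OF K_G[OF k]]
  have "X = k_part X + p_part X" by (simp add: parts)
  then have "\<theta> (Ad ex k X) = \<theta> (Ad ex k (k_part X)) + \<theta> (Ad ex k (p_part X))" by (metis linear_add[OF l] theta_simps(1))
  also have "\<dots> = Ad ex k (k_part X) - Ad ex k (p_part X)"
    using Ad_K_k[OF k k_part_in] Ad_K_p[OF k p_part_in] by (simp add: pspace_iff kspace_iff)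
  also have "\<dots> = Ad ex k (\<theta> (k_part X + p_part X))"
    using k_part_in p_part_in by (simp add: pspace_iff kspace_iff theta_simps linear_diff[OF l])
  finally show ?thesis by (simp add: parts)
qed

lemma Ad_K_ip: "k \<in> K \<Longrightarrow> ip (Ad ex k X) (Ad ex k Y) = ip X Y"
  using killing_form_Ad[OF K_G] Ad_theta by (simp add: cartan_ip_def)

lemma Ad_K_part: "k \<in> K \<Longrightarrow> p_part (Ad ex k X) = Ad ex k (p_part X)" "k \<in> K \<Longrightarrow> k_part (Ad ex k X) = Ad ex k (k_part X)"
  using Ad_linear[OF K_G, of k] Ad_theta[of k X] by (auto simp: p_part_def k_part_def linear_add linear_diff linear_scale)

lemma zeta_facts: "\<zeta> \<in> \<kk>" "Y \<in> \<kk> \<Longrightarrow> br \<zeta> Y = 0" "X \<in> \<pp> \<Longrightarrow> br \<zeta> (br \<zeta> X) = - X"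
  and G_J: "f \<in> G \<Longrightarrow> preserves_J A J f"
  using kaehler unfolding standard_kaehler_def Let_def by blast+

lemma fundamental_bij: "c \<in> A \<Longrightarrow> ob \<in> fst c \<Longrightarrow> bij_betw (\<lambda>X. fundamental ex c X ob) \<pp> UNIV"
  and fundamental_J: "c \<in> A \<Longrightarrow> ob \<in> fst c \<Longrightarrow> X \<in> \<pp> \<Longrightarrow> J c ob (fundamental ex c X ob) = fundamental ex c (br \<zeta> X) ob"
  and fundamental_g: "c \<in> A \<Longrightarrow> ob \<in> fst c \<Longrightarrow> X \<in> \<pp> \<Longrightarrow> Y \<in> \<pp> \<Longrightarrow>
        g c ob (fundamental ex c X ob) (fundamental ex c Y ob) = ip X Y"
  using kaehler unfolding standard_kaehler_def Let_def by blast+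

lemma fundamental_k: assumes "c \<in> A" "ob \<in> fst c" "Z \<in> \<kk>" shows "fundamental ex c Z ob = 0"
proof -
  have "(\<lambda>t. ex (t *\<^sub>R Z) ob) = (\<lambda>_. ob)" using assms(3) k_iff by auto
  then show ?thesis using fundamental_velocity[OF assms(1,2), of Z]
    by (simp add: has_velocity_def) (metis has_vector_derivative_const vector_derivative_unique_at)
qed

lemma fundamental_p_part: "c \<in> A \<Longrightarrow> ob \<in> fst c \<Longrightarrow> fundamental ex c X ob = fundamental ex c (p_part X) ob"
  using linear_add[OF fundamental_linear, of c ob "k_part X" "p_part X"] fundamental_k[OF _ _ k_part_in] by (simp add: parts)

lemma fundamental_inj: "c \<in> A \<Longrightarrow> ob \<in> fst c \<Longrightarrow> X \<in> \<pp> \<Longrightarrow> Y \<in> \<pp> \<Longrightarrow> fundamental ex c X ob = fundamental ex c Y ob \<Longrightarrow> X = Y"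
  using fundamental_bij[of c] by (auto simp: bij_betw_def dest: inj_onD)

text \<open>Invariance of the complex structure of the manifold under \<open>k\<close>, read at the
  base point, where \<open>\<pp>\<close> is identified with the tangent space.\<close>

lemma Ad_K_J:
  assumes k: "k \<in> K" and X: "X \<in> \<pp>" shows "Ad ex k (br \<zeta> X) = br \<zeta> (Ad ex k X)"
proof -
  obtain c where c: "c \<in> A" "ob \<in> fst c" by (rule chart_at)
  have kob: "k ob = ob" by (rule K_ob[OF k])
  have kc: "k ob \<in> fst c" using c kob by simp
  note F = fundamental_Ad[OF K_G[OF k] c(1,1,2) kc]
  have "fundamental ex c (Ad ex k (br \<zeta> X)) ob = chart_deriv c (snd c \<circ> k) ob (J c ob (fundamental ex c X ob))"
    using F[of "br \<zeta> X"] fundamental_J[OF c X] kob by simp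
  also have "\<dots> = J c ob (chart_deriv c (snd c \<circ> k) ob (fundamental ex c X ob))"
    using G_J[OF K_G[OF k]] c kc kob unfolding preserves_J_def by simp
  also have "\<dots> = fundamental ex c (br \<zeta> (Ad ex k X)) ob"
    using F[of X] fundamental_J[OF c Ad_K_p[OF k X]] kob by simp
  finally show ?thesis
    by (rule fundamental_inj[OF c Ad_K_p[OF k br_kp[OF zeta_facts(1) X]] br_kp[OF zeta_facts(1) Ad_K_p[OF k X]]])
qed

text \<open>The two elements have the same brackets with \<open>\<pp>\<close> by
  \<open>Ad_K_J\<close> and with \<open>\<kk>\<close> by centrality, and the center of the whole Lie
  algebra is trivial.\<close>

lemma Ad_K_zeta: assumes k: "k \<in> K" shows "Ad ex k \<zeta> = \<zeta>"
proof -
  have eq: "br (Ad ex k \<zeta>) Y = br \<zeta> Y" for Y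
  proof -
    have *: "br (Ad ex k \<zeta>) V = Ad ex k (br \<zeta> (Ad ex (inv k) V))" for V
      using bracket_Ad[OF K_G[OF k], of \<zeta> "Ad ex (inv k) V"] Ad_inv(1)[OF K_G[OF k], of V] by metis
    have p: "br (Ad ex k \<zeta>) X = br \<zeta> X" if "X \<in> \<pp>" for X
      unfolding * Ad_K_J[OF k Ad_K_p[OF K_inv[OF k] that]] Ad_inv(1)[OF K_G[OF k]] by (rule refl)
    have z: "br (Ad ex k \<zeta>) Z = br \<zeta> Z" if "Z \<in> \<kk>" for Z
      unfolding * zeta_facts(2)[OF Ad_K_k[OF K_inv[OF k] that]] zeta_facts(2)[OF that] by (rule linear_0[OF Ad_linear[OF K_G[OF k]]])
    have "br (Ad ex k \<zeta>) (k_part Y + p_part Y) = br \<zeta> (k_part Y + p_part Y)"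
      by (simp only: br_simps p[OF p_part_in] z[OF k_part_in])
    then show ?thesis unfolding parts .
  qed
  have "Ad ex k \<zeta> - \<zeta> = 0" by (rule center_trivial) (simp add: br_simps eq)
  then show ?thesis by simp
qed

lemma ex_Ad_K: "k \<in> K \<Longrightarrow> ex (Ad ex k X) ob = k (ex X ob)"
  using Ad_apply1[OF K_G, of k X ob] K_ob[of k] by simp

lemma br_Ad_ex: "br X (Ad ex (ex (t *\<^sub>R X)) Y) = Ad ex (ex (t *\<^sub>R X)) (br X Y)"
  using bracket_Ad[OF ex_G, of "t *\<^sub>R X" X Y] by (simp add: Ad_ex_self)

lemma ip_bounded_bilinear: "bounded_bilinear ip"
  using form.bilin by (simp add: bilinear_conv_bounded_bilinear)

text \<open>Since \<open>br X\<close> is symmetric, the pairing of Ad(exp(tX)) Y with Ad(exp(-tX)) U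
  does not depend on t.\<close>

lemma Ad_ex_symmetric: assumes X: "X \<in> \<pp>" shows "ip (Ad ex (ex X) Y) V = ip Y (Ad ex (ex X) V)"
proof -
  let ?A = "\<lambda>t. Ad ex (ex (t *\<^sub>R X))" and ?B = "\<lambda>t. Ad ex (ex (t *\<^sub>R - X))"
  have "((\<lambda>t. ip (?A t Y) (?B t U)) has_vector_derivative 0) (at t)" for U t
  proof -
    have "((\<lambda>t. ip (?A t Y) (?B t U)) has_vector_derivative ip (?A t Y) (?B t (br (- X) U)) + ip (?A t (br X Y)) (?B t U)) (at t)"
      by (rule bounded_bilinear.has_vector_derivative[OF ip_bounded_bilinear Ad_derivative Ad_derivative])
    moreover have "?B t (br (- X) U) = - br X (?B t U)" using br_Ad_ex[of "- X" t U] by (simp add: br_simps)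
    moreover have "?A t (br X Y) = br X (?A t Y)" by (rule br_Ad_ex[symmetric])
    ultimately show ?thesis by (simp add: form.form_simps ip_br_p[OF X])
  qed
  from zero_vector_derivative_constant[OF this, where t = 1 and s = 0, of "?A 1 V"]
  have "ip (Ad ex (ex X) Y) (Ad ex (ex (- X)) (Ad ex (ex X) V)) = ip Y (Ad ex (ex X) V)"
    by (simp add: ex_0[abs_def] flip: id_def)
  then show ?thesis by simp
qed

text \<open>The operator is the square of the symmetric injective operator belonging to half of
  \<open>X\<close>.\<close>

lemma Ad_ex_positive: assumes X: "X \<in> \<pp>" "Y \<noteq> 0" shows "ip (Ad ex (ex X) Y) Y > 0"
proof -
  let ?h = "Ad ex (ex ((1 / 2) *\<^sub>R X))"
  have "Ad ex (ex X) Y = ?h (?h Y)" using Ad_ex_add[of "1/2" X "1/2" Y] by simp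
  then have "ip (Ad ex (ex X) Y) Y = ip (?h Y) (?h Y)"
    using Ad_ex_symmetric[OF subspace_scale[OF subspace_p X(1)]] by simp
  moreover have "?h Y \<noteq> 0" using X(2) Ad_inv(2)[OF ex_G, of "(1/2) *\<^sub>R X" Y] linear_0[OF Ad_linear[OF G_inv[OF ex_G]]] by metis
  ultimately show ?thesis using ip_pos by simp
qed

text \<open>Uniqueness of the logarithm of a positive operator: eigenvectors of \<open>br X\<close>
  and \<open>br Y\<close> with different eigenvalues are orthogonal, because the exponentials of the
  eigenvalues differ. So ad(X) = ad(Y), and the center is trivial.\<close>

lemma Ad_ex_inj:
  assumes X: "X \<in> \<pp>" "Y \<in> \<pp>" and eq: "\<And>V. Ad ex (ex X) V = Ad ex (ex Y) V" shows "X = Y"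
proof -
  have fam: "form.commuting_family UNIV {br Z}" if "Z \<in> \<pp>" for Z
    using that by (simp add: form.commuting_family_def bracket_linear_right ip_br_p)
  obtain S where S: "span S = UNIV" "\<forall>b\<in>S. \<forall>T\<in>{br X}. \<exists>l. T b = l *\<^sub>R b"
    using form.joint_eigenbasis[OF subspace_UNIV fam[OF X(1)]] by blast
  obtain S' where S': "span S' = UNIV" "\<forall>b\<in>S'. \<forall>T\<in>{br Y}. \<exists>l. T b = l *\<^sub>R b"
    using form.joint_eigenbasis[OF subspace_UNIV fam[OF X(2)]] by blast
  have *: "br Y E = br X E" if E: "E \<in> S" for E
  proof -
    obtain l where l: "br X E = l *\<^sub>R E" using S(2) E by auto
    have "br Y E - l *\<^sub>R E = 0"
    proof (rule form.orthogonal_span_eq_0)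
      show "br Y E - l *\<^sub>R E \<in> span S'" by (simp add: S')
      fix b assume "b \<in> S'"
      then obtain m where m: "br Y b = m *\<^sub>R b" using S'(2) by auto
      have "exp l * ip E b = ip (Ad ex (ex X) E) b" using Ad_eigenvector[OF l, of 1] by (simp add: form.form_simps)
      also have "\<dots> = ip E (Ad ex (ex Y) b)" using eq[of E] Ad_ex_symmetric[OF X(2)] by simp
      also have "\<dots> = exp m * ip E b" using Ad_eigenvector[OF m, of 1] by (simp add: form.form_simps)
      finally have "l = m \<or> ip E b = 0" by auto
      then show "ip (br Y E - l *\<^sub>R E) b = 0" using m by (auto simp: form.form_simps ip_br_p[OF X(2)])
    qed
    then show ?thesis using l by simp
  qed
  have ad: "br Y V = br X V" for V
    by (rule linear_eq_on_span[where B = S, OF bracket_linear_right bracket_linear_right *]) (simp_all add: S(1))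
  have "X - Y = 0" by (rule center_trivial) (simp add: br_simps ad)
  then show ?thesis by simp
qed

text \<open>Uniqueness in the polar decomposition. Equal images give Ad(exp Y) = Ad(exp X) Ad(k)
  with k in the isotropy group; taking adjoints gives Ad(exp Y) = Ad(k^-1) Ad(exp X), so the squares
  of Ad(exp X) and Ad(exp Y) agree.\<close>

lemma Exp_inj:
  assumes X: "X \<in> \<pp>" "Y \<in> \<pp>" and eq: "ex X ob = ex Y ob" shows "X = Y"
proof -
  define k where "k = ex (- X) \<circ> ex Y"
  have kG: "k \<in> G" using G_comp ex_G by (simp add: k_def)
  have k: "k \<in> K" using kG eq[symmetric] by (simp add: stabilizer_def k_def)
  have Yk: "ex Y = ex X \<circ> k" by (auto simp: k_def)
  have AY: "Ad ex (ex Y) V = Ad ex (ex X) (Ad ex k V)" for V unfolding Yk by (rule Ad_comp[OF ex_G kG])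
  have AY': "Ad ex (ex Y) V = Ad ex (inv k) (Ad ex (ex X) V)" for V
  proof -
    let ?d = "Ad ex (ex Y) V - Ad ex (inv k) (Ad ex (ex X) V)"
    have "ip (Ad ex (ex Y) V) U = ip (Ad ex (inv k) (Ad ex (ex X) V)) U" for U
    proof -
      have "ip (Ad ex (ex Y) V) U = ip V (Ad ex (ex X) (Ad ex k U))" using Ad_ex_symmetric[OF X(2)] AY by simp
      also have "\<dots> = ip (Ad ex (ex X) V) (Ad ex k U)" using Ad_ex_symmetric[OF X(1)] by simp
      also have "\<dots> = ip (Ad ex (inv k) (Ad ex (ex X) V)) U"
        using Ad_K_ip[OF K_inv[OF k], of "Ad ex (ex X) V" "Ad ex k U"] kG by simp
      finally show ?thesis .
    qed
    then have "ip ?d ?d = 0" by (simp add: form.form_simps)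
    then show ?thesis by (simp add: form.eq_0_iff)
  qed
  have "Ad ex (ex (2 *\<^sub>R X)) V = Ad ex (ex (2 *\<^sub>R Y)) V" for V
  proof -
    have "Ad ex (ex (2 *\<^sub>R Y)) V = Ad ex (ex Y) (Ad ex (ex Y) V)" using Ad_ex_add[of 1 Y 1 V] by simp
    also have "\<dots> = Ad ex (ex X) (Ad ex k (Ad ex (ex Y) V))" by (rule AY)
    also have "Ad ex (ex Y) V = Ad ex (inv k) (Ad ex (ex X) V)" by (rule AY')
    also have "Ad ex k (Ad ex (inv k) (Ad ex (ex X) V)) = Ad ex (ex X) V" by (rule Ad_inv(1)[OF kG])
    also have "Ad ex (ex X) (Ad ex (ex X) V) = Ad ex (ex (2 *\<^sub>R X)) V" using Ad_ex_add[of 1 X 1 V] by simp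
    finally show ?thesis by simp
  qed
  then have "2 *\<^sub>R X = 2 *\<^sub>R Y"
    by (intro Ad_ex_inj[OF subspace_scale[OF subspace_p X(1)] subspace_scale[OF subspace_p X(2)]])
  then show ?thesis by simp
qed

end

context symmetric_space
begin

subsection \<open>The exponential map is a diffeomorphism\<close>

definition c0 :: "('m, 'e) chart" where "c0 = (SOME c. c \<in> A \<and> ob \<in> fst c)"

lemma c0: "c0 \<in> A" "ob \<in> fst c0"
  using someI_ex[of "\<lambda>c. c \<in> A \<and> ob \<in> fst c"] chart_at[of ob] unfolding c0_def by blast+

text \<open>With \<open>lift\<close> it identifies \<open>\<pp>\<close> with the model space of the
  charts. This replaces a subspace, on which \<open>Ck_on\<close> is of no use, by a full Euclidean
  space of the dimension of the manifold.\<close>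

definition tang :: "'g \<Rightarrow> 'e" where "tang X = fundamental ex c0 X ob"
definition lift :: "'e \<Rightarrow> 'g" where "lift = inv_into \<pp> tang"

lemma tang_linear: "linear tang"
  using fundamental_linear[OF c0] by (simp add: tang_def[abs_def])

lemma tang_bij: "bij_betw tang \<pp> UNIV"
  using fundamental_bij[OF c0] by (simp add: tang_def[abs_def])

lemma lift_p: "lift u \<in> \<pp>" and tang_lift [simp]: "tang (lift u) = u"
  using tang_bij by (auto simp: lift_def bij_betw_def intro: inv_into_into f_inv_into_f)

lemma lift_tang_p: "X \<in> \<pp> \<Longrightarrow> lift (tang X) = X"
  using tang_bij by (auto simp: lift_def bij_betw_def)

lemma lift_tang: "lift (tang X) = p_part X"
  using fundamental_p_part[OF c0, of X] lift_tang_p[OF p_part_in, of X] by (simp add: tang_def)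

lemma lift_linear: "linear lift"
proof (rule linearI)
  show "lift (u + v) = lift u + lift v" for u v
    using lift_tang_p[OF subspace_add[OF subspace_p lift_p lift_p], of u v] by (simp add: linear_add[OF tang_linear])
  show "lift (t *\<^sub>R u) = t *\<^sub>R lift u" for t u
    using lift_tang_p[OF subspace_scale[OF subspace_p lift_p], of t u] by (simp add: linear_scale[OF tang_linear])
qed

lemma ip_p_part: "Y \<in> \<pp> \<Longrightarrow> ip (p_part X) Y = ip X Y"
  using ip_kp[OF k_part_in, of Y X] parts[of X] form.form_simps(2)[of "k_part X" "p_part X" Y] by simp

lemma exp_derivative:
  assumes c: "c \<in> A" "ex X ob \<in> fst c"
  shows "((\<lambda>Y. snd c (ex Y ob)) has_derivative frechet_derivative (\<lambda>Y. snd c (ex Y ob)) (at X)) (at X)"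
proof -
  have "Ck_into A (Suc 0) UNIV (\<lambda>Y. ex Y ob)" by (intro Ck_into_ex open_UNIV Ck_into_const Ck_on_id)
  then have "Ck_on (Suc 0) (UNIV \<inter> (\<lambda>Y. ex Y ob) -` fst c) (\<lambda>Y. snd c (ex Y ob))" using c by (simp add: Ck_into_def)
  then show ?thesis by (rule Ck_on_SucD(1)) (use c in simp)
qed

text \<open>If the differential at \<open>X\<close> killed a nonzero \<open>Y\<close>, a real
  function of the time t in [0, 1] would vanish at both ends while its derivative, the inner product
  of Ad(exp(-tX)) Y with Y, is positive throughout.\<close>

lemma exp_derivative_inj:
  assumes X: "X \<in> \<pp>" and Y: "Y \<in> \<pp>" and c: "c \<in> A" "ex X ob \<in> fst c"
    and 0: "frechet_derivative (\<lambda>Y. snd c (ex Y ob)) (at X) Y = 0"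
  shows "Y = 0"
proof (rule ccontr)
  assume "Y \<noteq> 0"
  \<comment> \<open>The variation exp(-tX) exp(t(X + sY)) o rests at the base point for s = 0. Its
    t-derivative is s times a fundamental field, so exchanging the order of differentiation gives
    the t-derivative of its s-derivative along s = 0.\<close>
  define h where "h p = ex (fst p *\<^sub>R - X) (ex (fst p *\<^sub>R (X + snd p *\<^sub>R Y)) ob)" for p :: "real \<times> real"
  define \<psi> where "\<psi> p = snd c0 (h p)" for p
  have h0: "h (t, 0) = ob" for t by (simp add: h_def)
  have into: "Ck_into A k UNIV h" for k
    unfolding h_def by (intro Ck_into_ex open_UNIV Ck_into_const Ck_on_scaleR Ck_on_add Ck_on_linear linear_fst linear_snd Ck_on_const)
  define W where "W = UNIV \<inter> h -` fst c0"
  have W: "open W" unfolding W_def by (rule Ck_into_open[OF open_UNIV into c0(1)])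
  have W0: "(t, 0) \<in> W" for t using c0 by (simp add: W_def h0)
  have C: "Ck_on k W \<psi>" for k using into[of k] c0 by (simp add: Ck_into_def W_def \<psi>_def[abs_def])
  let ?D = "\<lambda>v p. frechet_derivative \<psi> (at p) v"
  have d\<psi>: "(\<psi> has_derivative frechet_derivative \<psi> (at p)) (at p)" if "p \<in> W" for p by (rule Ck_on_SucD(1)[OF C that])
  have CD: "Ck_on k W (?D v)" for k v by (rule Ck_on_SucD(2)[OF C])
  have dD: "(?D v has_derivative frechet_derivative (?D v) (at p)) (at p)" if "p \<in> W" for v p by (rule Ck_on_SucD(1)[OF CD that])
  let ?A = "\<lambda>t. Ad ex (ex (t *\<^sub>R - X))"
  have 1: "?D (1, 0) (t, s) = s *\<^sub>R fundamental ex c0 (?A t Y) (h (t, s))" if ts: "(t, s) \<in> W" for t s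
  proof -
    let ?Z = "X + s *\<^sub>R Y" let ?x = "ex (t *\<^sub>R ?Z) ob" let ?f = "ex (t *\<^sub>R - X)"
    have fx: "?f ?x = h (t, s)" by (simp add: h_def)
    obtain d where d: "d \<in> A" "?x \<in> fst d" by (rule chart_at)
    have fxc: "?f ?x \<in> fst c0" using ts unfolding fx by (simp add: W_def)
    have "has_velocity d (\<lambda>\<delta>. ex (\<delta> *\<^sub>R - X) (ex (\<delta> *\<^sub>R ?Z) ?x)) 0 (fundamental ex d (- X + ?Z) ?x)"
      by (rule ex_product_velocity[OF d])
    from has_velocity_self[OF this d(1) G_smooth[OF ex_G[of "t *\<^sub>R - X"]] c0(1)]
    have "has_velocity c0 (\<lambda>\<delta>. ?f (ex (\<delta> *\<^sub>R - X) (ex (\<delta> *\<^sub>R ?Z) ?x))) 0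
        (chart_deriv d (snd c0 \<circ> ?f) ?x (s *\<^sub>R fundamental ex d Y ?x))"
      using fxc by (simp add: linear_scale[OF fundamental_linear[OF d]])
    moreover have "chart_deriv d (snd c0 \<circ> ?f) ?x (s *\<^sub>R fundamental ex d Y ?x) = s *\<^sub>R fundamental ex c0 (?A t Y) (?f ?x)"
      using fundamental_Ad[OF ex_G d(1) c0(1) d(2) fxc, of Y] linear_scale[OF chart_deriv_G_linear[OF ex_G d(1) c0(1) d(2) fxc]] by simp
    moreover have "?f (ex (\<delta> *\<^sub>R - X) (ex (\<delta> *\<^sub>R ?Z) ?x)) = h (t + \<delta>, s)" for \<delta>
      unfolding h_def using ex_add[of t "- X" \<delta>] ex_add[of \<delta> ?Z t ob] by (simp add: add.commute)
    ultimately have "((\<lambda>\<delta>. \<psi> (t + \<delta>, s)) has_vector_derivative s *\<^sub>R fundamental ex c0 (?A t Y) (h (t, s))) (at 0)"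
      unfolding fx by (simp add: has_velocity_def \<psi>_def)
    moreover have "((\<lambda>\<delta>. (t + \<delta>, s)) has_vector_derivative (1, 0)) (at 0)" by (auto intro!: derivative_eq_intros)
    then have "((\<lambda>\<delta>. \<psi> (t + \<delta>, s)) has_vector_derivative ?D (1, 0) (t, s)) (at 0)"
      by (rule has_vector_derivative_compose) (use d\<psi>[OF ts] in simp)
    ultimately show ?thesis using vector_derivative_unique_at by blast
  qed
  have V: "((\<lambda>t. ?D (0, 1) (t, 0)) has_vector_derivative tang (?A t Y)) (at t)" for t
  proof -
    have "((\<lambda>t. (t, 0)) has_vector_derivative (1, 0)) (at t)" by (auto intro!: derivative_eq_intros)
    from has_vector_derivative_compose[OF this dD[OF W0]]
    have "((\<lambda>t. ?D (0, 1) (t, 0)) has_vector_derivative frechet_derivative (?D (0, 1)) (at (t, 0)) (1, 0)) (at t)" .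
    moreover have "frechet_derivative (?D (0, 1)) (at (t, 0)) (1, 0) = frechet_derivative (?D (1, 0)) (at (t, 0)) (0, 1)"
      by (rule second_derivative_symmetric[OF W C W0])
    moreover have "frechet_derivative (?D (1, 0)) (at (t, 0)) (0, 1) = tang (?A t Y)"
    proof -
      have l: "((\<lambda>s. (t, s)) has_vector_derivative (0, 1)) (at 0)" by (auto intro!: derivative_eq_intros)
      from has_vector_derivative_compose[OF l dD[OF W0]]
      have a: "((\<lambda>s. ?D (1, 0) (t, s)) has_vector_derivative frechet_derivative (?D (1, 0)) (at (t, 0)) (0, 1)) (at 0)" .
      let ?F = "\<lambda>y. fundamental ex c0 (?A t Y) (cinv c0 y)"
      have "(?F has_derivative frechet_derivative ?F (at (\<psi> (t, 0)))) (at (\<psi> (t, 0)))"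
        by (rule Ck_on_SucD(1)[OF fundamental_Ck[OF c0(1)]]) (use c0 in \<open>simp add: \<psi>_def h0\<close>)
      from has_vector_derivative_compose[OF has_vector_derivative_compose[OF l d\<psi>[OF W0]] this]
      have "((\<lambda>s. ?F (\<psi> (t, s))) has_vector_derivative frechet_derivative ?F (at (\<psi> (t, 0))) (?D (0, 1) (t, 0))) (at 0)" .
      from has_vector_derivative_scaleR[of "\<lambda>s. s" 1, OF _ this]
      have "((\<lambda>s. s *\<^sub>R ?F (\<psi> (t, s))) has_vector_derivative ?F (\<psi> (t, 0))) (at 0)"
        by (simp add: DERIV_ident)
      moreover have "open ((\<lambda>s. (t, s)) -` W)" by (rule open_vimage[OF W]) (intro continuous_intros)
      then have "\<forall>\<^sub>F s in at 0. s \<in> (\<lambda>s. (t, s)) -` W" using W0 by (intro eventually_at_in_open') auto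
      then have "\<forall>\<^sub>F s in at 0. s *\<^sub>R ?F (\<psi> (t, s)) = ?D (1, 0) (t, s)"
        by (rule eventually_mono) (use 1 c0 in \<open>auto simp: W_def \<psi>_def\<close>)
      ultimately have "((\<lambda>s. ?D (1, 0) (t, s)) has_vector_derivative ?F (\<psi> (t, 0))) (at 0)"
        by (rule has_vector_derivative_transform_eventually) (use 1[OF W0] in simp)
      then show ?thesis using vector_derivative_unique_at[OF a] c0 by (simp add: \<psi>_def h0 tang_def)
    qed
    ultimately show ?thesis by simp
  qed
  \<comment> \<open>It vanishes at time 0 because \<open>h (0, s)\<close> does not depend on
    \<open>s\<close>, and at time 1 because of the assumption on the differential of the exponential
    map.\<close>
  define \<phi> where "\<phi> t = ip (lift (?D (0, 1) (t, 0))) Y" for t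
  have "linear (\<lambda>v. ip (lift v) Y)" using linear_compose[OF lift_linear form.lin(2)] by (simp add: comp_def)
  then have bl: "bounded_linear (\<lambda>v. ip (lift v) Y)" by (simp add: linear_conv_bounded_linear)
  have d\<phi>: "(\<phi> has_real_derivative ip (?A t Y) Y) (at t)" for t
    using bounded_linear.has_vector_derivative[OF bl V[of t]]
    by (simp add: has_real_derivative_iff_has_vector_derivative \<phi>_def[abs_def] lift_tang ip_p_part[OF Y])
  have pos: "ip (?A t Y) Y > 0" for t
    by (rule Ad_ex_positive[OF subspace_scale[OF subspace_p subspace_neg[OF subspace_p X]] \<open>Y \<noteq> 0\<close>])
  have "\<phi> 0 < \<phi> 1" by (rule DERIV_pos_imp_increasing[OF zero_less_one]) (use d\<phi> pos in blast)
  have s1: "((\<lambda>s. (u, s)) has_vector_derivative (0, 1)) (at 0)" for u :: real by (auto intro!: derivative_eq_intros)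
  have "((\<lambda>s. \<psi> (0, s)) has_vector_derivative ?D (0, 1) (0, 0)) (at 0)"
    by (rule has_vector_derivative_compose[OF s1 d\<psi>[OF W0]])
  moreover have "((\<lambda>s. \<psi> (0, s)) has_vector_derivative 0) (at 0)" by (simp add: \<psi>_def h_def)
  ultimately have "?D (0, 1) (0, 0) = 0" using vector_derivative_unique_at by blast
  then have "\<phi> 0 = 0" by (simp add: \<phi>_def linear_0[OF lift_linear])
  have "((\<lambda>s. X + s *\<^sub>R Y) has_vector_derivative Y) (at 0)" by (auto intro!: derivative_eq_intros)
  from has_vector_derivative_compose[OF this, of "\<lambda>Y. snd c (ex Y ob)" "frechet_derivative (\<lambda>Y. snd c (ex Y ob)) (at X)"]
  have "((\<lambda>s. snd c (ex (X + s *\<^sub>R Y) ob)) has_vector_derivative 0) (at 0)"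
    using exp_derivative[OF c] 0 by simp
  moreover have "Ck_into A 0 UNIV (\<lambda>s. ex (X + s *\<^sub>R Y) ob)"
    by (intro Ck_into_ex open_UNIV Ck_into_const Ck_on_add Ck_on_scaleR Ck_on_id Ck_on_const)
  ultimately have "has_velocity c (\<lambda>s. ex (X + s *\<^sub>R Y) ob) 0 0"
    using c by (simp add: has_velocity_def Ck_into_def continuous_on_eq_continuous_at)
  from has_velocity_self[OF this c(1) G_smooth[OF ex_G[of "- X"]] c0(1)]
  have "has_velocity c0 (\<lambda>s. h (1, s)) 0 (chart_deriv c (snd c0 \<circ> ex (- X)) (ex X ob) 0)"
    using c0 by (simp add: h_def)
  moreover have "chart_deriv c (snd c0 \<circ> ex (- X)) (ex X ob) 0 = 0"
    by (rule linear_0[OF chart_deriv_G_linear[OF ex_G c(1) c0(1) c(2)]]) (use c0 in simp)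
  ultimately have "((\<lambda>s. \<psi> (1, s)) has_vector_derivative 0) (at 0)" by (simp add: has_velocity_def \<psi>_def)
  moreover have "((\<lambda>s. \<psi> (1, s)) has_vector_derivative ?D (0, 1) (1, 0)) (at 0)"
    by (rule has_vector_derivative_compose[OF s1 d\<psi>[OF W0]])
  ultimately have "?D (0, 1) (1, 0) = 0" using vector_derivative_unique_at by blast
  then have "\<phi> 1 = 0" by (simp add: \<phi>_def linear_0[OF lift_linear])
  then show False using \<open>\<phi> 0 < \<phi> 1\<close> \<open>\<phi> 0 = 0\<close> by simp
qed

definition Ex :: "'e \<Rightarrow> 'm" where "Ex u = ex (lift u) ob"

lemma Ex_into: "Ck_into A k UNIV Ex"
  unfolding Ex_def[abs_def] by (intro Ck_into_ex open_UNIV Ck_into_const Ck_on_linear lift_linear)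

lemma Ex_inj: "inj Ex"
  unfolding Ex_def[abs_def] by (rule injI) (metis Exp_inj lift_p tang_lift)

lemma Ex_chart:
  assumes c: "c \<in> A" and S: "open S"
  defines "U \<equiv> S \<inter> Ex -` fst c"
  shows "open ((\<lambda>u. snd c (Ex u)) ` U)" "Ck_on k ((\<lambda>u. snd c (Ex u)) ` U) (\<lambda>y. inv Ex (cinv c y))"
proof -
  let ?f = "\<lambda>u. snd c (Ex u)"
  have U: "open U" unfolding U_def by (rule Ck_into_open[OF S Ck_into_subset[OF Ex_into] c]) simp
  have C: "Ck_on k U ?f" for k using Ck_into_subset[OF Ex_into[of k], of S] c by (simp add: Ck_into_def U_def)
  have inv: "inv Ex (cinv c (?f u)) = u" if "u \<in> U" for u using that c Ex_inj by (simp add: U_def)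
  have inj: "inj (frechet_derivative ?f (at u))" if u: "u \<in> U" for u
  proof -
    have cu: "ex (lift u) ob \<in> fst c" using u by (simp add: U_def Ex_def)
    let ?D = "frechet_derivative (\<lambda>Y. snd c (ex Y ob)) (at (lift u))"
    have "(?f has_derivative (\<lambda>v. ?D (lift v))) (at u)"
      unfolding Ex_def
      by (rule has_derivative_compose_at[where f = lift, OF linear_imp_has_derivative[OF lift_linear] exp_derivative[OF c cu]]) simp
    from frechet_derivative_at[OF this, symmetric] has_derivative_linear[OF this]
    have eq: "frechet_derivative ?f (at u) = (\<lambda>v. ?D (lift v))" and l: "linear (\<lambda>v. ?D (lift v))" .
    show ?thesis
      unfolding eq linear_injective_0[OF l]
    proof (intro allI impI)
      fix v assume "?D (lift v) = 0"
      then have "lift v = 0" by (rule exp_derivative_inj[OF lift_p lift_p c cu])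
      then show "v = 0" by (metis tang_lift linear_0[OF tang_linear])
    qed
  qed
  show "open (?f ` U)" by (rule smooth_inverse(1)[OF U C inv inj])
  show "Ck_on k (?f ` U) (\<lambda>y. inv Ex (cinv c y))" by (rule smooth_inverse(2)[OF U C inv inj])
qed

lemma Ex_open: assumes S: "open S" shows "open (Ex ` S)"
proof -
  have "Ex ` S = (\<Union>c\<in>A. fst c \<inter> snd c -` ((\<lambda>u. snd c (Ex u)) ` (S \<inter> Ex -` fst c)))" (is "_ = (\<Union>c\<in>A. ?T c)")
  proof
    show "Ex ` S \<subseteq> (\<Union>c\<in>A. ?T c)"
    proof
      fix x assume "x \<in> Ex ` S"
      then obtain u where u: "u \<in> S" "x = Ex u" by blast
      obtain c where c: "c \<in> A" "x \<in> fst c" by (rule chart_at)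
      have "x \<in> ?T c" using u c by auto
      then show "x \<in> (\<Union>c\<in>A. ?T c)" using c(1) by blast
    qed
    show "(\<Union>c\<in>A. ?T c) \<subseteq> Ex ` S"
    proof
      fix x assume "x \<in> (\<Union>c\<in>A. ?T c)"
      then obtain c u where c: "c \<in> A" "x \<in> fst c" "u \<in> S" "Ex u \<in> fst c" "snd c x = snd c (Ex u)" by auto
      then have "x = Ex u" using cinv_chart by metis
      then show "x \<in> Ex ` S" using c by blast
    qed
  qed
  moreover have "open (?T c)" if "c \<in> A" for c
    using continuous_open_preimage[OF chart_continuous[OF that] chart_open(1)[OF that] Ex_chart(1)[OF that S]] .
  ultimately show ?thesis by auto
qed

end

lemma (in positive_form) norm_bound: "\<exists>m>0. \<forall>v. m * (norm v)\<^sup>2 \<le> f v v"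
proof -
  have b: "bounded_bilinear f" using bilin by (simp add: bilinear_conv_bounded_bilinear)
  obtain m where m: "m > 0" "\<And>u. norm u = 1 \<Longrightarrow> m \<le> f u u"
  proof (cases "sphere (0::'a) 1 = {}")
    case True
    then show thesis using that[of 1] by auto
  next
    case False
    have "continuous_on (sphere 0 1) (\<lambda>u. f u u)" by (intro bounded_bilinear.continuous_on[OF b] continuous_on_id)
    then obtain u where u: "u \<in> sphere 0 1" "\<forall>v\<in>sphere 0 1. f u u \<le> f v v"
      using continuous_attains_inf[OF compact_sphere False] by blast
    have "u \<noteq> 0" using u(1) by auto
    then show thesis using that[OF pos] u(2) by auto
  qed
  have "m * (norm v)\<^sup>2 \<le> f v v" for v
  proof (cases "v = 0")
    case False
    have "m \<le> f ((1 / norm v) *\<^sub>R v) ((1 / norm v) *\<^sub>R v)" by (rule m(2)) (use False in simp)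
    then show ?thesis using False by (simp add: form_simps field_simps power2_eq_square)
  qed simp
  then show ?thesis using m(1) by blast
qed

section \<open>Properness and surjectivity of the exponential map, and its smooth inverse\<close>

context symmetric_space
begin

lemma Ad_ex_bounded:
  assumes "compact S" shows "\<exists>C. \<forall>V\<in>S. \<forall>Y. norm (Ad ex (ex V) Y) \<le> C * norm Y"
proof -
  have "\<exists>C. \<forall>V\<in>S. norm (Ad ex (ex V) b) \<le> C" for b
  proof -
    have "continuous_on S (\<lambda>V. Ad ex (ex V) b)"
      using Ad_ex_Ck[of 0 b] continuous_on_subset by fastforce
    then have "bounded ((\<lambda>V. Ad ex (ex V) b) ` S)" by (intro compact_imp_bounded compact_continuous_image assms)
    then show ?thesis by (auto simp: bounded_iff)
  qed
  then obtain C where C: "\<And>b V. V \<in> S \<Longrightarrow> norm (Ad ex (ex V) b) \<le> C b" by metis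
  have "norm (Ad ex (ex V) Y) \<le> (\<Sum>b\<in>Basis. C b) * norm Y" if V: "V \<in> S" for V Y
  proof -
    note l = Ad_linear[OF ex_G, of V]
    have "Ad ex (ex V) Y = Ad ex (ex V) (\<Sum>b\<in>Basis. (Y \<bullet> b) *\<^sub>R b)" by (simp add: euclidean_representation)
    also have "\<dots> = (\<Sum>b\<in>Basis. (Y \<bullet> b) *\<^sub>R Ad ex (ex V) b)" by (simp add: linear_sum[OF l] linear_scale[OF l])
    finally have "norm (Ad ex (ex V) Y) \<le> (\<Sum>b\<in>Basis. norm ((Y \<bullet> b) *\<^sub>R Ad ex (ex V) b))" by (simp only: norm_sum)
    also have "\<dots> \<le> (\<Sum>b\<in>Basis. norm Y * C b)"
      using C[OF V] by (intro sum_mono) (simp add: mult_mono Basis_le_norm)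
    finally show ?thesis by (simp add: sum_distrib_left mult.commute)
  qed
  then show ?thesis by blast
qed

text \<open>An eigenvalue m of \<open>br X\<close> gives the eigenvalue exp m of the group operator,
  so exp(2m) is at most \<open>C\<close>. As \<open>\<theta>\<close> turns eigenvectors for m into
  eigenvectors for -m, the absolute value of m is bounded too.\<close>

lemma ad_bound:
  assumes X: "X \<in> \<pp>" and C: "\<And>Y. ip (Ad ex (ex X) Y) (Ad ex (ex X) Y) \<le> C * ip Y Y" "C > 0"
  shows "ip (br X Y) (br X Y) \<le> (ln C / 2)\<^sup>2 * ip Y Y"
proof -
  have fam: "form.commuting_family UNIV {br X}"
    using X by (simp add: form.commuting_family_def bracket_linear_right ip_br_p)
  obtain S where S: "finite S" "span S = UNIV" "0 \<notin> S" "\<forall>b\<in>S. \<forall>T\<in>{br X}. \<exists>l. T b = l *\<^sub>R b" "\<forall>b\<in>S. \<forall>c\<in>S. b \<noteq> c \<longrightarrow> ip b c = 0"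
    using form.joint_eigenbasis[OF subspace_UNIV fam] by blast
  have "\<forall>b\<in>S. \<exists>l. br X b = l *\<^sub>R b" using S(4) by simp
  then obtain l where l: "\<And>b. b \<in> S \<Longrightarrow> br X b = l b *\<^sub>R b" unfolding bchoice_iff by blast
  have le: "2 * m \<le> ln C" if E: "br X E = m *\<^sub>R E" "E \<noteq> 0" for m E
  proof -
    have "Ad ex (ex X) E = exp m *\<^sub>R E" using Ad_eigenvector[OF E(1), of 1] by simp
    then have "exp (2 * m) * ip E E \<le> C * ip E E" using C(1)[of E] by (simp add: form.form_simps mult_exp_exp mult.assoc[symmetric])
    then have "exp (2 * m) \<le> C" using ip_pos[OF E(2)] by simp
    then show ?thesis using C(2) by (simp add: ln_ge_iff)
  qed
  have l2: "(l b)\<^sup>2 \<le> (ln C / 2)\<^sup>2" if b: "b \<in> S" for b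
  proof -
    have b0: "b \<noteq> 0" using S(3) b by blast
    have "br X (\<theta> b) = \<theta> (br (\<theta> X) b)" by (simp add: theta_br)
    also have "\<dots> = (- l b) *\<^sub>R \<theta> b" using X l[OF b] by (simp add: pspace_iff br_simps theta_simps)
    finally have "br X (\<theta> b) = (- l b) *\<^sub>R \<theta> b" .
    then have "2 * - l b \<le> ln C" by (rule le) (metis b0 theta_theta linear_0[OF theta_linear])
    moreover have "2 * l b \<le> ln C" by (rule le[OF l[OF b] b0])
    ultimately show ?thesis by (intro power2_le_iff_abs_le[THEN iffD2]) auto
  qed
  have orth: "ip (\<Sum>b\<in>S. x b *\<^sub>R b) (\<Sum>b\<in>S. x b *\<^sub>R b) = (\<Sum>b\<in>S. (x b)\<^sup>2 * ip b b)" for x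
  proof -
    have "ip b (\<Sum>c\<in>S. x c *\<^sub>R c) = x b * ip b b" if b: "b \<in> S" for b
    proof -
      have "ip b (\<Sum>c\<in>S. x c *\<^sub>R c) = (\<Sum>c\<in>S. if c = b then x b * ip b b else 0)"
        unfolding linear_sum[OF form.lin(1)] using S(5) b by (intro sum.cong) (auto simp: form.form_simps)
      then show ?thesis using b S(1) by simp
    qed
    then show ?thesis unfolding linear_sum[OF form.lin(2)] by (simp add: form.form_simps power2_eq_square mult.assoc)
  qed
  define x where "x b = ip Y b / ip b b" for b
  have Y: "Y = (\<Sum>b\<in>S. x b *\<^sub>R b)" unfolding x_def
    by (rule form.orthogonal_expansion[OF S(1,3)]) (use S in auto)
  have "br X Y = (\<Sum>b\<in>S. (x b * l b) *\<^sub>R b)"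
    by (subst Y) (simp add: linear_sum[OF bracket_right] br_simps l)
  then have "ip (br X Y) (br X Y) = (\<Sum>b\<in>S. (x b * l b)\<^sup>2 * ip b b)" by (simp only: orth)
  also have "\<dots> \<le> (\<Sum>b\<in>S. (ln C / 2)\<^sup>2 * ((x b)\<^sup>2 * ip b b))"
  proof (rule sum_mono)
    fix b assume "b \<in> S"
    then have "(l b)\<^sup>2 * ((x b)\<^sup>2 * ip b b) \<le> (ln C / 2)\<^sup>2 * ((x b)\<^sup>2 * ip b b)"
      by (intro mult_right_mono l2) (simp_all add: form.nonneg)
    then show "(x b * l b)\<^sup>2 * ip b b \<le> (ln C / 2)\<^sup>2 * ((x b)\<^sup>2 * ip b b)"
      by (simp add: power_mult_distrib mult_ac)
  qed
  also have "\<dots> = (ln C / 2)\<^sup>2 * ip Y Y" unfolding arg_cong2[where f = ip, OF Y Y] orth by (simp only: sum_distrib_left)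
  finally show ?thesis .
qed

text \<open>On \<open>\<pp>\<close> the inner product is the Killing form, hence the trace of the
  square of \<open>br X\<close>, and a trace is controlled by an operator bound.\<close>

lemma killing_bound: "\<exists>N. \<forall>X R. X \<in> \<pp> \<longrightarrow> 0 \<le> R \<longrightarrow> (\<forall>Y. ip (br X Y) (br X Y) \<le> R * ip Y Y) \<longrightarrow> ip X X \<le> R * N"
proof -
  obtain m where m: "m > 0" "\<And>v. m * (norm v)\<^sup>2 \<le> ip v v" using form.norm_bound by blast
  have "ip X X \<le> R * (\<Sum>b\<in>Basis. sqrt (ip b b / m))" if X: "X \<in> \<pp>" and R: "0 \<le> R" and le: "\<And>Y. ip (br X Y) (br X Y) \<le> R * ip Y Y" for X R
  proof -
    have "ip X X = (\<Sum>b\<in>Basis. br X (br X b) \<bullet> b)" using ip_p(1)[OF X] by (simp add: killing_form_def)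
    also have "\<dots> \<le> (\<Sum>b\<in>Basis. R * sqrt (ip b b / m))"
    proof (rule sum_mono)
      fix b :: 'g assume b: "b \<in> Basis"
      have "m * (norm (br X (br X b)))\<^sup>2 \<le> ip (br X (br X b)) (br X (br X b))" by (rule m(2))
      also have "\<dots> \<le> R * ip (br X b) (br X b)" by (rule le)
      also have "\<dots> \<le> R * (R * ip b b)" by (intro mult_left_mono le R)
      finally have "(norm (br X (br X b)))\<^sup>2 \<le> R\<^sup>2 * (ip b b / m)" using m(1) by (simp add: field_simps power2_eq_square)
      then have "norm (br X (br X b)) \<le> sqrt (R\<^sup>2 * (ip b b / m))" by (rule real_le_rsqrt)
      also have "\<dots> = R * sqrt (ip b b / m)" using R by (simp only: real_sqrt_mult real_sqrt_abs abs_of_nonneg)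
      finally show "br X (br X b) \<bullet> b \<le> R * sqrt (ip b b / m)" using Basis_le_norm[OF b, of "br X (br X b)"] by simp
    qed
    finally show ?thesis by (simp add: sum_distrib_left)
  qed
  then show ?thesis by blast
qed

text \<open>If \<open>exp(X) o = h exp(V) o\<close> with \<open>V\<close> bounded, then \<open>exp(X)\<close> is \<open>h exp(V)\<close> up to an element of \<open>K\<close>,
  which bounds \<open>Ad(exp(X))\<close>, hence \<open>ad(X)\<close>, hence the Killing form of \<open>X\<close>.\<close>

lemma Ex_bounded:
  assumes h: "h \<in> G" shows "\<exists>R. \<forall>u v. norm v \<le> 1 \<longrightarrow> Ex u = h (Ex v) \<longrightarrow> norm u \<le> R"
proof -
  obtain m where m: "m > 0" "\<And>v. m * (norm v)\<^sup>2 \<le> ip v v" using form.norm_bound by blast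
  obtain M where M: "M > 0" "\<And>v. ip v v \<le> M * (norm v)\<^sup>2"
  proof -
    obtain M where "M > 0" "\<And>a b. norm (ip a b) \<le> norm a * norm b * M"
      using bounded_bilinear.pos_bounded[OF ip_bounded_bilinear] by blast
    then show thesis using that[of M] by (metis abs_le_D1 mult.commute power2_eq_square real_norm_def)
  qed
  obtain H where H: "H > 0" "\<And>Y. norm (Ad ex h Y) \<le> norm Y * H"
    using bounded_linear.pos_bounded[OF Ad_bounded_linear[OF h]] by blast
  have "compact (lift ` cball 0 1)"
    by (intro compact_continuous_image compact_cball linear_continuous_on) (simp add: linear_conv_bounded_linear[symmetric] lift_linear)
  then obtain C where "\<forall>V\<in>lift ` cball 0 1. \<forall>Y. norm (Ad ex (ex V) Y) \<le> C * norm Y" using Ad_ex_bounded by blast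
  then have C: "norm (Ad ex (ex (lift v)) Y) \<le> C * norm Y" if "norm v \<le> 1" for v Y using that by auto
  \<comment> \<open>The summand 1 guarantees positivity, which the logarithm in
    \<open>ad_bound\<close> requires.\<close>
  define D where "D = M * (H * C)\<^sup>2 / m + 1"
  have D0: "D > 0" using M m by (simp add: D_def add_nonneg_pos)
  have D: "ip (Ad ex (ex (lift u)) Y) (Ad ex (ex (lift u)) Y) \<le> D * ip Y Y" if v: "norm v \<le> 1" and eq: "Ex u = h (Ex v)" for u v Y
  proof -
    define k where "k = ex (- lift v) \<circ> inv h \<circ> ex (lift u)"
    have kG: "k \<in> G" unfolding k_def by (intro G_comp ex_G G_inv h)
    have k: "k \<in> K" using kG eq h by (simp add: stabilizer_def k_def Ex_def)
    have hv: "h \<circ> ex (lift v) \<in> G" by (intro G_comp ex_G h)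
    have "ex (lift u) = (h \<circ> ex (lift v)) \<circ> k" using h by (auto simp: k_def)
    then have A: "Ad ex (ex (lift u)) Y = Ad ex h (Ad ex (ex (lift v)) (Ad ex k Y))"
      by (simp only: Ad_comp[OF hv kG] Ad_comp[OF h ex_G])
    have "norm (Ad ex (ex (lift u)) Y) \<le> norm (Ad ex (ex (lift v)) (Ad ex k Y)) * H" unfolding A by (rule H(2))
    also have "\<dots> \<le> (C * norm (Ad ex k Y)) * H" using H(1) by (intro mult_right_mono C v) simp
    finally have "norm (Ad ex (ex (lift u)) Y) \<le> H * C * norm (Ad ex k Y)" by (simp add: mult_ac)
    then have n: "(norm (Ad ex (ex (lift u)) Y))\<^sup>2 \<le> (H * C)\<^sup>2 * (norm (Ad ex k Y))\<^sup>2"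
      using power_mono[of _ _ 2] by (fastforce simp: power_mult_distrib)
    have "ip (Ad ex (ex (lift u)) Y) (Ad ex (ex (lift u)) Y) \<le> M * (norm (Ad ex (ex (lift u)) Y))\<^sup>2" by (rule M(2))
    also have "\<dots> \<le> M * ((H * C)\<^sup>2 * (norm (Ad ex k Y))\<^sup>2)" using M(1) by (intro mult_left_mono n) simp
    also have "\<dots> = M * (H * C)\<^sup>2 / m * (m * (norm (Ad ex k Y))\<^sup>2)" using m(1) by simp
    also have "\<dots> \<le> M * (H * C)\<^sup>2 / m * ip (Ad ex k Y) (Ad ex k Y)" using M(1) m(1) by (intro mult_left_mono m(2)) simp
    also have "\<dots> \<le> D * ip Y Y" using Ad_K_ip[OF k] form.nonneg[of Y] by (simp add: D_def distrib_right)
    finally show ?thesis .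
  qed
  obtain N where N: "\<And>X R. X \<in> \<pp> \<Longrightarrow> 0 \<le> R \<Longrightarrow> (\<And>Y. ip (br X Y) (br X Y) \<le> R * ip Y Y) \<Longrightarrow> ip X X \<le> R * N"
    using killing_bound by blast
  obtain T where T: "T > 0" "\<And>X. norm (tang X) \<le> norm X * T"
    using bounded_linear.pos_bounded[of tang] tang_linear by (auto simp: linear_conv_bounded_linear)
  have "norm u \<le> sqrt ((ln D / 2)\<^sup>2 * N / m) * T" if v: "norm v \<le> 1" and eq: "Ex u = h (Ex v)" for u v
  proof -
    have "m * (norm (lift u))\<^sup>2 \<le> ip (lift u) (lift u)" by (rule m(2))
    also have "\<dots> \<le> (ln D / 2)\<^sup>2 * N" by (intro N lift_p ad_bound D[OF v eq] D0) simp
    finally have "(norm (lift u))\<^sup>2 \<le> (ln D / 2)\<^sup>2 * N / m" using m(1) by (simp add: field_simps)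
    then have "norm (lift u) \<le> sqrt ((ln D / 2)\<^sup>2 * N / m)" by (rule real_le_rsqrt)
    then have "norm (lift u) * T \<le> sqrt ((ln D / 2)\<^sup>2 * N / m) * T" using T(1) by simp
    then show ?thesis using T(2)[of "lift u"] by simp
  qed
  then show ?thesis by blast
qed

lemma Ex_continuous: "continuous_on S Ex"
proof -
  have "continuous_on UNIV Ex" using Ex_into[of 0] unfolding Ck_into_def by blast
  then show ?thesis by (rule continuous_on_subset) simp
qed

text \<open>The range is open; it is also closed. Around a limit point h o the translate by
  \<open>h\<close> of the image of the unit ball is a neighbourhood that meets the range, by
  \<open>Ex_bounded\<close>, only inside the compact image of some closed ball. Connectedness
  finishes.\<close>

lemma Ex_surj: "surj Ex"
proof -
  have "closed (range Ex)"
  proof -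
    have "x \<in> range Ex" if x: "x \<in> closure (range Ex)" for x
    proof -
      obtain h where h: "h \<in> G" "h ob = x" using transitive by blast
      obtain R where R: "\<And>u v. norm v \<le> 1 \<Longrightarrow> Ex u = h (Ex v) \<Longrightarrow> norm u \<le> R" using Ex_bounded[OF h(1)] by blast
      have "h ` Ex ` ball 0 1 = inv h -` Ex ` ball 0 1" using bij_vimage_eq_inv_image[OF bij_imp_bij_inv[OF G_bij[OF h(1)]]] inv_inv_eq[OF G_bij[OF h(1)]] by simp
      moreover have "continuous_on UNIV (inv h)" using isometry_continuous G_inv[OF h(1)] G_subset by blast
      ultimately have o: "open (h ` Ex ` ball 0 1)" using Ex_open[OF open_ball] by (simp add: open_vimage)
      have "Ex 0 = ob" by (simp add: Ex_def linear_0[OF lift_linear])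
      moreover have "h (Ex 0) \<in> h ` Ex ` ball 0 1" by (intro imageI) simp
      ultimately have "x \<in> h ` Ex ` ball 0 1" using h(2) by simp
      then have "x \<in> closure (h ` Ex ` ball 0 1 \<inter> range Ex)" using open_Int_closure_subset[OF o] x by blast
      moreover have "h ` Ex ` ball 0 1 \<inter> range Ex \<subseteq> Ex ` cball 0 R"
      proof
        fix y assume "y \<in> h ` Ex ` ball 0 1 \<inter> range Ex"
        then obtain u v where "norm v < 1" "y = h (Ex v)" "y = Ex u" by auto
        then have "y = Ex u" "u \<in> cball 0 R" using R[of v u] by auto
        then show "y \<in> Ex ` cball 0 R" by (rule image_eqI)
      qed
      moreover have "closed (Ex ` cball 0 R)" by (intro compact_imp_closed compact_continuous_image Ex_continuous compact_cball)
      ultimately show ?thesis using closure_minimal by blast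
    qed
    then show ?thesis using closure_subset_eq by blast
  qed
  moreover have "open (range Ex)" by (rule Ex_open) simp
  ultimately have "range Ex = {} \<or> range Ex = UNIV" using conn unfolding connected_clopen by (auto simp: open_openin[symmetric] closed_closedin[symmetric])
  then show ?thesis by simp
qed

abbreviation "Lg \<equiv> inv Ex"

lemma Ex_Lg [simp]: "Ex (Lg x) = x" and Lg_Ex [simp]: "Lg (Ex u) = u"
  using Ex_surj Ex_inj by (auto simp: surj_f_inv_f)

lemma ex_lift_Lg: "ex (lift (Lg x)) ob = x"
  using Ex_Lg[of x] by (simp only: Ex_def)

lemma Lg_ex: "X \<in> \<pp> \<Longrightarrow> Lg (ex X ob) = tang X"
  using Lg_Ex[of "tang X"] by (simp add: Ex_def lift_tang_p)

lemma Lg_Ck: "Ck_fun A k Lg"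
  unfolding Ck_fun_def
proof
  fix c assume c: "c \<in> A"
  have "(\<lambda>u. snd c (Ex u)) ` (UNIV \<inter> Ex -` fst c) = snd c ` (Ex ` (Ex -` fst c))" by (simp only: image_image Int_UNIV_left)
  also have "Ex ` (Ex -` fst c) = fst c" using Ex_surj by (rule surj_image_vimage_eq)
  finally show "Ck_on k (snd c ` fst c) (Lg \<circ> cinv c)"
    using Ex_chart(2)[OF c open_UNIV, of k] by (simp add: comp_def)
qed

end

section \<open>Geodesics\<close>

context lie_action
begin

lemma metric_bilinear: "c \<in> A \<Longrightarrow> x \<in> fst c \<Longrightarrow> bilinear (g c x)"
  and metric_sym: "c \<in> A \<Longrightarrow> x \<in> fst c \<Longrightarrow> g c x u w = g c x w u"
  and metric_smooth: "c \<in> A \<Longrightarrow> smooth_on (snd c ` fst c) (\<lambda>y. g c (cinv c y) u w)"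
  using metric by (auto simp: riemannian_metric_def)

lemma metric_expand:
  assumes "c \<in> A" "x \<in> fst c"
  shows "g c x v w = (\<Sum>p\<in>Basis \<times> Basis. (v \<bullet> fst p) * (w \<bullet> snd p) * g c x (fst p) (snd p))"
proof -
  note b = metric_bilinear[OF assms]
  have "g c x v w = g c x (\<Sum>b\<in>Basis. (v \<bullet> b) *\<^sub>R b) (\<Sum>b\<in>Basis. (w \<bullet> b) *\<^sub>R b)" by (simp add: euclidean_representation)
  also have "\<dots> = (\<Sum>(b, b')\<in>Basis \<times> Basis. g c x ((v \<bullet> b) *\<^sub>R b) ((w \<bullet> b') *\<^sub>R b'))" by (rule bilinear_sum[OF b])
  finally show ?thesis by (simp add: bilinear_lmul[OF b] bilinear_rmul[OF b] case_prod_beta mult_ac)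
qed

lemma metric_component_derivative:
  assumes "c \<in> A" "y \<in> snd c ` fst c"
  shows "((\<lambda>y. g c (cinv c y) v w) has_derivative (\<lambda>u. metric_deriv c g (cinv c y) u v w)) (at y)"
proof -
  have "Ck_on (Suc 0) (snd c ` fst c) (\<lambda>y. g c (cinv c y) v w)" using metric_smooth[OF assms(1)] by (simp only: smooth_on_def)
  from Ck_on_SucD(1)[OF this assms(2)] show ?thesis
    using assms by (simp add: metric_deriv_def[abs_def] chart_deriv_def comp_def)
qed

lemma metric_deriv_expand:
  assumes "c \<in> A" "y \<in> snd c ` fst c"
  shows "metric_deriv c g (cinv c y) u v w =
    (\<Sum>p\<in>Basis \<times> Basis. (v \<bullet> fst p) * (w \<bullet> snd p) * metric_deriv c g (cinv c y) u (fst p) (snd p))"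
proof -
  have "((\<lambda>y. \<Sum>p\<in>Basis \<times> Basis. (v \<bullet> fst p) * (w \<bullet> snd p) * g c (cinv c y) (fst p) (snd p)) has_derivative
      (\<lambda>u. \<Sum>p\<in>Basis \<times> Basis. (v \<bullet> fst p) * (w \<bullet> snd p) * metric_deriv c g (cinv c y) u (fst p) (snd p))) (at y)"
    by (intro has_derivative_sum has_derivative_mult_right metric_component_derivative assms)
  then have "((\<lambda>y. g c (cinv c y) v w) has_derivative
      (\<lambda>u. \<Sum>p\<in>Basis \<times> Basis. (v \<bullet> fst p) * (w \<bullet> snd p) * metric_deriv c g (cinv c y) u (fst p) (snd p))) (at y)"
    by (rule has_derivative_transform_within_open[OF _ chart_open(2)[OF assms(1)] assms(2)])
       (rule metric_expand[symmetric, OF assms(1) cinv_in[OF assms(1)]])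
  from has_derivative_unique[OF metric_component_derivative[OF assms] this] show ?thesis by (rule fun_cong)
qed

text \<open>The components of the metric are known to be differentiable for fixed arguments;
  expansion in the basis reduces moving arguments to the ordinary product rule.\<close>

lemma metric_along_curve:
  assumes c: "c \<in> A" and q: "(q has_vector_derivative q') (at t)" "q t \<in> snd c ` fst c"
    and P: "(P has_vector_derivative P') (at t)" and R: "(R has_vector_derivative R') (at t)"
  shows "((\<lambda>s. g c (cinv c (q s)) (P s) (R s)) has_vector_derivative
    metric_deriv c g (cinv c (q t)) q' (P t) (R t) + g c (cinv c (q t)) P' (R t) + g c (cinv c (q t)) (P t) R') (at t)"
proof -
  let ?x = "cinv c (q t)"
  note x = cinv_in[OF c q(2)]
  have 1: "((\<lambda>s. P s \<bullet> b) has_real_derivative P' \<bullet> b) (at t)" for b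
    using bounded_linear.has_vector_derivative[OF bounded_linear_inner_left P] by (simp add: has_real_derivative_iff_has_vector_derivative)
  have 2: "((\<lambda>s. R s \<bullet> b) has_real_derivative R' \<bullet> b) (at t)" for b
    using bounded_linear.has_vector_derivative[OF bounded_linear_inner_left R] by (simp add: has_real_derivative_iff_has_vector_derivative)
  have 3: "((\<lambda>s. g c (cinv c (q s)) v w) has_real_derivative metric_deriv c g ?x q' v w) (at t)" for v w
    using has_vector_derivative_compose[OF q(1) metric_component_derivative[OF c q(2)]] by (simp add: has_real_derivative_iff_has_vector_derivative)
  let ?G = "\<lambda>v w h. \<Sum>p\<in>Basis \<times> Basis. (v \<bullet> fst p) * (w \<bullet> snd p) * h (fst p) (snd p)"
  have "((\<lambda>s. ?G (P s) (R s) (g c (cinv c (q s)))) has_real_derivative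
      (\<Sum>p\<in>Basis \<times> Basis. ((P' \<bullet> fst p) * (R t \<bullet> snd p) + (R' \<bullet> snd p) * (P t \<bullet> fst p)) * g c ?x (fst p) (snd p)
        + metric_deriv c g ?x q' (fst p) (snd p) * ((P t \<bullet> fst p) * (R t \<bullet> snd p)))) (at t)"
    by (intro DERIV_sum DERIV_mult 1 2 3)
  moreover have "(\<Sum>p\<in>Basis \<times> Basis. ((P' \<bullet> fst p) * (R t \<bullet> snd p) + (R' \<bullet> snd p) * (P t \<bullet> fst p)) * g c ?x (fst p) (snd p)
        + metric_deriv c g ?x q' (fst p) (snd p) * ((P t \<bullet> fst p) * (R t \<bullet> snd p)))
     = ?G (P t) (R t) (metric_deriv c g ?x q') + ?G P' (R t) (g c ?x) + ?G (P t) R' (g c ?x)"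
    unfolding sum.distrib[symmetric] by (intro sum.cong) (auto simp: algebra_simps)
  moreover have "\<dots> = metric_deriv c g ?x q' (P t) (R t) + g c ?x P' (R t) + g c ?x (P t) R'"
    by (simp only: metric_expand[OF c x, symmetric] metric_deriv_expand[OF c q(2), symmetric])
  ultimately have "((\<lambda>s. ?G (P s) (R s) (g c (cinv c (q s)))) has_vector_derivative
      metric_deriv c g ?x q' (P t) (R t) + g c ?x P' (R t) + g c ?x (P t) R') (at t)"
    by (simp only: has_real_derivative_iff_has_vector_derivative)
  moreover have "\<forall>\<^sub>F s in at t. q s \<in> snd c ` fst c"
    using topological_tendstoD[OF _ chart_open(2)[OF c] q(2)] has_vector_derivative_continuous[OF q(1)] by (simp add: continuous_at)
  then have "\<forall>\<^sub>F s in at t. ?G (P s) (R s) (g c (cinv c (q s))) = g c (cinv c (q s)) (P s) (R s)"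
    by (rule eventually_mono) (rule metric_expand[symmetric, OF c cinv_in[OF c]])
  ultimately show ?thesis
    by (rule has_vector_derivative_transform_eventually) (rule metric_expand[symmetric, OF c x])
qed

lemma G_metric: "f \<in> G \<Longrightarrow> c \<in> A \<Longrightarrow> d \<in> A \<Longrightarrow> x \<in> fst c \<Longrightarrow> f x \<in> fst d \<Longrightarrow>
    g d (f x) (chart_deriv c (snd d \<circ> f) x u) (chart_deriv c (snd d \<circ> f) x w) = g c x u w"
  using G_subset unfolding isometries_def preserves_metric_def by blast

text \<open>The Lie derivative of the metric along \<open>W\<close> vanishes, in coordinates. The
  invariant length of a vector transported by the flow is differentiated at time 0; symmetry of
  second derivatives turns the time derivative of the differential of the flow into the differential
  of the field.\<close>

lemma killing_equation:
  assumes c: "c \<in> A" and y: "y \<in> snd c ` fst c"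
  shows "metric_deriv c g (cinv c y) (fundamental ex c W (cinv c y)) u u +
    2 * g c (cinv c y) (frechet_derivative (\<lambda>y. fundamental ex c W (cinv c y)) (at y) u) u = 0"
proof -
  let ?F = "\<lambda>p. snd c (flow c W p)" and ?V = "\<lambda>y. fundamental ex c W (cinv c y)"
  let ?D = "\<lambda>v p. frechet_derivative ?F (at p) v"
  note y0 = flow_dom_0[OF c y, of W] and x = cinv_in[OF c y]
  have dD: "(?D v has_derivative frechet_derivative (?D v) (at (0, y))) (at (0, y))" for v
    by (rule Ck_on_SucD(1)[OF Ck_on_SucD(2)[OF flow_Ck[OF c]] y0])
  have l: "((\<lambda>s. (s, y)) has_vector_derivative (1, 0)) (at 0)" by (auto intro!: derivative_eq_intros)
  have q: "((\<lambda>s. ?F (s, y)) has_vector_derivative ?V y) (at 0)"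
    using has_vector_derivative_compose[OF l flow_has_derivative[OF c y0]] by (simp only: flow_derivative[OF c y])
  have F0: "?F (0, z) = z" if "z \<in> snd c ` fst c" for z using c that by (simp add: flow_def)
  have l2: "((\<lambda>r. (s, y + r *\<^sub>R u)) has_vector_derivative (0, u)) (at 0)" for s :: real
    by (auto intro!: derivative_eq_intros)
  have P: "((\<lambda>s. ?D (0, u) (s, y)) has_vector_derivative frechet_derivative ?V (at y) u) (at 0)"
  proof -
    have "((\<lambda>s. ?D (0, u) (s, y)) has_vector_derivative frechet_derivative (?D (0, u)) (at (0, y)) (1, 0)) (at 0)"
      by (rule has_vector_derivative_compose[OF l dD])
    also have "frechet_derivative (?D (0, u)) (at (0, y)) (1, 0) = frechet_derivative (?D (1, 0)) (at (0, y)) (0, u)"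
      by (rule second_derivative_symmetric[OF flow_dom_open[OF c] flow_Ck[OF c] y0])
    also have "\<dots> = frechet_derivative ?V (at y) u"
    proof -
      have "((\<lambda>z. (0::real, z)) has_derivative (\<lambda>v. (0, v))) (at y)" by (auto intro!: derivative_eq_intros)
      from has_derivative_compose[OF this dD]
      have "((\<lambda>z. ?D (1, 0) (0, z)) has_derivative (\<lambda>v. frechet_derivative (?D (1, 0)) (at (0, y)) (0, v))) (at y)" .
      then have "(?V has_derivative (\<lambda>v. frechet_derivative (?D (1, 0)) (at (0, y)) (0, v))) (at y)"
        by (rule has_derivative_transform_within_open[OF _ chart_open(2)[OF c] y]) (rule flow_derivative[OF c, symmetric])
      from frechet_derivative_at[OF this] show ?thesis by (rule fun_cong)
    qed
    finally show ?thesis .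
  qed
  have Pe: "chart_deriv c (snd c \<circ> ex (s *\<^sub>R W)) (cinv c y) u = ?D (0, u) (s, y)" if s: "(s, y) \<in> flow_dom c W" for s
  proof -
    have "((\<lambda>z. (s, z)) has_derivative (\<lambda>v. (0, v))) (at y)" by (auto intro!: derivative_eq_intros)
    from has_derivative_compose[OF this flow_has_derivative[OF c s]]
    have "((\<lambda>z. ?F (s, z)) has_derivative (\<lambda>v. ?D (0, v) (s, y))) (at y)" .
    from frechet_derivative_at[OF this, symmetric] show ?thesis
      using c y by (simp add: chart_deriv_def comp_def flow_def)
  qed
  have sx: "ex (s *\<^sub>R W) (cinv c y) \<in> fst c" if "(s, y) \<in> flow_dom c W" for s using that by (simp add: flow_dom_def flow_def)
  have "?F (0, y) \<in> snd c ` fst c" using y F0[OF y] by simp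
  from metric_along_curve[OF c q this P P]
  have d: "((\<lambda>s. g c (cinv c (?F (s, y))) (?D (0, u) (s, y)) (?D (0, u) (s, y))) has_vector_derivative
     metric_deriv c g (cinv c y) (?V y) u u + g c (cinv c y) (frechet_derivative ?V (at y) u) u + g c (cinv c y) u (frechet_derivative ?V (at y) u)) (at 0)"
    using Pe[OF y0] chart_deriv_id[OF c x, of u] by (simp add: F0[OF y] ex_0[abs_def] id_def)
  have const: "g c (cinv c (?F (s, y))) (?D (0, u) (s, y)) (?D (0, u) (s, y)) = g c (cinv c y) u u" if s: "(s, y) \<in> flow_dom c W" for s
    using G_metric[OF ex_G c c x sx[OF s], of u u] cinv_chart[OF c sx[OF s]] unfolding Pe[OF s] by (simp add: flow_def)
  have "open ((\<lambda>s. (s, y)) -` flow_dom c W)" by (rule open_vimage[OF flow_dom_open[OF c]]) (intro continuous_intros)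
  then have "\<forall>\<^sub>F s in at 0. s \<in> (\<lambda>s. (s, y)) -` flow_dom c W" using y0 by (intro eventually_at_in_open') auto
  then have "\<forall>\<^sub>F s in at 0. g c (cinv c y) u u = g c (cinv c (?F (s, y))) (?D (0, u) (s, y)) (?D (0, u) (s, y))"
    by (rule eventually_mono) (use const in simp)
  from has_vector_derivative_transform_eventually[OF has_vector_derivative_const this]
  have "((\<lambda>s. g c (cinv c (?F (s, y))) (?D (0, u) (s, y)) (?D (0, u) (s, y))) has_vector_derivative 0) (at 0)"
    using const[OF y0] by simp
  from vector_derivative_unique_at[OF d this] show ?thesis
    using metric_sym[OF c x, of u "frechet_derivative ?V (at y) u"] by simp
qed

text \<open>Noether: for a twice differentiable curve the derivative of \<open>g(\<gamma>', W)\<close> is the covariant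
  acceleration paired with \<open>W\<close>.\<close>

lemma momentum_derivative:
  assumes c: "c \<in> A" and q: "(q has_vector_derivative P t) (at t)" "q t \<in> snd c ` fst c"
    and P: "(P has_vector_derivative acc) (at t)"
  shows "((\<lambda>s. g c (cinv c (q s)) (P s) (fundamental ex c W (cinv c (q s)))) has_vector_derivative
    g c (cinv c (q t)) acc (fundamental ex c W (cinv c (q t))) +
    christoffel c g (cinv c (q t)) (P t) (P t) (fundamental ex c W (cinv c (q t)))) (at t)"
proof -
  let ?V = "\<lambda>y. fundamental ex c W (cinv c y)" and ?x = "cinv c (q t)"
  note x = cinv_in[OF c q(2)]
  have "((\<lambda>s. ?V (q s)) has_vector_derivative frechet_derivative ?V (at (q t)) (P t)) (at t)"
    by (rule has_vector_derivative_compose[OF q(1) Ck_on_SucD(1)[OF fundamental_Ck[OF c] q(2)]])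
  from metric_along_curve[OF c q P this]
  have "((\<lambda>s. g c (cinv c (q s)) (P s) (?V (q s))) has_vector_derivative
      metric_deriv c g ?x (P t) (P t) (?V (q t)) + g c ?x acc (?V (q t)) + g c ?x (P t) (frechet_derivative ?V (at (q t)) (P t))) (at t)"
    (is "(_ has_vector_derivative ?e) _") .
  moreover have arith: "a + b + z = b + (a + a - k) / 2" if "k + 2 * z' = 0" "z = z'" for a b k z z' :: real
    using that by (simp add: field_simps)
  have "?e = g c ?x acc (?V (q t)) + christoffel c g ?x (P t) (P t) (?V (q t))"
    unfolding christoffel_def by (rule arith[OF killing_equation[OF c q(2)] metric_sym[OF c x]])
  ultimately show ?thesis by simp
qed

lemma fundamental_transform:
  assumes "c \<in> A" "d \<in> A" "x \<in> fst c" "x \<in> fst d"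
  shows "fundamental ex d W x = chart_deriv c (snd d \<circ> id) x (fundamental ex c W x)"
  using fundamental_Ad[OF G_id assms(1,2,3), of W] assms(4) by simp

lemma momentum_chart:
  assumes c: "c \<in> A" "d \<in> A" "x \<in> fst c" "x \<in> fst d" and v: "has_velocity c \<gamma> t u" "has_velocity d \<gamma> t v" "\<gamma> t = x"
  shows "g d x v (fundamental ex d W x) = g c x u (fundamental ex c W x)"
proof -
  have "v = chart_deriv c (snd d \<circ> id) x u"
    using has_velocity_self[OF v(1) c(1) smooth_self_id c(2)] v c has_velocity_unique[of d \<gamma> t v] by simp
  then show ?thesis
    using G_metric[OF G_id c(1,2,3), of u "fundamental ex c W x"] c(4) fundamental_transform[OF c] by simp
qed

lemma geodesic_velocity:
  assumes "geodesic A g \<gamma>" "c \<in> A" "\<gamma> t \<in> fst c" shows "has_velocity c \<gamma> t (velocity c \<gamma> t)"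
  using assms unfolding geodesic_def has_velocity_def velocity_def
  by (auto simp: continuous_on_eq_continuous_at comp_def vector_derivative_works)

text \<open>The conservation law behind both the description and the uniqueness of geodesics; it
  compares two times that need not share a chart.\<close>

lemma geodesic_momentum:
  assumes \<gamma>: "geodesic A g \<gamma>" and c: "c \<in> A" "\<gamma> 0 \<in> fst c" and d: "d \<in> A" "\<gamma> t \<in> fst d"
  shows "g d (\<gamma> t) (velocity d \<gamma> t) (fundamental ex d W (\<gamma> t)) = g c (\<gamma> 0) (velocity c \<gamma> 0) (fundamental ex c W (\<gamma> 0))"
proof -
  \<comment> \<open>The chart is an arbitrary choice at each time. By \<open>momentum_chart\<close>
    the number does not depend on it, so the local computations glue to one function with zero
    derivative.\<close>
  define N where "N t = (let c = SOME c. c \<in> A \<and> \<gamma> t \<in> fst c in g c (\<gamma> t) (velocity c \<gamma> t) (fundamental ex c W (\<gamma> t)))" for t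
  have N: "N t = g c (\<gamma> t) (velocity c \<gamma> t) (fundamental ex c W (\<gamma> t))" if c: "c \<in> A" "\<gamma> t \<in> fst c" for t c
  proof -
    let ?e = "SOME c. c \<in> A \<and> \<gamma> t \<in> fst c"
    have e: "?e \<in> A" "\<gamma> t \<in> fst ?e" using someI_ex[of "\<lambda>c. c \<in> A \<and> \<gamma> t \<in> fst c"] c by blast+
    show ?thesis unfolding N_def Let_def
      by (rule momentum_chart[OF c(1) e(1) c(2) e(2) geodesic_velocity[OF \<gamma> c] geodesic_velocity[OF \<gamma> e]]) simp
  qed
  have "(N has_vector_derivative 0) (at t)" for t
  proof -
    obtain c where c: "c \<in> A" "\<gamma> t \<in> fst c" by (rule chart_at)
    obtain acc where acc: "(velocity c \<gamma> has_vector_derivative acc) (at t)"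
      "\<And>w. g c (\<gamma> t) acc w + christoffel c g (\<gamma> t) (velocity c \<gamma> t) (velocity c \<gamma> t) w = 0"
      using \<gamma> c unfolding geodesic_def by blast
    note v = geodesic_velocity[OF \<gamma> c]
    have q: "((\<lambda>s. snd c (\<gamma> s)) has_vector_derivative velocity c \<gamma> t) (at t)" "snd c (\<gamma> t) \<in> snd c ` fst c"
      using v c by (auto simp: has_velocity_def)
    from momentum_derivative[OF c(1) q acc(1), of W]
    have 1: "((\<lambda>s. g c (cinv c (snd c (\<gamma> s))) (velocity c \<gamma> s) (fundamental ex c W (cinv c (snd c (\<gamma> s))))) has_vector_derivative 0) (at t)"
      using acc(2)[of "fundamental ex c W (\<gamma> t)"] c by simp
    have "\<forall>\<^sub>F s in at t. g c (cinv c (snd c (\<gamma> s))) (velocity c \<gamma> s) (fundamental ex c W (cinv c (snd c (\<gamma> s)))) = N s"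
      using has_velocity_eventually[OF v c(1)] by (rule eventually_mono) (use c N in simp)
    from has_vector_derivative_transform_eventually[OF 1 this] show ?thesis using c N[OF c] by simp
  qed
  then have "N t = N 0" by (rule zero_vector_derivative_constant)
  then show ?thesis using N[OF c] N[OF d] by simp
qed

end

section \<open>Geodesics through the base point are orbits of one-parameter groups\<close>

context symmetric_space
begin

lemma fundamental_point:
  assumes V: "V \<in> G" and c: "c \<in> A" "V ob \<in> fst c" shows "\<exists>\<eta>\<in>\<pp>. fundamental ex c (Ad ex V \<eta>) (V ob) = w"
proof -
  obtain W where "fundamental ex c (Ad ex V W) (V ob) = w"
  proof -
    note s = chart_deriv_comp[OF c(1) c0(1) c(1) c(2) _ _ G_smooth[OF G_inv[OF V]] G_smooth[OF V]]
    let ?u = "chart_deriv c (snd c0 \<circ> inv V) (V ob) w"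
    have ob: "inv V (V ob) = ob" using V by simp
    have "chart_deriv c0 (snd c \<circ> V) ob ?u = chart_deriv c (snd c \<circ> (V \<circ> inv V)) (V ob) w"
      using s[of w] ob c c0 by simp
    also have "V \<circ> inv V = id" using V by auto
    also have "chart_deriv c (snd c \<circ> id) (V ob) w = w" by (rule chart_deriv_id[OF c])
    finally have "fundamental ex c (Ad ex V (lift ?u)) (V ob) = w"
      unfolding fundamental_Ad[OF V c0(1) c(1) c0(2) c(2)] tang_lift[of ?u, unfolded tang_def] .
    then show ?thesis by (rule that)
  qed
  moreover have "fundamental ex c (Ad ex V W) (V ob) = fundamental ex c (Ad ex V (p_part W)) (V ob)"
    unfolding fundamental_Ad[OF V c0(1) c(1) c0(2) c(2)] fundamental_p_part[OF c0, of W] by (rule refl)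
  ultimately show ?thesis using p_part_in by metis
qed

text \<open>After translation to the base point only the part of the second element in
  \<open>\<pp>\<close> matters, and \<open>\<kk>\<close> is orthogonal to \<open>\<pp>\<close>. So
  the metric becomes the invariant Killing form, with \<open>W\<close> arbitrary.\<close>

lemma metric_fundamental:
  assumes V: "V \<in> G" and c: "c \<in> A" "V ob \<in> fst c" and X: "X \<in> \<pp>"
  shows "g c (V ob) (fundamental ex c (Ad ex V X) (V ob)) (fundamental ex c W (V ob)) = B (Ad ex V X) W"
proof -
  let ?W = "Ad ex (inv V) W"
  have W: "W = Ad ex V ?W" using V by simp
  have "g c (V ob) (fundamental ex c (Ad ex V X) (V ob)) (fundamental ex c (Ad ex V ?W) (V ob)) = g c0 ob (fundamental ex c0 X ob) (fundamental ex c0 ?W ob)"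
    unfolding fundamental_Ad[OF V c0(1) c(1) c0(2) c(2)] by (rule G_metric[OF V c0(1) c(1) c0(2) c(2)])
  also have "\<dots> = ip X (p_part ?W)" unfolding fundamental_p_part[OF c0, of ?W] by (rule fundamental_g[OF c0 X p_part_in])
  also have "\<dots> = B X ?W" using ip_p_part[OF X, of ?W] form.sym ip_p(2)[OF X] by metis
  also have "\<dots> = B (Ad ex V X) (Ad ex V ?W)" by (rule killing_form_Ad[OF V, symmetric])
  finally show ?thesis unfolding W[symmetric] .
qed

text \<open>By \<open>momentum_derivative\<close> the covariant acceleration paired with the field
  of \<open>W\<close> is the derivative of the momentum, which along this curve is the constant
  \<open>B X W\<close>; the fields fill every tangent space.\<close>

lemma ex_geodesic: assumes X: "X \<in> \<pp>" shows "geodesic A g (\<lambda>t. ex (t *\<^sub>R X) ob)"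
  unfolding geodesic_def
proof (intro conjI ballI allI impI)
  let ?\<gamma> = "\<lambda>t. ex (t *\<^sub>R X) ob"
  show cont: "continuous_on UNIV ?\<gamma>" using ex_curve_Ck_into[of 0 X ob] unfolding Ck_into_def by blast
  fix c t assume c: "c \<in> A" "?\<gamma> t \<in> fst c"
  let ?V = "\<lambda>W y. fundamental ex c W (cinv c y)" and ?q = "\<lambda>s. snd c (?\<gamma> s)"
  have v: "has_velocity c ?\<gamma> s (fundamental ex c X (?\<gamma> s))" if "?\<gamma> s \<in> fst c" for s
    by (rule fundamental_velocity_at[OF c(1) that])
  then have q: "(?q has_vector_derivative ?V X (?q t)) (at t)" and qc: "?q t \<in> snd c ` fst c"
    using c by (auto simp: has_velocity_def)
  then show "(snd c \<circ> ?\<gamma>) differentiable (at t)"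
    unfolding comp_def by (intro differentiableI_vector)
  have P: "((\<lambda>s. ?V X (?q s)) has_vector_derivative frechet_derivative (?V X) (at (?q t)) (?V X (?q t))) (at t)" (is "(_ has_vector_derivative ?acc) _")
    by (rule has_vector_derivative_compose[OF q Ck_on_SucD(1)[OF fundamental_Ck[OF c(1)] qc]])
  have ev: "\<forall>\<^sub>F s in at t. ?\<gamma> s \<in> fst c" by (rule has_velocity_eventually[OF v[OF c(2)] c(1)])
  show "\<exists>acc. (velocity c ?\<gamma> has_vector_derivative acc) (at t) \<and>
        (\<forall>w. g c (?\<gamma> t) acc w + christoffel c g (?\<gamma> t) (velocity c ?\<gamma> t) (velocity c ?\<gamma> t) w = 0)"
  proof (intro exI conjI allI)
    have "\<forall>\<^sub>F s in at t. ?V X (?q s) = velocity c ?\<gamma> s"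
      using ev by (rule eventually_mono) (use c has_velocity_imp_velocity[OF v] in simp)
    then show "(velocity c ?\<gamma> has_vector_derivative ?acc) (at t)"
      by (rule has_vector_derivative_transform_eventually[OF P]) (use c has_velocity_imp_velocity[OF v[OF c(2)]] in simp)
    fix w
    obtain \<eta> where \<eta>: "fundamental ex c (Ad ex (ex (t *\<^sub>R X)) \<eta>) (?\<gamma> t) = w"
      using fundamental_point[OF ex_G c] by blast
    let ?W = "Ad ex (ex (t *\<^sub>R X)) \<eta>"
    have mf: "B X ?W = g c (cinv c (?q s)) (?V X (?q s)) (?V ?W (?q s))" if "?\<gamma> s \<in> fst c" for s
      using metric_fundamental[OF ex_G c(1) that X, of ?W] cinv_chart[OF c(1) that] by (simp add: Ad_ex_self)
    then have "\<forall>\<^sub>F s in at t. B X ?W = g c (cinv c (?q s)) (?V X (?q s)) (?V ?W (?q s))"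
      using ev by (rule eventually_mono[rotated])
    from has_vector_derivative_transform_eventually[OF has_vector_derivative_const this]
    have "((\<lambda>s. g c (cinv c (?q s)) (?V X (?q s)) (?V ?W (?q s))) has_vector_derivative 0) (at t)"
      by this (rule mf[OF c(2)])
    from vector_derivative_unique_at[OF momentum_derivative[OF c(1) q qc P, of ?W] this]
    show "g c (?\<gamma> t) ?acc w + christoffel c g (?\<gamma> t) (velocity c ?\<gamma> t) (velocity c ?\<gamma> t) w = 0"
      using c \<eta> has_velocity_imp_velocity[OF v[OF c(2)]] by simp
  qed
qed

text \<open>Conservation of all momenta lowers the order of the equation: since the Killing form is
  nondegenerate, the momenta determine the velocity as the value of the fundamental field of
  \<open>X\<close>, so the geodesic is an integral curve of that field.\<close>

lemma geodesic_unique: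
  assumes \<gamma>: "geodesic A g \<gamma>" "\<gamma> 0 = ob" and X: "X \<in> \<pp>"
    and v: "\<And>c. c \<in> A \<Longrightarrow> ob \<in> fst c \<Longrightarrow> velocity c \<gamma> 0 = fundamental ex c X ob"
  shows "\<gamma> t = ex (t *\<^sub>R X) ob"
proof -
  have vel: "has_velocity c \<gamma> t (fundamental ex c X (\<gamma> t))" if c: "c \<in> A" "\<gamma> t \<in> fst c" for c t
  proof -
    obtain h where h: "h \<in> G" "h ob = \<gamma> t" using transitive by blast
    have hc: "h ob \<in> fst c" using h c by simp
    obtain \<eta> where \<eta>: "\<eta> \<in> \<pp>" "fundamental ex c (Ad ex h \<eta>) (h ob) = velocity c \<gamma> t"
      using fundamental_point[OF h(1) c(1) hc] by blast
    have "B (Ad ex h \<eta>) W = B X W" for W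
    proof -
      have "B (Ad ex h \<eta>) W = g c (h ob) (velocity c \<gamma> t) (fundamental ex c W (h ob))"
        using metric_fundamental[OF h(1) c(1) hc \<eta>(1), of W] \<eta>(2) by simp
      also have "\<dots> = g c0 ob (fundamental ex c0 X ob) (fundamental ex c0 W ob)"
        using geodesic_momentum[OF \<gamma>(1) c0(1) _ c, of W] c0 \<gamma>(2) v[OF c0] h(2) by simp
      also have "\<dots> = B X W" using metric_fundamental[OF G_id c0(1) _ X, of W] c0 by simp
      finally show ?thesis .
    qed
    then have "Ad ex h \<eta> - X = 0" by (intro killing_eq_0) (simp add: killing_simps)
    then show ?thesis using geodesic_velocity[OF \<gamma>(1) c] \<eta>(2) h(2) by simp
  qed
  \<comment> \<open>Moving an integral curve back along the flow leaves a curve with zero velocity,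
    to which \<open>constant_curve\<close> applies.\<close>
  define \<delta> where "\<delta> t = ex (t *\<^sub>R - X) (\<gamma> t)" for t
  have cont: "continuous_on UNIV \<gamma>" using \<gamma>(1) by (simp add: geodesic_def)
  have ex_cont: "continuous_on UNIV (\<lambda>(X, x). ex X x)" using lie by (simp add: is_lie_algebra_of_def)
  have "\<delta> t = \<delta> 0"
  proof (rule constant_curve)
    have "continuous_on UNIV (\<lambda>t. (\<lambda>(X, x). ex X x) (t *\<^sub>R - X, \<gamma> t))"
      by (rule continuous_on_compose2[OF ex_cont]) (auto intro!: continuous_intros cont)
    then show "continuous_on UNIV \<delta>" by (simp add: \<delta>_def[abs_def])
    fix t d assume d: "d \<in> A" "\<delta> t \<in> fst d"
    obtain c where c: "c \<in> A" "\<gamma> t \<in> fst c" by (rule chart_at)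
    let ?y = "snd c (\<gamma> t)"
    have y: "?y \<in> snd c ` fst c" using c by simp
    note y0 = flow_dom_0[OF c(1) y, of "- X"]
    let ?F = "\<lambda>p. snd c (flow c (- X) p)"
    let ?D = "frechet_derivative ?F (at (0, ?y))"
    have lin: "linear ?D" by (rule has_derivative_linear[OF flow_has_derivative[OF c(1) y0]])
    have shift: "((\<lambda>r. \<gamma> (t + r)) has_vector_derivative w) (at 0)" if "(\<gamma> has_vector_derivative w) (at t)" for w and \<gamma> :: "real \<Rightarrow> 'e"
    proof -
      have "((\<lambda>r. t + r) has_vector_derivative 1) (at 0)" by (auto intro!: derivative_eq_intros)
      from has_vector_derivative_compose[OF this, where f = \<gamma> and f' = "\<lambda>x. x *\<^sub>R w"] that show ?thesis by (simp add: has_vector_derivative_def)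
    qed
    have q: "((\<lambda>r. snd c (\<gamma> (t + r))) has_vector_derivative fundamental ex c X (\<gamma> t)) (at 0)"
      by (rule shift[where \<gamma> = "\<lambda>s. snd c (\<gamma> s)"]) (use vel[OF c] in \<open>simp add: has_velocity_def\<close>)
    have "((\<lambda>r. (r, snd c (\<gamma> (t + r)))) has_vector_derivative (1, fundamental ex c X (\<gamma> t))) (at 0)"
      by (rule has_vector_derivative_Pair[OF _ q]) (auto intro!: derivative_eq_intros)
    from has_vector_derivative_compose[OF this, of ?F ?D] flow_has_derivative[OF c(1) y0]
    have 1: "((\<lambda>r. ?F (r, snd c (\<gamma> (t + r)))) has_vector_derivative ?D (1, fundamental ex c X (\<gamma> t))) (at 0)" by simp
    have "?D (1, fundamental ex c X (\<gamma> t)) = ?D ((1, 0) + (0, fundamental ex c X (\<gamma> t)))" by simp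
    also have "\<dots> = ?D (1, 0) + ?D (0, fundamental ex c X (\<gamma> t))" by (rule linear_add[OF lin])
    also have "?D (1, 0) = - fundamental ex c X (\<gamma> t)"
      using flow_derivative[OF c(1) y, of "- X"] c linear_neg[OF fundamental_linear[OF c]] by simp
    also have "?D (0, u) = u" for u
    proof -
      have "((\<lambda>z. (0::real, z)) has_derivative (\<lambda>v. (0, v))) (at ?y)" by (auto intro!: derivative_eq_intros)
      from has_derivative_compose[OF this flow_has_derivative[OF c(1) y0]]
      have "((\<lambda>z. ?F (0, z)) has_derivative (\<lambda>v. ?D (0, v))) (at ?y)" .
      moreover have "?F (0, z) = z" if "z \<in> snd c ` fst c" for z using c that by (simp add: flow_def)
      ultimately have "((\<lambda>z. z) has_derivative (\<lambda>v. ?D (0, v))) (at ?y)"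
        by (rule has_derivative_transform_within_open[OF _ chart_open(2)[OF c(1)] y])
      from has_derivative_unique[OF this has_derivative_ident] show ?thesis by (rule fun_cong)
    qed
    finally have D0: "?D (1, fundamental ex c X (\<gamma> t)) = 0" by simp
    have sh: "isCont (\<lambda>r. t + r) 0" by (intro continuous_intros)
    have "isCont (\<lambda>r. \<gamma> (t + r)) 0" using cont by (intro isCont_o2[OF sh]) (simp add: continuous_on_eq_continuous_at)
    then have sc: "\<forall>\<^sub>F r in at 0. \<gamma> (t + r) \<in> fst c"
      using topological_tendstoD[of _ _ "at 0" "fst c"] chart_open(1)[OF c(1)] c(2) by (fastforce simp: isCont_def)
    have "continuous_on UNIV (\<lambda>r. (\<lambda>(X, x). ex X x) (r *\<^sub>R - X, \<gamma> (t + r)))"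
      by (rule continuous_on_compose2[OF ex_cont]) (auto intro!: continuous_intros continuous_on_compose2[OF cont])
    then have ic: "isCont (\<lambda>r. ex (r *\<^sub>R - X) (\<gamma> (t + r))) 0" by (simp add: continuous_on_eq_continuous_at)
    have "\<forall>\<^sub>F r in at 0. ?F (r, snd c (\<gamma> (t + r))) = snd c (ex (r *\<^sub>R - X) (\<gamma> (t + r)))"
      using sc by (rule eventually_mono) (use c in \<open>simp add: flow_def\<close>)
    from has_vector_derivative_transform_eventually[OF 1 this]
    have "has_velocity c (\<lambda>r. ex (r *\<^sub>R - X) (\<gamma> (t + r))) 0 0"
      using ic c D0 by (simp add: has_velocity_def flow_def)
    from has_velocity_self[OF this c(1) G_smooth[OF ex_G[of "t *\<^sub>R - X"]] d(1)]
    have "has_velocity d (\<lambda>r. ex (t *\<^sub>R - X) (ex (r *\<^sub>R - X) (\<gamma> (t + r)))) 0 (chart_deriv c (snd d \<circ> ex (t *\<^sub>R - X)) (\<gamma> t) 0)"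
      using d(2) by (simp add: \<delta>_def)
    also have "chart_deriv c (snd d \<circ> ex (t *\<^sub>R - X)) (\<gamma> t) 0 = 0"
      by (rule linear_0[OF chart_deriv_G_linear[OF ex_G c(1) d(1) c(2)]]) (use d(2) in \<open>simp add: \<delta>_def\<close>)
    also have "(\<lambda>r. ex (t *\<^sub>R - X) (ex (r *\<^sub>R - X) (\<gamma> (t + r)))) = (\<lambda>r. \<delta> (t + r))"
      unfolding \<delta>_def ex_add by (rule refl)
    finally show "has_velocity d \<delta> t 0" by (rule has_velocity_shift)
  qed
  then have "ex (- (t *\<^sub>R X)) (\<gamma> t) = ob" using \<gamma>(2) by (simp add: \<delta>_def)
  then show ?thesis by (metis ex_minus(2))
qed

lemma Exp_at_eq: assumes X: "X \<in> \<pp>" shows "Exp_at A g ex ob X = ex X ob"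
  unfolding Exp_at_def riemannian_exp_def
proof (rule the_equality)
  have "velocity c (\<lambda>t. ex (t *\<^sub>R X) ob) 0 = fundamental ex c X ob" for c :: "('m, 'e) chart" by (simp add: fundamental_def)
  then show "\<exists>\<gamma>. geodesic A g \<gamma> \<and> \<gamma> 0 = ob \<and> (\<forall>c\<in>A. ob \<in> fst c \<longrightarrow> velocity c \<gamma> 0 = fundamental ex c X ob) \<and> \<gamma> 1 = ex X ob"
    using ex_geodesic[OF X] by (intro exI[of _ "\<lambda>t. ex (t *\<^sub>R X) ob"]) simp
  fix y assume "\<exists>\<gamma>. geodesic A g \<gamma> \<and> \<gamma> 0 = ob \<and> (\<forall>c\<in>A. ob \<in> fst c \<longrightarrow> velocity c \<gamma> 0 = fundamental ex c X ob) \<and> \<gamma> 1 = y"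
  then obtain \<gamma> where \<gamma>: "geodesic A g \<gamma>" "\<gamma> 0 = ob" "\<And>c. c \<in> A \<Longrightarrow> ob \<in> fst c \<Longrightarrow> velocity c \<gamma> 0 = fundamental ex c X ob" "\<gamma> 1 = y"
    by blast
  from geodesic_unique[OF \<gamma>(1,2) X \<gamma>(3), of 1] show "y = ex X ob" using \<gamma>(4) by simp
qed

end

section \<open>Compactness of the isotropy group\<close>

context symmetric_space
begin

text \<open>A connected set stays connected when a point of its closure is added, here for pointwise
  convergence; so the limit lies in the same component.\<close>

lemma G_closed:
  assumes "k \<in> isometries A g" "\<And>n. f n \<in> G" "\<And>x. (\<lambda>n::nat. f n x) \<longlonglongrightarrow> k x" shows "k \<in> G"
proof -
  have "f \<longlonglongrightarrow> k"
    using assms(3) limitin_componentwise[of "\<lambda>_. euclidean" UNIV f k sequentially] by (simp add: euclidean_product_topology)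
  moreover have "\<forall>\<^sub>F n in sequentially. f n \<in> closure G" using assms(2) closure_subset by (intro always_eventually) blast
  ultimately have "k \<in> closure G" by (rule Lim_in_closed_set[OF closed_closure _ sequentially_bot, rotated])
  then have "connected (insert k G)"
    by (intro connected_intermediate_closure[OF G_connected]) (auto intro: closure_subset[THEN subsetD])
  then have "insert k G \<subseteq> G"
    by (rule G_maximal) (use assms(1) G_subset G_id in auto)
  then show ?thesis by blast
qed

lemma exp_continuous: "continuous_on UNIV (\<lambda>p. ex (fst p) (snd p))"
  using lie by (simp add: is_lie_algebra_of_def case_prod_beta)

lemma ex_tendsto:
  assumes "(X \<longlongrightarrow> X') F" "(x \<longlongrightarrow> x') F" shows "((\<lambda>n. ex (X n) (x n)) \<longlongrightarrow> ex X' x') F"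
proof -
  have "isCont (\<lambda>p. ex (fst p) (snd p)) (X', x')" using exp_continuous by (simp add: continuous_on_eq_continuous_at)
  then have "((\<lambda>n. ex (fst (X n, x n)) (snd (X n, x n))) \<longlongrightarrow> ex (fst (X', x')) (snd (X', x'))) F"
    by (rule isCont_tendsto_compose) (rule tendsto_Pair[OF assms])
  then show ?thesis by simp
qed

text \<open>A map known only as a limit is recovered from a limit \<open>T\<close> of adjoint
  operators: in exponential coordinates it is linear, hence smooth with smooth inverse. The relation
  with translations moves the metric to the base point, where it is the orthogonality of
  \<open>T\<close>.\<close>

lemma isometry_of_limit:
  assumes T: "linear T" "\<And>X. X \<in> \<pp> \<Longrightarrow> T X \<in> \<pp>" "\<And>X Y. ip (T X) (T Y) = ip X Y"
    and T': "linear T'" "\<And>X. X \<in> \<pp> \<Longrightarrow> T' X \<in> \<pp>" "\<And>X. T' (T X) = X" "\<And>X. T (T' X) = X"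
    and k: "\<And>X. X \<in> \<pp> \<Longrightarrow> k (ex X ob) = ex (T X) ob" and eq: "\<And>W x. k (ex W x) = ex (T W) (k x)"
  shows "k \<in> isometries A g" "k ob = ob" "inv k (k x) = x" "k (inv k x) = x"
proof -
  show kob: "k ob = ob" using k[OF subspace_0[OF subspace_p]] by (simp add: linear_0[OF T(1)])
  define k' where "k' x = ex (T' (lift (Lg x))) ob" for x
  have kx: "k x = ex (T (lift (Lg x))) ob" for x using k[OF lift_p, of "Lg x"] by (simp add: ex_lift_Lg)
  have k'k: "k' (k x) = x" for x
    unfolding k'_def kx using Lg_ex[OF T(2)[OF lift_p]] lift_tang_p[OF T(2)[OF lift_p]] T'(3) by (simp add: ex_lift_Lg)
  have kk': "k (k' x) = x" for x
    unfolding k'_def kx using Lg_ex[OF T'(2)[OF lift_p]] lift_tang_p[OF T'(2)[OF lift_p]] T'(4) by (simp add: ex_lift_Lg)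
  have "k' = inv k" using inv_equality[of k' k] k'k kk' by metis
  then show "inv k (k x) = x" "k (inv k x) = x" using k'k kk' by auto
  have bij: "bij k" by (rule o_bij[of k']) (auto simp: k'k kk')
  have smooth: "smooth_self A (\<lambda>x. ex (S (lift (Lg x))) ob)" if S: "linear S" for S
  proof -
    have "Ck_into A j (snd c ` fst c) (\<lambda>y. ex (S (lift (Lg (cinv c y)))) ob)" if c: "c \<in> A" for c j
    proof (rule Ck_into_ex[OF chart_open(2)[OF c] _ Ck_into_const])
      have 1: "Ck_on j (snd c ` fst c) (\<lambda>y. Lg (cinv c y))"
        by (rule Ck_fun_compose[OF chart_open(2)[OF c] Lg_Ck Ck_into_cinv[OF c]])
      have 2: "bounded_linear (\<lambda>u. S (lift u))"
        using linear_compose[OF lift_linear S] by (simp add: linear_conv_bounded_linear comp_def)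
      show "Ck_on j (snd c ` fst c) (\<lambda>y. S (lift (Lg (cinv c y))))"
        by (rule Ck_on_bounded_linear[OF 2 chart_open(2)[OF c] 1])
    qed
    moreover have "continuous_on UNIV (\<lambda>x. ex (S (lift (Lg x))) ob)"
      unfolding continuous_on_eq_continuous_at[OF open_UNIV]
    proof
      fix x :: 'm
      obtain c where c: "c \<in> A" "x \<in> fst c" by (rule chart_at)
      have "continuous_on (snd c ` fst c) (\<lambda>y. ex (S (lift (Lg (cinv c y)))) ob)"
        using calculation[OF c(1), of 0] by (simp add: Ck_into_def)
      then have "continuous_on (fst c) (\<lambda>x. ex (S (lift (Lg (cinv c (snd c x))))) ob)"
        by (rule continuous_on_compose2[OF _ chart_continuous[OF c(1)]]) simp
      then have "continuous_on (fst c) (\<lambda>x. ex (S (lift (Lg x))) ob)"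
        by (rule continuous_on_eq) (use c in simp)
      then show "isCont (\<lambda>x. ex (S (lift (Lg x))) ob) x"
        using c chart_open(1) by (simp add: continuous_on_eq_continuous_at)
    qed
    ultimately show ?thesis by (simp add: smooth_self_iff)
  qed
  have sk: "smooth_self A k" using smooth[OF T(1)] kx by presburger
  have sk': "smooth_self A (inv k)" using smooth[OF T'(1)] \<open>k' = inv k\<close> k'_def by presburger
  have "preserves_metric A g k"
    unfolding preserves_metric_def
  proof (intro ballI impI allI)
    fix c d x u w assume c: "c \<in> A" "d \<in> A" "x \<in> fst c" "k x \<in> fst d"
    let ?W = "lift (Lg x)"
    have x: "ex ?W ob = x" by (rule ex_lift_Lg)
    have xc: "ex ?W ob \<in> fst c" using x c by simp
    have eqf: "k \<circ> ex ?W = ex (T ?W) \<circ> k" using eq by auto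
    have kxd: "ex (T ?W) ob \<in> fst d" using c(4) kx by simp
    have kc0: "k ob \<in> fst c0" using kob c0 by simp
    have d0: "chart_deriv c0 (snd c0 \<circ> k) ob (fundamental ex c0 X ob) = fundamental ex c0 (T X) ob" if X: "X \<in> \<pp>" for X
    proof -
      have "k (ex 0 ob) \<in> fst c0" using kc0 by simp
      with has_velocity_self[OF fundamental_velocity[OF c0, of X] c0(1) sk c0(1)]
      have "has_velocity c0 (\<lambda>t. k (ex (t *\<^sub>R X) ob)) 0 (chart_deriv c0 (snd c0 \<circ> k) ob (fundamental ex c0 X ob))" by simp
      moreover have "k (ex (t *\<^sub>R X) ob) = ex (t *\<^sub>R T X) ob" for t
        using k[OF subspace_scale[OF subspace_p X]] by (simp add: linear_scale[OF T(1)])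
      ultimately show ?thesis using fundamental_velocity[OF c0, of "T X"] has_velocity_unique by simp
    qed
    have dk: "\<exists>X\<in>\<pp>. u = chart_deriv c0 (snd c \<circ> ex ?W) ob (fundamental ex c0 X ob) \<and>
      chart_deriv c (snd d \<circ> k) x u = chart_deriv c0 (snd d \<circ> ex (T ?W)) ob (fundamental ex c0 (T X) ob)" for u
    proof -
      obtain X where X: "X \<in> \<pp>" "fundamental ex c (Ad ex (ex ?W) X) (ex ?W ob) = u" using fundamental_point[OF ex_G c(1) xc] by blast
      have u: "u = chart_deriv c0 (snd c \<circ> ex ?W) ob (fundamental ex c0 X ob)"
        using fundamental_Ad[OF ex_G c0(1) c(1) c0(2) xc] X(2) by simp
      have "k (ex ?W ob) \<in> fst d" using c(4) x by simp
      from chart_deriv_comp[OF c0(1) c(1,2) c0(2) xc this G_smooth[OF ex_G] sk, of "fundamental ex c0 X ob"]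
      have "chart_deriv c (snd d \<circ> k) x u = chart_deriv c0 (snd d \<circ> (k \<circ> ex ?W)) ob (fundamental ex c0 X ob)"
        unfolding u[symmetric] x by (rule sym)
      also have "\<dots> = chart_deriv c0 (snd d \<circ> (ex (T ?W) \<circ> k)) ob (fundamental ex c0 X ob)" unfolding eqf by (rule refl)
      also have "\<dots> = chart_deriv c0 (snd d \<circ> ex (T ?W)) (k ob) (chart_deriv c0 (snd c0 \<circ> k) ob (fundamental ex c0 X ob))"
        by (rule chart_deriv_comp[OF c0(1) c0(1) c(2) c0(2) kc0 _ sk G_smooth[OF ex_G]]) (use kxd kob in simp)
      finally show ?thesis using u X(1) d0[OF X(1)] kob by auto
    qed
    obtain X where X: "X \<in> \<pp>" "u = chart_deriv c0 (snd c \<circ> ex ?W) ob (fundamental ex c0 X ob)"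
      "chart_deriv c (snd d \<circ> k) x u = chart_deriv c0 (snd d \<circ> ex (T ?W)) ob (fundamental ex c0 (T X) ob)" using dk by blast
    obtain Y where Y: "Y \<in> \<pp>" "w = chart_deriv c0 (snd c \<circ> ex ?W) ob (fundamental ex c0 Y ob)"
      "chart_deriv c (snd d \<circ> k) x w = chart_deriv c0 (snd d \<circ> ex (T ?W)) ob (fundamental ex c0 (T Y) ob)" using dk by blast
    have "g d (k x) (chart_deriv c (snd d \<circ> k) x u) (chart_deriv c (snd d \<circ> k) x w) = g c0 ob (fundamental ex c0 (T X) ob) (fundamental ex c0 (T Y) ob)"
      unfolding X(3) Y(3) kx by (rule G_metric[OF ex_G c0(1) c(2) c0(2) kxd])
    also have "\<dots> = ip X Y" using fundamental_g[OF c0 T(2)[OF X(1)] T(2)[OF Y(1)]] T(3) by simp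
    also have "\<dots> = g c0 ob (fundamental ex c0 X ob) (fundamental ex c0 Y ob)" by (rule fundamental_g[OF c0 X(1) Y(1), symmetric])
    also have "\<dots> = g c (ex ?W ob) u w" unfolding X(2) Y(2) by (rule G_metric[OF ex_G c0(1) c(1) c0(2) xc, symmetric])
    finally show "g d (k x) (chart_deriv c (snd d \<circ> k) x u) (chart_deriv c (snd d \<circ> k) x w) = g c x u w" unfolding x .
  qed
  then show "k \<in> isometries A g" using bij sk sk' by (simp add: isometries_def)
qed

text \<open>Passing to the limit in the adjointness of Ad(k) and Ad(k^-1) shows that
  \<open>T'\<close> inverts \<open>T\<close>. The map defined by \<open>T\<close> in exponential
  coordinates is then the pointwise limit of the \<open>k n\<close>.\<close>

lemma K_limit:
  assumes k: "\<And>n. k n \<in> K" and T: "\<And>Y. (\<lambda>n::nat. Ad ex (k n) Y) \<longlonglongrightarrow> T Y" and T': "\<And>Y. (\<lambda>n. Ad ex (inv (k n)) Y) \<longlonglongrightarrow> T' Y"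
  shows "\<exists>h\<in>K. \<forall>Y. Ad ex h Y = T Y"
proof -
  note tip = bounded_bilinear.tendsto[OF ip_bounded_bilinear]
  have lim: "linear S" "\<And>X. X \<in> \<pp> \<Longrightarrow> S X \<in> \<pp>" "\<And>X Y. ip (S X) (S Y) = ip X Y"
    if h: "\<And>n. h n \<in> K" and S: "\<And>Y. (\<lambda>n::nat. Ad ex (h n) Y) \<longlonglongrightarrow> S Y" for h S
  proof -
    note l = Ad_linear[OF K_G[OF h]]
    show "linear S"
    proof (rule linearI)
      show "S (X + Y) = S X + S Y" for X Y
        using tendsto_add[OF S[of X] S[of Y]] S[of "X + Y"] by (simp add: linear_add[OF l] LIMSEQ_unique)
      show "S (t *\<^sub>R X) = t *\<^sub>R S X" for t X
        using tendsto_scaleR[OF tendsto_const S[of X], of t] S[of "t *\<^sub>R X"] by (simp add: linear_scale[OF l] LIMSEQ_unique)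
    qed
    show "S X \<in> \<pp>" if "X \<in> \<pp>" for X
      using closed_sequentially[OF closed_subspace[OF subspace_p] _ S[of X]] Ad_K_p[OF h that] by simp
    show "ip (S X) (S Y) = ip X Y" for X Y
      using tip[OF S[of X] S[of Y]] by (simp add: Ad_K_ip[OF h] LIMSEQ_const_iff)
  qed
  note T1 = lim[of k, OF k T] and T2 = lim[of "\<lambda>n. inv (k n)", OF K_inv[OF k] T']
  have adj: "ip (T' X) Y = ip X (T Y)" for X Y
  proof -
    have "ip (Ad ex (inv (k n)) X) Y = ip X (Ad ex (k n) Y)" for n
      using Ad_K_ip[OF k, of n "Ad ex (inv (k n)) X" Y] K_G[OF k] by simp
    then have "(\<lambda>n. ip (Ad ex (inv (k n)) X) Y) \<longlonglongrightarrow> ip X (T Y)" using tip[OF tendsto_const T] by simp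
    then show ?thesis using tip[OF T' tendsto_const] LIMSEQ_unique by blast
  qed
  have "ip (T' (T X) - X) Y = 0" "ip Y (T (T' X) - X) = 0" for X Y
    using adj[of "T X" Y] adj[of Y "T' X"] T1(3) T2(3) by (simp_all add: form.form_simps)
  then have inv: "T' (T X) = X" "T (T' X) = X" for X
    using form.eq_0_iff[of "T' (T X) - X"] form.eq_0_iff[of "T (T' X) - X"] by auto
  define h where "h x = ex (T (lift (Lg x))) ob" for x
  have kn: "k n x = ex (Ad ex (k n) (lift (Lg x))) ob" for n x
    using Ad_apply1[OF K_G[OF k], of n "lift (Lg x)" ob] K_ob[OF k] by (simp add: ex_lift_Lg)
  have hlim: "(\<lambda>n. k n x) \<longlonglongrightarrow> h x" for x
  proof -
    have "(\<lambda>n. ex (Ad ex (k n) (lift (Lg x))) ob) \<longlonglongrightarrow> ex (T (lift (Lg x))) ob" by (rule ex_tendsto[OF T tendsto_const])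
    then show ?thesis unfolding h_def by (rule Lim_transform_eventually) (simp add: kn[of _ x, symmetric])
  qed
  have eq: "h (ex W x) = ex (T W) (h x)" for W x
  proof -
    have "(\<lambda>n. ex (Ad ex (k n) W) (k n x)) \<longlonglongrightarrow> ex (T W) (h x)" by (rule ex_tendsto[OF T hlim])
    then have "(\<lambda>n. k n (ex W x)) \<longlonglongrightarrow> ex (T W) (h x)" by (simp add: Ad_apply1[OF K_G[OF k]])
    then show ?thesis using hlim[of "ex W x"] LIMSEQ_unique by blast
  qed
  have hX: "h (ex X ob) = ex (T X) ob" if "X \<in> \<pp>" for X
    using that by (simp add: h_def Lg_ex lift_tang_p)
  note iso = isometry_of_limit[OF T1 T2(1,2) inv hX eq]
  have hG: "h \<in> G" by (rule G_closed[OF iso(1) K_G[OF k] hlim])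
  then have "h \<in> K" using iso(2) by (simp add: stabilizer_def)
  moreover have "Ad ex h Y = T Y" for Y
  proof (rule Ad_eqI[OF hG], rule ext)
    fix t x
    show "ex (t *\<^sub>R T Y) x = (h \<circ> ex (t *\<^sub>R Y) \<circ> inv h) x"
      using eq[of "t *\<^sub>R Y" "inv h x"] iso(4)[of x] by (simp add: linear_scale[OF T1(1)])
  qed
  ultimately show ?thesis by blast
qed

text \<open>The isotropy group acts by isometries of the inner product, so its operators are
  bounded. The subsequence is chosen jointly for the elements and their inverses, because
  \<open>K_limit\<close> uses both limits.\<close>

lemma K_subsequence:
  assumes k: "\<And>n::nat. k n \<in> K"
  shows "\<exists>h\<in>K. \<exists>\<rho>::nat \<Rightarrow> nat. strict_mono \<rho> \<and> (\<forall>Y. (\<lambda>n. Ad ex (k (\<rho> n)) Y) \<longlonglongrightarrow> Ad ex h Y)"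
proof -
  obtain m where m: "m > 0" "\<And>v. m * (norm v)\<^sup>2 \<le> ip v v" using form.norm_bound by blast
  obtain M where M: "M > 0" "\<And>a b. norm (ip a b) \<le> norm a * norm b * M"
    using bounded_bilinear.pos_bounded[OF ip_bounded_bilinear] by blast
  have bound: "norm (Ad ex h Y) \<le> sqrt (M / m) * norm Y" if h: "h \<in> K" for h Y
  proof -
    have "m * (norm (Ad ex h Y))\<^sup>2 \<le> ip (Ad ex h Y) (Ad ex h Y)" by (rule m(2))
    also have "\<dots> \<le> norm Y * norm Y * M" using M(2)[of Y Y] by (simp add: Ad_K_ip[OF h])
    finally have "(norm (Ad ex h Y))\<^sup>2 \<le> M / m * (norm Y)\<^sup>2" using m(1) by (simp add: field_simps power2_eq_square)
    then have "norm (Ad ex h Y) \<le> sqrt (M / m * (norm Y)\<^sup>2)" by (rule real_le_rsqrt)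
    then show ?thesis by (simp add: real_sqrt_mult real_sqrt_divide)
  qed
  define F where "F h = Blinfun (Ad ex h)" for h
  have F: "blinfun_apply (F h) = Ad ex h" if "h \<in> K" for h
    unfolding F_def by (rule bounded_linear_Blinfun_apply[OF Ad_bounded_linear[OF K_G[OF that]]])
  have Fb: "norm (F h) \<le> sqrt (M / m)" if "h \<in> K" for h
    by (rule norm_blinfun_bound) (use M(1) m(1) bound[OF that] F[OF that] in auto)
  have "bounded (range (\<lambda>n. (F (k n), F (inv (k n)))))"
  proof (rule boundedI)
    fix z assume "z \<in> range (\<lambda>n. (F (k n), F (inv (k n))))"
    then obtain n where z: "z = (F (k n), F (inv (k n)))" by blast
    have "norm z \<le> norm (F (k n)) + norm (F (inv (k n)))" unfolding z by (rule norm_Pair_le)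
    also have "\<dots> \<le> sqrt (M / m) + sqrt (M / m)" by (intro add_mono Fb k K_inv)
    finally show "norm z \<le> sqrt (M / m) + sqrt (M / m)" .
  qed
  then obtain l \<rho> where \<rho>: "strict_mono \<rho>" "((\<lambda>n. (F (k n), F (inv (k n)))) \<circ> \<rho>) \<longlonglongrightarrow> l"
    using bounded_imp_convergent_subsequence by blast
  have l: "(\<lambda>n. F (k (\<rho> n))) \<longlonglongrightarrow> fst l" "(\<lambda>n. F (inv (k (\<rho> n)))) \<longlonglongrightarrow> snd l"
    using tendsto_fst[OF \<rho>(2)] tendsto_snd[OF \<rho>(2)] by (simp_all add: comp_def)
  have 1: "(\<lambda>n. Ad ex (k (\<rho> n)) Y) \<longlonglongrightarrow> fst l Y" "(\<lambda>n. Ad ex (inv (k (\<rho> n))) Y) \<longlonglongrightarrow> snd l Y" for Y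
    using blinfun.tendsto[OF l(1) tendsto_const, of Y] blinfun.tendsto[OF l(2) tendsto_const, of Y] F[OF k] F[OF K_inv[OF k]] by simp_all
  from K_limit[of "\<lambda>n. k (\<rho> n)", OF k 1] obtain h where "h \<in> K" "\<forall>Y. Ad ex h Y = fst l Y" by blast
  moreover have "\<forall>Y. (\<lambda>n. Ad ex (k (\<rho> n)) Y) \<longlonglongrightarrow> Ad ex h Y" using 1(1) calculation(2) by simp
  ultimately show ?thesis using \<rho>(1) by blast
qed

lemma orbit_compact: "compact ((\<lambda>k. Ad ex k X) ` K)"
  unfolding compact_eq_seq_compact_metric seq_compact_def
proof (intro allI impI)
  fix f :: "nat \<Rightarrow> 'g" assume "\<forall>n. f n \<in> (\<lambda>k. Ad ex k X) ` K"
  then have "\<forall>n. \<exists>k. k \<in> K \<and> f n = Ad ex k X" by blast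
  then obtain k where k: "\<And>n. k n \<in> K" "\<And>n. f n = Ad ex (k n) X" by metis
  obtain h \<rho> where h: "h \<in> K" "strict_mono \<rho>" "\<forall>Y. (\<lambda>n. Ad ex (k (\<rho> n)) Y) \<longlonglongrightarrow> Ad ex h Y"
    using K_subsequence[of k, OF k(1)] by blast
  then show "\<exists>l\<in>(\<lambda>k. Ad ex k X) ` K. \<exists>\<rho>. strict_mono \<rho> \<and> (f \<circ> \<rho>) \<longlonglongrightarrow> l"
    using k(2) by (auto simp: comp_def intro!: bexI[of _ h] exI[of _ \<rho>])
qed

end

section \<open>Hermitian symmetric spaces\<close>

locale hermitian_space = symmetric_space A g ex br J ob \<theta> \<zeta> + hermitian_algebra br \<theta> \<zeta> a e
  for A :: "('m::{t2_space,second_countable_topology}, 'e::euclidean_space) chart set"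
    and g :: "('m, 'e) metric_tensor" and ex :: "'g::euclidean_space \<Rightarrow> 'm \<Rightarrow> 'm" and br
    and J :: "('m, 'e) endo_tensor" and ob :: 'm and \<theta> :: "'g \<Rightarrow> 'g" and \<zeta> :: 'g
    and a :: "'g set" and e :: "nat \<Rightarrow> 'g \<Rightarrow> real"
begin

text \<open>The functional given by a regular element \<open>H\<close> has a maximum on the compact
  orbit, at \<open>Y\<close> say. Stationarity under the isotropy algebra makes [Y, H], which lies
  in k, orthogonal to k; so Y commutes with H and lies in \<open>a\<close>.\<close>

theorem Ad_K_flat:
  assumes X: "X \<in> \<pp>" shows "\<exists>k\<in>K. \<exists>x. X = Ad ex k (flat x)"
proof -
  obtain H where H: "regular H" using regular_exists by blast
  have Ha: "H \<in> a" using H by (simp add: regular_def)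
  have "continuous_on ((\<lambda>k. Ad ex k X) ` K) (\<lambda>Y. ip Y H)"
    by (intro bounded_bilinear.continuous_on[OF ip_bounded_bilinear] continuous_on_id continuous_on_const)
  moreover have "(\<lambda>k. Ad ex k X) ` K \<noteq> {}" using K_id by blast
  ultimately obtain Y where "Y \<in> (\<lambda>k. Ad ex k X) ` K" "\<forall>Z\<in>(\<lambda>k. Ad ex k X) ` K. ip Z H \<le> ip Y H"
    using continuous_attains_sup[OF orbit_compact] by blast
  then obtain k where k: "k \<in> K" and mx: "\<And>h. h \<in> K \<Longrightarrow> ip (Ad ex h X) H \<le> ip (Ad ex k X) H" by auto
  define Y where "Y = Ad ex k X"
  have Y: "Y \<in> \<pp>" unfolding Y_def by (rule Ad_K_p[OF k X])
  have "ip Z (br Y H) = 0" if Z: "Z \<in> \<kk>" for Z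
  proof -
    have "((\<lambda>t. Ad ex (ex (t *\<^sub>R Z)) Y) has_vector_derivative Ad ex (ex (0 *\<^sub>R Z)) (br Z Y)) (at 0)" by (rule Ad_derivative)
    from bounded_bilinear.has_vector_derivative[OF ip_bounded_bilinear this has_vector_derivative_const]
    have "((\<lambda>t. ip (Ad ex (ex (t *\<^sub>R Z)) Y) H) has_real_derivative ip (br Z Y) H) (at 0)"
      by (simp add: has_real_derivative_iff_has_vector_derivative ex_0[abs_def] flip: id_def)
    moreover have "ip (Ad ex (ex (t *\<^sub>R Z)) Y) H \<le> ip (Ad ex (ex (0 *\<^sub>R Z)) Y) H" for t
    proof -
      have kt: "ex (t *\<^sub>R Z) \<in> K" by (rule ex_k_K[OF subspace_scale[OF subspace_k Z]])
      have "ip (Ad ex (ex (t *\<^sub>R Z) \<circ> k) X) H \<le> ip Y H" unfolding Y_def by (rule mx[OF K_comp[OF kt k]])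
      then show ?thesis using Ad_comp[OF ex_G K_G[OF k], of "t *\<^sub>R Z" X] by (simp add: Y_def ex_0[abs_def] flip: id_def)
    qed
    ultimately have "ip (br Z Y) H = 0" by (intro DERIV_local_max[of _ _ 0 1]) auto
    moreover have "br Z Y = - br Y Z" by (rule br_anti)
    ultimately show ?thesis by (simp add: form.form_simps ip_br_p[OF Y])
  qed
  from this[OF br_pp[OF Y a_p[OF Ha]]] have "br Y H = 0" by (simp add: form.eq_0_iff)
  then have "br H Y = 0" using br_anti[of H Y] by simp
  then have "Y \<in> a" by (rule regular_centralizer[OF H Y])
  then have "Ad ex (inv k) (flat (\<lambda>i. e i Y)) = X" using a_flat K_G[OF k] by (simp add: Y_def)
  then show ?thesis using K_inv[OF k] by blast
qed

lemma point_flat: "\<exists>k\<in>K. \<exists>x. p = k (ex (flat x) ob)"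
proof -
  obtain k x where kx: "k \<in> K" "lift (Lg p) = Ad ex k (flat x)" using Ad_K_flat[OF lift_p] by blast
  have "p = ex (Ad ex k (flat x)) ob" using ex_lift_Lg[of p] kx(2) by simp
  then show ?thesis using ex_Ad_K[OF kx(1)] kx(1) by metis
qed

end

section \<open>The radial maps\<close>

context hermitian_space
begin

lemma Ad_ex_root_pair:
  assumes rp: "root_pair \<mu> Y W" and H: "H \<in> a"
  shows "Ad ex (ex H) Y = cosh (\<mu> H) *\<^sub>R Y + sinh (\<mu> H) *\<^sub>R W"
    "Ad ex (ex H) W = sinh (\<mu> H) *\<^sub>R Y + cosh (\<mu> H) *\<^sub>R W"
proof -
  note b = root_pairD(3,4)[OF rp H] and l = Ad_linear[OF ex_G, of H]
  have "br H (Y + W) = \<mu> H *\<^sub>R (Y + W)" "br H (Y - W) = (- \<mu> H) *\<^sub>R (Y - W)"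
    by (simp_all add: br_simps b algebra_simps)
  from Ad_eigenvector[OF this(1), of 1] Ad_eigenvector[OF this(2), of 1]
  have E: "Ad ex (ex H) (Y + W) = exp (\<mu> H) *\<^sub>R (Y + W)" "Ad ex (ex H) (Y - W) = exp (- \<mu> H) *\<^sub>R (Y - W)" by simp_all
  have c: "2 * cosh (\<mu> H) = exp (\<mu> H) + exp (- \<mu> H)" "2 * sinh (\<mu> H) = exp (\<mu> H) - exp (- \<mu> H)"
    by (simp_all add: cosh_field_def sinh_field_def)
  have "2 *\<^sub>R Ad ex (ex H) Y = Ad ex (ex H) (Y + W) + Ad ex (ex H) (Y - W)"
    by (simp add: linear_add[OF l] linear_diff[OF l] scaleR_2)
  also have "\<dots> = (2 * cosh (\<mu> H)) *\<^sub>R Y + (2 * sinh (\<mu> H)) *\<^sub>R W"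
    unfolding E c by (simp add: algebra_simps)
  also have "\<dots> = 2 *\<^sub>R (cosh (\<mu> H) *\<^sub>R Y + sinh (\<mu> H) *\<^sub>R W)" by (simp add: scaleR_add_right)
  finally show "Ad ex (ex H) Y = cosh (\<mu> H) *\<^sub>R Y + sinh (\<mu> H) *\<^sub>R W" by simp
  have "2 *\<^sub>R Ad ex (ex H) W = Ad ex (ex H) (Y + W) - Ad ex (ex H) (Y - W)"
    by (simp add: linear_add[OF l] linear_diff[OF l] scaleR_2)
  also have "\<dots> = (2 * sinh (\<mu> H)) *\<^sub>R Y + (2 * cosh (\<mu> H)) *\<^sub>R W"
    unfolding E c by (simp add: algebra_simps)
  also have "\<dots> = 2 *\<^sub>R (sinh (\<mu> H) *\<^sub>R Y + cosh (\<mu> H) *\<^sub>R W)" by (simp add: scaleR_add_right)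
  finally show "Ad ex (ex H) W = sinh (\<mu> H) *\<^sub>R Y + cosh (\<mu> H) *\<^sub>R W" by simp
qed

text \<open>The element \<open>\<zeta>\<close> plus half the sum of the \<open>Wt i\<close> commutes
  with \<open>a\<close>, since the root 2 e_i of \<open>Wt i\<close> compensates the action of
  \<open>\<zeta>\<close>. So only the \<open>Wt i\<close> move, each by a hyperbolic rotation of
  argument 2 x_i.\<close>

lemma Ad_ex_flat_zeta:
  "Ad ex (ex (flat x)) \<zeta> = \<zeta> + (\<Sum>i=1..r. ((1 - cosh (2 * x i)) / 2) *\<^sub>R Wt i) - (\<Sum>i=1..r. (sinh (2 * x i) / 2) *\<^sub>R JJ (Ht i))"
proof -
  note l = Ad_linear[OF ex_G, of "flat x"]
  let ?R = "\<zeta> + (\<Sum>i=1..r. (1/2) *\<^sub>R Wt i)"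
  have "br (flat x) ?R = - JJ (flat x) + (\<Sum>i=1..r. (1/2) *\<^sub>R br (flat x) (Wt i))"
    using br_anti[of "flat x" \<zeta>] by (simp only: linear_add[OF bracket_right] linear_sum[OF bracket_right] linear_scale[OF bracket_right])
  also have "(\<Sum>i=1..r. (1/2) *\<^sub>R br (flat x) (Wt i)) = (\<Sum>i=1..r. x i *\<^sub>R JJ (Ht i))"
    by (rule sum.cong) (simp_all only: Ht_J_Ht(2)[OF _ flat_a] e_flat, simp)
  finally have "br (flat x) ?R = 0" by (simp add: J_flat)
  then have R: "Ad ex (ex (flat x)) ?R = ?R" by (rule Ad_commuting)
  have W: "Ad ex (ex (flat x)) (Wt i) = sinh (2 * x i) *\<^sub>R JJ (Ht i) + cosh (2 * x i) *\<^sub>R Wt i" if "i \<in> {1..r}" for i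
    using Ad_ex_root_pair(2)[OF Ht_root_pair[OF that] flat_a, of x] e_flat[OF that] by simp
  have "Ad ex (ex (flat x)) \<zeta> = Ad ex (ex (flat x)) (?R - (\<Sum>i=1..r. (1/2) *\<^sub>R Wt i))" by simp
  also have "\<dots> = ?R - (\<Sum>i=1..r. (1/2) *\<^sub>R Ad ex (ex (flat x)) (Wt i))"
    by (simp only: linear_diff[OF l] R linear_sum[OF l] linear_scale[OF l])
  also have "(\<Sum>i=1..r. (1/2) *\<^sub>R Ad ex (ex (flat x)) (Wt i)) =
      (\<Sum>i=1..r. (1/2) *\<^sub>R (sinh (2 * x i) *\<^sub>R JJ (Ht i) + cosh (2 * x i) *\<^sub>R Wt i))"
    by (rule sum.cong) (simp_all only: W)
  also have "?R - \<dots> = \<zeta> + ((\<Sum>i=1..r. (1/2) *\<^sub>R Wt i) - (\<Sum>i=1..r. (cosh (2 * x i) / 2) *\<^sub>R Wt i)) - (\<Sum>i=1..r. (sinh (2 * x i) / 2) *\<^sub>R JJ (Ht i))"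
    by (simp add: sum.distrib scaleR_add_right)
  also have "(\<Sum>i=1..r. (1/2) *\<^sub>R Wt i) - (\<Sum>i=1..r. (cosh (2 * x i) / 2) *\<^sub>R Wt i) = (\<Sum>i=1..r. ((1 - cosh (2 * x i)) / 2) *\<^sub>R Wt i)"
    unfolding sum_subtractf[symmetric] scaleR_left_diff_distrib[symmetric] diff_divide_distrib[symmetric] by (rule refl)
  finally show ?thesis .
qed

lemma sum_k: "(\<Sum>i=1..r. c i *\<^sub>R Wt i) \<in> \<kk>" and sum_J_Ht: "(\<Sum>i=1..r. c i *\<^sub>R JJ (Ht i)) \<in> \<pp>"
  by (intro subspace_sum subspace_scale subspace_k subspace_p Wt_k J_p Ht_p; assumption)+

lemma flat_zeta_parts:
  "p_part (Ad ex (ex (flat x)) \<zeta>) = - (\<Sum>i=1..r. (sinh (2 * x i) / 2) *\<^sub>R JJ (Ht i))"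
  "k_part (Ad ex (ex (flat x)) \<zeta>) = \<zeta> + (\<Sum>i=1..r. ((1 - cosh (2 * x i)) / 2) *\<^sub>R Wt i)"
proof -
  let ?k = "\<zeta> + (\<Sum>i=1..r. ((1 - cosh (2 * x i)) / 2) *\<^sub>R Wt i)" and ?p = "\<Sum>i=1..r. (sinh (2 * x i) / 2) *\<^sub>R JJ (Ht i)"
  have k: "?k \<in> \<kk>" by (rule subspace_add[OF subspace_k zeta_k sum_k])
  note p = sum_J_Ht[of "\<lambda>i. sinh (2 * x i) / 2"]
  show "p_part (Ad ex (ex (flat x)) \<zeta>) = - ?p"
    unfolding Ad_ex_flat_zeta linear_diff[OF part_linear(2)] part_simps(3)[OF k] part_simps(1)[OF p] by simp
  show "k_part (Ad ex (ex (flat x)) \<zeta>) = ?k"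
    unfolding Ad_ex_flat_zeta linear_diff[OF part_linear(1)] part_simps(4)[OF k] part_simps(2)[OF p] by simp
qed

lemma flat_eq: "flat x = (\<Sum>i=1..r. x i *\<^sub>R Ht i)"
  by (rule flat_vector_def)

lemma J_p_part_zeta: "JJ (p_part (Ad ex (ex (flat x)) \<zeta>)) = flat (\<lambda>i. sinh (2 * x i) / 2)"
proof -
  have "JJ (p_part (Ad ex (ex (flat x)) \<zeta>)) = - (\<Sum>i=1..r. (sinh (2 * x i) / 2) *\<^sub>R JJ (JJ (Ht i)))"
    unfolding flat_zeta_parts(1) linear_neg[OF bracket_right] linear_sum[OF bracket_right] linear_scale[OF bracket_right] by (rule refl)
  also have "(\<Sum>i=1..r. (sinh (2 * x i) / 2) *\<^sub>R JJ (JJ (Ht i))) = (\<Sum>i=1..r. (sinh (2 * x i) / 2) *\<^sub>R - Ht i)"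
    by (rule sum.cong) (simp_all only: J_J Ht_p)
  finally show ?thesis by (simp add: flat_eq sum_negf)
qed

lemma Ad_K_Ad_ex: "k \<in> K \<Longrightarrow> Ad ex k (Ad ex (ex X) Y) = Ad ex (ex (Ad ex k X)) (Ad ex k Y)"
proof -
  assume k: "k \<in> K"
  have "k \<circ> ex X = ex (Ad ex k X) \<circ> k" using Ad_apply1[OF K_G[OF k], of X] by auto
  then show ?thesis using Ad_comp[OF K_G[OF k] ex_G, of X Y] Ad_comp[OF ex_G K_G[OF k], of "Ad ex k X" Y] by simp
qed

lemma Ad_K_JJ: "k \<in> K \<Longrightarrow> Ad ex k (JJ Y) = JJ (Ad ex k Y)"
  using bracket_Ad[OF K_G, of k \<zeta> Y] Ad_K_zeta[of k] by simp

definition sinh_map :: "'g \<Rightarrow> 'g" where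
  "sinh_map X = 2 *\<^sub>R JJ (p_part (Ad ex (ex ((1/2) *\<^sub>R X)) \<zeta>))"

text \<open>The operator U of the overview, continued by the identity on \<open>\<kk>\<close> and,
  through \<open>p_part X\<close>, to all arguments. It is then invertible on the whole Lie algebra,
  and \<open>operator_inverse_Ck\<close> applies.\<close>

definition cosh_op :: "'g \<Rightarrow> 'g \<Rightarrow> 'g" where
  "cosh_op X v = v - JJ (br (k_part (Ad ex (ex (p_part X)) \<zeta>)) (p_part v))"

definition tanh_map :: "'g \<Rightarrow> 'g" where
  "tanh_map X = inv (cosh_op X) (2 *\<^sub>R JJ (p_part (Ad ex (ex (p_part X)) \<zeta>)))"

lemma sinh_map_flat: "sinh_map (flat x) = flat (\<lambda>i. sinh (x i))"
proof -
  have "(1/2) *\<^sub>R flat x = flat (\<lambda>i. (1/2) * x i)" by (rule flat_linear(2)[symmetric])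
  then have "sinh_map (flat x) = 2 *\<^sub>R flat (\<lambda>i. sinh (x i) / 2)" by (simp add: sinh_map_def J_p_part_zeta)
  also have "\<dots> = flat (\<lambda>i. 2 * (sinh (x i) / 2))" by (rule flat_linear(2)[symmetric])
  finally show ?thesis by simp
qed

lemma sinh_map_equivariant: "k \<in> K \<Longrightarrow> sinh_map (Ad ex k X) = Ad ex k (sinh_map X)"
  unfolding sinh_map_def
  by (simp add: linear_scale[OF Ad_linear[OF K_G]] Ad_K_JJ Ad_K_part(1)[symmetric] Ad_K_Ad_ex Ad_K_zeta)

lemma part_Ck: "open U \<Longrightarrow> Ck_on k U f \<Longrightarrow> Ck_on k U (\<lambda>x. p_part (f x))" "open U \<Longrightarrow> Ck_on k U f \<Longrightarrow> Ck_on k U (\<lambda>x. k_part (f x))"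
  using Ck_on_bounded_linear[of p_part U k f] Ck_on_bounded_linear[of k_part U k f] part_linear by (auto simp: linear_conv_bounded_linear)

lemma JJ_Ck: "open U \<Longrightarrow> Ck_on k U f \<Longrightarrow> Ck_on k U (\<lambda>x. JJ (f x))"
  using Ck_on_bounded_linear[of JJ U k f] bracket_right by (auto simp: linear_conv_bounded_linear)

lemma Ad_ex_zeta_Ck: "linear h \<Longrightarrow> Ck_on k UNIV (\<lambda>X. Ad ex (ex (h X)) \<zeta>)"
  by (rule Ck_on_compose[where f = "\<lambda>X. Ad ex (ex X) \<zeta>" and g = h, OF open_UNIV Ad_ex_Ck]) (auto intro: Ck_on_linear)

lemma sinh_map_Ck: "Ck_on k UNIV sinh_map"
proof -
  have "linear (\<lambda>X::'g. (1/2) *\<^sub>R X)" by (rule linear_scale_self)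
  then show ?thesis unfolding sinh_map_def[abs_def]
    by (intro Ck_on_scaleR_const JJ_Ck part_Ck open_UNIV Ad_ex_zeta_Ck)
qed

lemma cosh_op_linear: "linear (cosh_op X)"
  unfolding cosh_op_def[abs_def]
  by (auto simp: linear_iff linear_add[OF part_linear(2)] linear_scale[OF part_linear(2)] br_simps algebra_simps)

lemma cosh_op_flat:
  assumes v: "v \<in> \<pp>"
  shows "cosh_op (flat x) v = 2 *\<^sub>R v + (\<Sum>i=1..r. ((cosh (2 * x i) - 1) / 4) *\<^sub>R JJ (br (br (Ht i) (JJ (Ht i))) v))"
proof -
  have "JJ (br (k_part (Ad ex (ex (flat x)) \<zeta>)) v) = JJ (JJ v) + (\<Sum>i=1..r. ((1 - cosh (2 * x i)) / 2) *\<^sub>R JJ (br (Wt i) v))"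
    unfolding flat_zeta_parts(2) linear_add[OF bracket_left] linear_sum[OF bracket_left] linear_scale[OF bracket_left]
      linear_add[OF bracket_right] linear_sum[OF bracket_right] linear_scale[OF bracket_right] by (rule refl)
  also have "(\<Sum>i=1..r. ((1 - cosh (2 * x i)) / 2) *\<^sub>R JJ (br (Wt i) v)) = - (\<Sum>i=1..r. ((cosh (2 * x i) - 1) / 4) *\<^sub>R JJ (br (br (Ht i) (JJ (Ht i))) v))"
    unfolding sum_negf[symmetric] by (rule sum.cong) (simp_all add: br_simps flip: scaleR_minus_left, simp add: field_simps)
  finally show ?thesis
    unfolding cosh_op_def part_simps(1)[OF flat_p] part_simps(1)[OF v] J_J[OF v] by (simp add: scaleR_2)
qed

lemma Ad_K_zeta_part: "k \<in> K \<Longrightarrow> p_part (Ad ex (ex (p_part (Ad ex k X))) \<zeta>) = Ad ex k (p_part (Ad ex (ex (p_part X)) \<zeta>))"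
  "k \<in> K \<Longrightarrow> k_part (Ad ex (ex (p_part (Ad ex k X))) \<zeta>) = Ad ex k (k_part (Ad ex (ex (p_part X)) \<zeta>))"
  by (simp_all only: Ad_K_part(1)[of k X] Ad_K_part[of k "Ad ex (ex (p_part X)) \<zeta>", symmetric] Ad_K_Ad_ex Ad_K_zeta)

lemma cosh_op_equivariant:
  assumes k: "k \<in> K" shows "cosh_op (Ad ex k X) (Ad ex k v) = Ad ex k (cosh_op X v)"
  unfolding cosh_op_def Ad_K_zeta_part(2)[OF k]
  unfolding Ad_K_part(1)[OF k] bracket_Ad[OF K_G[OF k]] linear_diff[OF Ad_linear[OF K_G[OF k]]] Ad_K_zeta[OF k]
  by (rule refl)

text \<open>A kernel vector lies in \<open>\<pp>\<close>, and equivariance moves the argument to the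
  flat. There the operator is 2 plus a combination of the operators of
  \<open>positive_square\<close> with coefficients (cosh - 1) / 4, hence positive definite.\<close>

lemma cosh_op_inj: "inj (cosh_op X)"
  unfolding linear_injective_0[OF cosh_op_linear]
proof (intro allI impI)
  fix v assume 0: "cosh_op X v = 0"
  have "JJ (br (k_part (Ad ex (ex (p_part X)) \<zeta>)) (p_part v)) \<in> \<pp>" by (intro J_p br_kp k_part_in p_part_in)
  moreover have "v = JJ (br (k_part (Ad ex (ex (p_part X)) \<zeta>)) (p_part v))" using 0 by (simp add: cosh_op_def)
  ultimately have v: "v \<in> \<pp>" by simp
  obtain k x where kx: "k \<in> K" "p_part X = Ad ex k (flat x)" using Ad_K_flat[OF p_part_in] by blast
  let ?u = "Ad ex (inv k) v"
  note u = Ad_K_p[OF K_inv[OF kx(1)] v]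
  have "cosh_op X v = cosh_op (p_part X) v" by (simp add: cosh_op_def part_simps(1)[OF p_part_in])
  also have "\<dots> = cosh_op (Ad ex k (flat x)) (Ad ex k ?u)" using kx(2) K_G[OF kx(1)] by simp
  also have "\<dots> = Ad ex k (cosh_op (flat x) ?u)" by (rule cosh_op_equivariant[OF kx(1)])
  finally have "Ad ex (inv k) (Ad ex k (cosh_op (flat x) ?u)) = Ad ex (inv k) 0" using 0 by simp
  then have u0: "cosh_op (flat x) ?u = 0" using K_G[OF kx(1)] linear_0[OF Ad_linear[OF K_G[OF K_inv[OF kx(1)]]]] by simp
  have "ip (cosh_op (flat x) ?u) ?u = 2 * ip ?u ?u + (\<Sum>i=1..r. ((cosh (2 * x i) - 1) / 4) * ip (JJ (br (br (Ht i) (JJ (Ht i))) ?u)) ?u)"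
    unfolding cosh_op_flat[OF u] by (simp only: form.form_simps linear_sum[OF form.lin(2)] real_scaleR_def)
  moreover have "0 \<le> (\<Sum>i=1..r. ((cosh (2 * x i) - 1) / 4) * ip (JJ (br (br (Ht i) (JJ (Ht i))) ?u)) ?u)"
    by (intro sum_nonneg mult_nonneg_nonneg positive_square Ht_p u) (simp_all add: cosh_real_ge_1)
  ultimately have "ip ?u ?u \<le> 0" using u0 by simp
  then have "?u = 0" using form.nonneg[of ?u] form.eq_0_iff[of ?u] by linarith
  then show "v = 0" using Ad_inv(1)[OF K_G[OF kx(1)], of v] linear_0[OF Ad_linear[OF K_G[OF kx(1)]]] by simp
qed

lemma tanh_map_eqI: "cosh_op X V = 2 *\<^sub>R JJ (p_part (Ad ex (ex (p_part X)) \<zeta>)) \<Longrightarrow> tanh_map X = V"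
  unfolding tanh_map_def using linear_inv(3)[OF cosh_op_linear cosh_op_inj] by metis

lemma cosh_op_tanh_map: "cosh_op X (tanh_map X) = 2 *\<^sub>R JJ (p_part (Ad ex (ex (p_part X)) \<zeta>))"
  unfolding tanh_map_def by (rule linear_inv(2)[OF cosh_op_linear cosh_op_inj])

lemma tanh_map_equivariant: assumes k: "k \<in> K" shows "tanh_map (Ad ex k X) = Ad ex k (tanh_map X)"
  by (rule tanh_map_eqI)
     (simp only: cosh_op_equivariant[OF k] cosh_op_tanh_map linear_scale[OF Ad_linear[OF K_G[OF k]]] Ad_K_JJ[OF k] Ad_K_zeta_part(1)[OF k])

lemma triple_Ht:
  assumes "i \<in> {1..r}" "j \<in> {1..r}"
  shows "JJ (br (br (Ht i) (JJ (Ht i))) (Ht j)) = (if i = j then 4 else 0) *\<^sub>R Ht j"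
proof -
  have "br (br (Ht i) (JJ (Ht i))) (Ht j) = - br (Ht j) (2 *\<^sub>R Wt i)" by (subst br_anti) simp
  also have "\<dots> = - (2 *\<^sub>R br (Ht j) (Wt i))" by (simp only: br_simps)
  also have "\<dots> = - ((if i = j then 4 else 0) *\<^sub>R JJ (Ht j))"
    using Ht_J_Ht(2)[OF assms(1) Ht_a[OF assms(2)]] e_Ht[OF assms] by auto
  finally show ?thesis using J_J[OF Ht_p[OF assms(2)]] by (simp only: br_simps) simp
qed

lemma tanh_map_flat: "tanh_map (flat x) = flat (\<lambda>i. tanh (x i))"
proof (rule tanh_map_eqI)
  have Ht: "cosh_op (flat x) (Ht j) = (cosh (2 * x j) + 1) *\<^sub>R Ht j" if j: "j \<in> {1..r}" for j
  proof -
    have "(\<Sum>i=1..r. ((cosh (2 * x i) - 1) / 4) *\<^sub>R JJ (br (br (Ht i) (JJ (Ht i))) (Ht j))) =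
        (\<Sum>i=1..r. if i = j then (cosh (2 * x j) - 1) *\<^sub>R Ht j else 0)"
      by (rule sum.cong) (simp_all only: triple_Ht[OF _ j], simp)
    also have "\<dots> = (cosh (2 * x j) - 1) *\<^sub>R Ht j" using j by simp
    finally show ?thesis unfolding cosh_op_flat[OF Ht_p[OF j]] by (simp flip: scaleR_add_left)
  qed
  have "cosh_op (flat x) (flat (\<lambda>i. tanh (x i))) = (\<Sum>i=1..r. tanh (x i) *\<^sub>R cosh_op (flat x) (Ht i))"
    unfolding flat_eq[of "\<lambda>i. tanh (x i)"] linear_sum[OF cosh_op_linear] linear_scale[OF cosh_op_linear] by (rule refl)
  also have "\<dots> = (\<Sum>i=1..r. (2 * (sinh (2 * x i) / 2)) *\<^sub>R Ht i)"
  proof (rule sum.cong)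
    fix i assume "i \<in> {1..r}"
    have "tanh (x i) * (cosh (2 * x i) + 1) = sinh (2 * x i)"
      by (simp only: tanh_def cosh_double_cosh sinh_double) (simp add: field_simps power2_eq_square)
    then show "tanh (x i) *\<^sub>R cosh_op (flat x) (Ht i) = (2 * (sinh (2 * x i) / 2)) *\<^sub>R Ht i"
      unfolding Ht[OF \<open>i \<in> {1..r}\<close>] by simp
  qed simp
  also have "\<dots> = 2 *\<^sub>R JJ (p_part (Ad ex (ex (p_part (flat x))) \<zeta>))"
    unfolding part_simps(1)[OF flat_p] J_p_part_zeta flat_linear(2)[symmetric] by (simp only: flat_eq)
  finally show "cosh_op (flat x) (flat (\<lambda>i. tanh (x i))) = 2 *\<^sub>R JJ (p_part (Ad ex (ex (p_part (flat x))) \<zeta>))" .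
qed

lemma tanh_map_Ck: "Ck_on k UNIV tanh_map"
proof -
  have Q: "Ck_on k UNIV (\<lambda>X. Ad ex (ex (p_part X)) \<zeta>)" for k by (rule Ad_ex_zeta_Ck[OF part_linear(2)])
  have "Ck_on k UNIV (\<lambda>X. br (k_part (Ad ex (ex (p_part X)) \<zeta>)) (p_part v))" for v k
    by (rule Ck_on_bounded_bilinear[where h = br, OF bracket_bounded_bilinear open_UNIV part_Ck(2)[OF open_UNIV Q] Ck_on_const])
  then have C: "Ck_on k UNIV (\<lambda>X. cosh_op X v)" for v k
    unfolding cosh_op_def by (intro Ck_on_diff JJ_Ck open_UNIV Ck_on_const)
  have I: "Ck_on k UNIV (\<lambda>X. inv (cosh_op X) v)" for v
    by (rule operator_inverse_Ck[where F = cosh_op, OF open_UNIV cosh_op_linear cosh_op_inj C])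
  show ?thesis
    unfolding tanh_map_def[abs_def]
    by (rule Ck_on_apply_linear[where F = "\<lambda>X. inv (cosh_op X)", OF open_UNIV linear_inv(1)[OF cosh_op_linear cosh_op_inj] I
        Ck_on_scaleR_const[OF open_UNIV JJ_Ck[OF open_UNIV part_Ck(1)[OF open_UNIV Q]]]])
qed

end

section \<open>Equivariant maps into the tangent space\<close>

lemma vector_derivative_in_subspace:
  fixes f :: "real \<Rightarrow> 'a::euclidean_space"
  assumes S: "subspace S" "\<And>t. f t \<in> S" and d: "(f has_vector_derivative d) (at t)" shows "d \<in> S"
proof -
  have "((\<lambda>h. norm (f (t + h) - f t - h *\<^sub>R d) / norm h) \<longlongrightarrow> 0) (at 0)"
    using d by (simp add: has_vector_derivative_def has_derivative_at)
  moreover have "\<forall>\<^sub>F h in at 0. norm (f (t + h) - f t - h *\<^sub>R d) / norm h = norm ((1 / h) *\<^sub>R (f (t + h) - f t) - d)"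
    unfolding eventually_at_filter
  proof (intro always_eventually allI impI)
    fix h :: real assume h: "h \<noteq> 0"
    have "f (t + h) - f t - h *\<^sub>R d = h *\<^sub>R ((1 / h) *\<^sub>R (f (t + h) - f t) - d)" using h by (simp add: scaleR_diff_right)
    then show "norm (f (t + h) - f t - h *\<^sub>R d) / norm h = norm ((1 / h) *\<^sub>R (f (t + h) - f t) - d)" using h by simp
  qed
  ultimately have "((\<lambda>h. norm ((1 / h) *\<^sub>R (f (t + h) - f t) - d)) \<longlongrightarrow> 0) (at 0)" by (rule Lim_transform_eventually)
  then have "((\<lambda>h. (1 / h) *\<^sub>R (f (t + h) - f t)) \<longlongrightarrow> d) (at 0)"
    by (rule LIM_zero_cancel[OF tendsto_norm_zero_cancel])
  then show ?thesis
    by (rule Lim_in_closed_set[OF closed_subspace[OF S(1)] _ at_neq_bot, rotated])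
       (intro always_eventually allI subspace_scale subspace_diff S)
qed

context symmetric_space
begin

text \<open>The differential of \<open>\<Omega>\<close> at \<open>exp(X) o\<close>, pulled back to the tangent space at \<open>o\<close> by the translation \<open>exp(X)\<close>.\<close>

definition diff_at :: "('m \<Rightarrow> 'g) \<Rightarrow> 'g \<Rightarrow> 'g \<Rightarrow> 'g" where
  "diff_at \<Omega> X V = vector_derivative (\<lambda>t. \<Omega> (ex X (ex (t *\<^sub>R V) ob))) (at 0)"

lemma translate_velocity:
  assumes "c \<in> A" "ex X ob \<in> fst c"
  shows "has_velocity c (\<lambda>t. ex X (ex (t *\<^sub>R V) ob)) 0 (fundamental ex c (Ad ex (ex X) V) (ex X ob))"
  using fundamental_velocity[OF assms, of "Ad ex (ex X) V"] by (simp add: Ad_apply[OF ex_G])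

lemma diff_at_chart:
  assumes "Ck_fun A (Suc 0) \<Omega>" "c \<in> A" "ex X ob \<in> fst c"
  shows "((\<lambda>t. \<Omega> (ex X (ex (t *\<^sub>R V) ob))) has_vector_derivative diff_at \<Omega> X V) (at 0)"
    "chart_deriv c \<Omega> (ex X ob) (fundamental ex c (Ad ex (ex X) V) (ex X ob)) = diff_at \<Omega> X V"
proof -
  have "((\<lambda>t. \<Omega> (ex X (ex (t *\<^sub>R V) ob))) has_vector_derivative
      chart_deriv c \<Omega> (ex X ob) (fundamental ex c (Ad ex (ex X) V) (ex X ob))) (at 0)"
    using has_velocity_fun[OF translate_velocity[OF assms(2,3)] assms(2,1), of V] by simp
  moreover from vector_derivative_at[OF this]
  show "chart_deriv c \<Omega> (ex X ob) (fundamental ex c (Ad ex (ex X) V) (ex X ob)) = diff_at \<Omega> X V" by (simp add: diff_at_def)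
  ultimately show "((\<lambda>t. \<Omega> (ex X (ex (t *\<^sub>R V) ob))) has_vector_derivative diff_at \<Omega> X V) (at 0)" by simp
qed

lemma diff_at_derivative:
  assumes "Ck_fun A (Suc 0) \<Omega>"
  shows "((\<lambda>t. \<Omega> (ex X (ex (t *\<^sub>R V) ob))) has_vector_derivative diff_at \<Omega> X V) (at 0)"
proof -
  obtain c where "c \<in> A" "ex X ob \<in> fst c" by (rule chart_at)
  then show ?thesis by (rule diff_at_chart(1)[OF assms])
qed

lemma diff_at_eqI:
  assumes "Ck_fun A (Suc 0) \<Omega>" "((\<lambda>t. \<Omega> (ex X (ex (t *\<^sub>R V) ob))) has_vector_derivative D) (at 0)" shows "diff_at \<Omega> X V = D"
  using vector_derivative_unique_at[OF diff_at_derivative[OF assms(1)] assms(2)] .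

lemma diff_at_linear:
  assumes \<Omega>: "Ck_fun A (Suc 0) \<Omega>" shows "linear (diff_at \<Omega> X)"
proof -
  obtain c where c: "c \<in> A" "ex X ob \<in> fst c" by (rule chart_at)
  have "linear (\<lambda>V. chart_deriv c \<Omega> (ex X ob) (fundamental ex c (Ad ex (ex X) V) (ex X ob)))"
    using linear_compose[OF linear_compose[OF Ad_linear[OF ex_G] fundamental_linear[OF c]] chart_deriv_linear[OF Ck_fun_differentiable[OF \<Omega> c]]]
    by (simp add: comp_def)
  then show ?thesis by (simp only: diff_at_chart(2)[OF \<Omega> c])
qed

lemma diff_at_p_part:
  assumes \<Omega>: "Ck_fun A (Suc 0) \<Omega>" shows "diff_at \<Omega> X V = diff_at \<Omega> X (p_part V)"
proof -
  have "diff_at \<Omega> X (k_part V) = 0"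
    by (rule diff_at_eqI[OF \<Omega>]) (use k_part_in[of V] k_iff in simp)
  then show ?thesis using linear_add[OF diff_at_linear[OF \<Omega>], of X "k_part V" "p_part V"] by (simp add: parts)
qed

lemma diff_at_p: assumes \<Omega>: "Ck_fun A (Suc 0) \<Omega>" "range \<Omega> \<subseteq> \<pp>" shows "diff_at \<Omega> X V \<in> \<pp>"
  by (rule vector_derivative_in_subspace[OF subspace_p _ diff_at_derivative[OF \<Omega>(1)]]) (use \<Omega>(2) in blast)

lemma diff_at_continuous:
  assumes \<Omega>: "Ck_fun A (Suc 0) \<Omega>" shows "continuous_on UNIV (\<lambda>X. diff_at \<Omega> X V)"
proof -
  define F where "F p = \<Omega> (ex (fst p) (ex (snd p *\<^sub>R V) ob))" for p :: "'g \<times> real"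
  have C: "Ck_on (Suc 0) UNIV F"
    unfolding F_def
    by (rule Ck_fun_compose[OF open_UNIV \<Omega>])
       (intro Ck_into_ex open_UNIV Ck_into_const Ck_on_scaleR Ck_on_linear linear_fst linear_snd Ck_on_const)
  have "diff_at \<Omega> X V = frechet_derivative F (at (X, 0)) (0, 1)" for X
  proof (rule diff_at_eqI[OF \<Omega>])
    have "((\<lambda>t. (X, t)) has_vector_derivative (0, 1)) (at 0)" by (auto intro!: derivative_eq_intros)
    from has_vector_derivative_compose[OF this Ck_on_SucD(1)[OF C UNIV_I]]
    show "((\<lambda>t. \<Omega> (ex X (ex (t *\<^sub>R V) ob))) has_vector_derivative frechet_derivative F (at (X, 0)) (0, 1)) (at 0)"
      by (simp add: F_def)
  qed
  moreover have "continuous_on UNIV (\<lambda>p. frechet_derivative F (at p) (0, 1))"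
    using Ck_on_SucD(2)[OF C, of "(0, 1)"] by simp
  then have "continuous_on UNIV (\<lambda>X. frechet_derivative F (at (X, 0)) (0, 1))"
    by (rule continuous_on_compose2) (auto intro!: continuous_intros)
  ultimately show ?thesis by simp
qed

lemma equivariantD: "K_equivariant A g ex ob \<Omega> \<Longrightarrow> k \<in> K \<Longrightarrow> \<Omega> (k x) = Ad ex k (\<Omega> x)"
  by (simp add: K_equivariant_def)

lemma diff_at_equivariant:
  assumes \<Omega>: "Ck_fun A (Suc 0) \<Omega>" "K_equivariant A g ex ob \<Omega>" and k: "k \<in> K"
  shows "diff_at \<Omega> (Ad ex k X) (Ad ex k V) = Ad ex k (diff_at \<Omega> X V)"
proof (rule diff_at_eqI[OF \<Omega>(1)])
  have "\<Omega> (ex (Ad ex k X) (ex (t *\<^sub>R Ad ex k V) ob)) = Ad ex k (\<Omega> (ex X (ex (t *\<^sub>R V) ob)))" for t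
    using Ad_apply[OF K_G[OF k], of t V ob] Ad_apply1[OF K_G[OF k], of X] equivariantD[OF \<Omega>(2) k] K_ob[OF k] by simp
  then show "((\<lambda>t. \<Omega> (ex (Ad ex k X) (ex (t *\<^sub>R Ad ex k V) ob))) has_vector_derivative Ad ex k (diff_at \<Omega> X V)) (at 0)"
    using bounded_linear.has_vector_derivative[OF Ad_bounded_linear[OF K_G[OF k]] diff_at_derivative[OF \<Omega>(1)]] by simp
qed

text \<open>exp(X) exp(t Ad(exp(-X)) W) o = exp(tW) exp(X) o, and exp(tW) belongs to the isotropy
  group, so equivariance makes the derivative explicit.\<close>

lemma diff_at_isotropy:
  assumes \<Omega>: "Ck_fun A (Suc 0) \<Omega>" "K_equivariant A g ex ob \<Omega>" and W: "W \<in> \<kk>"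
  shows "diff_at \<Omega> X (Ad ex (ex (- X)) W) = br W (\<Omega> (ex X ob))"
proof (rule diff_at_eqI[OF \<Omega>(1)])
  have "ex (t *\<^sub>R W) \<in> K" for t by (rule ex_k_K[OF subspace_scale[OF subspace_k W]])
  then have "\<Omega> (ex X (ex (t *\<^sub>R Ad ex (ex (- X)) W) ob)) = Ad ex (ex (t *\<^sub>R W)) (\<Omega> (ex X ob))" for t
    using Ad_apply[OF ex_G, of t X "Ad ex (ex (- X)) W" ob] equivariantD[OF \<Omega>(2), of "ex (t *\<^sub>R W)" "ex X ob"] by simp
  then show "((\<lambda>t. \<Omega> (ex X (ex (t *\<^sub>R Ad ex (ex (- X)) W) ob))) has_vector_derivative br W (\<Omega> (ex X ob))) (at 0)"
    using Ad_derivative_0 by simp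
qed

lemma tangent_vector:
  assumes c: "c \<in> A" "x \<in> fst c"
  shows "\<exists>X\<in>\<pp>. x = ex X ob \<and> (\<forall>u. \<exists>V\<in>\<pp>. u = fundamental ex c (Ad ex (ex X) V) x)"
proof -
  have x: "x = ex (lift (Lg x)) ob" by (rule ex_lift_Lg[symmetric])
  then have "ex (lift (Lg x)) ob \<in> fst c" using c by simp
  from fundamental_point[OF ex_G c(1) this] show ?thesis using x lift_p[of "Lg x"] by metis
qed

lemma fundamental_translate_J:
  assumes c: "c \<in> A" "ex X ob \<in> fst c" and V: "V \<in> \<pp>"
  shows "J c (ex X ob) (fundamental ex c (Ad ex (ex X) V) (ex X ob)) = fundamental ex c (Ad ex (ex X) (br \<zeta> V)) (ex X ob)"
proof -
  have "chart_deriv c0 (snd c \<circ> ex X) ob (J c0 ob (fundamental ex c0 V ob)) = J c (ex X ob) (chart_deriv c0 (snd c \<circ> ex X) ob (fundamental ex c0 V ob))"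
    using G_J[OF ex_G[of X]] c0 c unfolding preserves_J_def by blast
  then show ?thesis unfolding fundamental_Ad[OF ex_G c0(1) c(1) c0(2) c(2)] fundamental_J[OF c0 V] by (rule sym)
qed

lemma fundamental_translate_g:
  assumes c: "c \<in> A" "ex X ob \<in> fst c" and V: "V \<in> \<pp>" "V' \<in> \<pp>"
  shows "g c (ex X ob) (fundamental ex c (Ad ex (ex X) V) (ex X ob)) (fundamental ex c (Ad ex (ex X) V') (ex X ob)) = ip V V'"
  unfolding fundamental_Ad[OF ex_G c0(1) c(1) c0(2) c(2)] G_metric[OF ex_G c0(1) c(1) c0(2) c(2)]
  by (rule fundamental_g[OF c0 V])

lemma p_at_point: obtains c where "c \<in> A" "ex X ob \<in> fst c" by (rule chart_at)

text \<open>Transport by the group removes the charts: the invariant complex structure becomes the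
  fixed operator \<open>br \<zeta>\<close> on \<open>\<pp>\<close> at every point.\<close>

lemma holomorphic_iff:
  assumes \<Omega>: "Ck_fun A (Suc 0) \<Omega>"
  shows "holomorphic_map A J br \<zeta> \<Omega> \<longleftrightarrow> (\<forall>X\<in>\<pp>. \<forall>V\<in>\<pp>. br \<zeta> (diff_at \<Omega> X V) = diff_at \<Omega> X (br \<zeta> V))" (is "_ \<longleftrightarrow> ?R")
proof
  assume h: "holomorphic_map A J br \<zeta> \<Omega>"
  show ?R
  proof (intro ballI)
    fix X V assume XV: "X \<in> \<pp>" "V \<in> \<pp>"
    obtain c where c: "c \<in> A" "ex X ob \<in> fst c" by (rule p_at_point)
    have "br \<zeta> (chart_deriv c \<Omega> (ex X ob) (fundamental ex c (Ad ex (ex X) V) (ex X ob))) =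
        chart_deriv c \<Omega> (ex X ob) (J c (ex X ob) (fundamental ex c (Ad ex (ex X) V) (ex X ob)))"
      using h c unfolding holomorphic_map_def by blast
    then show "br \<zeta> (diff_at \<Omega> X V) = diff_at \<Omega> X (br \<zeta> V)"
      unfolding fundamental_translate_J[OF c XV(2)] diff_at_chart(2)[OF \<Omega> c] .
  qed
next
  assume R: ?R
  show "holomorphic_map A J br \<zeta> \<Omega>"
    unfolding holomorphic_map_def
  proof (intro ballI allI)
    fix c x u assume c: "c \<in> A" "x \<in> fst c"
    obtain X where X: "X \<in> \<pp>" "x = ex X ob" "\<forall>u. \<exists>V\<in>\<pp>. u = fundamental ex c (Ad ex (ex X) V) x"
      using tangent_vector[OF c] by blast
    obtain V where V: "V \<in> \<pp>" "u = fundamental ex c (Ad ex (ex X) V) x" using X(3) by blast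
    have xc: "ex X ob \<in> fst c" using c X by simp
    show "br \<zeta> (chart_deriv c \<Omega> x u) = chart_deriv c \<Omega> x (J c x u)"
      unfolding V(2) X(2) fundamental_translate_J[OF c(1) xc V(1)] diff_at_chart(2)[OF \<Omega> c(1) xc] using R X(1) V(1) by blast
  qed
qed

lemma symplectic_iff:
  assumes \<Omega>: "Ck_fun A (Suc 0) \<Omega>"
  shows "symplectic_map A g J br \<theta> \<zeta> \<Omega> \<longleftrightarrow>
    (\<forall>X\<in>\<pp>. \<forall>V\<in>\<pp>. \<forall>V'\<in>\<pp>. ip (br \<zeta> (diff_at \<Omega> X V)) (diff_at \<Omega> X V') = ip (br \<zeta> V) V')" (is "_ \<longleftrightarrow> ?R")
proof
  assume h: "symplectic_map A g J br \<theta> \<zeta> \<Omega>"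
  show ?R
  proof (intro ballI)
    fix X V V' assume XV: "X \<in> \<pp>" "V \<in> \<pp>" "V' \<in> \<pp>"
    obtain c where c: "c \<in> A" "ex X ob \<in> fst c" by (rule p_at_point)
    let ?f = "\<lambda>V. fundamental ex c (Ad ex (ex X) V) (ex X ob)"
    have "ip (br \<zeta> (chart_deriv c \<Omega> (ex X ob) (?f V))) (chart_deriv c \<Omega> (ex X ob) (?f V')) = g c (ex X ob) (J c (ex X ob) (?f V)) (?f V')"
      using h c unfolding symplectic_map_def kaehler_form_def by blast
    then show "ip (br \<zeta> (diff_at \<Omega> X V)) (diff_at \<Omega> X V') = ip (br \<zeta> V) V'"
      unfolding fundamental_translate_J[OF c XV(2)] fundamental_translate_g[OF c br_kp[OF zeta_facts(1) XV(2)] XV(3)] diff_at_chart(2)[OF \<Omega> c] .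
  qed
next
  assume R: ?R
  show "symplectic_map A g J br \<theta> \<zeta> \<Omega>"
    unfolding symplectic_map_def kaehler_form_def
  proof (intro ballI allI)
    fix c x u w assume c: "c \<in> A" "x \<in> fst c"
    obtain X where X: "X \<in> \<pp>" "x = ex X ob" "\<forall>u. \<exists>V\<in>\<pp>. u = fundamental ex c (Ad ex (ex X) V) x"
      using tangent_vector[OF c] by blast
    obtain V where V: "V \<in> \<pp>" "u = fundamental ex c (Ad ex (ex X) V) x" using X(3) by blast
    obtain V' where V': "V' \<in> \<pp>" "w = fundamental ex c (Ad ex (ex X) V') x" using X(3) by blast
    have xc: "ex X ob \<in> fst c" using c X by simp
    show "ip (br \<zeta> (chart_deriv c \<Omega> x u)) (chart_deriv c \<Omega> x w) = g c x (J c x u) w"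
      unfolding V(2) V'(2) X(2) fundamental_translate_J[OF c(1) xc V(1)] fundamental_translate_g[OF c(1) xc br_kp[OF zeta_facts(1) V(1)] V'(1)]
        diff_at_chart(2)[OF \<Omega> c(1) xc] using R X(1) V(1) V'(1) by blast
  qed
qed

lemma chart_deriv_inj:
  assumes \<Omega>: "Ck_fun A (Suc 0) \<Omega>" and inj: "\<And>X V. X \<in> \<pp> \<Longrightarrow> V \<in> \<pp> \<Longrightarrow> diff_at \<Omega> X V = 0 \<Longrightarrow> V = 0"
    and c: "c \<in> A" "x \<in> fst c"
  shows "inj (chart_deriv c \<Omega> x)"
  unfolding linear_injective_0[OF chart_deriv_linear[OF Ck_fun_differentiable[OF \<Omega> c]]]
proof (intro allI impI)
  fix u assume 0: "chart_deriv c \<Omega> x u = 0"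
  obtain X where X: "X \<in> \<pp>" "x = ex X ob" "\<forall>u. \<exists>V\<in>\<pp>. u = fundamental ex c (Ad ex (ex X) V) x"
    using tangent_vector[OF c] by blast
  obtain V where V: "V \<in> \<pp>" "u = fundamental ex c (Ad ex (ex X) V) x" using X(3) by blast
  have xc: "ex X ob \<in> fst c" using c X by simp
  have "diff_at \<Omega> X V = 0" using 0 unfolding V(2) X(2) diff_at_chart(2)[OF \<Omega> c(1) xc] .
  then have "V = 0" by (rule inj[OF X(1) V(1)])
  then have "u = fundamental ex c 0 (ex X ob)" using V(2) X(2) linear_0[OF Ad_linear[OF ex_G]] by simp
  then show "u = 0" using linear_0[OF fundamental_linear[OF c(1) xc]] by simp
qed

text \<open>After composition with \<open>tang\<close> both sides have the same dimension and
  \<open>smooth_inverse\<close> applies in each chart. As \<open>tang\<close> is defined on the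
  whole Lie algebra, pulling the local inverses back along it supplies the extensions to open sets
  demanded by \<open>smooth_into\<close>.\<close>

lemma immersion_diffeo:
  assumes \<Omega>: "\<And>k. Ck_fun A k \<Omega>" and D: "range \<Omega> = D" "D \<subseteq> \<pp>" and inj: "inj \<Omega>"
    and dinj: "\<And>X V. X \<in> \<pp> \<Longrightarrow> V \<in> \<pp> \<Longrightarrow> diff_at \<Omega> X V = 0 \<Longrightarrow> V = 0"
  shows "diffeo_onto A \<pp> D \<Omega>" "C1_embedding A \<pp> \<Omega>"
proof -
  have \<Omega>p: "\<Omega> x \<in> \<pp>" for x using D by blast
  have inv\<Omega>: "inv \<Omega> (\<Omega> x) = x" for x using inj by simp
  have lt: "lift (tang (\<Omega> x)) = \<Omega> x" for x by (rule lift_tang_p[OF \<Omega>p])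
  let ?f = "\<lambda>c y. tang (\<Omega> (cinv c y))" and ?g = "\<lambda>c v. snd c (inv \<Omega> (lift v))"
  have main: "open (tang ` \<Omega> ` fst c)" "Ck_on k (tang ` \<Omega> ` fst c) (?g c)" if c: "c \<in> A" for c k
  proof -
    let ?U = "snd c ` fst c"
    have C: "Ck_on k ?U (\<lambda>y. \<Omega> (cinv c y))" for k using \<Omega>[of k] c by (simp add: Ck_fun_def comp_def)
    have bl: "bounded_linear tang" using tang_linear by (simp add: linear_conv_bounded_linear)
    have C': "Ck_on k ?U (?f c)" for k by (rule Ck_on_bounded_linear[OF bl chart_open(2)[OF c] C])
    have left: "?g c (?f c y) = y" if "y \<in> ?U" for y using c that by (simp add: lt inv\<Omega>)
    have di: "inj (frechet_derivative (?f c) (at y))" if y: "y \<in> ?U" for y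
    proof -
      let ?x = "cinv c y"
      have x: "?x \<in> fst c" "snd c ?x = y" using c y by auto
      have "((\<lambda>y. \<Omega> (cinv c y)) has_derivative chart_deriv c \<Omega> ?x) (at y)"
        using Ck_on_SucD(1)[OF C y] x(2) by (simp add: chart_deriv_def[abs_def] comp_def)
      from bounded_linear.has_derivative[OF bl this]
      have "(?f c has_derivative (\<lambda>u. tang (chart_deriv c \<Omega> ?x u))) (at y)" .
      from frechet_derivative_at[OF this]
      have eq: "frechet_derivative (?f c) (at y) = (\<lambda>u. tang (chart_deriv c \<Omega> ?x u))" by (rule sym)
      have cp: "chart_deriv c \<Omega> ?x u \<in> \<pp>" for u
      proof -
        have "((\<lambda>s. \<Omega> (cinv c (snd c ?x + s *\<^sub>R u))) has_vector_derivative chart_deriv c \<Omega> (cinv c (snd c ?x + 0 *\<^sub>R u)) u) (at 0)"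
          by (rule has_velocity_fun[OF has_velocity_line[OF c x(1)] c \<Omega>])
        then have "((\<lambda>s. \<Omega> (cinv c (snd c ?x + s *\<^sub>R u))) has_vector_derivative chart_deriv c \<Omega> ?x u) (at 0)" using c x by simp
        then show ?thesis by (rule vector_derivative_in_subspace[OF subspace_p \<Omega>p])
      qed
      show ?thesis unfolding eq
      proof (rule injI)
        fix u v assume "tang (chart_deriv c \<Omega> ?x u) = tang (chart_deriv c \<Omega> ?x v)"
        then have "chart_deriv c \<Omega> ?x u = chart_deriv c \<Omega> ?x v" using lift_tang_p[OF cp] by metis
        then show "u = v" using chart_deriv_inj[OF \<Omega> dinj c x(1)] by (simp add: inj_eq)
      qed
    qed
    have im: "?f c ` ?U = tang ` \<Omega> ` fst c"
    proof -
      have "?f c ` ?U = tang ` \<Omega> ` cinv c ` ?U" by (simp add: image_image)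
      also have "cinv c ` ?U = fst c" using c by (force simp: image_image)
      finally show ?thesis .
    qed
    show "open (tang ` \<Omega> ` fst c)" "Ck_on k (tang ` \<Omega> ` fst c) (?g c)"
      using smooth_inverse[OF chart_open(2)[OF c] C' left di] unfolding im by blast+
  qed
  have tanC: "continuous_on S tang" for S using tang_linear by (simp add: linear_continuous_on linear_conv_bounded_linear)
  define U where "U c = tang -` (tang ` \<Omega> ` fst c)" for c :: "('m, 'e) chart"
  have U: "open (U c)" if "c \<in> A" for c unfolding U_def by (rule open_vimage[OF main(1)[OF that] tanC])
  have UD: "q \<in> U c \<longleftrightarrow> inv \<Omega> q \<in> fst c" if "q \<in> D" for q c
  proof -
    from that[folded D(1)] obtain x where x: "q = \<Omega> x" by (rule rangeE)
    have "x \<in> fst c" if t: "tang (\<Omega> x) \<in> tang ` \<Omega> ` fst c"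
    proof -
      obtain y where y: "y \<in> fst c" "tang (\<Omega> x) = tang (\<Omega> y)" using t by blast
      have "x = y" using arg_cong[OF y(2), of lift] unfolding lt by (rule injD[OF inj])
      then show ?thesis using y(1) by simp
    qed
    then have "tang (\<Omega> x) \<in> tang ` \<Omega> ` fst c \<longleftrightarrow> x \<in> fst c" by blast
    then show ?thesis by (simp add: U_def x inv\<Omega>)
  qed
  have lq: "lift (tang q) = q" if "q \<in> D" for q using that D by (intro lift_tang_p) blast
  have "D = \<pp> \<inter> (\<Union>c\<in>A. U c)"
  proof
    show "D \<subseteq> \<pp> \<inter> (\<Union>c\<in>A. U c)"
    proof
      fix q assume q: "q \<in> D"
      obtain c where c: "c \<in> A" "inv \<Omega> q \<in> fst c" by (rule chart_at)
      then show "q \<in> \<pp> \<inter> (\<Union>c\<in>A. U c)" using q UD D by blast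
    qed
    show "\<pp> \<inter> (\<Union>c\<in>A. U c) \<subseteq> D"
    proof
      fix q assume "q \<in> \<pp> \<inter> (\<Union>c\<in>A. U c)"
      then obtain c x where x: "q \<in> \<pp>" "tang q = tang (\<Omega> x)" by (auto simp: U_def)
      then have "q = \<Omega> x" using lift_tang_p lt by metis
      then show "q \<in> D" using D by blast
    qed
  qed
  moreover have "open (\<Union>c\<in>A. U c)" using U by blast
  ultimately have od: "openin (top_of_set \<pp>) D" by (auto simp: openin_open)
  have cont: "continuous_on D (inv \<Omega>)"
    unfolding continuous_on_eq_continuous_within
  proof
    fix q assume q: "q \<in> D"
    obtain c where c: "c \<in> A" "inv \<Omega> q \<in> fst c" by (rule chart_at)
    have 1: "continuous_on (D \<inter> U c) (\<lambda>q. ?g c (tang q))"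
      by (rule continuous_on_compose2[OF Ck_on_continuous[OF main(2)[OF c(1), of 0]] tanC]) (auto simp: U_def)
    have "continuous_on (D \<inter> U c) (\<lambda>q. cinv c (?g c (tang q)))"
      by (rule continuous_on_compose2[OF cinv_continuous[OF c(1)] 1]) (use UD[of _ c] lq in auto)
    then have "continuous_on (D \<inter> U c) (inv \<Omega>)"
      by (rule continuous_on_eq) (use UD[of _ c] lq c(1) in auto)
    moreover have "q \<in> D \<inter> U c" using q c UD by blast
    moreover have "at q within D = at q within D \<inter> U c"
      by (rule at_within_nhd[OF _ U[OF c(1)]]) (use q c UD[of q c] in auto)
    ultimately show "continuous (at q within D) (inv \<Omega>)" by (simp add: continuous_on_eq_continuous_within)
  qed
  have si: "smooth_into A D (inv \<Omega>)"
    unfolding smooth_into_def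
  proof (intro conjI ballI impI)
    fix c p assume c: "c \<in> A" "p \<in> D" "inv \<Omega> p \<in> fst c"
    show "\<exists>U F. open U \<and> p \<in> U \<and> smooth_on U F \<and> (\<forall>q\<in>D \<inter> U. inv \<Omega> q \<in> fst c \<and> F q = snd c (inv \<Omega> q))"
    proof (intro exI conjI ballI)
      show "open (U c)" by (rule U[OF c(1)])
      show "p \<in> U c" using c UD by blast
      show "smooth_on (U c) (\<lambda>q. ?g c (tang q))"
        unfolding smooth_on_def
        by (intro allI Ck_on_compose[where f = "?g c" and g = tang, OF U[OF c(1)] main(2)[OF c(1)]] Ck_on_linear tang_linear) (auto simp: U_def)
      show "inv \<Omega> q \<in> fst c" "?g c (tang q) = snd c (inv \<Omega> q)" if "q \<in> D \<inter> U c" for q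
        using that UD[of q c] lq by auto
    qed
  qed (rule cont)
  show "diffeo_onto A \<pp> D \<Omega>"
    unfolding diffeo_onto_def using od si \<Omega> inj D by (auto simp: bij_betw_def)
  have "continuous_on UNIV \<Omega>"
    unfolding continuous_on_eq_continuous_at[OF open_UNIV]
  proof
    fix x :: 'm
    obtain c where c: "c \<in> A" "x \<in> fst c" by (rule chart_at)
    have "continuous_on (snd c ` fst c) (\<lambda>y. \<Omega> (cinv c y))" using \<Omega>[of 0] c by (simp add: Ck_fun_def comp_def)
    then have "continuous_on (fst c) (\<lambda>x. \<Omega> (cinv c (snd c x)))"
      by (rule continuous_on_compose2[OF _ chart_continuous[OF c(1)]]) simp
    then have "continuous_on (fst c) \<Omega>" by (rule continuous_on_eq) (use c in simp)
    then show "isCont \<Omega> x" using c chart_open(1) by (simp add: continuous_on_eq_continuous_at)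
  qed
  moreover have "inv \<Omega> ` range \<Omega> = UNIV" using inv\<Omega> by (simp add: image_image)
  ultimately have "homeomorphism UNIV (range \<Omega>) \<Omega> (inv \<Omega>)"
    unfolding homeomorphism_def using cont D inv\<Omega> by (auto simp: f_inv_into_f)
  then show "C1_embedding A \<pp> \<Omega>"
    unfolding C1_embedding_def using \<Omega>[of "Suc 0"] chart_deriv_inj[OF \<Omega> dinj] D by auto
qed

end

section \<open>Differentials along the flat\<close>

context hermitian_space
begin

lemma diff_at_root:
  assumes \<Omega>: "Ck_fun A (Suc 0) \<Omega>" "K_equivariant A g ex ob \<Omega>" and H: "H \<in> a" "\<Omega> (ex H ob) \<in> a"
    and rp: "root_pair \<mu> Y W" and odd: "\<mu> (- H) = - \<mu> H"
  shows "sinh (\<mu> H) *\<^sub>R diff_at \<Omega> H Y = \<mu> (\<Omega> (ex H ob)) *\<^sub>R Y"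
proof -
  note D = root_pairD[OF rp] and l = diff_at_linear[OF \<Omega>(1), of H]
  have "- H \<in> a" by (rule subspace_neg[OF a_subspace H(1)])
  from Ad_ex_root_pair(2)[OF rp this]
  have A: "Ad ex (ex (- H)) W = (- sinh (\<mu> H)) *\<^sub>R Y + cosh (\<mu> H) *\<^sub>R W" by (simp add: odd)
  have "p_part (Ad ex (ex (- H)) W) = (- sinh (\<mu> H)) *\<^sub>R Y"
    unfolding A linear_add[OF part_linear(2)] linear_scale[OF part_linear(2)] part_simps(1)[OF D(1)] part_simps(3)[OF D(2)] by simp
  then have "diff_at \<Omega> H (Ad ex (ex (- H)) W) = (- sinh (\<mu> H)) *\<^sub>R diff_at \<Omega> H Y"
    using diff_at_p_part[OF \<Omega>(1)] linear_scale[OF l] by metis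
  moreover have "diff_at \<Omega> H (Ad ex (ex (- H)) W) = br W (\<Omega> (ex H ob))" by (rule diff_at_isotropy[OF \<Omega> D(2)])
  moreover have "br W (\<Omega> (ex H ob)) = - br (\<Omega> (ex H ob)) W" by (rule br_anti)
  moreover have "br (\<Omega> (ex H ob)) W = \<mu> (\<Omega> (ex H ob)) *\<^sub>R Y" by (rule D(4)[OF H(2)])
  ultimately show ?thesis by simp
qed

lemma diff_at_flat_derivative:
  assumes \<Omega>: "Ck_fun A (Suc 0) \<Omega>" and H: "H \<in> a" "V \<in> a"
  shows "((\<lambda>t. \<Omega> (ex (H + t *\<^sub>R V) ob)) has_vector_derivative diff_at \<Omega> (H + s *\<^sub>R V) V) (at s)"
proof -
  have "ex (H + s *\<^sub>R V) (ex (t *\<^sub>R V) ob) = ex (H + (s + t) *\<^sub>R V) ob" for t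
  proof -
    have "br (H + s *\<^sub>R V) (t *\<^sub>R V) = 0" by (rule a_abelian) (intro subspace_add subspace_scale a_subspace H)+
    from ex_commuting_add[OF this, of ob] show ?thesis by (simp add: algebra_simps)
  qed
  then have "((\<lambda>t. \<Omega> (ex (H + (s + t) *\<^sub>R V) ob)) has_vector_derivative diff_at \<Omega> (H + s *\<^sub>R V) V) (at 0)"
    using diff_at_derivative[OF \<Omega>, of "H + s *\<^sub>R V" V] by simp
  then have d: "((\<lambda>t. \<Omega> (ex (H + (s + t) *\<^sub>R V) ob)) has_derivative (\<lambda>r. r *\<^sub>R diff_at \<Omega> (H + s *\<^sub>R V) V)) (at (s - s))"
    by (simp add: has_vector_derivative_def)
  have "((\<lambda>t. t - s) has_vector_derivative 1) (at s)" by (auto intro!: derivative_eq_intros)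
  from has_vector_derivative_compose[OF this d] show ?thesis by simp
qed

lemma diff_at_flat_in_a:
  assumes \<Omega>: "Ck_fun A (Suc 0) \<Omega>" and H: "H \<in> a" "V \<in> a" and a: "\<And>H. H \<in> a \<Longrightarrow> \<Omega> (ex H ob) \<in> a"
  shows "diff_at \<Omega> H V \<in> a"
proof -
  have "((\<lambda>t. \<Omega> (ex (H + t *\<^sub>R V) ob)) has_vector_derivative diff_at \<Omega> H V) (at 0)"
    using diff_at_flat_derivative[OF \<Omega> H, of 0] by simp
  then show ?thesis
    by (rule vector_derivative_in_subspace[OF a_subspace, rotated]) (intro a subspace_add subspace_scale a_subspace H)
qed

lemma diff_at_flat_continuous:
  assumes \<Omega>: "Ck_fun A (Suc 0) \<Omega>" shows "isCont (\<lambda>t. diff_at \<Omega> (H + t *\<^sub>R V) Y) s"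
proof -
  have "continuous_on UNIV (\<lambda>t. diff_at \<Omega> (H + t *\<^sub>R V) Y)"
    by (rule continuous_on_compose2[OF diff_at_continuous[OF \<Omega>]]) (auto intro!: continuous_intros)
  then show ?thesis by (simp add: continuous_on_eq_continuous_at)
qed

lemma isCont_eq_if_punctured:
  fixes f h :: "real \<Rightarrow> 'a::t2_space"
  assumes "isCont f s" "isCont h s" "\<forall>\<^sub>F t in at s. f t = h t" shows "f s = h s"
proof -
  have "(h \<longlongrightarrow> f s) (at s)" using assms(1,3) unfolding isCont_def by (rule Lim_transform_eventually)
  then show ?thesis using assms(2) unfolding isCont_def by (rule tendsto_unique[OF at_neq_bot])
qed

lemma flat_shift: "flat x + t *\<^sub>R Ht i = flat (\<lambda>k. x k + (if k = i then t else 0))" if "i \<in> {1..r}"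
  unfolding flat_linear(1) flat_Ht[OF that] by (rule refl)

text \<open>\<open>l\<close> is the continuous extension of the quotient \<open>\<mu>(f(x)) / sinh(\<mu>(x))\<close> to the walls.\<close>

lemma radial_root:
  assumes \<Omega>: "Ck_fun A (Suc 0) \<Omega>" "K_equivariant A g ex ob \<Omega>" and rad: "\<And>x. \<Omega> (ex (flat x) ob) = flat (\<lambda>i. f (x i))"
    and rp: "root_pair \<mu> Y W" and \<mu>: "\<And>X Y t. X \<in> a \<Longrightarrow> Y \<in> a \<Longrightarrow> \<mu> (X + t *\<^sub>R Y) = \<mu> X + t * \<mu> Y"
    and i: "i \<in> {1..r}" "\<mu> (Ht i) \<noteq> 0" and eq: "\<And>x. \<mu> (flat (\<lambda>i. f (x i))) = l x * sinh (\<mu> (flat x))"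
    and cont: "isCont (\<lambda>t. l (\<lambda>k. x k + (if k = i then t else 0))) 0"
  shows "diff_at \<Omega> (flat x) Y = l x *\<^sub>R Y"
proof -
  have 0: "\<mu> 0 = 0" using \<mu>[OF subspace_0[OF a_subspace] subspace_0[OF a_subspace], of 1] by simp
  have odd: "\<mu> (- H) = - \<mu> H" if "H \<in> a" for H
    using \<mu>[OF subspace_0[OF a_subspace] that, of "-1"] 0 by simp
  have "sinh (\<mu> (flat x)) *\<^sub>R (diff_at \<Omega> (flat x) Y - l x *\<^sub>R Y) = 0" for x
    using diff_at_root[OF \<Omega> flat_a _ rp odd[OF flat_a], of x] rad[of x] flat_a eq[of x] by (simp add: algebra_simps)
  then have eq': "diff_at \<Omega> (flat x) Y = l x *\<^sub>R Y" if "\<mu> (flat x) \<noteq> 0" for x using that by fastforce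
  let ?x = "\<lambda>t k. x k + (if k = i then t else 0)"
  have lin: "\<mu> (flat (?x t)) = \<mu> (flat x) + t * \<mu> (Ht i)" for t
    unfolding flat_shift[OF i(1), symmetric] by (rule \<mu>[OF flat_a Ht_a[OF i(1)]])
  have "\<forall>\<^sub>F t in at 0. \<mu> (flat (?x t)) \<noteq> 0"
  proof (cases "\<mu> (flat x) = 0")
    case True
    then show ?thesis using i(2) by (simp add: lin eventually_at_filter)
  next
    case False
    have "isCont (\<lambda>t. \<mu> (flat x) + t * \<mu> (Ht i)) 0" by (intro continuous_intros)
    then have "((\<lambda>t. \<mu> (flat x) + t * \<mu> (Ht i)) \<longlongrightarrow> \<mu> (flat x)) (at 0)" by (simp add: isCont_def)
    from tendsto_imp_eventually_ne[OF this False] show ?thesis by (simp add: lin)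
  qed
  then have ev: "\<forall>\<^sub>F t in at 0. diff_at \<Omega> (flat x + t *\<^sub>R Ht i) Y = l (?x t) *\<^sub>R Y"
    by (rule eventually_mono) (simp add: flat_shift[OF i(1)] eq')
  have "isCont (\<lambda>t. l (?x t) *\<^sub>R Y) 0" by (rule isCont_scaleR[OF cont continuous_const])
  from isCont_eq_if_punctured[OF diff_at_flat_continuous[OF \<Omega>(1)] this ev]
  show ?thesis by (simp add: if_distrib cong: if_cong)
qed

lemma sum_root_linear:
  assumes "i \<in> {1..r}" "j \<in> {1..r}" "X \<in> a" "Y \<in> a"
  shows "s * e i (X + t *\<^sub>R Y) + u * e j (X + t *\<^sub>R Y) = (s * e i X + u * e j X) + t * (s * e i Y + u * e j Y)"
  using assms by (simp add: e_linear subspace_scale[OF a_subspace] algebra_simps)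

lemma radial_Ht:
  assumes \<Omega>: "Ck_fun A (Suc 0) \<Omega>" and rad: "\<And>x. \<Omega> (ex (flat x) ob) = flat (\<lambda>i. f (x i))"
    and i: "i \<in> {1..r}" and f: "(f has_real_derivative f') (at (x i))"
  shows "diff_at \<Omega> (flat x) (Ht i) = f' *\<^sub>R Ht i"
proof -
  have "((\<lambda>t. \<Omega> (ex (flat x + t *\<^sub>R Ht i) ob)) has_vector_derivative diff_at \<Omega> (flat x) (Ht i)) (at 0)"
    using diff_at_flat_derivative[OF \<Omega> flat_a Ht_a[OF i], of x 0] by simp
  moreover have "\<Omega> (ex (flat x + t *\<^sub>R Ht i) ob) = flat (\<lambda>k. f (x k)) + (f (x i + t) - f (x i)) *\<^sub>R Ht i" for t
    unfolding flat_shift[OF i] rad by (rule flat_eqI) simp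
  moreover have "((\<lambda>t. f (x i + t)) has_real_derivative f') (at 0)"
    using DERIV_shift[of f f' 0 "x i"] f by (simp add: add.commute)
  then have "((\<lambda>t. flat (\<lambda>k. f (x k)) + (f (x i + t) - f (x i)) *\<^sub>R Ht i) has_vector_derivative f' *\<^sub>R Ht i) (at 0)"
    by (auto intro!: derivative_eq_intros)
  ultimately show ?thesis using vector_derivative_unique_at by simp
qed

text \<open>The root spaces of \<open>\<pp>\<close>, arranged in pairs that are interchanged by the complex structure.\<close>

definition J_basis :: "'g set" where
  "J_basis = Ht ` {1..r} \<union> (\<lambda>i. JJ (Ht i)) ` {1..r} \<union>
     {Y. \<exists>s\<in>{-1, 1}. \<exists>t\<in>{-1, 1}. \<exists>i\<in>{1..r}. \<exists>j\<in>{1..r}. i \<noteq> j \<and> (\<exists>W. root_pair (\<lambda>X. s * e i X + t * e j X) Y W)} \<union>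
     {Y. \<exists>s\<in>{-1, 1}. \<exists>i\<in>{1..r}. \<exists>W. root_pair (\<lambda>X. s * e i X) Y W}"

lemma a_span: "H \<in> a \<Longrightarrow> H \<in> span J_basis" and J_a_span: "H \<in> a \<Longrightarrow> JJ H \<in> span J_basis"
proof -
  assume H: "H \<in> a"
  let ?x = "\<lambda>i. e i H"
  have "flat ?x \<in> span J_basis" unfolding flat_eq
    by (intro span_sum span_scale span_base) (auto simp: J_basis_def)
  then show "H \<in> span J_basis" by (simp add: a_flat[OF H])
  have "JJ (flat ?x) \<in> span J_basis" unfolding J_flat
    by (intro span_sum span_scale span_base) (auto simp: J_basis_def)
  then show "JJ H \<in> span J_basis" by (simp add: a_flat[OF H])
qed

text \<open>A vector of a long root lies in J a by \<open>J_long_root\<close>, so it is covered by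
  the vectors \<open>JJ (Ht i)\<close>.\<close>

lemma J_basis_span: "X \<in> \<pp> \<Longrightarrow> X \<in> span J_basis"
proof -
  assume X: "X \<in> \<pp>"
  obtain S where S: "S \<subseteq> \<pp>" "span S = \<pp>" "\<forall>b\<in>S. b \<in> a \<or> (\<exists>\<mu>\<in>\<Sigma>'. \<exists>W. root_pair \<mu> b W)"
    using eigenbasis_p by blast
  have "S \<subseteq> span J_basis"
  proof
    fix b assume b: "b \<in> S"
    show "b \<in> span J_basis"
    proof (cases "b \<in> a")
      case True then show ?thesis by (rule a_span)
    next
      case False
      then obtain \<mu> W where \<mu>: "\<mu> \<in> \<Sigma>'" "root_pair \<mu> b W" using S(3) b by blast
      show ?thesis using \<mu>(1)
      proof (cases rule: root_cases)
        case (sum s t i j)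
        then have "i \<noteq> j" by simp
        then show ?thesis using sum \<mu>(2) by (intro span_base) (unfold J_basis_def, blast)
      next
        case (long s i)
        have "JJ b \<in> a" using \<mu>(2) unfolding long(3) by (rule J_long_root[OF long(1,2)])
        from J_a_span[OF this] have "- b \<in> span J_basis" using J_J S(1) b by auto
        then show ?thesis using span_neg by fastforce
      next
        case (short s i)
        then show ?thesis using \<mu>(2) by (intro span_base) (unfold J_basis_def, blast)
      qed
    qed
  qed
  then show ?thesis using X S(2) span_minimal[OF _ subspace_span] by blast
qed

lemma J_basis_cases:
  assumes "b \<in> J_basis"
  obtains (Ht) i where "i \<in> {1..r}" "b = Ht i" | (J_Ht) i where "i \<in> {1..r}" "b = JJ (Ht i)"
    | (sum) s t i j W where "s \<in> {-1, 1}" "t \<in> {-1, 1}" "i \<in> {1..r}" "j \<in> {1..r}" "i \<noteq> j" "root_pair (\<lambda>X. s * e i X + t * e j X) b W"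
    | (short) s i W where "s \<in> {-1, 1}" "i \<in> {1..r}" "root_pair (\<lambda>X. s * e i X) b W"
  using assms unfolding J_basis_def by blast

section \<open>Operators diagonal along the root spaces and their interplay with the complex
  structure\<close>

context
  fixes L :: "'g \<Rightarrow> 'g" and d l m :: "nat \<Rightarrow> real" and c :: "real \<Rightarrow> real \<Rightarrow> nat \<Rightarrow> nat \<Rightarrow> real"
  assumes L: "linear L" and L_Ht: "i \<in> {1..r} \<Longrightarrow> L (Ht i) = d i *\<^sub>R Ht i"
    and L_J_Ht: "i \<in> {1..r} \<Longrightarrow> L (JJ (Ht i)) = l i *\<^sub>R JJ (Ht i)"
    and L_sum: "s \<in> {-1, 1} \<Longrightarrow> t \<in> {-1, 1} \<Longrightarrow> i \<in> {1..r} \<Longrightarrow> j \<in> {1..r} \<Longrightarrow> i \<noteq> j \<Longrightarrow>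
      root_pair (\<lambda>X. s * e i X + t * e j X) Y W \<Longrightarrow> L Y = c s t i j *\<^sub>R Y"
    and L_short: "s \<in> {-1, 1} \<Longrightarrow> i \<in> {1..r} \<Longrightarrow> root_pair (\<lambda>X. s * e i X) Y W \<Longrightarrow> L Y = m i *\<^sub>R Y"
begin

text \<open>\<open>P\<close> is whatever relation is wanted between the eigenvalue on a basis vector
  and the one on its image under J. The pairs are \<open>Ht i\<close> with \<open>JJ (Ht i)\<close>,
  the sign \<open>t\<close> with \<open>- t\<close>, and each short root with itself.\<close>

lemma L_J_basis:
  assumes "b \<in> J_basis"
    and P: "\<And>i. i \<in> {1..r} \<Longrightarrow> P (d i) (l i)" "\<And>i. i \<in> {1..r} \<Longrightarrow> P (l i) (d i)" "\<And>s t i j. P (c s t i j) (c s (- t) i j)" "\<And>i. P (m i) (m i)"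
  shows "\<exists>\<beta> \<beta>'. L b = \<beta> *\<^sub>R b \<and> L (JJ b) = \<beta>' *\<^sub>R JJ b \<and> P \<beta> \<beta>' \<and> b \<in> \<pp>"
  using assms(1)
proof (cases rule: J_basis_cases)
  case (Ht i)
  then show ?thesis using L_Ht[OF Ht(1)] L_J_Ht[OF Ht(1)] Ht_p[OF Ht(1)] P(1)[OF Ht(1)] by blast
next
  case (J_Ht i)
  have "JJ b = - Ht i" using J_Ht J_J[OF Ht_p] by simp
  then have "L (JJ b) = d i *\<^sub>R JJ b" using L_Ht[OF J_Ht(1)] by (simp add: linear_neg[OF L])
  moreover have "L b = l i *\<^sub>R b" "b \<in> \<pp>" unfolding J_Ht(2) by (rule L_J_Ht[OF J_Ht(1)]) (rule J_p[OF Ht_p[OF J_Ht(1)]])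
  ultimately show ?thesis using P(2)[OF J_Ht(1)] by blast
next
  case (sum s t i j W)
  obtain W' where W': "root_pair (\<lambda>X. s * e i X - t * e j X) (JJ b) W'"
    using J_sum_root[OF sum(1-6)] by blast
  have t: "- t \<in> {-1, 1}" using sum(2) by auto
  have "root_pair (\<lambda>X. s * e i X + - t * e j X) (JJ b) W'" using W' by simp
  from L_sum[OF sum(1) t sum(3,4,5) this] L_sum[OF sum] root_pairD(1)[OF sum(6)] show ?thesis
    using P(3)[of s t i j] by blast
next
  case (short s i W)
  obtain W' where "root_pair (\<lambda>X. s * e i X) (JJ b) W'" using J_short_root[OF short] by blast
  from L_short[OF short(1,2) this] L_short[OF short] root_pairD(1)[OF short(3)] show ?thesis
    using P(4)[of i] by blast
qed

lemma L_commutes_J: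
  assumes "\<And>i. i \<in> {1..r} \<Longrightarrow> l i = d i" "\<And>s t i j. c s t i j = c s (- t) i j" and X: "X \<in> \<pp>"
  shows "L (JJ X) = JJ (L X)"
proof -
  have "linear (\<lambda>X. L (JJ X))" "linear (\<lambda>X. JJ (L X))"
    using linear_compose[OF bracket_right L] linear_compose[OF L bracket_right] by (simp_all add: comp_def)
  then show ?thesis
  proof (rule linear_eq_on_span[OF _ _ _ J_basis_span[OF X]])
    fix b assume b: "b \<in> J_basis"
    have "\<exists>\<beta> \<beta>'. L b = \<beta> *\<^sub>R b \<and> L (JJ b) = \<beta>' *\<^sub>R JJ b \<and> \<beta> = \<beta>' \<and> b \<in> \<pp>"
      by (rule L_J_basis[OF b]) (simp_all only: assms(1), rule assms(2))
    then show "L (JJ b) = JJ (L b)" by (auto simp: br_simps)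
  qed
qed

text \<open>For a symmetric \<open>L\<close> this is the symplectic condition: J L X paired with L Y
  equals L J L X paired with Y. In eigenvalues, those exchanged by J must be reciprocal.\<close>

lemma L_J_L:
  assumes "\<And>i. i \<in> {1..r} \<Longrightarrow> l i * d i = 1" "\<And>s t i j. c s t i j * c s (- t) i j = 1" "\<And>i. m i * m i = 1" and X: "X \<in> \<pp>"
  shows "L (JJ (L X)) = JJ X"
proof -
  have "linear (\<lambda>X. L (JJ (L X)))"
    using linear_compose[OF linear_compose[OF L bracket_right] L] by (simp add: comp_def)
  then show ?thesis
  proof (rule linear_eq_on_span[OF _ bracket_right _ J_basis_span[OF X]])
    fix b assume b: "b \<in> J_basis"
    have "\<exists>\<beta> \<beta>'. L b = \<beta> *\<^sub>R b \<and> L (JJ b) = \<beta>' *\<^sub>R JJ b \<and> \<beta> * \<beta>' = 1 \<and> b \<in> \<pp>"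
      by (rule L_J_basis[OF b]) (use assms(1-3) in \<open>simp_all add: mult.commute\<close>)
    then show "L (JJ (L b)) = JJ b" by (auto simp: br_simps linear_scale[OF L])
  qed
qed

text \<open>The long root space is the line through \<open>JJ (Ht i)\<close>: the vector
  \<open>JJ Y\<close> lies in \<open>a\<close>, and it is orthogonal to every other
  \<open>Ht k\<close> because Y and \<open>JJ (Ht k)\<close> have the different eigenvalues 4 and 0
  under ad(Ht_i)^2.\<close>

lemma L_long:
  assumes "s \<in> {-1, 1}" "i \<in> {1..r}" "root_pair (\<lambda>X. s * (2 * e i X)) Y W" shows "L Y = l i *\<^sub>R Y"
proof -
  have Yp: "Y \<in> \<pp>" by (rule root_pairD(1)[OF assms(3)])
  have Ja: "JJ Y \<in> a" by (rule J_long_root[OF assms])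
  have "ip (JJ Y) (Ht k) = 0" if k: "k \<in> {1..r}" "k \<noteq> i" for k
  proof -
    have "root_pair (\<lambda>H. 2 * e k H) (JJ (Ht k)) (Wt k)" by (rule Ht_root_pair[OF k(1)])
    from root_pairD(3)[OF this Ht_a[OF assms(2)]] have z: "br (Ht i) (JJ (Ht k)) = 0" using e_Ht[OF k(1) assms(2)] k(2) by simp
    have Y: "br (Ht i) (br (Ht i) Y) = 4 *\<^sub>R Y"
      using root_pair_square[OF assms(3) Ht_a[OF assms(2)]] e_Ht[OF assms(2,2)] assms(1) by auto
    have "4 * ip Y (JJ (Ht k)) = ip (br (Ht i) (br (Ht i) Y)) (JJ (Ht k))" unfolding Y by (simp add: form.form_simps)
    also have "\<dots> = ip (br (Ht i) Y) (br (Ht i) (JJ (Ht k)))" by (rule ip_br_p[OF Ht_p[OF assms(2)]])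
    also have "\<dots> = 0" by (simp add: z)
    finally show ?thesis by (simp add: J_skew)
  qed
  then have e0: "e k (JJ Y) = 0" if "k \<in> {1..r}" "k \<noteq> i" for k using e_eq[OF that(1) Ja] that by simp
  have "JJ Y = flat (\<lambda>k. e k (JJ Y))" by (rule a_flat[OF Ja, symmetric])
  also have "\<dots> = flat (\<lambda>k. if k = i then e i (JJ Y) else 0)" by (rule flat_eqI) (use e0 in auto)
  also have "\<dots> = e i (JJ Y) *\<^sub>R Ht i" by (rule flat_Ht[OF assms(2)])
  finally have "- Y = e i (JJ Y) *\<^sub>R JJ (Ht i)" using J_J[OF Yp] by (metis linear_scale[OF bracket_right])
  then have "Y = (- e i (JJ Y)) *\<^sub>R JJ (Ht i)" by (metis minus_minus scaleR_minus_left)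
  then obtain u where "Y = u *\<^sub>R JJ (Ht i)" by blast
  then show ?thesis using L_J_Ht[OF assms(2)] by (simp add: linear_scale[OF L])
qed

lemma L_root:
  assumes "\<mu> \<in> \<Sigma>'" and rp: "root_pair \<mu> Y W" shows "\<exists>\<beta>. L Y = \<beta> *\<^sub>R Y"
  using assms(1)
proof (cases rule: root_cases)
  case (sum s t i j)
  then have "i \<noteq> j" by simp
  from L_sum[OF sum(1-4) this rp[unfolded sum(6)]] show ?thesis by blast
next
  case (long s i)
  from L_long[OF long(1,2) rp[unfolded long(3)]] show ?thesis by blast
next
  case (short s i)
  from L_short[OF short(1,2) rp[unfolded short(3)]] show ?thesis by blast
qed

lemma L_a: assumes "H \<in> a" shows "L H = flat (\<lambda>i. d i * e i H)"
proof -
  have "L H = L (\<Sum>i=1..r. e i H *\<^sub>R Ht i)" using a_flat[OF assms] by (simp add: flat_eq)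
  also have "\<dots> = (\<Sum>i=1..r. e i H *\<^sub>R L (Ht i))" by (simp add: linear_sum[OF L] linear_scale[OF L])
  also have "\<dots> = (\<Sum>i=1..r. (d i * e i H) *\<^sub>R Ht i)" by (rule sum.cong) (simp_all add: L_Ht mult.commute)
  finally show ?thesis by (simp add: flat_eq)
qed

lemma root_pair_orth_a: "\<mu> \<in> \<Sigma>' \<Longrightarrow> root_pair \<mu> Y W \<Longrightarrow> H \<in> a \<Longrightarrow> ip Y H = 0"
proof -
  assume \<mu>: "\<mu> \<in> \<Sigma>'" and rp: "root_pair \<mu> Y W" and H: "H \<in> a"
  obtain H' where "\<mu> H' \<noteq> 0" using \<mu> by (auto simp: restricted_roots_def)
  moreover have "H' \<in> a" using root_dual[OF \<mu>] calculation by (auto simp: dual_space_def)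
  ultimately show "ip Y H = 0" using root_pair_orthogonal[OF rp _ _ H] by blast
qed

text \<open>Checked on the orthogonal basis of \<open>eigenbasis_p\<close>; \<open>J_basis\<close>
  contains whole root spaces, whose members need not be orthogonal to each other.\<close>

lemma L_symmetric:
  assumes X: "X \<in> \<pp>" and Y: "Y \<in> \<pp>" shows "ip (L X) Y = ip X (L Y)"
proof -
  obtain S where S: "S \<subseteq> \<pp>" "span S = \<pp>" "\<forall>b\<in>S. \<forall>c\<in>S. b \<noteq> c \<longrightarrow> ip b c = 0" "\<forall>b\<in>S. b \<in> a \<or> (\<exists>\<mu>\<in>\<Sigma>'. \<exists>W. root_pair \<mu> b W)"
    using eigenbasis_p by blast
  have aa: "ip (L H) H' = ip H (L H')" if H: "H \<in> a" "H' \<in> a" for H H'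
  proof -
    have e: "ip (Ht i) V = e i V * ip (Ht i) (Ht i)" if "i \<in> {1..r}" "V \<in> a" for i V
      using e_eq[OF that] Ht_pos[OF that(1)] form.sym[of V] by simp
    have *: "ip (L U) V = (\<Sum>i=1..r. d i * e i U * (e i V * ip (Ht i) (Ht i)))" if V: "U \<in> a" "V \<in> a" for U V
      unfolding L_a[OF V(1)] flat_eq linear_sum[OF form.lin(2)] linear_scale[OF form.lin(2)]
      by (rule sum.cong) (simp_all add: e V)
    show ?thesis using *[OF H] *[OF H(2,1)] form.sym[of H "L H'"] by (simp add: mult_ac)
  qed
  have La: "L H \<in> a" if "H \<in> a" for H unfolding L_a[OF that] by (rule flat_a)
  have ra: "ip (L b) H = ip b (L H)" if "\<mu> \<in> \<Sigma>'" "root_pair \<mu> b W" "H \<in> a" for b H \<mu> W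
    using L_root[OF that(1,2)] root_pair_orth_a[OF that(1,2)] La that(3) by (auto simp: form.form_simps)
  have bb: "ip (L b) b' = ip b (L b')" if b: "b \<in> S" "b' \<in> S" for b b'
  proof (cases "b \<in> a"; cases "b' \<in> a")
    assume "b \<in> a" "b' \<in> a" then show ?thesis by (rule aa)
  next
    assume h: "b \<in> a" "b' \<notin> a"
    then obtain \<mu> W where "\<mu> \<in> \<Sigma>'" "root_pair \<mu> b' W" using S(4) b by blast
    from ra[OF this h(1)] show ?thesis using form.sym by metis
  next
    assume h: "b \<notin> a" "b' \<in> a"
    then obtain \<mu> W where "\<mu> \<in> \<Sigma>'" "root_pair \<mu> b W" using S(4) b by blast
    from ra[OF this h(2)] show ?thesis .
  next
    assume h: "b \<notin> a" "b' \<notin> a"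
    obtain \<mu> W where 1: "\<mu> \<in> \<Sigma>'" "root_pair \<mu> b W" using S(4) b h by blast
    obtain \<mu>' W' where 2: "\<mu>' \<in> \<Sigma>'" "root_pair \<mu>' b' W'" using S(4) b h by blast
    obtain \<beta> \<beta>' where "L b = \<beta> *\<^sub>R b" "L b' = \<beta>' *\<^sub>R b'" using L_root[OF 1] L_root[OF 2] by blast
    then show ?thesis using S(3) b by (cases "b = b'") (auto simp: form.form_simps)
  qed
  have bl: "bilinear (\<lambda>X Y. ip (L X) Y)" "bilinear (\<lambda>X Y. ip X (L Y))"
    by (auto simp: bilinear_def linear_iff form.form_simps linear_add[OF L] linear_scale[OF L])
  show ?thesis
    by (rule bilinear_eq[OF bl, of \<pp> S \<pp> S]) (use S X Y bb in auto)
qed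

lemma L_inj:
  assumes nz: "\<And>i. i \<in> {1..r} \<Longrightarrow> d i \<noteq> 0" "\<And>i. i \<in> {1..r} \<Longrightarrow> l i \<noteq> 0" "\<And>s t i j. c s t i j \<noteq> 0" "\<And>i. m i \<noteq> 0"
    and X: "X \<in> \<pp>" "L X = 0" shows "X = 0"
proof (rule form.orthogonal_span_eq_0[OF _ J_basis_span[OF X(1)]])
  fix b assume "b \<in> J_basis"
  from L_J_basis[OF this, of "\<lambda>\<beta> _. \<beta> \<noteq> 0"] obtain \<beta> where b: "L b = \<beta> *\<^sub>R b" "\<beta> \<noteq> 0" "b \<in> \<pp>" using nz by blast
  have "\<beta> * ip X b = ip X (L b)" by (simp add: b(1) form.form_simps)
  also have "\<dots> = ip (L X) b" by (rule L_symmetric[OF X(1) b(3), symmetric])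
  finally show "ip X b = 0" using b(2) X(2) by simp
qed

end

end

section \<open>Properties of the radial maps\<close>

lemma interpolation_poly:
  fixes T :: "real set"
  assumes "finite T" shows "\<exists>p. \<forall>t\<in>T. poly p t = v t"
  using assms
proof induction
  case (insert t T)
  then obtain p where p: "\<And>t. t \<in> T \<Longrightarrow> poly p t = v t" by blast
  define q where "q = (\<Prod>s\<in>T. [:- s, 1:])"
  have q: "poly q x = (\<Prod>s\<in>T. x - s)" for x by (simp add: q_def poly_prod)
  have q0: "poly q t \<noteq> 0" unfolding q using insert.hyps by (simp add: prod_zero_iff)
  have qT: "poly q s = 0" if "s \<in> T" for s unfolding q using that insert.hyps(1) by (auto simp: prod_zero_iff)
  have "poly (p + smult ((v t - poly p t) / poly q t) q) s = v s" if "s \<in> insert t T" for s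
    using that p qT q0 by auto
  then show ?case by blast
qed simp

text \<open>A polynomial p interpolates \<open>\<phi> (sqrt t) / sqrt t\<close> at the squares of
  the points, and s p(s^2) is odd. At 0 oddness forces \<open>\<phi> 0 = 0\<close>, so the
  conventional value of the quotient does no harm.\<close>

lemma odd_interpolation:
  fixes S :: "real set"
  assumes S: "finite S" and odd: "\<And>s. \<phi> (- s) = - \<phi> s"
  shows "\<exists>c (N::nat). \<forall>s\<in>S. (\<Sum>n\<le>N. c n * s ^ (2 * n + 1)) = \<phi> s"
proof -
  have "finite ((\<lambda>s. s\<^sup>2) ` S)" using S by simp
  from interpolation_poly[OF this, of "\<lambda>t. \<phi> (sqrt t) / sqrt t"]
  obtain p where p: "\<And>s. s \<in> S \<Longrightarrow> poly p (s\<^sup>2) = \<phi> \<bar>s\<bar> / \<bar>s\<bar>" by auto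
  have "(\<Sum>n\<le>degree p. coeff p n * s ^ (2 * n + 1)) = \<phi> s" if s: "s \<in> S" for s
  proof -
    have "(\<Sum>n\<le>degree p. coeff p n * s ^ (2 * n + 1)) = s * poly p (s\<^sup>2)"
      unfolding poly_altdef sum_distrib_left by (rule sum.cong) (simp_all add: power_mult)
    also have "\<dots> = \<phi> s"
    proof (cases "s = 0")
      case True
      then show ?thesis using odd[of 0] by simp
    next
      case False
      then show ?thesis using p[OF s] odd[of s] by (cases "s > 0") auto
    qed
    finally show ?thesis .
  qed
  then show ?thesis by blast
qed

lemma odd_left_inverse:
  fixes f :: "real \<Rightarrow> real"
  assumes "inj f" "\<And>x. f (- x) = - f x"
  shows "\<exists>\<phi>. (\<forall>s. \<phi> (- s) = - \<phi> s) \<and> (\<forall>u. \<phi> (f u) = u)"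
proof (intro exI conjI allI)
  \<comment> \<open>The range is symmetric, and the default 0 outside keeps the function
    odd.\<close>
  let ?\<phi> = "\<lambda>s. if s \<in> range f then inv f s else 0"
  show "?\<phi> (f u) = u" for u using assms(1) by simp
  show "?\<phi> (- s) = - ?\<phi> s" for s
  proof (cases "s \<in> range f")
    case True
    then obtain u where u: "s = f u" by blast
    then have "- s = f (- u)" by (simp add: assms(2))
    then show ?thesis using u assms(1) by simp
  next
    case False
    have "- s \<notin> range f"
    proof
      assume "- s \<in> range f"
      then obtain u where u: "- s = f u" by blast
      have "s = f (- u)" unfolding assms(2) u[symmetric] by simp
      then show False using False by blast
    qed
    then show ?thesis using False by simp
  qed
qed

section \<open>Passing from the flat to the whole space, and injectivity of radial maps\<close>

context hermitian_space
begin

text \<open>On the flat \<open>square_op X\<close> multiplies the \<open>i\<close>-th coordinate by \<open>x\<^sub>i\<^sup>2\<close>; so an odd polynomial applied coordinatewise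
  is the restriction of an equivariant map.\<close>

definition square_op :: "'g \<Rightarrow> 'g \<Rightarrow> 'g" where
  "square_op X V = (1/4) *\<^sub>R JJ (br (br X (JJ X)) V)"

lemma square_op_flat: "square_op (flat y) (flat v) = flat (\<lambda>i. (y i)\<^sup>2 * v i)"
proof -
  have "JJ (br (br (flat y) (JJ (flat y))) (Ht j)) = (4 * (y j)\<^sup>2) *\<^sub>R Ht j" if j: "j \<in> {1..r}" for j
  proof -
    have "JJ (br (br (flat y) (JJ (flat y))) (Ht j)) = (\<Sum>i=1..r. (2 * (y i)\<^sup>2) *\<^sub>R JJ (br (Wt i) (Ht j)))"
      unfolding br_flat_J_flat linear_sum[OF bracket_left] linear_sum[OF bracket_right] linear_scale[OF bracket_left] linear_scale[OF bracket_right] by (rule refl)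
    also have "\<dots> = (\<Sum>i=1..r. if i = j then (4 * (y j)\<^sup>2) *\<^sub>R Ht j else 0)"
    proof (rule sum.cong)
      fix i assume i: "i \<in> {1..r}"
      have "JJ (br (Wt i) (Ht j)) = (1/2) *\<^sub>R JJ (br (br (Ht i) (JJ (Ht i))) (Ht j))" by (simp only: br_simps)
      then show "(2 * (y i)\<^sup>2) *\<^sub>R JJ (br (Wt i) (Ht j)) = (if i = j then (4 * (y j)\<^sup>2) *\<^sub>R Ht j else 0)"
        using triple_Ht[OF i j] by auto
    qed simp
    finally show ?thesis using j by simp
  qed
  then have "square_op (flat y) (Ht j) = (y j)\<^sup>2 *\<^sub>R Ht j" if "j \<in> {1..r}" for j using that by (simp add: square_op_def)
  moreover have l: "linear (square_op X)" for X unfolding square_op_def[abs_def] by (auto simp: linear_iff br_simps algebra_simps)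
  ultimately have "square_op (flat y) (flat v) = (\<Sum>j=1..r. v j *\<^sub>R (y j)\<^sup>2 *\<^sub>R Ht j)"
    unfolding flat_eq[of v] linear_sum[OF l] linear_scale[OF l] by (intro sum.cong) simp_all
  then show ?thesis by (simp add: flat_eq mult.commute)
qed

lemma square_op_equivariant:
  assumes k: "k \<in> K" shows "square_op (Ad ex k X) (Ad ex k V) = Ad ex k (square_op X V)"
  unfolding square_op_def linear_scale[OF Ad_linear[OF K_G[OF k]]] Ad_K_JJ[OF k]
  unfolding Ad_K_JJ[OF k, symmetric] bracket_Ad[OF K_G[OF k], symmetric] by (rule refl)

lemma square_op_power_flat: "(square_op (flat y) ^^ n) (flat y) = flat (\<lambda>i. (y i) ^ (2 * n + 1))"
  by (induction n) (simp_all add: square_op_flat power2_eq_square mult_ac)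

lemma square_op_power_equivariant:
  "k \<in> K \<Longrightarrow> (square_op (Ad ex k X) ^^ n) (Ad ex k X) = Ad ex k ((square_op X ^^ n) X)"
  by (induction n) (simp_all add: square_op_equivariant)

text \<open>Only the finitely many coordinates of \<open>y\<close> and \<open>y'\<close> are
  involved, so \<open>\<phi>\<close>, however irregular, may be replaced by an odd polynomial;
  applied coordinatewise it is the restriction of an equivariant map built from powers of
  \<open>square_op\<close>.\<close>

lemma Ad_flat_odd:
  assumes k: "k \<in> K" "Ad ex k (flat y) = flat y'" and odd: "\<And>s. \<phi> (- s) = - \<phi> s"
  shows "Ad ex k (flat (\<lambda>i. \<phi> (y i))) = flat (\<lambda>i. \<phi> (y' i))"
proof -
  have "finite (y ` {1..r} \<union> y' ` {1..r})" by simp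
  from odd_interpolation[where \<phi> = \<phi>, OF this odd]
  obtain c and N :: nat where c: "\<And>s. s \<in> y ` {1..r} \<union> y' ` {1..r} \<Longrightarrow> (\<Sum>n\<le>N. c n * s ^ (2 * n + 1)) = \<phi> s"
    by blast
  have flat_sum: "flat (\<lambda>i. \<Sum>n\<le>N. c n * z i ^ (2 * n + 1)) = (\<Sum>n\<le>N. c n *\<^sub>R flat (\<lambda>i. z i ^ (2 * n + 1)))" for z
  proof -
    have "(\<Sum>n\<le>N. c n *\<^sub>R flat (\<lambda>i. z i ^ (2 * n + 1))) = (\<Sum>n\<le>N. \<Sum>i=1..r. (c n * z i ^ (2 * n + 1)) *\<^sub>R Ht i)"
      by (simp add: flat_eq scaleR_sum_right)
    also have "\<dots> = (\<Sum>i=1..r. \<Sum>n\<le>N. (c n * z i ^ (2 * n + 1)) *\<^sub>R Ht i)" by (rule sum.swap)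
    finally show ?thesis by (simp add: flat_eq scaleR_sum_left)
  qed
  have y: "flat (\<lambda>i. \<phi> (y i)) = flat (\<lambda>i. \<Sum>n\<le>N. c n * y i ^ (2 * n + 1))" by (rule flat_eqI) (use c in auto)
  have y': "flat (\<lambda>i. \<phi> (y' i)) = flat (\<lambda>i. \<Sum>n\<le>N. c n * y' i ^ (2 * n + 1))" by (rule flat_eqI) (use c in auto)
  note l = Ad_linear[OF K_G[OF k(1)]]
  have "Ad ex k (flat (\<lambda>i. \<phi> (y i))) = (\<Sum>n\<le>N. c n *\<^sub>R Ad ex k ((square_op (flat y) ^^ n) (flat y)))"
    unfolding y flat_sum linear_sum[OF l] linear_scale[OF l] square_op_power_flat by (rule refl)
  also have "\<dots> = (\<Sum>n\<le>N. c n *\<^sub>R (square_op (flat y') ^^ n) (flat y'))"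
    unfolding square_op_power_equivariant[OF k(1), symmetric] k(2) by (rule refl)
  also have "\<dots> = flat (\<lambda>i. \<phi> (y' i))" unfolding y' flat_sum square_op_power_flat by (rule refl)
  finally show ?thesis .
qed

lemma diff_at_holomorphic:
  assumes \<Omega>: "Ck_fun A (Suc 0) \<Omega>" "K_equivariant A g ex ob \<Omega>"
    and flat: "\<And>x V. V \<in> \<pp> \<Longrightarrow> diff_at \<Omega> (flat x) (JJ V) = JJ (diff_at \<Omega> (flat x) V)"
  shows "holomorphic_map A J br \<zeta> \<Omega>"
  unfolding holomorphic_iff[OF \<Omega>(1)]
proof (intro ballI)
  fix X V assume X: "X \<in> \<pp>" and V: "V \<in> \<pp>"
  obtain k x where k: "k \<in> K" "X = Ad ex k (flat x)" using Ad_K_flat[OF X] by blast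
  let ?V = "Ad ex (inv k) V"
  have V': "V = Ad ex k ?V" using K_G[OF k(1)] by simp
  have "diff_at \<Omega> X (JJ V) = diff_at \<Omega> (Ad ex k (flat x)) (Ad ex k (JJ ?V))" using Ad_K_JJ[OF k(1), of ?V] k(2) V' by simp
  also have "\<dots> = Ad ex k (diff_at \<Omega> (flat x) (JJ ?V))" by (rule diff_at_equivariant[OF \<Omega> k(1)])
  also have "\<dots> = Ad ex k (JJ (diff_at \<Omega> (flat x) ?V))" by (simp only: flat[OF Ad_K_p[OF K_inv[OF k(1)] V]])
  also have "\<dots> = JJ (diff_at \<Omega> (Ad ex k (flat x)) (Ad ex k ?V))" by (simp only: Ad_K_JJ[OF k(1)] diff_at_equivariant[OF \<Omega> k(1)])
  finally show "JJ (diff_at \<Omega> X V) = diff_at \<Omega> X (JJ V)" using k(2) V' by simp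
qed

lemma diff_at_symplectic:
  assumes \<Omega>: "Ck_fun A (Suc 0) \<Omega>" "K_equivariant A g ex ob \<Omega>"
    and flat: "\<And>x V V'. V \<in> \<pp> \<Longrightarrow> V' \<in> \<pp> \<Longrightarrow> ip (JJ (diff_at \<Omega> (flat x) V)) (diff_at \<Omega> (flat x) V') = ip (JJ V) V'"
  shows "symplectic_map A g J br \<theta> \<zeta> \<Omega>"
  unfolding symplectic_iff[OF \<Omega>(1)]
proof (intro ballI)
  fix X V V' assume X: "X \<in> \<pp>" and V: "V \<in> \<pp>" "V' \<in> \<pp>"
  obtain k x where k: "k \<in> K" "X = Ad ex k (flat x)" using Ad_K_flat[OF X] by blast
  let ?V = "Ad ex (inv k) V" and ?V' = "Ad ex (inv k) V'"
  have e: "V = Ad ex k ?V" "V' = Ad ex k ?V'" using K_G[OF k(1)] by simp_all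
  have "ip (JJ (diff_at \<Omega> (Ad ex k (flat x)) (Ad ex k ?V))) (diff_at \<Omega> (Ad ex k (flat x)) (Ad ex k ?V')) =
      ip (JJ (diff_at \<Omega> (flat x) ?V)) (diff_at \<Omega> (flat x) ?V')"
    by (simp only: diff_at_equivariant[OF \<Omega> k(1)] Ad_K_JJ[OF k(1), symmetric] Ad_K_ip[OF k(1)])
  also have "\<dots> = ip (JJ ?V) ?V'" by (intro flat Ad_K_p K_inv k V)
  also have "\<dots> = ip (JJ (Ad ex k ?V)) (Ad ex k ?V')" by (simp only: Ad_K_JJ[OF k(1), symmetric] Ad_K_ip[OF k(1)])
  finally show "ip (JJ (diff_at \<Omega> X V)) (diff_at \<Omega> X V') = ip (JJ V) V'" using k(2) e by simp
qed

lemma diff_at_injective: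
  assumes \<Omega>: "Ck_fun A (Suc 0) \<Omega>" "K_equivariant A g ex ob \<Omega>"
    and flat: "\<And>x V. V \<in> \<pp> \<Longrightarrow> diff_at \<Omega> (flat x) V = 0 \<Longrightarrow> V = 0"
    and X: "X \<in> \<pp>" and V: "V \<in> \<pp>" "diff_at \<Omega> X V = 0"
  shows "V = 0"
proof -
  obtain k x where k: "k \<in> K" "X = Ad ex k (flat x)" using Ad_K_flat[OF X] by blast
  let ?V = "Ad ex (inv k) V"
  have V': "V = Ad ex k ?V" using K_G[OF k(1)] by simp
  have "Ad ex k (diff_at \<Omega> (flat x) ?V) = diff_at \<Omega> X V" using diff_at_equivariant[OF \<Omega> k(1), of "flat x" ?V] k(2) V' by simp
  then have "Ad ex (inv k) (Ad ex k (diff_at \<Omega> (flat x) ?V)) = Ad ex (inv k) 0" using V(2) by simp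
  then have "diff_at \<Omega> (flat x) ?V = 0" using K_G[OF k(1)] linear_0[OF Ad_linear[OF K_G[OF K_inv[OF k(1)]]]] by simp
  then have "?V = 0" by (rule flat[OF Ad_K_p[OF K_inv[OF k(1)] V(1)]])
  then show ?thesis using V' linear_0[OF Ad_linear[OF K_G[OF k(1)]]] by simp
qed

lemma radial_map_flat:
  "radial_map A g ex br \<theta> ob a e f \<Omega> \<longleftrightarrow> (\<forall>k\<in>K. \<forall>x. \<Omega> (k (ex (flat x) ob)) = Ad ex k (flat (\<lambda>i. f (x i))))"
  by (simp add: radial_map_def Exp_at_eq[OF flat_p])

lemma radial_map_unique:
  assumes "radial_map A g ex br \<theta> ob a e f \<Omega>" "radial_map A g ex br \<theta> ob a e f \<Omega>'" shows "\<Omega> = \<Omega>'"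
proof
  fix p
  obtain k x where k: "k \<in> K" "p = k (ex (flat x) ob)" using point_flat by blast
  then show "\<Omega> p = \<Omega>' p" using assms unfolding radial_map_flat by simp
qed

context
  fixes \<rho> :: "'g \<Rightarrow> 'g" and f :: "real \<Rightarrow> real"
  assumes smooth: "\<And>k. Ck_on k UNIV \<rho>" and equivariant: "\<And>k X. k \<in> K \<Longrightarrow> \<rho> (Ad ex k X) = Ad ex k (\<rho> X)"
    and on_flat: "\<And>x. \<rho> (flat x) = flat (\<lambda>i. f (x i))"
begin

abbreviation (input) "\<Omega>\<^sub>\<rho> \<equiv> (\<lambda>p. \<rho> (lift (Lg p)))"

lemma radial_ex: "X \<in> \<pp> \<Longrightarrow> \<Omega>\<^sub>\<rho> (ex X ob) = \<rho> X"
  by (simp add: Lg_ex lift_tang_p)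

lemma radial_Ck: "Ck_fun A k \<Omega>\<^sub>\<rho>"
  unfolding Ck_fun_def
proof
  fix c assume c: "c \<in> A"
  have bl: "bounded_linear lift" using lift_linear by (simp add: linear_conv_bounded_linear)
  have "Ck_on k (snd c ` fst c) (\<lambda>y. Lg (cinv c y))"
    by (rule Ck_fun_compose[OF chart_open(2)[OF c] Lg_Ck Ck_into_cinv[OF c]])
  from Ck_on_bounded_linear[OF bl chart_open(2)[OF c] this]
  have "Ck_on k (snd c ` fst c) (\<lambda>y. lift (Lg (cinv c y)))" .
  from Ck_on_compose[OF chart_open(2)[OF c] smooth this]
  show "Ck_on k (snd c ` fst c) (\<Omega>\<^sub>\<rho> \<circ> cinv c)" by (simp add: comp_def)
qed

lemma radial_equivariant: "K_equivariant A g ex ob \<Omega>\<^sub>\<rho>"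
  unfolding K_equivariant_def
proof (intro ballI allI)
  fix k x assume k: "k \<in> K"
  let ?X = "lift (Lg x)"
  have "k x = ex (Ad ex k ?X) ob" using ex_Ad_K[OF k, of ?X] by (simp add: ex_lift_Lg)
  then have "\<rho> (lift (Lg (k x))) = \<rho> (Ad ex k ?X)" using radial_ex[OF Ad_K_p[OF k lift_p]] by simp
  then show "\<rho> (lift (Lg (k x))) = Ad ex k (\<rho> (lift (Lg x)))" using equivariant[OF k] by simp
qed

lemma radial_flat: "\<Omega>\<^sub>\<rho> (ex (flat x) ob) = flat (\<lambda>i. f (x i))"
  using radial_ex[OF flat_p] on_flat by simp

lemma radial_radial: "radial_map A g ex br \<theta> ob a e f \<Omega>\<^sub>\<rho>"
  unfolding radial_map_flat using equivariantD[OF radial_equivariant] radial_flat by simp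

lemma radial_range: "range \<Omega>\<^sub>\<rho> = {Ad ex k (flat (\<lambda>i. f (x i))) | k x. k \<in> K}"
proof
  show "range \<Omega>\<^sub>\<rho> \<subseteq> {Ad ex k (flat (\<lambda>i. f (x i))) | k x. k \<in> K}"
  proof (rule image_subsetI)
    fix p
    obtain k x where k: "k \<in> K" "p = k (ex (flat x) ob)" using point_flat by blast
    then have "\<rho> (lift (Lg p)) = Ad ex k (flat (\<lambda>i. f (x i)))" using radial_radial unfolding radial_map_flat by blast
    then show "\<rho> (lift (Lg p)) \<in> {Ad ex k (flat (\<lambda>i. f (x i))) | k x. k \<in> K}" using k(1) by blast
  qed
  show "{Ad ex k (flat (\<lambda>i. f (x i))) | k x. k \<in> K} \<subseteq> range \<Omega>\<^sub>\<rho>"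
  proof
    fix y assume "y \<in> {Ad ex k (flat (\<lambda>i. f (x i))) | k x. k \<in> K}"
    then obtain k x where "k \<in> K" "y = Ad ex k (flat (\<lambda>i. f (x i)))" by blast
    then have "y = \<rho> (lift (Lg (k (ex (flat x) ob))))" using radial_radial unfolding radial_map_flat by metis
    then show "y \<in> range \<Omega>\<^sub>\<rho>" by blast
  qed
qed

lemma radial_maps_flat: "maps_flat A g ex ob a \<Omega>\<^sub>\<rho>"
  unfolding maps_flat_def
proof (rule image_subsetI)
  fix p assume "p \<in> Exp_at A g ex ob ` a"
  then obtain H where H: "H \<in> a" "p = ex H ob" using Exp_at_eq[OF a_p] by auto
  have "\<rho> (lift (Lg p)) = flat (\<lambda>i. f (e i H))" using radial_flat[of "\<lambda>i. e i H"] a_flat[OF H(1)] H(2) by simp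
  then show "\<rho> (lift (Lg p)) \<in> a" using flat_a by simp
qed

text \<open>An element of the isotropy group that carries the value of one point to the value of
  another carries the arguments too: \<open>Ad_flat_odd\<close> is applied to an odd left inverse of
  \<open>f\<close>.\<close>

lemma radial_injective:
  assumes f: "inj f" "\<And>x. f (- x) = - f x" shows "inj \<Omega>\<^sub>\<rho>"
proof (rule injI)
  fix p p' assume eq: "\<rho> (lift (Lg p)) = \<rho> (lift (Lg p'))"
  obtain \<phi> where \<phi>: "\<And>s. \<phi> (- s) = - \<phi> s" "\<And>u. \<phi> (f u) = u" using odd_left_inverse[OF f] by blast
  obtain k x where k: "k \<in> K" "p = k (ex (flat x) ob)" using point_flat by blast
  obtain k' x' where k': "k' \<in> K" "p' = k' (ex (flat x') ob)" using point_flat by blast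
  have R: "Ad ex k (flat (\<lambda>i. f (x i))) = Ad ex k' (flat (\<lambda>i. f (x' i)))"
    using eq radial_radial k k' unfolding radial_map_flat by metis
  define h where "h = inv k' \<circ> k"
  have h: "h \<in> K" unfolding h_def by (rule K_comp[OF K_inv[OF k'(1)] k(1)])
  have Ah: "Ad ex h V = Ad ex (inv k') (Ad ex k V)" for V unfolding h_def by (rule Ad_comp[OF G_inv[OF K_G[OF k'(1)]] K_G[OF k(1)]])
  have "Ad ex h (flat (\<lambda>i. f (x i))) = flat (\<lambda>i. f (x' i))" unfolding Ah R using K_G[OF k'(1)] by simp
  from Ad_flat_odd[where \<phi> = \<phi>, OF h this \<phi>(1)] have "Ad ex h (flat x) = flat x'" by (simp add: \<phi>(2))
  then have "Ad ex k' (Ad ex (inv k') (Ad ex k (flat x))) = Ad ex k' (flat x')" by (simp only: Ah)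
  then have "Ad ex k (flat x) = Ad ex k' (flat x')" using K_G[OF k'(1)] by simp
  then have "k (ex (flat x) ob) = k' (ex (flat x') ob)" by (simp flip: ex_Ad_K[OF k(1)] ex_Ad_K[OF k'(1)])
  then show "p = p'" using k(2) k'(2) by simp
qed

end

lemma flat_root_forms:
  assumes i: "i \<in> {1..r}"
  shows "X \<in> a \<Longrightarrow> Y \<in> a \<Longrightarrow> c * e i (X + t *\<^sub>R Y) = c * e i X + t * (c * e i Y)"
  using i by (simp add: e_linear subspace_scale[OF a_subspace] algebra_simps)

definition tanh_embedding :: "'m \<Rightarrow> 'g" where "tanh_embedding p = tanh_map (lift (Lg p))"
definition sinh_embedding :: "'m \<Rightarrow> 'g" where "sinh_embedding p = sinh_map (lift (Lg p))"

lemma tanh_facts: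
  shows "Ck_fun A k tanh_embedding" and "K_equivariant A g ex ob tanh_embedding"
    and "tanh_embedding (ex (flat x) ob) = flat (\<lambda>i. tanh (x i))"
    and "radial_map A g ex br \<theta> ob a e tanh tanh_embedding"
    and "range tanh_embedding = {Ad ex k (flat (\<lambda>i. tanh (x i))) | k x. k \<in> K}"
    and "maps_flat A g ex ob a tanh_embedding"
    and "inj (tanh :: real \<Rightarrow> real) \<Longrightarrow> inj tanh_embedding"
  unfolding tanh_embedding_def[abs_def]
  by (rule radial_Ck[where f = tanh] radial_equivariant[where f = tanh] radial_flat radial_radial radial_range radial_maps_flat[where f = tanh]
       radial_injective[where f = tanh] tanh_map_Ck tanh_map_equivariant tanh_map_flat tanh_minus | assumption)+

lemma sinh_facts:
  shows "Ck_fun A k sinh_embedding" and "K_equivariant A g ex ob sinh_embedding"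
    and "sinh_embedding (ex (flat x) ob) = flat (\<lambda>i. sinh (x i))"
    and "radial_map A g ex br \<theta> ob a e sinh sinh_embedding"
    and "range sinh_embedding = {Ad ex k (flat (\<lambda>i. sinh (x i))) | k x. k \<in> K}"
    and "maps_flat A g ex ob a sinh_embedding"
    and "inj (sinh :: real \<Rightarrow> real) \<Longrightarrow> inj sinh_embedding"
  unfolding sinh_embedding_def[abs_def]
  by (rule radial_Ck[where f = sinh] radial_equivariant[where f = sinh] radial_flat radial_radial radial_range radial_maps_flat[where f = sinh]
       radial_injective[where f = sinh] sinh_map_Ck sinh_map_equivariant sinh_map_flat sinh_minus | assumption)+

end

text \<open>The quotient is the same for all signs, so the two root spaces exchanged by J receive
  the same eigenvalue, as \<open>L_commutes_J\<close> requires.\<close>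

lemma tanh_sum_root:
  fixes u v :: real assumes "s \<in> {-1, 1}" "t \<in> {-1, 1}"
  shows "s * tanh u + t * tanh v = 1 / (cosh u * cosh v) * sinh (s * u + t * v)"
  using assms by (auto simp: tanh_def sinh_add sinh_diff field_simps)

lemma tanh_artanh_real: assumes "\<bar>x\<bar> < 1" shows "tanh (artanh x) = (x :: real)"
proof -
  have x: "1 + x > 0" "1 - x > 0" using assms by auto
  have "exp (- 2 * artanh x) = exp (ln ((1 - x) / (1 + x)))"
    using x by (simp add: artanh_def ln_div)
  also have "\<dots> = (1 - x) / (1 + x)" using x by simp
  finally have "tanh (artanh x) = (1 - (1 - x) / (1 + x)) / (1 + (1 - x) / (1 + x))" by (simp add: tanh_real_altdef)
  also have "\<dots> = x" using x by (simp add: field_simps)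
  finally show ?thesis .
qed

text \<open>Reversing the sign of \<open>t\<close> inverts the quotient of the two cosh factors,
  which is the reciprocity required by \<open>L_J_L\<close>.\<close>

lemma sinh_sum_root:
  fixes u v :: real assumes "s \<in> {-1, 1}" "t \<in> {-1, 1}"
  shows "s * sinh u + t * sinh v = cosh ((s * u - t * v) / 2) / cosh ((s * u + t * v) / 2) * sinh (s * u + t * v)"
proof -
  define p q where "p = (s * u + t * v) / 2" and "q = (s * u - t * v) / 2"
  have "s * sinh u = sinh (s * u)" "t * sinh v = sinh (t * v)" using assms by auto
  moreover have "s * u = p + q" "t * v = p - q" by (simp_all add: p_def q_def field_simps)
  ultimately have "s * sinh u + t * sinh v = 2 * sinh p * cosh q" by (simp add: sinh_add sinh_diff)
  also have "\<dots> = cosh q / cosh p * sinh (2 * p)" by (simp only: sinh_double) simp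
  finally show ?thesis by (simp add: p_def q_def)
qed

section \<open>The differentials of the tanh and sinh maps and the existence statements\<close>

context hermitian_space
begin

lemma tanh_differential:
  shows "i \<in> {1..r} \<Longrightarrow> diff_at tanh_embedding (flat x) (Ht i) = (1 / (cosh (x i))\<^sup>2) *\<^sub>R Ht i"
    and "i \<in> {1..r} \<Longrightarrow> diff_at tanh_embedding (flat x) (JJ (Ht i)) = (1 / (cosh (x i))\<^sup>2) *\<^sub>R JJ (Ht i)"
    and "s \<in> {-1, 1} \<Longrightarrow> t \<in> {-1, 1} \<Longrightarrow> i \<in> {1..r} \<Longrightarrow> j \<in> {1..r} \<Longrightarrow> i \<noteq> j \<Longrightarrow>
      root_pair (\<lambda>X. s * e i X + t * e j X) Y W \<Longrightarrow> diff_at tanh_embedding (flat x) Y = (1 / (cosh (x i) * cosh (x j))) *\<^sub>R Y"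
    and "s \<in> {-1, 1} \<Longrightarrow> i \<in> {1..r} \<Longrightarrow> root_pair (\<lambda>X. s * e i X) Y W \<Longrightarrow>
      diff_at tanh_embedding (flat x) Y = (1 / cosh (x i)) *\<^sub>R Y"
proof -
  note R = radial_root[OF tanh_facts(1,2,3)]
  show "diff_at tanh_embedding (flat x) (Ht i) = (1 / (cosh (x i))\<^sup>2) *\<^sub>R Ht i" if i: "i \<in> {1..r}" for i
  proof -
    have "(tanh has_real_derivative 1 - (tanh (x i))\<^sup>2) (at (x i))" by (auto intro!: derivative_eq_intros)
    also have "1 - (tanh (x i))\<^sup>2 = 1 / (cosh (x i))\<^sup>2"
      using cosh_real_nonzero[of "x i"] hyperbolic_pythagoras[of "x i"] by (simp add: tanh_def power_divide diff_divide_distrib[symmetric] divide_eq_eq eq_divide_eq left_diff_distrib)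
    finally show ?thesis by (rule radial_Ht[OF tanh_facts(1,3) i])
  qed
  show "diff_at tanh_embedding (flat x) (JJ (Ht i)) = (1 / (cosh (x i))\<^sup>2) *\<^sub>R JJ (Ht i)" if i: "i \<in> {1..r}" for i
  proof (rule R[where l = "\<lambda>x. 1 / (cosh (x i))\<^sup>2", OF Ht_root_pair[OF i] flat_root_forms[OF i] i])
    show "2 * e i (Ht i) \<noteq> 0" using e_Ht[OF i i] by simp
    show "2 * e i (flat (\<lambda>i. tanh (x i))) = 1 / (cosh (x i))\<^sup>2 * sinh (2 * e i (flat x))" for x
      unfolding e_flat[OF i] sinh_double by (simp add: tanh_def field_simps power2_eq_square)
    show "isCont (\<lambda>t. 1 / (cosh (x i + (if i = i then t else 0)))\<^sup>2) 0" by (simp, intro continuous_intros) simp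
  qed
  show "diff_at tanh_embedding (flat x) Y = (1 / (cosh (x i) * cosh (x j))) *\<^sub>R Y"
    if st: "s \<in> {-1, 1}" "t \<in> {-1, 1}" and i: "i \<in> {1..r}" "j \<in> {1..r}" "i \<noteq> j" and rp: "root_pair (\<lambda>X. s * e i X + t * e j X) Y W"
    for s t i j Y W
  proof (rule R[where l = "\<lambda>x. 1 / (cosh (x i) * cosh (x j))", OF rp sum_root_linear[OF i(1,2)] i(1)])
    show "s * e i (Ht i) + t * e j (Ht i) \<noteq> 0" using e_Ht[OF i(1,1)] e_Ht[OF i(2,1)] i(3) st by auto
    show "s * e i (flat (\<lambda>i. tanh (x i))) + t * e j (flat (\<lambda>i. tanh (x i))) =
        1 / (cosh (x i) * cosh (x j)) * sinh (s * e i (flat x) + t * e j (flat x))" for x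
      unfolding e_flat[OF i(1)] e_flat[OF i(2)] by (rule tanh_sum_root[OF st])
    show "isCont (\<lambda>t. 1 / (cosh (x i + (if i = i then t else 0)) * cosh (x j + (if j = i then t else 0)))) 0"
      using i(3) by (simp, intro continuous_intros) simp
  qed
  show "diff_at tanh_embedding (flat x) Y = (1 / cosh (x i)) *\<^sub>R Y"
    if s: "s \<in> {-1, 1}" and i: "i \<in> {1..r}" and rp: "root_pair (\<lambda>X. s * e i X) Y W" for s i Y W
  proof (rule R[where l = "\<lambda>x. 1 / cosh (x i)", OF rp flat_root_forms[OF i] i])
    show "s * e i (Ht i) \<noteq> 0" using e_Ht[OF i i] s by auto
    show "s * e i (flat (\<lambda>i. tanh (x i))) = 1 / cosh (x i) * sinh (s * e i (flat x))" for x
      unfolding e_flat[OF i] using s by (auto simp: tanh_def)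
    show "isCont (\<lambda>t. 1 / cosh (x i + (if i = i then t else 0))) 0" by (simp, intro continuous_intros) simp
  qed
qed

lemma sinh_differential:
  shows "i \<in> {1..r} \<Longrightarrow> diff_at sinh_embedding (flat x) (Ht i) = cosh (x i) *\<^sub>R Ht i"
    and "i \<in> {1..r} \<Longrightarrow> diff_at sinh_embedding (flat x) (JJ (Ht i)) = (1 / cosh (x i)) *\<^sub>R JJ (Ht i)"
    and "s \<in> {-1, 1} \<Longrightarrow> t \<in> {-1, 1} \<Longrightarrow> i \<in> {1..r} \<Longrightarrow> j \<in> {1..r} \<Longrightarrow> i \<noteq> j \<Longrightarrow>
      root_pair (\<lambda>X. s * e i X + t * e j X) Y W \<Longrightarrow>
      diff_at sinh_embedding (flat x) Y = (cosh ((s * x i - t * x j) / 2) / cosh ((s * x i + t * x j) / 2)) *\<^sub>R Y"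
    and "s \<in> {-1, 1} \<Longrightarrow> i \<in> {1..r} \<Longrightarrow> root_pair (\<lambda>X. s * e i X) Y W \<Longrightarrow>
      diff_at sinh_embedding (flat x) Y = 1 *\<^sub>R Y"
proof -
  note R = radial_root[OF sinh_facts(1,2,3)]
  show "diff_at sinh_embedding (flat x) (Ht i) = cosh (x i) *\<^sub>R Ht i" if i: "i \<in> {1..r}" for i
    by (rule radial_Ht[OF sinh_facts(1,3) i]) (auto intro!: derivative_eq_intros)
  show "diff_at sinh_embedding (flat x) (JJ (Ht i)) = (1 / cosh (x i)) *\<^sub>R JJ (Ht i)" if i: "i \<in> {1..r}" for i
  proof (rule R[where l = "\<lambda>x. 1 / cosh (x i)", OF Ht_root_pair[OF i] flat_root_forms[OF i] i])
    show "2 * e i (Ht i) \<noteq> 0" using e_Ht[OF i i] by simp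
    show "2 * e i (flat (\<lambda>i. sinh (x i))) = 1 / cosh (x i) * sinh (2 * e i (flat x))" for x
      unfolding e_flat[OF i] sinh_double by simp
    show "isCont (\<lambda>t. 1 / cosh (x i + (if i = i then t else 0))) 0" by (simp, intro continuous_intros) simp
  qed
  show "diff_at sinh_embedding (flat x) Y = (cosh ((s * x i - t * x j) / 2) / cosh ((s * x i + t * x j) / 2)) *\<^sub>R Y"
    if st: "s \<in> {-1, 1}" "t \<in> {-1, 1}" and i: "i \<in> {1..r}" "j \<in> {1..r}" "i \<noteq> j" and rp: "root_pair (\<lambda>X. s * e i X + t * e j X) Y W"
    for s t i j Y W
  proof (rule R[where l = "\<lambda>x. cosh ((s * x i - t * x j) / 2) / cosh ((s * x i + t * x j) / 2)", OF rp sum_root_linear[OF i(1,2)] i(1)])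
    show "s * e i (Ht i) + t * e j (Ht i) \<noteq> 0" using e_Ht[OF i(1,1)] e_Ht[OF i(2,1)] i(3) st by auto
    show "s * e i (flat (\<lambda>i. sinh (x i))) + t * e j (flat (\<lambda>i. sinh (x i))) =
        cosh ((s * x i - t * x j) / 2) / cosh ((s * x i + t * x j) / 2) * sinh (s * e i (flat x) + t * e j (flat x))" for x
      unfolding e_flat[OF i(1)] e_flat[OF i(2)] by (rule sinh_sum_root[OF st])
    show "isCont (\<lambda>u. cosh ((s * (x i + (if i = i then u else 0)) - t * (x j + (if j = i then u else 0))) / 2) /
        cosh ((s * (x i + (if i = i then u else 0)) + t * (x j + (if j = i then u else 0))) / 2)) 0"
      using i(3) by (simp, intro continuous_intros) simp_all
  qed
  show "diff_at sinh_embedding (flat x) Y = 1 *\<^sub>R Y"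
    if s: "s \<in> {-1, 1}" and i: "i \<in> {1..r}" and rp: "root_pair (\<lambda>X. s * e i X) Y W" for s i Y W
  proof (rule R[where l = "\<lambda>x. 1", OF rp flat_root_forms[OF i] i])
    show "s * e i (Ht i) \<noteq> 0" using e_Ht[OF i i] s by auto
    show "s * e i (flat (\<lambda>i. sinh (x i))) = 1 * sinh (s * e i (flat x))" for x
      unfolding e_flat[OF i] using s by auto
    show "isCont (\<lambda>t. 1 :: real) 0" by simp
  qed
qed

lemma tanh_holomorphic: "holomorphic_map A J br \<zeta> tanh_embedding"
proof (rule diff_at_holomorphic[OF tanh_facts(1,2)])
  fix x V assume V: "V \<in> \<pp>"
  show "diff_at tanh_embedding (flat x) (JJ V) = JJ (diff_at tanh_embedding (flat x) V)"
    by (rule L_commutes_J[where d = "\<lambda>i. 1 / (cosh (x i))\<^sup>2" and l = "\<lambda>i. 1 / (cosh (x i))\<^sup>2" and m = "\<lambda>i. 1 / cosh (x i)"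
          and c = "\<lambda>s t i j. 1 / (cosh (x i) * cosh (x j))", OF diff_at_linear[OF tanh_facts(1)] tanh_differential _ _ V])
       simp_all
qed

lemma tanh_injective: "V \<in> \<pp> \<Longrightarrow> diff_at tanh_embedding (flat x) V = 0 \<Longrightarrow> V = 0"
  by (rule L_inj[where d = "\<lambda>i. 1 / (cosh (x i))\<^sup>2" and l = "\<lambda>i. 1 / (cosh (x i))\<^sup>2" and m = "\<lambda>i. 1 / cosh (x i)"
        and c = "\<lambda>s t i j. 1 / (cosh (x i) * cosh (x j))", OF diff_at_linear[OF tanh_facts(1)] tanh_differential])
     simp_all

lemma sinh_symplectic: "symplectic_map A g J br \<theta> \<zeta> sinh_embedding"
proof (rule diff_at_symplectic[OF sinh_facts(1,2)])
  fix x V V' assume V: "V \<in> \<pp>" and V': "V' \<in> \<pp>"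
  let ?L = "diff_at sinh_embedding (flat x)"
  have p: "?L V \<in> \<pp>"
    by (rule diff_at_p[OF sinh_facts(1)]) (auto simp: sinh_facts(5) intro: Ad_K_p flat_p)
  have "ip (JJ (?L V)) (?L V') = ip (?L (JJ (?L V))) V'"
    by (rule L_symmetric[where d = "\<lambda>i. cosh (x i)" and l = "\<lambda>i. 1 / cosh (x i)" and m = "\<lambda>i. 1"
          and c = "\<lambda>s t i j. cosh ((s * x i - t * x j) / 2) / cosh ((s * x i + t * x j) / 2)",
          OF diff_at_linear[OF sinh_facts(1)] sinh_differential J_p[OF p] V', symmetric])
  also have "?L (JJ (?L V)) = JJ V"
    by (rule L_J_L[where d = "\<lambda>i. cosh (x i)" and l = "\<lambda>i. 1 / cosh (x i)" and m = "\<lambda>i. 1"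
          and c = "\<lambda>s t i j. cosh ((s * x i - t * x j) / 2) / cosh ((s * x i + t * x j) / 2)",
          OF diff_at_linear[OF sinh_facts(1)] sinh_differential _ _ _ V]) simp_all
  finally show "ip (JJ (?L V)) (?L V') = ip (JJ V) V'" .
qed

lemma sinh_injective: "V \<in> \<pp> \<Longrightarrow> diff_at sinh_embedding (flat x) V = 0 \<Longrightarrow> V = 0"
  by (rule L_inj[where d = "\<lambda>i. cosh (x i)" and l = "\<lambda>i. 1 / cosh (x i)" and m = "\<lambda>i. 1"
        and c = "\<lambda>s t i j. cosh ((s * x i - t * x j) / 2) / cosh ((s * x i + t * x j) / 2)",
        OF diff_at_linear[OF sinh_facts(1)] sinh_differential])
     simp_all

lemma D_tanh_eq: "D_tanh A g ex br \<theta> ob a e = {Ad ex k (flat (\<lambda>i. tanh (x i))) | k x. k \<in> K}"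
  unfolding D_tanh_def
proof (intro subset_antisym subsetI)
  fix Y assume "Y \<in> {Ad ex k (flat y) | k y. k \<in> K \<and> (\<forall>i\<in>{1..r}. \<bar>y i\<bar> < 1)}"
  then obtain k y where k: "k \<in> K" "Y = Ad ex k (flat y)" and y: "\<And>i. i \<in> {1..r} \<Longrightarrow> \<bar>y i\<bar> < 1" by blast
  have "flat y = flat (\<lambda>i. tanh (artanh (y i)))" by (rule flat_eqI) (use y in \<open>simp add: tanh_artanh_real\<close>)
  then show "Y \<in> {Ad ex k (flat (\<lambda>i. tanh (x i))) | k x. k \<in> K}" using k by (intro CollectI exI[of _ k] exI[of _ "\<lambda>i. artanh (y i)"]) simp
next
  fix Y assume "Y \<in> {Ad ex k (flat (\<lambda>i. tanh (x i))) | k x. k \<in> K}"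
  then obtain k x where k: "k \<in> K" "Y = Ad ex k (flat (\<lambda>i. tanh (x i)))" by blast
  then show "Y \<in> {Ad ex k (flat y) | k y. k \<in> K \<and> (\<forall>i\<in>{1..r}. \<bar>y i\<bar> < 1)}"
    using tanh_real_lt_1 tanh_real_gt_neg1 by (intro CollectI exI[of _ k] exI[of _ "\<lambda>i. tanh (x i)"]) (simp add: abs_less_iff minus_less_iff)
qed

lemma p_eq_sinh: "\<pp> = {Ad ex k (flat (\<lambda>i. sinh (x i))) | k x. k \<in> K}"
proof (intro subset_antisym subsetI)
  fix Y assume "Y \<in> \<pp>"
  then obtain k y where k: "k \<in> K" "Y = Ad ex k (flat y)" using Ad_K_flat by blast
  have "flat y = flat (\<lambda>i. sinh (arsinh (y i)))" by (rule flat_eqI) simp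
  then show "Y \<in> {Ad ex k (flat (\<lambda>i. sinh (x i))) | k x. k \<in> K}" using k by (intro CollectI exI[of _ k] exI[of _ "\<lambda>i. arsinh (y i)"]) simp
qed (auto intro: Ad_K_p flat_p)

lemma tanh_diffeo: "diffeo_onto A \<pp> (D_tanh A g ex br \<theta> ob a e) tanh_embedding" "C1_embedding A \<pp> tanh_embedding"
proof -
  have 1: "range tanh_embedding = D_tanh A g ex br \<theta> ob a e" unfolding D_tanh_eq by (rule tanh_facts(5))
  have 2: "D_tanh A g ex br \<theta> ob a e \<subseteq> \<pp>" unfolding D_tanh_eq by (auto intro: Ad_K_p flat_p)
  have 3: "inj tanh_embedding" by (rule tanh_facts(7)) (auto intro!: injI)
  note 4 = diff_at_injective[OF tanh_facts(1,2) tanh_injective]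
  show "diffeo_onto A \<pp> (D_tanh A g ex br \<theta> ob a e) tanh_embedding" by (rule immersion_diffeo(1)[OF tanh_facts(1) 1 2 3 4])
  show "C1_embedding A \<pp> tanh_embedding" by (rule immersion_diffeo(2)[OF tanh_facts(1) 1 2 3 4])
qed

lemma sinh_diffeo: "diffeo_onto A \<pp> \<pp> sinh_embedding" "C1_embedding A \<pp> sinh_embedding"
proof -
  have 1: "range sinh_embedding = \<pp>" by (subst p_eq_sinh) (rule sinh_facts(5))
  have 3: "inj sinh_embedding" by (rule sinh_facts(7)) (auto intro!: injI)
  note 4 = diff_at_injective[OF sinh_facts(1,2) sinh_injective]
  show "diffeo_onto A \<pp> \<pp> sinh_embedding" by (rule immersion_diffeo(1)[OF sinh_facts(1) 1 subset_refl 3 4])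
  show "C1_embedding A \<pp> sinh_embedding" by (rule immersion_diffeo(2)[OF sinh_facts(1) 1 subset_refl 3 4])
qed

end

section \<open>Uniqueness\<close>

text \<open>The equation degenerates at 0, where \<open>q\<close> vanishes, so the quotient of
  \<open>\<phi>\<close> by \<open>q\<close> is constant on each half-line separately. Both constants
  are the limit at 0, which is \<open>\<phi>' 0\<close> because \<open>q' 0 = 1\<close>.\<close>

lemma proportional_solution:
  fixes \<phi> q :: "real \<Rightarrow> real"
  assumes \<phi>: "\<And>s. (\<phi> has_real_derivative \<phi>' s) (at s)" and q: "\<And>s. (q has_real_derivative q' s) (at s)"
    and eq: "\<And>s. \<phi>' s * q s = \<phi> s * q' s" and q0: "q 0 = 0" "q' 0 = 1" "\<And>s. s \<noteq> 0 \<Longrightarrow> q s \<noteq> 0" and \<phi>0: "\<phi> 0 = 0"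
  shows "\<exists>c. \<forall>s. \<phi> s = c * q s"
proof -
  have d: "((\<lambda>s. \<phi> s / q s) has_real_derivative 0) (at s within S)" if "s \<noteq> 0" for s S
  proof -
    have "((\<lambda>s. \<phi> s / q s) has_real_derivative (\<phi>' s * q s - \<phi> s * q' s) / (q s * q s)) (at s)"
      by (rule DERIV_divide[OF \<phi> q q0(3)[OF that]])
    then show ?thesis by (simp add: eq has_field_derivative_at_within)
  qed
  obtain c1 where c1: "\<And>s. s > 0 \<Longrightarrow> \<phi> s / q s = c1"
    using has_field_derivative_zero_constant[of "{0::real<..}" "\<lambda>s. \<phi> s / q s"] d by (auto simp: convex_real_interval)
  obtain c2 where c2: "\<And>s. s < 0 \<Longrightarrow> \<phi> s / q s = c2"
    using has_field_derivative_zero_constant[of "{..<0::real}" "\<lambda>s. \<phi> s / q s"] d by (auto simp: convex_real_interval)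
  have "((\<lambda>s. q s / s) \<longlongrightarrow> 1) (at 0)" using q[of 0] by (simp add: DERIV_def q0)
  moreover have "((\<lambda>s. \<phi> s / s) \<longlongrightarrow> \<phi>' 0) (at 0)" using \<phi>[of 0] by (simp add: DERIV_def \<phi>0)
  ultimately have "((\<lambda>s. (\<phi> s / s) / (q s / s)) \<longlongrightarrow> \<phi>' 0 / 1) (at 0)" by (intro tendsto_divide) simp_all
  moreover have "\<forall>\<^sub>F s in at 0. (\<phi> s / s) / (q s / s) = \<phi> s / q s" by (simp add: eventually_at_filter)
  ultimately have lim: "((\<lambda>s. \<phi> s / q s) \<longlongrightarrow> \<phi>' 0) (at 0)" using Lim_transform_eventually by fastforce
  have "((\<lambda>s. \<phi> s / q s) \<longlongrightarrow> c1) (at_right 0)"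
    by (rule Lim_transform_eventually[OF tendsto_const]) (use c1 in \<open>auto simp: eventually_at_filter\<close>)
  moreover have "((\<lambda>s. \<phi> s / q s) \<longlongrightarrow> c2) (at_left 0)"
    by (rule Lim_transform_eventually[OF tendsto_const]) (use c2 in \<open>auto simp: eventually_at_filter\<close>)
  moreover have "((\<lambda>s. \<phi> s / q s) \<longlongrightarrow> \<phi>' 0) (at_right 0)" "((\<lambda>s. \<phi> s / q s) \<longlongrightarrow> \<phi>' 0) (at_left 0)"
    using lim by (auto intro: tendsto_mono at_le)
  ultimately have "c1 = \<phi>' 0" "c2 = \<phi>' 0"
    using tendsto_unique[OF trivial_limit_at_right_real] tendsto_unique[OF trivial_limit_at_left_real] by blast+
  then have "\<phi> s / q s = \<phi>' 0" if "s \<noteq> 0" for s using c1[of s] c2[of s] that by (cases "s > 0") auto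
  then have "\<phi> s = \<phi>' 0 * q s" for s using q0(1,3) \<phi>0 by (cases "s = 0") (auto simp: field_simps)
  then show ?thesis by blast
qed

context hermitian_space
begin

section \<open>Components along the flat of an arbitrary equivariant map of class C1\<close>

context
  fixes \<Omega> :: "'m \<Rightarrow> 'g"
  assumes \<Omega>: "Ck_fun A (Suc 0) \<Omega>" "K_equivariant A g ex ob \<Omega>" and flat_in_a: "maps_flat A g ex ob a \<Omega>"
begin

definition component :: "nat \<Rightarrow> (nat \<Rightarrow> real) \<Rightarrow> real" where
  "component i x = e i (\<Omega> (ex (flat x) ob))"

definition component_deriv :: "nat \<Rightarrow> nat \<Rightarrow> (nat \<Rightarrow> real) \<Rightarrow> real" where
  "component_deriv i j x = e i (diff_at \<Omega> (flat x) (Ht j))"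

lemma value_in_a: "H \<in> a \<Longrightarrow> \<Omega> (ex H ob) \<in> a"
  using flat_in_a Exp_at_eq[OF a_p] unfolding maps_flat_def by auto

lemma value_flat: "\<Omega> (ex (flat x) ob) = flat (\<lambda>i. component i x)"
  unfolding component_def by (rule a_flat[OF value_in_a[OF flat_a], symmetric])

lemma derivative_in_a: "H \<in> a \<Longrightarrow> j \<in> {1..r} \<Longrightarrow> diff_at \<Omega> H (Ht j) \<in> a"
  by (rule diff_at_flat_in_a[OF \<Omega>(1) _ Ht_a value_in_a])

lemma e_bounded_linear: "bounded_linear (\<lambda>V. ip V (Ht i) / ip (Ht i) (Ht i))"
  unfolding linear_conv_bounded_linear[symmetric]
  by (auto simp: linear_iff form.form_simps add_divide_distrib)

lemma component_has_derivative:
  assumes i: "i \<in> {1..r}" and j: "j \<in> {1..r}"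
  shows "((\<lambda>t. component i (\<lambda>k. x k + (if k = j then t else 0))) has_real_derivative
    component_deriv i j (\<lambda>k. x k + (if k = j then s else 0))) (at s)"
proof -
  from bounded_linear.has_vector_derivative[OF e_bounded_linear diff_at_flat_derivative[OF \<Omega>(1) flat_a Ht_a[OF j]]]
  have "((\<lambda>t. ip (\<Omega> (ex (flat x + t *\<^sub>R Ht j) ob)) (Ht i) / ip (Ht i) (Ht i)) has_vector_derivative
      ip (diff_at \<Omega> (flat x + s *\<^sub>R Ht j) (Ht j)) (Ht i) / ip (Ht i) (Ht i)) (at s)" .
  then show ?thesis
    unfolding flat_shift[OF j] e_eq[OF i value_in_a[OF flat_a], symmetric] e_eq[OF i derivative_in_a[OF flat_a j], symmetric]
    by (simp add: component_def component_deriv_def has_real_derivative_iff_has_vector_derivative)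
qed

lemma component_deriv_continuous:
  assumes i: "i \<in> {1..r}" and j: "j \<in> {1..r}"
  shows "isCont (\<lambda>t. component_deriv i j (\<lambda>k. x k + (if k = j then t else 0))) 0"
proof -
  from bounded_linear.isCont[OF e_bounded_linear diff_at_flat_continuous[OF \<Omega>(1)]]
  have "isCont (\<lambda>t. ip (diff_at \<Omega> (flat x + t *\<^sub>R Ht j) (Ht j)) (Ht i) / ip (Ht i) (Ht i)) 0" .
  then show ?thesis
    unfolding flat_shift[OF j] e_eq[OF i derivative_in_a[OF flat_a j], symmetric] component_deriv_def .
qed

text \<open>On the wall \<open>x\<^sub>i = x\<^sub>j\<close> the image commutes with the root vectors of \<open>e\<^sub>i - e\<^sub>j\<close>.\<close>

lemma component_wall:
  assumes i: "i \<in> {1..r}" and j: "j \<in> {1..r}" and x: "x i = x j" shows "component i x = component j x"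
proof -
  have lt: "component i x = component j x" if ij: "i \<in> {1..r}" "j \<in> {1..r}" "i < j" "x i = x j" for i j
  proof -
    let ?\<mu> = "\<lambda>X. e i X - e j X"
    obtain Y W where Y: "Y \<noteq> 0" "root_pair ?\<mu> Y W" using root_pair_root[OF diff_root[OF ij(1-3)]] by blast
    have e_minus: "e i (- H) = - e i H" if "i \<in> {1..r}" "H \<in> a" for i H
      using e_linear(2)[OF that, of "-1"] by simp
    have "?\<mu> (- flat x) = - ?\<mu> (flat x)" using e_minus[OF ij(1) flat_a] e_minus[OF ij(2) flat_a] by simp
    from diff_at_root[OF \<Omega> flat_a value_in_a[OF flat_a] Y(2) this]
    have "sinh (?\<mu> (flat x)) *\<^sub>R diff_at \<Omega> (flat x) Y = (component i x - component j x) *\<^sub>R Y" by (simp add: component_def)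
    then show ?thesis using Y(1) ij(4) e_flat[OF ij(1), of x] e_flat[OF ij(2), of x] by simp
  qed
  show ?thesis
  proof (cases i j rule: linorder_cases)
    case less then show ?thesis by (rule lt[OF i j _ x])
  next
    case greater then show ?thesis using lt[OF j i _ x[symmetric]] by simp
  qed simp
qed

lemma long_root_relation:
  assumes i: "i \<in> {1..r}"
  shows "sinh (2 * x i) *\<^sub>R diff_at \<Omega> (flat x) (JJ (Ht i)) = (2 * component i x) *\<^sub>R JJ (Ht i)"
proof -
  have "2 * e i (- flat x) = - (2 * e i (flat x))" using e_linear(2)[OF i flat_a, of "-1"] by simp
  from diff_at_root[OF \<Omega> flat_a value_in_a[OF flat_a] Ht_root_pair[OF i] this] show ?thesis
    unfolding e_flat[OF i] component_def .
qed

context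
  assumes decoupled: "\<And>i j x. i \<in> {1..r} \<Longrightarrow> j \<in> {1..r} \<Longrightarrow> i \<noteq> j \<Longrightarrow> component_deriv i j x = 0"
begin

text \<open>The other coordinates are changed one at a time along lines with zero partial
  derivative; indices outside 1, ..., r do not enter \<open>flat\<close>.\<close>

lemma component_depends:
  assumes i: "i \<in> {1..r}" and x: "x i = y i" shows "component i x = component i y"
proof -
  have "component i (\<lambda>k. if k \<in> S then y k else x k) = component i x" if S: "finite S" "S \<subseteq> {1..r} - {i}" for S
    using S
  proof (induction S rule: finite_induct)
    case (insert j S)
    let ?w = "\<lambda>k. if k \<in> S then y k else x k"
    have j: "j \<in> {1..r}" "i \<noteq> j" using insert.prems by auto
    have "((\<lambda>t. component i (\<lambda>k. ?w k + (if k = j then t else 0))) has_real_derivative 0) (at t)" for t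
      using component_has_derivative[OF i j(1), of ?w t] decoupled[OF i j] by simp
    then have "component i (\<lambda>k. ?w k + (if k = j then y j - x j else 0)) = component i (\<lambda>k. ?w k + (if k = j then 0 else 0))"
      using DERIV_isconst_all by blast
    moreover have "(\<lambda>k. ?w k + (if k = j then y j - x j else 0)) = (\<lambda>k. if k \<in> insert j S then y k else x k)"
      using insert.hyps by auto
    moreover have "(\<lambda>k. ?w k + (if k = j then 0 else 0)) = ?w" by auto
    ultimately show ?case using insert.IH insert.prems by simp
  qed simp
  from this[of "{1..r} - {i}"]
  have "component i (\<lambda>k. if k \<in> {1..r} - {i} then y k else x k) = component i x" by simp
  moreover have "flat (\<lambda>k. if k \<in> {1..r} - {i} then y k else x k) = flat y" by (rule flat_eqI) (use x in auto)
  ultimately show ?thesis by (simp add: component_def)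
qed

text \<open>\<open>P\<close> records what is claimed of the constant: nothing in the holomorphic
  case, membership in {-1, 1} in the symplectic one. The profile is taken from the first component;
  points with all coordinates equal lie on every wall, and through them it passes to the other
  components.\<close>

lemma radial_of_solution:
  assumes f: "radial_map A g ex br \<theta> ob a e f \<Omega>f"
    and sol: "\<And>\<phi> \<phi>'. (\<And>s. (\<phi> has_real_derivative \<phi>' s) (at s)) \<Longrightarrow>
      (\<And>s. \<exists>x. \<exists>i\<in>{1..r}. x i = s \<and> \<phi> s = component i x \<and> \<phi>' s = component_deriv i i x) \<Longrightarrow> \<exists>c. P c \<and> (\<forall>s. \<phi> s = c * f s)"
    and triv: "P 1"
  shows "\<exists>c. P c \<and> \<Omega> = (\<lambda>p. c *\<^sub>R \<Omega>f p)"
proof -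
  have "\<exists>c. P c \<and> (\<forall>x. \<Omega> (ex (flat x) ob) = flat (\<lambda>i. c * f (x i)))"
  proof (cases "r = 0")
    \<comment> \<open>With a zero-dimensional flat there is no component to read the constant from;
      \<open>P 1\<close> supplies one.\<close>
    case True
    then have "\<Omega> (ex (flat x) ob) = flat (\<lambda>i. 1 * f (x i))" for x unfolding value_flat by (intro flat_eqI) simp
    then show ?thesis using triv by blast
  next
    case False
    then have 1: "1 \<in> {1..r}" unfolding atLeastAtMost_iff by linarith
    let ?x = "\<lambda>s k. 0 + (if k = 1 then s else 0) :: real"
    define \<phi> where "\<phi> s = component 1 (?x s)" for s
    have d: "(\<phi> has_real_derivative component_deriv 1 1 (?x s)) (at s)" for s
      unfolding \<phi>_def[abs_def] by (rule component_has_derivative[OF 1 1])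
    have "\<exists>x. \<exists>i\<in>{1..r}. x i = s \<and> \<phi> s = component i x \<and> component_deriv 1 1 (?x s) = component_deriv i i x" for s
      using 1 by (intro exI[of _ "?x s"] bexI[of _ 1]) (auto simp: \<phi>_def)
    from sol[OF d this] obtain c where c: "P c" "\<And>s. \<phi> s = c * f s" by blast
    have "component i x = c * f (x i)" if i: "i \<in> {1..r}" for i x
    proof -
      have "component i x = component i (\<lambda>_. x i)" by (rule component_depends[OF i]) simp
      also have "\<dots> = component 1 (\<lambda>_. x i)" by (rule component_wall[OF i 1]) simp
      also have "\<dots> = \<phi> (x i)" unfolding \<phi>_def by (rule component_depends[OF 1]) simp
      finally show ?thesis by (simp add: c)
    qed
    then have "\<Omega> (ex (flat x) ob) = flat (\<lambda>i. c * f (x i))" for x unfolding value_flat by (intro flat_eqI)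
    then show ?thesis using c(1) by blast
  qed
  then obtain c where c: "P c" "\<And>x. \<Omega> (ex (flat x) ob) = flat (\<lambda>i. c * f (x i))" by blast
  have "\<Omega> p = c *\<^sub>R \<Omega>f p" for p
  proof -
    obtain k x where k: "k \<in> K" "p = k (ex (flat x) ob)" using point_flat by blast
    have "\<Omega> p = Ad ex k (c *\<^sub>R flat (\<lambda>i. f (x i)))"
      unfolding k(2) equivariantD[OF \<Omega>(2) k(1)] c(2) flat_linear(2) by (rule refl)
    also have "\<dots> = c *\<^sub>R \<Omega>f p" using f k unfolding radial_map_flat by (simp add: linear_scale[OF Ad_linear[OF K_G[OF k(1)]]])
    finally show ?thesis .
  qed
  then show ?thesis using c(1) by blast
qed

end

text \<open>Commuting with J moves \<open>long_root_relation\<close> from \<open>JJ (Ht i)\<close>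
  to \<open>Ht i\<close>, where the differential consists of partial derivatives. So the components
  decouple, and each solves sinh(2s) f' = 2 f, the equation of the multiples of tanh.\<close>

lemma holomorphic_unique:
  assumes hol: "holomorphic_map A J br \<zeta> \<Omega>" shows "\<exists>c. \<Omega> = (\<lambda>p. c *\<^sub>R tanh_embedding p)"
proof -
  have rel: "sinh (2 * x i) *\<^sub>R diff_at \<Omega> (flat x) (Ht i) = (2 * component i x) *\<^sub>R Ht i" if i: "i \<in> {1..r}" for i x
  proof -
    have "JJ (diff_at \<Omega> (flat x) (Ht i)) = diff_at \<Omega> (flat x) (JJ (Ht i))"
      using hol flat_p Ht_p[OF i] unfolding holomorphic_iff[OF \<Omega>(1)] by blast
    then have 0: "JJ (sinh (2 * x i) *\<^sub>R diff_at \<Omega> (flat x) (Ht i) - (2 * component i x) *\<^sub>R Ht i) = 0"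
      using long_root_relation[OF i, of x] by (simp add: br_simps)
    have "sinh (2 * x i) *\<^sub>R diff_at \<Omega> (flat x) (Ht i) - (2 * component i x) *\<^sub>R Ht i \<in> a"
      by (intro subspace_diff subspace_scale a_subspace derivative_in_a flat_a Ht_a i)
    from J_eq_0[OF a_p[OF this] 0] show ?thesis by simp
  qed
  have rel': "sinh (2 * x i) * component_deriv j i x = 2 * component i x * (if j = i then 1 else 0)"
    if i: "i \<in> {1..r}" and j: "j \<in> {1..r}" for i j x
    using arg_cong[OF rel[OF i, of x], of "e j"] e_Ht[OF j i]
    by (simp add: e_linear(2)[OF j derivative_in_a[OF flat_a i]] e_linear(2)[OF j Ht_a[OF i]] component_deriv_def)
  have dec: "component_deriv i j x = 0" if ij: "i \<in> {1..r}" "j \<in> {1..r}" "i \<noteq> j" for i j x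
  proof -
    have nz: "component_deriv i j x = 0" if "x j \<noteq> 0" for x using rel'[OF ij(2,1), of x] ij(3) that by simp
    show ?thesis
    proof (cases "x j = 0")
      \<comment> \<open>Where the factor sinh(2 x_j) vanishes the relation says nothing; continuity
        of the derivatives fills the gap.\<close>
      case True
      have "\<forall>\<^sub>F t in at 0. component_deriv i j (\<lambda>k. x k + (if k = j then t else 0)) = 0"
        unfolding eventually_at_filter by (intro always_eventually allI impI nz) (use True in simp)
      from isCont_eq_if_punctured[OF component_deriv_continuous[OF ij(1,2)] continuous_const this] show ?thesis by simp
    qed (rule nz)
  qed
  have "\<exists>c. True \<and> \<Omega> = (\<lambda>p. c *\<^sub>R tanh_embedding p)"
  proof (rule radial_of_solution[OF dec tanh_facts(4)])
    fix \<phi> \<phi>' :: "real \<Rightarrow> real" assume d: "\<And>s. (\<phi> has_real_derivative \<phi>' s) (at s)"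
      and *: "\<And>s. \<exists>x. \<exists>i\<in>{1..r}. x i = s \<and> \<phi> s = component i x \<and> \<phi>' s = component_deriv i i x"
    have eq: "sinh (2 * s) * \<phi>' s = 2 * \<phi> s" for s using *[of s] rel' by fastforce
    have \<phi>0: "\<phi> 0 = 0" using eq[of 0] by simp
    have td: "(tanh has_real_derivative 1 / (cosh s)\<^sup>2) (at s)" for s :: real
    proof -
      have "(tanh has_real_derivative 1 - (tanh s)\<^sup>2) (at s)" by (auto intro!: derivative_eq_intros)
      also have "1 - (tanh s)\<^sup>2 = 1 / (cosh s)\<^sup>2"
        using cosh_real_nonzero[of s] hyperbolic_pythagoras[of s]
        by (simp add: tanh_def power_divide diff_divide_distrib[symmetric] divide_eq_eq eq_divide_eq left_diff_distrib)
      finally show ?thesis .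
    qed
    have "\<exists>c. \<forall>s. \<phi> s = c * tanh s"
    proof (rule proportional_solution[OF d td])
      show "\<phi>' s * tanh s = \<phi> s * (1 / (cosh s)\<^sup>2)" for s
        using eq[of s] unfolding sinh_double by (simp add: tanh_def field_simps power2_eq_square)
    qed (auto simp: \<phi>0)
    then show "\<exists>c. True \<and> (\<forall>s. \<phi> s = c * tanh s)" by simp
  qed simp_all
  then show ?thesis by simp
qed

text \<open>Pairing the differential along the flat with \<open>long_root_relation\<close> shows
  that the square of component i has partial derivative sinh(2 x_i) in direction i and 0 in the
  others. So the profile satisfies f^2 = sinh^2, which puts the equation into the form of
  \<open>proportional_solution\<close> and forces the square of the constant to be 1.\<close>

lemma symplectic_unique:
  assumes symp: "symplectic_map A g J br \<theta> \<zeta> \<Omega>" shows "\<exists>c. c \<in> {-1, 1} \<and> \<Omega> = (\<lambda>p. c *\<^sub>R sinh_embedding p)"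
proof -
  have rel: "2 * component i x * component_deriv i j x = sinh (2 * x i) * (if i = j then 1 else 0)"
    if i: "i \<in> {1..r}" and j: "j \<in> {1..r}" for i j x
  proof -
    let ?L = "diff_at \<Omega> (flat x)"
    have "ip (JJ (?L (Ht j))) (?L (JJ (Ht i))) = ip (JJ (Ht j)) (JJ (Ht i))"
      using symp flat_p Ht_p[OF j] J_p[OF Ht_p[OF i]] unfolding symplectic_iff[OF \<Omega>(1)] by blast
    also have "\<dots> = ip (Ht j) (Ht i)" by (rule J_isometry[OF Ht_p[OF j]])
    finally have "sinh (2 * x i) * ip (Ht j) (Ht i) = ip (JJ (?L (Ht j))) (sinh (2 * x i) *\<^sub>R ?L (JJ (Ht i)))" by (simp add: form.form_simps)
    also have "\<dots> = 2 * component i x * ip (JJ (?L (Ht j))) (JJ (Ht i))" unfolding long_root_relation[OF i] by (simp add: form.form_simps)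
    also have "ip (JJ (?L (Ht j))) (JJ (Ht i)) = ip (?L (Ht j)) (Ht i)" by (rule J_isometry[OF a_p[OF derivative_in_a[OF flat_a j]]])
    also have "\<dots> = component_deriv i j x * ip (Ht i) (Ht i)"
      using e_eq[OF i derivative_in_a[OF flat_a j], of x] Ht_pos[OF i] by (simp add: component_deriv_def)
    also have "ip (Ht j) (Ht i) = (if i = j then 1 else 0) * ip (Ht i) (Ht i)" using Ht_orth[OF j i] by auto
    finally show ?thesis using Ht_pos[OF i] by (simp add: mult.assoc[symmetric])
  qed
  have zero: "component i x = 0" if i: "i \<in> {1..r}" "x i = 0" for i x
    using long_root_relation[OF i(1), of x] i(2) J_eq_0[OF Ht_p[OF i(1)]] Ht_pos[OF i(1)] by auto
  have dec: "component_deriv i j x = 0" if ij: "i \<in> {1..r}" "j \<in> {1..r}" "i \<noteq> j" for i j x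
  proof (cases "x i = 0")
    case True
    have "((\<lambda>t. component i (\<lambda>k. x k + (if k = j then t else 0))) has_real_derivative 0) (at 0)"
      using zero[OF ij(1)] True ij(3) by simp
    from DERIV_unique[OF component_has_derivative[OF ij(1,2), of x 0] this] show ?thesis by simp
  next
    case False
    have "component i x \<noteq> 0"
      using rel[OF ij(1,1), of x] False by auto
    then show ?thesis using rel[OF ij(1,2), of x] ij(3) by simp
  qed
  show ?thesis
  proof (rule radial_of_solution[OF dec sinh_facts(4)])
    fix \<phi> \<phi>' :: "real \<Rightarrow> real" assume d: "\<And>s. (\<phi> has_real_derivative \<phi>' s) (at s)"
      and *: "\<And>s. \<exists>x. \<exists>i\<in>{1..r}. x i = s \<and> \<phi> s = component i x \<and> \<phi>' s = component_deriv i i x"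
    have eq: "2 * \<phi> s * \<phi>' s = sinh (2 * s)" for s using *[of s] rel by fastforce
    have \<phi>0: "\<phi> 0 = 0" using *[of 0] zero by fastforce
    have "((\<lambda>s. (\<phi> s)\<^sup>2 - (sinh s)\<^sup>2) has_real_derivative 2 * \<phi> s * \<phi>' s - 2 * sinh s * cosh s) (at s)" for s
      by (auto intro!: derivative_eq_intros d)
    then have "((\<lambda>s. (\<phi> s)\<^sup>2 - (sinh s)\<^sup>2) has_real_derivative 0) (at s)" for s by (simp add: eq sinh_double)
    then have "(\<phi> s)\<^sup>2 - (sinh s)\<^sup>2 = (\<phi> 0)\<^sup>2 - (sinh 0)\<^sup>2" for s using DERIV_isconst_all by blast
    then have sq: "(\<phi> s)\<^sup>2 = (sinh s)\<^sup>2" for s by (simp add: \<phi>0)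
    have "\<exists>c. \<forall>s. \<phi> s = c * sinh s"
    proof (rule proportional_solution[OF d])
      show "(sinh has_real_derivative cosh s) (at s)" for s :: real by (auto intro!: derivative_eq_intros)
      show "\<phi>' s * sinh s = \<phi> s * cosh s" for s
      proof (cases "s = 0")
        case False
        then have ne: "\<phi> s \<noteq> 0" using sq[of s] by auto
        have "\<phi> s * (\<phi>' s * sinh s) = (sinh s)\<^sup>2 * cosh s" using eq[of s] by (simp add: sinh_double power2_eq_square)
        also have "\<dots> = \<phi> s * (\<phi> s * cosh s)" unfolding sq[of s, symmetric] by (simp add: power2_eq_square)
        finally show ?thesis using ne by simp
      qed (simp add: \<phi>0)
    qed (auto simp: \<phi>0)
    then obtain c where c: "\<And>s. \<phi> s = c * sinh s" by blast
    have "c\<^sup>2 * (sinh 1)\<^sup>2 = (sinh (1::real))\<^sup>2" using sq[of 1] by (simp add: c power_mult_distrib)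
    then have "c\<^sup>2 = 1" by simp
    then have "c \<in> {-1, 1}" by (auto simp: power2_eq_1_iff)
    then show "\<exists>c. c \<in> {-1, 1} \<and> (\<forall>s. \<phi> s = c * sinh s)" using c by blast
  qed simp_all
qed

end

end

text \<open>The two equivalences for \<open>radial_map\<close> express that the prescriptions are
  consistent, although k and x are not unique for a given point, and that they determine the maps,
  because every point is of the form k Exp(x).\<close>

theorem theorem1p3:
  fixes A :: "('m::{t2_space,second_countable_topology}, 'e::euclidean_space) chart set"
    and g :: "('m, 'e) metric_tensor" and J :: "('m, 'e) endo_tensor" and ob :: 'm
    and ex :: "'g::euclidean_space \<Rightarrow> 'm \<Rightarrow> 'm" and br :: "'g \<Rightarrow> 'g \<Rightarrow> 'g"
    and \<theta> :: "'g \<Rightarrow> 'g" and \<zeta> :: 'g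
    and a :: "'g set" and e :: "nat \<Rightarrow> 'g \<Rightarrow> real"
  assumes "hermitian_symmetric_space A g J"
    and "is_lie_algebra_of A (isom0 A g) ex br"
    and "\<forall>x. \<exists>f\<in>isom0 A g. f ob = x"
    and "noncompact_type_at ex br \<theta> ob"
    and "irreducible_pair br \<theta>"
    and "standard_kaehler A g J ex br \<theta> \<zeta> ob"
    and "maximal_abelian_in br (pspace \<theta>) a"
    and "orthogonal_dual_basis br a e"
    and "restricted_roots br a = roots_C (dim a) e \<or> restricted_roots br a = roots_BC (dim a) e"
  shows "\<exists>\<Psi> \<Phi>.
    (\<forall>\<Omega>. radial_map A g ex br \<theta> ob a e tanh \<Omega> \<longleftrightarrow> \<Omega> = \<Psi>) \<and>
    (\<forall>\<Omega>. radial_map A g ex br \<theta> ob a e sinh \<Omega> \<longleftrightarrow> \<Omega> = \<Phi>) \<and>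
    (K_equivariant A g ex ob \<Psi> \<and> holomorphic_map A J br \<zeta> \<Psi> \<and>
       diffeo_onto A (pspace \<theta>) (D_tanh A g ex br \<theta> ob a e) \<Psi>) \<and>
    (K_equivariant A g ex ob \<Phi> \<and> symplectic_map A g J br \<theta> \<zeta> \<Phi> \<and>
       diffeo_onto A (pspace \<theta>) (pspace \<theta>) \<Phi>) \<and>
    (C1_embedding A (pspace \<theta>) \<Psi> \<and> K_equivariant A g ex ob \<Psi> \<and>
       holomorphic_map A J br \<zeta> \<Psi> \<and> maps_flat A g ex ob a \<Psi>) \<and>
    (\<forall>\<Omega>. C1_embedding A (pspace \<theta>) \<Omega> \<and> K_equivariant A g ex ob \<Omega> \<and>
       holomorphic_map A J br \<zeta> \<Omega> \<and> maps_flat A g ex ob a \<Omega> \<longrightarrow>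
       (\<exists>t::real. \<Omega> = (\<lambda>x. t *\<^sub>R \<Psi> x))) \<and>
    (C1_embedding A (pspace \<theta>) \<Phi> \<and> K_equivariant A g ex ob \<Phi> \<and>
       symplectic_map A g J br \<theta> \<zeta> \<Phi> \<and> maps_flat A g ex ob a \<Phi>) \<and>
    (\<forall>\<Omega>. C1_embedding A (pspace \<theta>) \<Omega> \<and> K_equivariant A g ex ob \<Omega> \<and>
       symplectic_map A g J br \<theta> \<zeta> \<Omega> \<and> maps_flat A g ex ob a \<Omega> \<longrightarrow>
       \<Omega> = \<Phi> \<or> \<Omega> = (\<lambda>x. - \<Phi> x))"
proof -
  have h: "connected (UNIV :: 'm set)" "smooth_atlas A" "riemannian_metric A g"
    using assms(1) by (auto simp: hermitian_symmetric_space_def)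
  interpret lie_action A g ex br by unfold_locales (rule h(2), rule h(3), rule assms(2))
  interpret S: symmetric_space A g ex br J ob \<theta> \<zeta>
    by unfold_locales (use h(1) assms(3,4,6) in auto)
  interpret hermitian_space A g ex br J ob \<theta> \<zeta> a e
    by unfold_locales (use S.zeta_facts assms(7-9) in auto)
  have C1: "Ck_fun A (Suc 0) \<Omega>" if "C1_embedding A (pspace \<theta>) \<Omega>" for \<Omega>
    using that by (simp add: C1_embedding_def)
  show ?thesis
  proof (rule exI[of _ tanh_embedding], rule exI[of _ sinh_embedding], intro conjI allI impI)
    show "radial_map A g ex br \<theta> ob a e tanh \<Omega> \<longleftrightarrow> \<Omega> = tanh_embedding" for \<Omega>
      using radial_map_unique[OF _ tanh_facts(4)] tanh_facts(4) by blast
    show "radial_map A g ex br \<theta> ob a e sinh \<Omega> \<longleftrightarrow> \<Omega> = sinh_embedding" for \<Omega>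
      using radial_map_unique[OF _ sinh_facts(4)] sinh_facts(4) by blast
    show "\<exists>t. \<Omega> = (\<lambda>x. t *\<^sub>R tanh_embedding x)"
      if "C1_embedding A (pspace \<theta>) \<Omega> \<and> K_equivariant A g ex ob \<Omega> \<and> holomorphic_map A J br \<zeta> \<Omega> \<and> maps_flat A g ex ob a \<Omega>" for \<Omega>
      using that holomorphic_unique[OF C1] by blast
    show "\<Omega> = sinh_embedding \<or> \<Omega> = (\<lambda>x. - sinh_embedding x)"
      if "C1_embedding A (pspace \<theta>) \<Omega> \<and> K_equivariant A g ex ob \<Omega> \<and> symplectic_map A g J br \<theta> \<zeta> \<Omega> \<and> maps_flat A g ex ob a \<Omega>" for \<Omega>
      using that symplectic_unique[OF C1, of \<Omega>] by auto
  qed (fact tanh_facts tanh_holomorphic tanh_diffeo sinh_facts sinh_symplectic sinh_diffeo)+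
qed

end
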